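(* Let $\nu\ge2$, $\nu_0\in\{1,\dots,\nu-1\}$ and $\alpha\in(1,2)$. Let $\mathcal{X}$ be the Boolean set in $\mathbb{R}^\nu$ with generic grain $\Xi=R^{1/\nu}\,\Xi^0$, where $R>0$ is a random variable with $\mathrm{P}(R>x)\sim c_R\,x^{-\alpha}$ as $x\to\infty$ for some $c_R>0$, and $\Xi^0$ is a random closed set independent of $R$ with $\Xi^0\subset\{\boldsymbol{t}\in\mathbb{R}^\nu:|\boldsymbol{t}|\le1\}$ a.s. and $\mathrm{Leb}_\nu(\Xi^0)>0$ a.s. Let $\mu=\mathrm{E}\,\mathrm{Leb}_\nu(\Xi)$ and $p=1-\mathrm{e}^{-\mu}$. Let $$H_{\nu_0}=\{\boldsymbol{t}=(t_1,\dots,t_\nu)\in\mathbb{R}^\nu:\ t_i=0,\ \nu_0<i\le\nu\}$$ and let $A\subset H_{\nu_0}$ be an arbitrary bounded Borel set with $\mathrm{Leb}_{\nu_0}(A)>0$, and $$\widehat p_{\lambda,A}(H_{\nu_0})=\frac{\mathrm{Leb}_{\nu_0}(\mathcal{X}\cap H_{\nu_0}\cap(\lambda A))}{\mathrm{Leb}_{\nu_0}(H_{\nu_0}\cap(\lambda A))}.$$ (i) If $1<\alpha<1+\frac{\nu_0}{\nu}$ and $\alpha_0=1+\frac{\nu}{\nu_0}(\alpha-1)$, then $$\lambda^{\nu_0-(\nu_0/\alpha_0)}\big(\widehat p_{\lambda,A}(H_{\nu_0})-p\big)\ \stackrel{d}{\longrightarrow}\ \mathrm{e}^{-\mu}\,\frac{L_{\alpha_0}(A)}{\mathrm{Leb}_{\nu_0}(A)},\qquad\lambda\to\infty,$$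 where $L_{\alpha_0}(A)$ has the $\alpha_0$-stable distribution with log-characteristic function $$\log\mathrm{E}\,\mathrm{e}^{\mathrm{i}\theta L_{\alpha_0}(A)}=\mathrm{i}\,c_{0,\Xi}\,\theta\,\mathrm{Leb}_{\nu_0}(A)\int_0^\infty\big(\mathrm{e}^{\mathrm{i}\theta x}-1\big)x^{-\alpha_0}\,\mathrm{d}x,\quad\theta\in\mathbb{R},\qquad c_{0,\Xi}=\frac{c_R\,\alpha\,\nu}{\alpha_0\,\nu_0}\int_{\mathbb{R}^{\nu-\nu_0}}\mathrm{E}\big[g^0(\boldsymbol{s}'')^{\alpha_0}\big]\,\mathrm{d}\boldsymbol{s}''.$$ (ii) If $1+\frac{\nu_0}{\nu}<\alpha<2$, then $$\lambda^{\nu_0/2}\big(\widehat p_{\lambda,A}(H_{\nu_0})-p\big)\ \stackrel{d}{\longrightarrow}\ \frac{W_{0,1}(A)}{\mathrm{Leb}_{\nu_0}(A)},\qquad\lambda\to\infty,$$ where $W_{0,1}(A)$ is a centered Gaussian random variable with variance $$\mathrm{Var}(W_{0,1}(A))=\mathrm{Leb}_{\nu_0}(A)\int_{\mathbb{R}^{\nu_0}}\mathrm{Cov}\big(\widehat X(\boldsymbol{t}',0,\dots,0),\widehat X(\boldsymbol{0})\big)\,\mathrm{d}\boldsymbol{t}'.$$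
   Context: $\mathrm{Leb}_d$ is $d$-dimensional Lebesgue measure; $H_{\nu_0}$ is identified with $\mathbb{R}^{\nu_0}$, so $\mathrm{Leb}_{\nu_0}$ makes sense on its Borel subsets. $|\cdot|$ is the Euclidean norm. A random closed set is a measurable map from a complete probability space into the space of closed subsets of $\mathbb{R}^\nu$ with the Borel $\sigma$-algebra of the Fell topology. Boolean set with generic grain $\Xi$ (a random closed set with $\mathrm{E}\,\mathrm{Leb}_\nu(\Xi)<\infty$): let $\{\boldsymbol{u}_j;j\ge1\}$ be a stationary Poisson point process on $\mathbb{R}^\nu$ with unit intensity and let $\{\Xi,\Xi_j;j\ge1\}$ be i.i.d., independent of $\{\boldsymbol{u}_j\}$; then $$\mathcal{X}=\bigcup_{j=1}^\infty(\boldsymbol{u}_j+\Xi_j),\qquad \widehat X(\boldsymbol{t})=\mathbb{I}(\boldsymbol{t}\in\mathcal{X}),\quad\boldsymbol{t}\in\mathbb{R}^\nu.$$ The number $p=1-\mathrm{e}^{-\mu}=\mathrm{E}\widehat X(\boldsymbol{0})$ is the volume fraction of $\mathcal{X}$. Write $\boldsymbol{t}=(\boldsymbol{t}',\boldsymbol{t}'')$ with $\boldsymbol{t}'\in\mathbb{R}^{\nu_0}$, $\boldsymbol{t}''\in\mathbb{R}^{\nu-\nu_0}$. For $\boldsymbol{s}''\in\mathbb{R}^{\nu-\nu_0}$, $g^0(\boldsymbol{s}''):=\mathrm{Leb}_{\nu_0}\big(\{\boldsymbol{t}'\in\mathbb{R}^{\nu_0}:(\boldsymbol{t}',\boldsymbol{s}'')\in\Xi^0\}\big)$.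 $\stackrel{d}{\to}$ denotes convergence in distribution. *)

theory Defs
  imports "HOL-Probability.Probability" "HOL-Library.Landau_Symbols"
begin

subsection \<open>Random closed sets and independence\<close>

definition fell_topology :: "'a::topological_space set topology" where
  "fell_topology = topology_generated_by
     ({{F. closed F \<and> F \<inter> K = {}} | K. compact K} \<union>
      {{F. closed F \<and> F \<inter> G \<noteq> {}} | G. open G})"

definition fell_borel :: "'a::topological_space set measure" where
  "fell_borel = sigma {F. closed F} {U. openin fell_topology U}"

abbreviation random_closed_set :: "'w measure \<Rightarrow> ('w \<Rightarrow> 'a::topological_space set) \<Rightarrow> bool" where
  "random_closed_set M X \<equiv> X \<in> measurable M fell_borel"


text \<open>\<^const>\<open>prob_space.indep_var\<close> requires both random variables to have the same value type.\<close>

definition independent_rvs ::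
    "'w measure \<Rightarrow> 'b measure \<Rightarrow> ('w \<Rightarrow> 'b) \<Rightarrow> 'c measure \<Rightarrow> ('w \<Rightarrow> 'c) \<Rightarrow> bool" where
  "independent_rvs M S X T Y \<longleftrightarrow>
     X \<in> measurable M S \<and> Y \<in> measurable M T \<and>
     prob_space.indep_set M {X -` B \<inter> space M | B. B \<in> sets S} {Y -` C \<inter> space M | C. C \<in> sets T}"


subsection \<open>The unit-intensity Poisson process and the Boolean set\<close>

text \<open>The indices \<open>j \<ge> 1\<close> of the points and grains are shifted to start at 0. Points are counted
  with multiplicity; the count may be infinite.\<close>

definition point_count :: "(nat \<Rightarrow> 'w \<Rightarrow> 'a) \<Rightarrow> 'a set \<Rightarrow> 'w \<Rightarrow> ennreal" where
  "point_count u B \<omega> = (\<Sum>j. indicator B (u j \<omega>))"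

text \<open>The Poisson law is written out because \<^const>\<open>poisson_pmf\<close> excludes the rate 0. Independence
  is stated for sequences of disjoint sets; finite families are padded with empty sets.\<close>

definition unit_poisson_process ::
    "'w measure \<Rightarrow> (nat \<Rightarrow> 'w \<Rightarrow> 'a::euclidean_space) \<Rightarrow> bool" where
  "unit_poisson_process M u \<longleftrightarrow>
     (\<forall>j. u j \<in> borel_measurable M) \<and>
     (\<forall>B\<in>sets borel. emeasure lborel B < \<infinity> \<longrightarrow>
        (\<forall>k::nat. measure M {\<omega> \<in> space M. point_count u B \<omega> = of_nat k}
                   = exp (- measure lborel B) * measure lborel B ^ k / fact k)) \<and>
     (\<forall>B::nat \<Rightarrow> 'a set. range B \<subseteq> sets borel \<longrightarrow> disjoint_family B \<longrightarrow>
        prob_space.indep_vars M (\<lambda>_. borel) (\<lambda>i. point_count u (B i)) UNIV)"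

text \<open>In \<open>case_nat X Xs\<close> the generic grain \<open>X\<close> is the first member of the i.i.d. family, followed by
  the grains \<open>Xs 0, Xs 1, \<dots>\<close>. The sequence of points is independent of the whole family.\<close>

definition boolean_model ::
    "'w measure \<Rightarrow> (nat \<Rightarrow> 'w \<Rightarrow> 'a::euclidean_space) \<Rightarrow> ('w \<Rightarrow> 'a set) \<Rightarrow>
     (nat \<Rightarrow> 'w \<Rightarrow> 'a set) \<Rightarrow> bool" where
  "boolean_model M u X Xs \<longleftrightarrow>
     unit_poisson_process M u \<and>
     random_closed_set M X \<and>
     (\<integral>\<^sup>+\<omega>. emeasure lborel (X \<omega>) \<partial>M) < \<infinity> \<and>
     (\<forall>j. random_closed_set M (Xs j)) \<and>
     (\<forall>j. distr M fell_borel (Xs j) = distr M fell_borel X) \<and>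
     prob_space.indep_vars M (\<lambda>_. fell_borel) (case_nat X Xs) UNIV \<and>
     independent_rvs M
       (Pi\<^sub>M UNIV (\<lambda>_. borel)) (\<lambda>\<omega> j. u j \<omega>)
       (Pi\<^sub>M UNIV (\<lambda>_. fell_borel)) (\<lambda>\<omega> j. case_nat X Xs j \<omega>)"

definition boolean_set ::
    "(nat \<Rightarrow> 'w \<Rightarrow> 'a::euclidean_space) \<Rightarrow> (nat \<Rightarrow> 'w \<Rightarrow> 'a set) \<Rightarrow> 'w \<Rightarrow> 'a set" where
  "boolean_set u Xs \<omega> = (\<Union>j. (\<lambda>x. u j \<omega> + x) ` Xs j \<omega>)"

definition mean_volume :: "'w measure \<Rightarrow> ('w \<Rightarrow> 'a::euclidean_space set) \<Rightarrow> real" where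
  "mean_volume M X = (\<integral>\<omega>. measure lborel (X \<omega>) \<partial>M)"


subsection \<open>Sections by the coordinate hyperplane\<close>

text \<open>The space is split as \<open>'a \<times> 'b\<close>, with points \<open>t = (t', t'')\<close>; the product norm is Euclidean.
  The measure \<open>leb_H\<close> is Lebesgue measure on the hyperplane \<open>H\<close>, identified with \<open>'a\<close>.\<close>

definition H_plane :: "('a::euclidean_space \<times> 'b::euclidean_space) set" where
  "H_plane = {t. snd t = 0}"

definition leb_H :: "('a::euclidean_space \<times> 'b::euclidean_space) set \<Rightarrow> real" where
  "leb_H B = measure lborel {t'. (t', 0) \<in> B}"

definition section_volume :: "('a::euclidean_space \<times> 'b::euclidean_space) set \<Rightarrow> 'b \<Rightarrow> real" where
  "section_volume F s = measure lborel {t'. (t', s) \<in> F}"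

definition p_hat ::
    "('w \<Rightarrow> ('a::euclidean_space \<times> 'b::euclidean_space) set) \<Rightarrow> ('a \<times> 'b) set \<Rightarrow> real \<Rightarrow> 'w \<Rightarrow> real"
  where
  "p_hat X A l \<omega> =
     leb_H (X \<omega> \<inter> H_plane \<inter> (\<lambda>x. l *\<^sub>R x) ` A) / leb_H (H_plane \<inter> (\<lambda>x. l *\<^sub>R x) ` A)"


subsection \<open>Probability\<close>

definition covariance :: "'w measure \<Rightarrow> ('w \<Rightarrow> real) \<Rightarrow> ('w \<Rightarrow> real) \<Rightarrow> real" where
  "covariance M X Y = (\<integral>\<omega>. (X \<omega> - (\<integral>\<omega>'. X \<omega>' \<partial>M)) * (Y \<omega> - (\<integral>\<omega>'. Y \<omega>' \<partial>M)) \<partial>M)"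

text \<open>The analogue of \<^const>\<open>weak_conv_m\<close> along an arbitrary filter.\<close>

definition weak_conv_along :: "('i \<Rightarrow> real measure) \<Rightarrow> 'i filter \<Rightarrow> real measure \<Rightarrow> bool" where
  "weak_conv_along N F L \<longleftrightarrow>
     (\<forall>x. isCont (cdf L) x \<longrightarrow> ((\<lambda>i. cdf (N i) x) \<longlongrightarrow> cdf L x) F)"

definition stable_law :: "real \<Rightarrow> real measure \<Rightarrow> bool" where
  "stable_law \<alpha> N \<longleftrightarrow> real_distribution N \<and>
     (\<forall>a>0. \<forall>b>0. \<exists>d. distr (N \<Otimes>\<^sub>M N) borel (\<lambda>(x, y). a * x + b * y)
        = distr N borel (\<lambda>x. (a powr \<alpha> + b powr \<alpha>) powr (1 / \<alpha>) * x + d))"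

end

theory Submission
 imports Defs "HOL-Real_Asymp.Real_Asymp" "HOL-Analysis.Ball_Volume"
begin

text \<open>Let \<open>m\<close> be the intensity of the marked process of grains and \<open>C t\<close> the set of grains covering the
 point \<open>(t, 0)\<close> of the hyperplane, so that \<open>m (C t) = \<mu>\<close> and \<open>m (C t \<inter> C s) = \<rho> (t - s)\<close>. The uncovered part
 of a window \<open>B\<close> of the hyperplane has volume \<open>U = \<integral>\<^sub>B 1(no grain in C t) dt\<close>.

 If \<open>\<rho>\<close> is integrable, which is the case for \<open>\<alpha> > 1 + \<nu>\<^sub>0 / \<nu>\<close>, conditioning on a point being uncovered
 removes the grains in \<open>C t\<close> from the process (Slivnyak--Mecke for void events); this gives a Stein-type
 differential equation for the characteristic function of \<open>U\<close> with small error, hence Gaussian limits.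

 If \<open>\<alpha> < 1 + \<nu>\<^sub>0 / \<nu>\<close>, then \<open>U\<close> is, up to an error with second moment at most \<open>\<integral>\<integral> \<rho> (s - t)\<^sup>2 exp \<mu>\<close>, a constant
 minus \<open>exp (- \<mu>)\<close> times the Poisson shot noise \<open>Y = \<Sum>\<^sub>j Leb (B \<inter> {t. grain j \<in> C t})\<close>. The characteristic
 function of \<open>Y\<close> is explicit. Up to boundary effects each grain contributes \<open>R powr (\<nu>\<^sub>0 / \<nu>)\<close> times a section
 volume of \<open>\<Xi>\<^sup>0\<close>, and the regular variation of the tail of \<open>R\<close> yields the stable exponent. The limit law
 exists because the characteristic functions converge to a function that is continuous at 0.\<close>

text \<open>With \<open>q = \<nu>\<^sub>0 / \<nu>\<close>, a grain meets the hyperplane at a rate of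
  order R^(1-q) and cuts out a section of volume of order R^q. Both exponents of the theorem follow
  from this count. The integral of \<rho> is the mean of the integrated squared sections, of order E
  R^(1+q), so the regimes separate at \<alpha> = 1 + q; and the rate of sections larger than x,
  E(R^(1-q); R^q > x), decays with exponent (\<alpha> - 1 + q) / q =
  \<open>\<alpha>\<^sub>0\<close>. The obstacle in the Gaussian regime is that an integrable \<rho>
  controls merely first moments of the effect of deleting grains. The second order error of the
  Stein expansion is therefore split at a distance K: the near part is bounded by a ball volume, the
  far part enters linearly and is small for large K. In the stable regime the residual consists of
  the chaos terms of order two and higher of the uncovered volume. Its second moment is found by
  comparing avoidance with an infinitesimal thinning of the grains, in whose covariances the terms
  linear in \<rho> cancel. As \<open>p_hat\<close> measures the covered part, the signs are
  reversed, and large grains push the stable limit to the right.\<close>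

abbreviation lebesgue_integral_lborel :: "('a::euclidean_space \<Rightarrow> 'c::{banach, second_countable_topology}) \<Rightarrow> 'c"
 (binder "Leb " 10) where "lebesgue_integral_lborel f \<equiv> integral\<^sup>L lborel f"

abbreviation nn_integral_lborel :: "('a::euclidean_space \<Rightarrow> ennreal) \<Rightarrow> ennreal"
 (binder "nLeb " 10) where "nn_integral_lborel f \<equiv> integral\<^sup>N lborel f"

lemmas Bochner_integral_cong = Bochner_Integration.integral_cong
 and Bochner_integral_diff = Bochner_Integration.integral_diff
 and Bochner_integrable_diff = Bochner_Integration.integrable_diff
 and Bochner_integrable_bound = Bochner_Integration.integrable_bound

subsection \<open>Independence and random closed sets\<close>


text \<open>\<open>independent_rvs\<close> amounts to agreement of the joint law with the product
  law on rectangles; as both marginals are probability measures, rectangles determine the product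
  measure.\<close>

lemma (in prob_space) independent_rvs_distr_pair:
 assumes "independent_rvs M S X T Y"
 shows "distr M (S \<Otimes>\<^sub>M T) (\<lambda>w. (X w, Y w)) = distr M S X \<Otimes>\<^sub>M distr M T Y"
proof -
 have [measurable]: "X \<in> measurable M S" "Y \<in> measurable M T"
  and ind: "indep_set {X -` B \<inter> space M | B. B \<in> sets S} {Y -` C \<inter> space M | C. C \<in> sets T}"
  using assms by (auto simp: independent_rvs_def)
 interpret X: prob_space "distr M S X" by (rule prob_space_distr) fact
 interpret Y: prob_space "distr M T Y" by (rule prob_space_distr) fact
 show ?thesis
 proof (rule pair_measure_eqI[symmetric])
  fix B C assume B: "B \<in> sets (distr M S X)" and C: "C \<in> sets (distr M T Y)"
  then have [measurable]: "B \<in> sets S" "C \<in> sets T" by auto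
  have "prob ((X -` B \<inter> space M) \<inter> (Y -` C \<inter> space M)) = prob (X -` B \<inter> space M) * prob (Y -` C \<inter> space M)"
   by (rule indep_setD[OF ind]) (use B C in auto)
  moreover have "(\<lambda>w. (X w, Y w)) -` (B \<times> C) \<inter> space M = (X -` B \<inter> space M) \<inter> (Y -` C \<inter> space M)"
   by auto
  ultimately show "emeasure (distr M S X) B * emeasure (distr M T Y) C =
    emeasure (distr M (S \<Otimes>\<^sub>M T) (\<lambda>w. (X w, Y w))) (B \<times> C)"
   by (simp add: emeasure_distr emeasure_eq_measure ennreal_mult'')
 qed (auto simp: X.sigma_finite_measure_axioms Y.sigma_finite_measure_axioms)
qed

lemma space_fell_borel [simp]: "space fell_borel = {F. closed F}"
 by (auto simp: fell_borel_def space_measure_of_conv)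

lemma hits_open_sets_fell [measurable]:
 assumes "open G"
 shows "{F. closed F \<and> F \<inter> G \<noteq> {}} \<in> sets (fell_borel :: 'a::topological_space set measure)"
proof -
 have o: "openin fell_topology {F :: 'a set. closed F \<and> F \<inter> G \<noteq> {}}"
  unfolding fell_topology_def using assms by (intro topology_generated_by_Basis) auto
 \<comment> \<open>\<open>sets_measure_of\<close> asks for generators inside the carrier, so every
   Fell open family must consist of closed sets.\<close>
 have "topspace (fell_topology :: 'a set topology) \<subseteq> {F. closed F}"
  unfolding fell_topology_def by (auto simp: topology_generated_by_topspace)
 then have "{U :: 'a set set. openin fell_topology U} \<subseteq> Pow {F. closed F}"
  using openin_subset by blast
 then show ?thesis
  using o unfolding fell_borel_def by (subst sets_measure_of) auto
qed

text \<open>A point lies in a closed F exactly if arbitrarily small balls with centres in a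
  countable dense set contain the point and hit F. Joint measurability of membership thus reduces to
  countably many hitting events, which are Fell open. Measurability of the volumes and sections of
  random grains is derived from this.\<close>

lemma pred_mem_fell [measurable]:
 "Measurable.pred (borel \<Otimes>\<^sub>M fell_borel) (\<lambda>p :: 'a::euclidean_space \<times> 'a set. fst p \<in> snd p)"
proof -
 obtain D :: "'a set" where D: "countable D" "\<And>X. open X \<Longrightarrow> X \<noteq> {} \<Longrightarrow> \<exists>d\<in>D. d \<in> X"
  using countable_dense_setE by blast
 define r where "r n = inverse (real (Suc n))" for n
 have r: "r n > 0" for n by (simp add: r_def)
 have eq: "fst p \<in> snd p \<longleftrightarrow>
   (\<forall>n. \<exists>q\<in>D. fst p \<in> ball q (r n) \<and> snd p \<in> {F. closed F \<and> F \<inter> ball q (r n) \<noteq> {}})"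
  if p: "p \<in> space (borel \<Otimes>\<^sub>M fell_borel)" for p :: "'a \<times> 'a set"
 proof
  assume "fst p \<in> snd p"
  show "\<forall>n. \<exists>q\<in>D. fst p \<in> ball q (r n) \<and> snd p \<in> {F. closed F \<and> F \<inter> ball q (r n) \<noteq> {}}"
  proof
   fix n
   obtain q where "q \<in> D" "q \<in> ball (fst p) (r n)"
    using D(2)[OF open_ball, of "fst p" "r n"] r[of n] by (auto simp del: mem_ball)
   then show "\<exists>q\<in>D. fst p \<in> ball q (r n) \<and> snd p \<in> {F. closed F \<and> F \<inter> ball q (r n) \<noteq> {}}"
    using \<open>fst p \<in> snd p\<close> p
    by (intro bexI[of _ q]) (auto simp: space_pair_measure dist_commute)
  qed
 next
  assume *: "\<forall>n. \<exists>q\<in>D. fst p \<in> ball q (r n) \<and> snd p \<in> {F. closed F \<and> F \<inter> ball q (r n) \<noteq> {}}"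
  have "\<exists>y\<in>snd p. dist y (fst p) < e" if "e > 0" for e
  proof -
   obtain n where n: "r n < e / 2"
    using reals_Archimedean[of "e / 2"] \<open>e > 0\<close> unfolding r_def by auto
   obtain q y where q: "fst p \<in> ball q (r n)" "y \<in> snd p" "y \<in> ball q (r n)"
    using * by blast
   have "dist y (fst p) \<le> dist y q + dist q (fst p)" by (rule dist_triangle)
   also have "\<dots> < r n + r n" using q by (intro add_strict_mono) (auto simp: dist_commute)
   also have "\<dots> < e" using n by simp
   finally show ?thesis using q by auto
  qed
  then have "fst p \<in> closure (snd p)" by (auto simp: closure_approachable)
  then show "fst p \<in> snd p" using p by (auto simp: space_pair_measure)
 qed
 have m: "Measurable.pred (borel \<Otimes>\<^sub>M fell_borel) (\<lambda>p :: 'a \<times> 'a set. fst p \<in> ball q (r n))"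
  "Measurable.pred (borel \<Otimes>\<^sub>M fell_borel)
   (\<lambda>p :: 'a \<times> 'a set. snd p \<in> {F. closed F \<and> F \<inter> ball q (r n) \<noteq> {}})" for q n
  by (intro pred_sets2[OF _ measurable_fst] pred_sets2[OF _ measurable_snd] hits_open_sets_fell; simp)+
 have "Measurable.pred (borel \<Otimes>\<^sub>M fell_borel) (\<lambda>p :: 'a \<times> 'a set.
   \<forall>n. \<exists>q\<in>D. fst p \<in> ball q (r n) \<and> snd p \<in> {F. closed F \<and> F \<inter> ball q (r n) \<noteq> {}})"
 proof -
  have "D \<noteq> {}" using D(2)[of UNIV] by auto
  then have "D = range (from_nat_into D)" using D(1) by simp
  then have ex: "(\<exists>q\<in>D. P q) \<longleftrightarrow> (\<exists>k. P (from_nat_into D k))" for P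
   by (metis rangeE rangeI)
  show ?thesis unfolding ex by (intro pred_intros_countable pred_intros_logic m)
 qed
 then show ?thesis
  by (subst measurable_cong[OF eq]) auto
qed

section \<open>Lebesgue measure under small translations\<close>

lemma emeasure_lborel_translate:
 fixes A :: "'a::euclidean_space set"
 assumes [measurable]: "A \<in> sets borel"
 shows "emeasure lborel {x. x + h \<in> A} = emeasure lborel A"
proof -
 have "emeasure lborel A = emeasure (distr lborel borel ((+) h)) A"
  by (simp add: lborel_distr_plus)
 also have "\<dots> = emeasure lborel {x. x + h \<in> A}"
  by (subst emeasure_distr) (auto simp: vimage_def add.commute)
 finally show ?thesis ..
qed

text \<open>Regularity squeezes A between a compact K and an open U. Once h is so short that K + h
  stays in U, a point of A lost by the shift either lies outside K or is moved into U - A, and both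
  possibilities have measure below e / 2.\<close>

lemma measure_lborel_Int_translate_tendsto:
 fixes A :: "'a::euclidean_space set"
 assumes [measurable]: "A \<in> sets borel" and bdd: "bounded A"
 shows "((\<lambda>h. measure lborel (A \<inter> {x. x + h \<in> A})) \<longlongrightarrow> measure lborel A) (nhds 0)"
proof (rule tendstoI)
 fix e :: real assume "e > 0"
 have fin: "emeasure lborel A < \<infinity>"
  by (rule emeasure_bounded_finite[OF bdd])
 have lm: "A \<in> sets lebesgue" and e2: "0 < e / 2" using \<open>e > 0\<close> by simp_all
 obtain K where K: "closed K" "K \<subseteq> A" "emeasure lebesgue (A - K) < ennreal (e / 2)"
  by (rule sets_lebesgue_inner_closed[OF lm e2])
 have [measurable]: "K \<in> sets borel" using K(1) by simp
 have K3: "emeasure lborel (A - K) < ennreal (e / 2)" using K(3) by simp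
 obtain U where U: "open U" "A \<subseteq> U" "emeasure lborel (U - A) < ennreal (e / 2)"
  by (rule outer_regular_lborel[OF assms(1) e2])
 have [measurable]: "U \<in> sets borel" using U(1) by simp
 have "compact K" using K bdd by (auto simp: compact_eq_bounded_closed intro: bounded_subset)
 then obtain d where d: "d > 0" "(\<Union>x\<in>K. ball x d) \<subseteq> U"
  using compact_subset_open_imp_ball_epsilon_subset[OF \<open>compact K\<close> U(1)] K U by auto
 show "\<forall>\<^sub>F h in nhds 0. dist (measure lborel (A \<inter> {x. x + h \<in> A})) (measure lborel A) < e"
  unfolding eventually_nhds_metric
 proof (intro exI[of _ d] conjI d(1) allI impI)
  fix h :: 'a assume h: "dist h 0 < d"
  let ?B = "A \<inter> {x. x + h \<in> A}"
  have [measurable]: "{x. x + h \<in> A} \<in> sets borel" "{x. x + h \<in> U - A} \<in> sets borel"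
   by measurable
  have "A - ?B \<subseteq> (A - K) \<union> {x. x + h \<in> U - A}"
  proof
   fix x assume x: "x \<in> A - ?B"
   show "x \<in> (A - K) \<union> {x. x + h \<in> U - A}"
   proof (cases "x \<in> K")
    case True
    then have "x + h \<in> U" using d(2) h by (auto intro!: subsetD[OF d(2)] bexI[of _ x] simp: dist_norm)
    then show ?thesis using x by auto
   qed (use x in auto)
  qed
  then have "emeasure lborel (A - ?B) \<le> emeasure lborel (A - K) + emeasure lborel {x. x + h \<in> U - A}"
   by (intro order_trans[OF emeasure_mono emeasure_subadditive]) auto
  also have "\<dots> < ennreal (e / 2) + ennreal (e / 2)"
   using K3 U(3) by (subst emeasure_lborel_translate) (auto intro: add_strict_mono)
  also have "\<dots> = ennreal e" using \<open>e > 0\<close> by (simp flip: ennreal_plus)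
  finally have *: "emeasure lborel (A - ?B) < ennreal e" .
  have "measure lborel (A - ?B) = measure lborel A - measure lborel ?B"
   using fin by (intro measure_Diff) auto
  moreover have "measure lborel (A - ?B) < e"
  proof -
   have "emeasure lborel (A - ?B) \<noteq> top"
    using * by (metis ennreal_less_top less_trans order_less_irrefl)
   then show ?thesis
    using * by (simp add: emeasure_eq_ennreal_measure ennreal_less_iff)
  qed
  moreover have "measure lborel ?B \<le> measure lborel A"
   using fin by (intro measure_mono_fmeasurable) (auto simp: fmeasurable_def)
  ultimately show "dist (measure lborel ?B) (measure lborel A) < e"
   by (simp add: dist_real_def)
 qed
qed

abbreviation (in prob_space) integral_M :: "('a \<Rightarrow> 'c::{banach, second_countable_topology}) \<Rightarrow> 'c"
 (binder "Mean " 10) where "integral_M f \<equiv> integral\<^sup>L M f"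

abbreviation (in prob_space) nn_integral_M :: "('a \<Rightarrow> ennreal) \<Rightarrow> ennreal"
 (binder "nMean " 10) where "nn_integral_M f \<equiv> integral\<^sup>N M f"

subsection \<open>Regularly varying tails\<close>


lemma borel_measurable_indicator_greaterThan [measurable (raw)]:
 fixes f g :: "'x \<Rightarrow> real"
 assumes [measurable]: "f \<in> borel_measurable N" "g \<in> borel_measurable N"
 shows "(\<lambda>x. indicator {f x<..} (g x) :: real) \<in> borel_measurable N"
  and "(\<lambda>x. indicator {f x<..} (g x) :: ennreal) \<in> borel_measurable N"
 by (intro borel_measurable_indicator'; simp)+

locale regularly_varying_tail = prob_space M for M :: "'w measure" +
 fixes R :: "'w \<Rightarrow> real" and \<alpha> c :: real
 assumes R [measurable]: "R \<in> borel_measurable M" and R_pos: "AE \<omega> in M. 0 < R \<omega>"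
  and \<alpha>_pos: "0 < \<alpha>" and c_pos: "0 < c"
  and tail: "(\<lambda>x. prob {\<omega> \<in> space M. x < R \<omega>}) \<sim>[at_top] (\<lambda>x. c * x powr (- \<alpha>))"
begin

abbreviation G :: "real \<Rightarrow> real" where
 "G x \<equiv> prob {w \<in> space M. x < R w}"

lemma tail_limit: "((\<lambda>x. G x * x powr \<alpha>) \<longlongrightarrow> c) at_top"
proof -
 have ev: "\<forall>\<^sub>F x in at_top. x > (0::real)" by (rule eventually_gt_at_top)
 have "((\<lambda>x. G x / (c * x powr (- \<alpha>))) \<longlongrightarrow> 1) at_top"
  using c_pos by (intro asymp_equivD_strong[OF tail] eventually_mono[OF ev]) auto
 then have "((\<lambda>x. G x / (c * x powr (- \<alpha>)) * c) \<longlongrightarrow> 1 * c) at_top"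
  by (intro tendsto_intros)
 then have "((\<lambda>x. G x / (c * x powr (- \<alpha>)) * c) \<longlongrightarrow> c) at_top" by simp
 then show ?thesis
  by (rule Lim_transform_eventually)
    (use ev c_pos in \<open>auto elim!: eventually_mono simp: powr_minus field_simps\<close>)
qed

text \<open>Turns the asymptotics into a bound for all positive x: beyond some \<open>x0\<close> the
  limit gives the constant \<open>c + 1\<close>, and below it the trivial bound 1 for a probability
  costs the factor \<open>max x0 1 powr \<alpha>\<close>.\<close>

lemma tail_bound: "\<exists>C>0. \<forall>x>0. G x \<le> C * x powr (- \<alpha>)"
proof -
 have "\<forall>\<^sub>F x in at_top. G x * x powr \<alpha> < c + 1"
  using tail_limit by (rule order_tendstoD) simp
 then obtain x0 where x0: "\<And>x. x \<ge> x0 \<Longrightarrow> G x * x powr \<alpha> < c + 1"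
  by (auto simp: eventually_at_top_linorder)
 define C where "C = max (c + 1) (max x0 1 powr \<alpha>)"
 have C: "C > 0" "c + 1 \<le> C" "max x0 1 powr \<alpha> \<le> C" using c_pos by (auto simp: C_def)
 have "G x \<le> C * x powr (- \<alpha>)" if "x > 0" for x
 proof -
  have "G x * x powr \<alpha> \<le> C"
  proof (cases "x \<ge> x0")
   case True
   then show ?thesis using x0[OF True] C by simp
  next
   case False
   then have "x powr \<alpha> \<le> max x0 1 powr \<alpha>"
    using that \<alpha>_pos by (intro powr_mono2) auto
   moreover have "G x * x powr \<alpha> \<le> 1 * x powr \<alpha>"
    by (intro mult_right_mono) auto
   ultimately show ?thesis using C by simp
  qed
  then show ?thesis using that by (simp add: powr_minus field_simps)
 qed
 with C show ?thesis by blast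
qed

lemma nn_integral_indicator_tail: "(nMean w. indicator {y<..} (R w)) = ennreal (G y)"
proof -
 have "(nMean w. indicator {y<..} (R w)) = (nMean w. indicator {w \<in> space M. y < R w} w)"
  by (intro nn_integral_cong) (auto split: split_indicator)
 then show ?thesis by (simp add: emeasure_eq_measure)
qed

text \<open>Layer cake above the level x: for y > x, the power y^s is x^s times one plus the
  integral of s z^(s-1) over z from 1 to y / x. Tonelli then turns the mean into an integral of tail
  probabilities.\<close>

lemma nn_integral_powr_tail:
 assumes s: "s > 0" and x: "x > 0"
 shows "(nMean w. ennreal (R w powr s) * indicator {x<..} (R w)) =
  ennreal (x powr s) * (ennreal (G x) +
   (nLeb z. ennreal (s * z powr (s - 1) * G (x * z)) * indicator {1<..} z))"
proof -
 have pw: "ennreal (y powr s) * indicator {x<..} y = ennreal (x powr s) * (indicator {x<..} y +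
   (nLeb z. ennreal (s * z powr (s - 1)) * indicator {1<..} z * indicator {x * z<..} y))"
  (is "_ = _ * (_ + ?J)") for y :: real
 proof (cases "x < y")
  case True
  then have y: "y / x > 1" using x by simp
  have "?J = (nLeb z. ennreal (s * z powr (s - 1)) * indicator {1..y/x} z)"
  proof (rule nn_integral_cong_AE)
   have "AE z in lborel. z \<noteq> 1 \<and> z \<noteq> y / x"
    by (intro AE_conjI AE_lborel_singleton)
   then show "AE z in lborel. ennreal (s * z powr (s - 1)) * indicator {1<..} z * indicator {x * z<..} y =
     ennreal (s * z powr (s - 1)) * indicator {1..y/x} z"
    by eventually_elim (use x in \<open>auto split: split_indicator simp: field_simps\<close>)
  qed
  also have "\<dots> = ennreal ((y / x) powr s - 1 powr s)"
   using y s by (intro nn_integral_FTC_Icc[where F="\<lambda>z. z powr s"])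
    (auto intro!: derivative_eq_intros simp: has_real_derivative_iff_has_vector_derivative[symmetric])
  finally have "?J = ennreal ((y / x) powr s - 1)" by simp
  then show ?thesis using True x y s ge_one_powr_ge_zero[of "y / x" s]
   by (simp flip: ennreal_plus ennreal_1 ennreal_mult add: powr_divide)
 next
  case False
  then have "?J = (\<integral>\<^sup>+z. 0 \<partial>(lborel :: real measure))"
   proof (intro nn_integral_cong)
    fix z :: real
    show "ennreal (s * z powr (s - 1)) * indicator {1<..} z * indicator {x * z<..} y = 0"
    proof (cases "1 < z")
     case True
     then have "x * 1 < x * z" using x by (intro mult_strict_left_mono) auto
     then show ?thesis using False by (simp add: indicator_def)
    qed simp
   qed
  with False show ?thesis by simp
 qed
 have [measurable]: "(\<lambda>w. \<integral>\<^sup>+z. ennreal (s * z powr (s - 1)) * indicator {1<..} z *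
   indicator {x * z<..} (R w) \<partial>lborel) \<in> borel_measurable M"
  by measurable
 have "(nMean w. ennreal (R w powr s) * indicator {x<..} (R w)) = ennreal (x powr s) *
   ((nMean w. indicator {x<..} (R w)) +
   (nMean w. (nLeb z. ennreal (s * z powr (s - 1)) * indicator {1<..} z * indicator {x * z<..} (R w))))"
  unfolding pw by (subst nn_integral_cmult, measurable) (subst nn_integral_add; measurable)
 also have "(nMean w. (nLeb z. ennreal (s * z powr (s - 1)) * indicator {1<..} z * indicator {x * z<..} (R w))) =
   (nLeb z. (nMean w. ennreal (s * z powr (s - 1)) * indicator {1<..} z * indicator {x * z<..} (R w)))"
 proof -
  interpret pair_sigma_finite M "lborel :: real measure" ..
  show ?thesis
   by (subst Fubini'[symmetric]) auto
 qed
 also have "\<dots> = (nLeb z. ennreal (s * z powr (s - 1) * G (x * z)) * indicator {1<..} z)"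
 proof (rule nn_integral_cong)
  fix z :: real
  show "(nMean w. ennreal (s * z powr (s - 1)) * indicator {1<..} z * indicator {x * z<..} (R w)) =
    ennreal (s * z powr (s - 1) * G (x * z)) * indicator {1<..} z"
   using s by (simp add: nn_integral_cmult nn_integral_indicator_tail ennreal_mult mult_ac)
 qed
 also have "(nMean w. indicator {x<..} (R w)) = ennreal (G x)"
  by (rule nn_integral_indicator_tail)
 finally show ?thesis .
qed

text \<open>The tail bound inserted into the layer cake formula. The constant \<open>D\<close> is
  the integral of s z^(s-\<alpha>-1) over z > 1, finite because s < \<alpha>.\<close>

lemma nn_integral_powr_tail_bound:
 assumes s: "0 < s" "s < \<alpha>"
 shows "\<exists>C>0. \<forall>x>0. (nMean w. ennreal (R w powr s) * indicator {x<..} (R w)) \<le> ennreal (C * x powr (s - \<alpha>))"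
proof -
 obtain C where C: "C > 0" "\<And>x. x > 0 \<Longrightarrow> G x \<le> C * x powr (- \<alpha>)"
  using tail_bound by blast
 define D where "D = s / (\<alpha> - s)"
 have D: "D > 0" using s by (simp add: D_def)
 have "(nMean w. ennreal (R w powr s) * indicator {x<..} (R w)) \<le> ennreal (C * (1 + D) * x powr (s - \<alpha>))"
  if x: "x > 0" for x
 proof -
  have "(nLeb z. ennreal (s * z powr (s - 1) * G (x * z)) * indicator {1<..} z)
    \<le> (nLeb z. ennreal (s * C * x powr (- \<alpha>)) * (ennreal (z powr (s - \<alpha> - 1)) * indicator {1..} z))"
  proof (rule nn_integral_mono)
   fix z :: real
   have "s * z powr (s - 1) * G (x * z) \<le> s * C * x powr (- \<alpha>) * z powr (s - \<alpha> - 1)" if "z > 1"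
   proof -
    have "s * z powr (s - 1) * G (x * z) \<le> s * z powr (s - 1) * (C * (x * z) powr (- \<alpha>))"
     using s x that by (intro mult_left_mono C) auto
    also have "\<dots> = s * C * x powr (- \<alpha>) * (z powr (s - 1) * z powr (- \<alpha>))"
     using x that by (simp add: powr_mult)
    also have "z powr (s - 1) * z powr (- \<alpha>) = z powr (s - \<alpha> - 1)"
     by (simp flip: powr_add add: algebra_simps)
    finally show ?thesis .
   qed
   then show "ennreal (s * z powr (s - 1) * G (x * z)) * indicator {1<..} z
     \<le> ennreal (s * C * x powr (- \<alpha>)) * (ennreal (z powr (s - \<alpha> - 1)) * indicator {1..} z)"
    using C s by (auto split: split_indicator simp flip: ennreal_mult intro!: ennreal_leI)
  qed
  also have "\<dots> = ennreal (s * C * x powr (- \<alpha>)) * ennreal (1 / (\<alpha> - s))"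
  proof -
   have "((\<lambda>z. z powr (s - \<alpha> - 1)) has_integral 1 / (\<alpha> - s)) {1..}"
    using has_integral_powr_to_inf[of "s - \<alpha> - 1" 1] s by (simp add: minus_divide_right)
   then have "(nLeb z. ennreal (z powr (s - \<alpha> - 1)) * indicator {1..} z) = ennreal (1 / (\<alpha> - s))"
    by (intro nn_integral_has_integral_lebesgue') auto
   then show ?thesis by (subst nn_integral_cmult) auto
  qed
  also have "\<dots> = ennreal (C * D * x powr (- \<alpha>))"
   using s C by (simp flip: ennreal_mult add: D_def)
  finally have "(nMean w. ennreal (R w powr s) * indicator {x<..} (R w))
    \<le> ennreal (x powr s) * (ennreal (C * x powr (- \<alpha>)) + ennreal (C * D * x powr (- \<alpha>)))"
   unfolding nn_integral_powr_tail[OF s(1) x]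
   using C(2)[OF x] by (intro mult_left_mono add_mono ennreal_leI) auto
  also have "\<dots> = ennreal (C * (1 + D) * x powr (s - \<alpha>))"
  proof -
   have "x powr (s - \<alpha>) = x powr s * x powr (- \<alpha>)" by (simp flip: powr_add)
   then show ?thesis
    using C D by (simp flip: ennreal_mult ennreal_plus add: algebra_simps)
  qed
  finally show ?thesis .
 qed
 then show ?thesis using C D by (intro exI[of _ "C * (1 + D)"]) auto
qed

text \<open>The mirror image for exponents above \<alpha>: the power is now built up from 0, and p
  z^(p-\<alpha>-1) is integrable at the origin. \<open>D\<close> is its integral over the unit
  interval.\<close>

lemma nn_integral_powr_trunc_bound:
 assumes p: "\<alpha> < p"
 shows "\<exists>C>0. \<forall>x>0. (nMean w. ennreal (R w powr p) * indicator {..x} (R w)) \<le> ennreal (C * x powr (p - \<alpha>))"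
proof -
 obtain C where C: "C > 0" "\<And>x. x > 0 \<Longrightarrow> G x \<le> C * x powr (- \<alpha>)"
  using tail_bound by blast
 define D where "D = p / (p - \<alpha>)"
 have D: "D > 0" using p \<alpha>_pos by (simp add: D_def)
 have "(nMean w. ennreal (R w powr p) * indicator {..x} (R w)) \<le> ennreal (C * D * x powr (p - \<alpha>))"
  if x: "x > 0" for x
 proof -
  \<comment> \<open>The cut at x is moved from y to the integration variable z. This gives an
    inequality, since values y > x contribute to the right side as well.\<close>
  have pw: "ennreal (y powr p) * indicator {..x} y \<le>
    (nLeb z. ennreal (p * z powr (p - 1)) * indicator {0<..x} z * indicator {z<..} y)" if y: "0 < y" for y
  proof (cases "y \<le> x")
   case True
   have "((\<lambda>z. z powr (p - 1)) has_integral y powr p / p) {0..y}"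
    using has_integral_powr_from_0[of "p - 1" y] p \<alpha>_pos y by simp
   then have "((\<lambda>z. p * z powr (p - 1)) has_integral p * (y powr p / p)) {0..y}"
    by (rule has_integral_mult_right)
   then have "(nLeb z. ennreal (p * z powr (p - 1)) * indicator {0..y} z) = ennreal (p * (y powr p / p))"
    using p \<alpha>_pos by (intro nn_integral_has_integral_lebesgue') auto
   then have "ennreal (y powr p) = (nLeb z. ennreal (p * z powr (p - 1)) * indicator {0..y} z)"
    using p \<alpha>_pos by simp
   also have "\<dots> = (nLeb z. ennreal (p * z powr (p - 1)) * indicator {0<..x} z * indicator {z<..} y)"
   proof (rule nn_integral_cong_AE)
    have "AE z in lborel. z \<noteq> 0 \<and> z \<noteq> y"
     by (intro AE_conjI AE_lborel_singleton)
    then show "AE z in lborel. ennreal (p * z powr (p - 1)) * indicator {0..y} z =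
      ennreal (p * z powr (p - 1)) * indicator {0<..x} z * indicator {z<..} y"
     by eventually_elim (use True in \<open>auto split: split_indicator\<close>)
   qed
   finally show ?thesis using True by simp
  qed simp
  have "(nMean w. ennreal (R w powr p) * indicator {..x} (R w)) \<le>
    (nMean w. (nLeb z. ennreal (p * z powr (p - 1)) * indicator {0<..x} z * indicator {z<..} (R w)))"
   by (rule nn_integral_mono_AE) (use R_pos pw in auto)
  also have "\<dots> = (nLeb z. (nMean w. ennreal (p * z powr (p - 1)) * indicator {0<..x} z * indicator {z<..} (R w)))"
  proof -
   interpret pair_sigma_finite M "lborel :: real measure" ..
   show ?thesis
    by (subst Fubini'[symmetric]) auto
  qed
  also have "\<dots> \<le> (nLeb z. ennreal (p * C) * (ennreal (z powr (p - \<alpha> - 1)) * indicator {0..x} z))"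
  proof (rule nn_integral_mono)
   fix z :: real
   have "(nMean w. ennreal (p * z powr (p - 1)) * indicator {0<..x} z * indicator {z<..} (R w)) =
     ennreal (p * z powr (p - 1) * G z) * indicator {0<..x} z"
    using p \<alpha>_pos
    by (subst nn_integral_cmult, simp, subst nn_integral_indicator_tail) (simp add: ennreal_mult mult_ac)
   also have "\<dots> \<le> ennreal (p * C) * (ennreal (z powr (p - \<alpha> - 1)) * indicator {0..x} z)"
   proof (cases "0 < z \<and> z \<le> x")
    case True
    have "p * z powr (p - 1) * G z \<le> p * z powr (p - 1) * (C * z powr (- \<alpha>))"
     using p \<alpha>_pos True by (intro mult_left_mono C) auto
    also have "\<dots> = p * C * (z powr (p - 1) * z powr (- \<alpha>))" by simp
    also have "z powr (p - 1) * z powr (- \<alpha>) = z powr (p - \<alpha> - 1)"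
     by (simp flip: powr_add add: algebra_simps)
    finally show ?thesis using True p \<alpha>_pos C by (simp flip: ennreal_mult add: ennreal_leI)
   qed auto
   finally show "(nMean w. ennreal (p * z powr (p - 1)) * indicator {0<..x} z * indicator {z<..} (R w))
     \<le> ennreal (p * C) * (ennreal (z powr (p - \<alpha> - 1)) * indicator {0..x} z)" .
  qed
  also have "\<dots> = ennreal (p * C) * ennreal (x powr (p - \<alpha>) / (p - \<alpha>))"
  proof -
   have "((\<lambda>z. z powr (p - \<alpha> - 1)) has_integral x powr (p - \<alpha>) / (p - \<alpha>)) {0..x}"
    using has_integral_powr_from_0[of "p - \<alpha> - 1" x] p x by simp
   then have "(nLeb z. ennreal (z powr (p - \<alpha> - 1)) * indicator {0..x} z) = ennreal (x powr (p - \<alpha>) / (p - \<alpha>))"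
    by (intro nn_integral_has_integral_lebesgue') auto
   then show ?thesis by (subst nn_integral_cmult) auto
  qed
  also have "\<dots> = ennreal (C * D * x powr (p - \<alpha>))"
   using p \<alpha>_pos C by (simp flip: ennreal_mult add: D_def)
  finally show ?thesis .
 qed
 then show ?thesis using C D by (intro exI[of _ "C * D"]) auto
qed

definition tail_moment :: "real \<Rightarrow> real \<Rightarrow> real" where
 "tail_moment s x = (Mean w. R w powr s * indicator {x<..} (R w))"

text \<open>Karamata's theorem. Normalised by x^\<alpha>, the layer cake integrand converges
  pointwise to c s z^(s-\<alpha>-1) and is dominated by a multiple of the same power, so the limit
  is c + c s / (\<alpha> - s).\<close>

lemma tail_moment_limit:
 assumes s: "0 < s" "s < \<alpha>"
 shows "((\<lambda>x. tail_moment s x * x powr (\<alpha> - s)) \<longlongrightarrow> c * \<alpha> / (\<alpha> - s)) at_top"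
proof -
 obtain C where C: "C > 0" "\<And>x. x > 0 \<Longrightarrow> G x \<le> C * x powr (- \<alpha>)"
  using tail_bound by blast
 \<comment> \<open>The probability is rewritten as a parameter integral of a jointly measurable
   indicator.\<close>
 have [measurable]: "(\<lambda>z. G (x * z)) \<in> borel_measurable borel" for x
 proof -
  have "(\<lambda>z. G (x * z)) = (\<lambda>z. \<integral>y. indicator {x * z<..} (R y) \<partial>M)"
  proof
   fix z
   have "G (x * z) = (Mean y. indicator {y \<in> space M. x * z < R y} y)" by simp
   also have "\<dots> = (Mean y. indicator {x * z<..} (R y))"
    by (intro Bochner_integral_cong) (auto split: split_indicator)
   finally show "G (x * z) = (Mean y. indicator {x * z<..} (R y))" .
  qed
  also have "\<dots> \<in> borel_measurable borel" by measurable
  finally show ?thesis .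
 qed
 define h where "h x z = s * z powr (s - 1) * (G (x * z) * x powr \<alpha>) * indicator {1<..} z" for x z
 define h0 where "h0 z = s * z powr (s - 1) * (c * z powr (- \<alpha>)) * indicator {1<..} z" for z
 have J: "((\<lambda>z. z powr (s - \<alpha> - 1)) has_integral 1 / (\<alpha> - s)) {1..}"
  using has_integral_powr_to_inf[of "s - \<alpha> - 1" 1] s by (simp add: minus_divide_right)
 have hb: "has_bochner_integral lborel (\<lambda>z. z powr (s - \<alpha> - 1) * indicator {1..} z) (1 / (\<alpha> - s))"
  using s nn_integral_has_integral_lebesgue'[OF _ J]
  by (intro has_bochner_integral_nn_integral) (auto simp: ennreal_mult'' ennreal_indicator)
 have bound: "norm (h x z) \<le> s * C * (z powr (s - \<alpha> - 1) * indicator {1..} z)" if "x > 0" for x z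
 proof (cases "z > 1")
  case True
  have "G (x * z) * x powr \<alpha> \<le> C * (x * z) powr (- \<alpha>) * x powr \<alpha>"
   using that True by (intro mult_right_mono C) auto
  also have "\<dots> = C * z powr (- \<alpha>)"
   using that True by (simp add: powr_mult powr_minus field_simps)
  finally have "s * z powr (s - 1) * (G (x * z) * x powr \<alpha>) \<le> s * z powr (s - 1) * (C * z powr (- \<alpha>))"
   using s by (intro mult_left_mono) auto
  also have "\<dots> = s * C * (z powr (s - 1) * z powr (- \<alpha>))" by simp
  also have "z powr (s - 1) * z powr (- \<alpha>) = z powr (s - \<alpha> - 1)"
   by (simp flip: powr_add add: algebra_simps)
  finally show ?thesis using True s by (simp add: h_def abs_mult)
 qed (use C s in \<open>auto simp: h_def\<close>)
 have lim: "((\<lambda>x. h x z) \<longlongrightarrow> h0 z) at_top" for z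
 proof (cases "z > 1")
  case True
  have "filterlim (\<lambda>x. x * z) at_top at_top"
   using True by (intro filterlim_at_top_mult_tendsto_pos[OF tendsto_const] filterlim_ident) auto
  from filterlim_compose[OF tail_limit this]
  have "((\<lambda>x. G (x * z) * (x * z) powr \<alpha> * z powr (- \<alpha>)) \<longlongrightarrow> c * z powr (- \<alpha>)) at_top"
   by (intro tendsto_intros)
  then have L: "((\<lambda>x. G (x * z) * x powr \<alpha>) \<longlongrightarrow> c * z powr (- \<alpha>)) at_top"
   by (rule Lim_transform_eventually)
     (use True in \<open>auto intro!: eventually_mono[OF eventually_gt_at_top[of 0]] simp: powr_mult powr_minus field_simps\<close>)
  show ?thesis unfolding h_def h0_def by (intro tendsto_mult tendsto_const L)
 qed (simp add: h_def h0_def)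
 have meas: "h x \<in> borel_measurable lborel" "h0 \<in> borel_measurable lborel" for x
  unfolding h_def h0_def by measurable
 have "((\<lambda>x. \<integral>z. h x z \<partial>lborel) \<longlongrightarrow> (Leb z. h0 z)) at_top"
 proof (rule integral_dominated_convergence_at_top[where w="\<lambda>z. s * C * (z powr (s - \<alpha> - 1) * indicator {1..} z)"])
  show "integrable lborel (\<lambda>z. s * C * (z powr (s - \<alpha> - 1) * indicator {1..} z))"
   using hb by (intro integrable_mult_right) (auto simp: has_bochner_integral_iff)
  show "\<forall>\<^sub>F x in at_top. AE z in lborel. norm (h x z) \<le> s * C * (z powr (s - \<alpha> - 1) * indicator {1..} z)"
   by (rule eventually_mono[OF eventually_gt_at_top[of 0]]) (use bound in auto)
 qed (use lim meas in auto)
 moreover have "(Leb z. h0 z) = c * s / (\<alpha> - s)"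
 proof -
  have pw: "z powr (s - \<alpha> - 1) = z powr (s - 1) * z powr (- \<alpha>)" for z
   by (simp flip: powr_add add: algebra_simps)
  have "AE z in lborel. h0 z = s * c * (z powr (s - \<alpha> - 1) * indicator {1..} z)"
   using AE_lborel_singleton[of 1]
   by eventually_elim (auto simp: h0_def pw split: split_indicator)
  then have "(Leb z. h0 z) = (Leb z. s * c * (z powr (s - \<alpha> - 1) * indicator {1..} z))"
   using meas by (intro integral_cong_AE) auto
  also have "\<dots> = s * c * (1 / (\<alpha> - s))"
   using hb by (simp add: has_bochner_integral_iff)
  finally show ?thesis by simp
 qed
 ultimately have "((\<lambda>x. G x * x powr \<alpha> + (Leb z. h x z)) \<longlongrightarrow> c + c * s / (\<alpha> - s)) at_top"
  by (intro tendsto_intros tail_limit) auto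
 also have "c + c * s / (\<alpha> - s) = c * \<alpha> / (\<alpha> - s)"
  using s by (simp add: field_simps)
 finally show ?thesis
 proof (rule Lim_transform_eventually)
  have "G x * x powr \<alpha> + (Leb z. h x z) = tail_moment s x * x powr (\<alpha> - s)" if x: "x > 0" for x
  proof -
   define g where "g z = s * z powr (s - 1) * G (x * z) * indicator {1<..} z" for z
   have [measurable]: "g \<in> borel_measurable lborel" unfolding g_def by measurable
   have g0: "g z \<ge> 0" for z using s by (simp add: g_def)
   have hg: "h x z = x powr \<alpha> * g z" for z by (simp add: h_def g_def)
   have gh: "g = (\<lambda>z. x powr (- \<alpha>) * h x z)" using x by (simp add: hg powr_minus fun_eq_iff)
   have "integrable lborel (h x)"
    by (rule Bochner_integrable_bound[of _ "\<lambda>z. s * C * (z powr (s - \<alpha> - 1) * indicator {1..} z)"])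
      (use hb meas bound[OF x] C s in \<open>auto simp: has_bochner_integral_iff\<close>)
   then have gi: "integrable lborel g" unfolding gh by (rule integrable_mult_right)
   have "tail_moment s x = enn2real (nMean y. ennreal (R y powr s * indicator {x<..} (R y)))"
    unfolding tail_moment_def by (rule integral_eq_nn_integral) auto
   also have "(nMean y. ennreal (R y powr s * indicator {x<..} (R y))) =
     ennreal (x powr s) * (ennreal (G x) + (nLeb z. ennreal (g z)))"
    using nn_integral_powr_tail[OF s(1) x] s
    by (simp add: ennreal_mult'' ennreal_indicator g_def)
   also have "(nLeb z. ennreal (g z)) = ennreal (Leb z. g z)"
    using gi g0 by (intro nn_integral_eq_integral) auto
   also have "enn2real (ennreal (x powr s) * (ennreal (G x) + ennreal (Leb z. g z))) =
     x powr s * (G x + (Leb z. g z))"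
    using g0 by (simp flip: ennreal_plus ennreal_mult add: integral_nonneg_AE)
   finally have "tail_moment s x = x powr s * (G x + (Leb z. g z))" .
   moreover have "(Leb z. h x z) = x powr \<alpha> * (Leb z. g z)"
    by (simp add: hg)
   moreover have "x powr s * x powr (\<alpha> - s) = x powr \<alpha>"
    by (simp flip: powr_add)
   ultimately show ?thesis by (simp add: algebra_simps)
  qed
  then show "\<forall>\<^sub>F x in at_top. G x * x powr \<alpha> + (Leb z. h x z) = tail_moment s x * x powr (\<alpha> - s)"
   by (intro eventually_mono[OF eventually_gt_at_top[of 0]]) auto
 qed
qed

end

subsection \<open>Campbell formula and generating functional of the Poisson process\<close>


text \<open>Connects the extended valued count with counts over prefixes of the enumeration: a
  finite count means finitely many hits, all of which occur before some index.\<close>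

lemma eventually_card_prefix:
 fixes x :: "nat \<Rightarrow> 'a"
 assumes "(\<Sum>j. indicator B (x j) :: ennreal) = of_nat k"
 shows "\<forall>\<^sub>F n in sequentially. card {j. j < n \<and> x j \<in> B} = k"
proof -
 let ?J = "{j. x j \<in> B}"
 have "(\<Sum>j. indicator B (x j) :: ennreal) = (\<integral>\<^sup>+j. indicator ?J j \<partial>count_space UNIV)"
 proof -
  have "(\<lambda>j. indicator B (x j) :: ennreal) = indicator ?J"
   by (auto simp: fun_eq_iff split: split_indicator)
  then show ?thesis by (simp add: nn_integral_count_space_nat)
 qed
 also have "\<dots> = emeasure (count_space UNIV) ?J" by simp
 finally have e: "emeasure (count_space UNIV) ?J = of_nat k" using assms by simp
 have fin: "finite ?J"
  by (rule ccontr) (use e in simp)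
 then have "card ?J = k" using e by (simp add: emeasure_count_space_finite)
 moreover obtain m where "\<forall>j\<in>?J. j < m" using fin finite_nat_set_iff_bounded by blast
 ultimately show ?thesis
  by (intro eventually_sequentiallyI[of m]) (auto intro!: arg_cong[where f=card])
qed

text \<open>The power of v to a count, totalised so that it is a Borel function on the extended half
  line and independence of counts carries over to it. Its value at infinity is v^0 = 1.\<close>

definition power_count :: "complex \<Rightarrow> ennreal \<Rightarrow> complex" where
 "power_count v c = v ^ nat \<lfloor>enn2real c\<rfloor>"

lemma power_count_of_nat [simp]: "power_count v (of_nat k) = v ^ k"
 by (simp add: power_count_def)

lemma borel_measurable_power_count [measurable]: "power_count v \<in> borel_measurable borel"
 unfolding power_count_def by measurable

lemma norm_power_count_le: "norm v \<le> 1 \<Longrightarrow> norm (power_count v c) \<le> 1"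
 by (simp add: power_count_def norm_power power_le_one)

locale unit_poisson = prob_space M for M :: "'w measure" +
 fixes u :: "nat \<Rightarrow> 'w \<Rightarrow> 'a::euclidean_space"
 assumes unit_poisson: "unit_poisson_process M u"
begin

lemma borel_measurable_points [measurable]: "u j \<in> borel_measurable M"
 using unit_poisson by (auto simp: unit_poisson_process_def)

lemma borel_measurable_point_count [measurable]:
 assumes [measurable]: "B \<in> sets borel"
 shows "point_count u B \<in> borel_measurable M"
 unfolding point_count_def[abs_def] by measurable

lemma prob_point_count:
 assumes "B \<in> sets borel" "emeasure lborel B < \<infinity>"
 shows "prob {w \<in> space M. point_count u B w = of_nat k} =
  exp (- measure lborel B) * measure lborel B ^ k / fact k"
 using unit_poisson assms by (auto simp: unit_poisson_process_def)

text \<open>The Poisson weights sum to one, so no mass is left for an infinite count.\<close>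

lemma AE_point_count_nat:
 assumes [measurable]: "B \<in> sets borel" and fin: "emeasure lborel B < \<infinity>"
 shows "AE w in M. \<exists>k. point_count u B w = of_nat k"
proof -
 let ?m = "measure lborel B"
 let ?A = "\<lambda>k::nat. {w \<in> space M. point_count u B w = of_nat k}"
 have "(\<lambda>k. exp (- ?m) * (?m ^ k /\<^sub>R fact k)) sums (exp (- ?m) * exp ?m)"
  by (intro sums_mult exp_converges)
 then have "(\<lambda>k. prob (?A k)) sums 1"
  by (simp add: prob_point_count[OF assms] exp_minus field_simps)
 moreover have "(\<lambda>k. prob (?A k)) sums prob (\<Union>k. ?A k)"
  by (intro finite_measure_UNION) (auto simp: disjoint_family_on_def)
 ultimately have "prob (\<Union>k. ?A k) = 1" by (simp add: sums_iff)
 then have "AE w in M. w \<in> (\<Union>k. ?A k)"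
  by (intro AE_prob_1) auto
 then show ?thesis by eventually_elim auto
qed

text \<open>Probability generating function of the Poisson law, summed over the values of the count;
  the exponential series in \<open>?m * norm v\<close> justifies the interchange of sum and
  mean.\<close>

lemma integral_power_count:
 assumes [measurable]: "B \<in> sets borel" and fin: "emeasure lborel B < \<infinity>" and v: "norm v \<le> 1"
 shows "(Mean w. power_count v (point_count u B w)) = exp (of_real (measure lborel B) * (v - 1))"
proof -
 let ?m = "measure lborel B"
 let ?A = "\<lambda>k::nat. {w \<in> space M. point_count u B w = of_nat k}"
 define f where "f k w = indicator (?A k) w *\<^sub>R v ^ k" for k w
 have one: "f k w = 0" if "point_count u B w = of_nat l" "k \<noteq> l" for k l w
  using that by (auto simp: f_def)
 have fs: "(\<lambda>k. norm (f k w)) sums norm (f l w)" "(\<lambda>k. f k w) sums f l w"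
  if "point_count u B w = of_nat l" for l w
  using sums_finite[of "{l}" "\<lambda>k. norm (f k w)"] sums_finite[of "{l}" "\<lambda>k. f k w"] one[OF that] by auto
 have intf: "(Mean w. f k w) = of_real (exp (- ?m)) * ((of_real ?m * v) ^ k /\<^sub>R fact k)"
  "(Mean w. norm (f k w)) = exp (- ?m) * ((?m * norm v) ^ k /\<^sub>R fact k)" for k
 proof -
  have "(Mean w. f k w) = prob (?A k) *\<^sub>R v ^ k"
   unfolding f_def
   by (intro has_bochner_integral_integral_eq has_bochner_integral_indicator) (auto simp: less_top[symmetric])
  then show "(Mean w. f k w) = of_real (exp (- ?m)) * ((of_real ?m * v) ^ k /\<^sub>R fact k)"
   by (simp add: prob_point_count[OF assms(1,2)] power_mult_distrib scaleR_conv_of_real field_simps)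
  have "(Mean w. norm (f k w)) = (Mean w. norm v ^ k * indicator (?A k) w)"
   unfolding f_def by (intro Bochner_integral_cong) (auto simp: norm_mult norm_power split: split_indicator)
  then show "(Mean w. norm (f k w)) = exp (- ?m) * ((?m * norm v) ^ k /\<^sub>R fact k)"
   by (simp add: prob_point_count[OF assms(1,2)] power_mult_distrib field_simps)
 qed
 have "(\<lambda>k. \<integral>w. f k w \<partial>M) sums (Mean w. (\<Sum>k. f k w))"
 proof (rule sums_integral)
  show "integrable M (f k)" for k
   by (rule integrable_const_bound[of _ "norm v ^ k"]) (auto simp: f_def[abs_def] norm_mult norm_power split: split_indicator)
  show "AE w in M. summable (\<lambda>k. norm (f k w))"
   using AE_point_count_nat[OF assms(1,2)] by eventually_elim (use fs in \<open>auto simp: sums_iff\<close>)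
  show "summable (\<lambda>k. \<integral>w. norm (f k w) \<partial>M)"
   unfolding intf by (intro summable_mult summable_exp_generic)
 qed
 moreover have "(\<lambda>k. \<integral>w. f k w \<partial>M) sums (of_real (exp (- ?m)) * exp (of_real ?m * v))"
  unfolding intf by (intro sums_mult exp_converges)
 ultimately have "(Mean w. (\<Sum>k. f k w)) = of_real (exp (- ?m)) * exp (of_real ?m * v)"
  by (rule sums_unique2)
 moreover have "(Mean w. power_count v (point_count u B w)) = (Mean w. (\<Sum>k. f k w))"
 proof (rule integral_cong_AE)
  show "AE w in M. power_count v (point_count u B w) = (\<Sum>k. f k w)"
   using AE_point_count_nat[OF assms(1,2)] AE_space
  proof eventually_elim
   case (elim w)
   then obtain l where l: "point_count u B w = of_nat l" by auto
   then show ?case using fs(2)[OF l] elim by (simp add: sums_iff f_def)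
  qed
 qed (auto simp: f_def[abs_def])
 ultimately show ?thesis
  by (simp add: right_diff_distrib exp_diff exp_of_real exp_minus field_simps flip: exp_of_real)
qed

lemma nn_integral_point_count:
 assumes [measurable]: "B \<in> sets borel" and fin: "emeasure lborel B < \<infinity>"
 shows "(nMean w. point_count u B w) = emeasure lborel B"
proof -
 let ?m = "measure lborel B"
 let ?A = "\<lambda>k::nat. {w \<in> space M. point_count u B w = of_nat k}"
 have "(nMean w. point_count u B w) = (nMean w. (\<Sum>k. of_nat k * indicator (?A k) w))"
 proof (rule nn_integral_cong_AE)
  show "AE w in M. point_count u B w = (\<Sum>k. of_nat k * indicator (?A k) w)"
   using AE_point_count_nat[OF assms] AE_space
  proof eventually_elim
   case (elim w)
   then obtain l where l: "point_count u B w = of_nat l" by auto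
   have "(\<Sum>k. of_nat k * indicator (?A k) w :: ennreal) = (\<Sum>k\<in>{l}. of_nat k * indicator (?A k) w)"
    by (rule suminf_finite) (auto simp: l)
   then show ?case using elim l by simp
  qed
 qed
 also have "\<dots> = (\<Sum>k. of_nat k * emeasure M (?A k))"
  by (subst nn_integral_suminf) (simp_all add: nn_integral_cmult)
 also have "\<dots> = (\<Sum>k. ennreal (real k * (exp (- ?m) * ?m ^ k / fact k)))"
  unfolding emeasure_eq_measure prob_point_count[OF assms]
  by (simp add: ennreal_of_nat_eq_real_of_nat flip: ennreal_mult)
 also have "\<dots> = ennreal ?m"
 proof -
  have "(\<lambda>k. ?m * exp (- ?m) * (?m ^ k /\<^sub>R fact k)) sums (?m * exp (- ?m) * exp ?m)"
   by (intro sums_mult exp_converges)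
  \<comment> \<open>The term for k = 0 vanishes, so the series for the mean is an exponential series
    shifted by one index.\<close>
  moreover have "?m * exp (- ?m) * (?m ^ k /\<^sub>R fact k) = real (Suc k) * (exp (- ?m) * ?m ^ Suc k / fact (Suc k))" for k
   by (simp add: divide_simps del: of_nat_Suc)
  ultimately have "(\<lambda>k. real (Suc k) * (exp (- ?m) * ?m ^ Suc k / fact (Suc k))) sums ?m"
   by (simp only: exp_minus) (simp add: mult.assoc)
  then have "(\<lambda>k. real k * (exp (- ?m) * ?m ^ k / fact k)) sums ?m"
   by (subst (asm) sums_Suc_iff) simp
  then show ?thesis
   by (intro suminf_ennreal_eq) auto
 qed
 finally show ?thesis using fin by (simp add: emeasure_eq_ennreal_measure)
qed

text \<open>The intensity measure, the image of counting measure times \<open>M\<close> under the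
  enumeration of points, gives every box its volume and therefore is Lebesgue measure. The formula
  is integration of F against it.\<close>

lemma campbell:
 fixes F :: "'a \<Rightarrow> ennreal"
 assumes [measurable]: "F \<in> borel_measurable borel"
 shows "(nMean w. (\<Sum>j. F (u j w))) = (nLeb x. F x)"
proof -
 let ?C = "count_space UNIV :: nat measure"
 interpret C: sigma_finite_measure ?C by (rule sigma_finite_measure_count_space)
 interpret P: pair_sigma_finite ?C M ..
 have [measurable]: "(\<lambda>(j, w). u j w) \<in> borel_measurable (?C \<Otimes>\<^sub>M M)"
  by measurable
 define N where "N = distr (?C \<Otimes>\<^sub>M M) borel (\<lambda>(j, w). u j w)"
 have N: "(\<integral>\<^sup>+x. f x \<partial>N) = (nMean w. (\<Sum>j. f (u j w)))" if [measurable]: "f \<in> borel_measurable borel"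
  for f :: "'a \<Rightarrow> ennreal"
 proof -
  have "(\<integral>\<^sup>+x. f x \<partial>N) = (\<integral>\<^sup>+p. f (u (fst p) (snd p)) \<partial>(?C \<Otimes>\<^sub>M M))"
   unfolding N_def by (subst nn_integral_distr) (auto simp: split_beta')
  also have "\<dots> = (nMean w. (\<integral>\<^sup>+j. f (u j w) \<partial>?C))"
   by (subst P.nn_integral_snd[symmetric]) (auto simp: split_beta')
  finally show ?thesis by (simp add: nn_integral_count_space_nat)
 qed
 have "lborel = N"
 proof (rule lborel_eqI)
  fix l r :: 'a assume le: "\<And>b. b \<in> Basis \<Longrightarrow> l \<bullet> b \<le> r \<bullet> b"
  have "emeasure N (box l r) = (\<integral>\<^sup>+x. indicator (box l r) x \<partial>N)"
   by (simp add: N_def)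
  also have "\<dots> = (nMean w. point_count u (box l r) w)"
   by (subst N) (auto simp: point_count_def[abs_def])
  also have "\<dots> = emeasure lborel (box l r)"
   by (rule nn_integral_point_count) (auto simp: emeasure_lborel_box_eq)
  finally show "emeasure N (box l r) = (\<Prod>b\<in>Basis. (r - l) \<bullet> b)"
   using le by (simp add: emeasure_lborel_box)
 qed (simp add: N_def)
 then show ?thesis using N[OF assms] by simp
qed

text \<open>The level sets of the values other than 1 are disjoint and of finite measure, so their
  counts are independent Poisson variables, and the product over points is a product of powers of
  these values. Prefix products stand in for the product over the whole enumeration.\<close>

lemma generating_functional_finite_range:
 fixes H :: "'a \<Rightarrow> complex"
 assumes [measurable]: "H \<in> borel_measurable borel" and H1: "\<And>x. norm (H x) \<le> 1"
  and fr: "finite (range H)" and fm: "emeasure lborel {x. H x \<noteq> 1} < \<infinity>"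
 shows "(\<lambda>n. \<integral>z. (\<Prod>j<n. H (u j z)) \<partial>M) \<longlonglongrightarrow> exp (Leb x. H x - 1)"
proof -
 let ?V = "range H - {1}"
 have finV: "finite ?V" using fr by simp
 obtain f where f: "bij_betw f {..<card ?V} ?V"
  using ex_bij_betw_nat_finite[OF finV] by (auto simp: atLeast0LessThan)
 define K where "K = card ?V"
 define B where "B i = (if i < K then H -` {f i} else {})" for i
 have B [measurable]: "B i \<in> sets borel" for i
  unfolding B_def using measurable_sets_borel[OF assms(1), of "{f i}"] by auto
 have fV: "f i \<in> ?V" if "i < K" for i using f that by (auto simp: bij_betw_def K_def)
 have finj: "f i = f j \<longleftrightarrow> i = j" if "i < K" "j < K" for i j
  using f that by (auto simp: bij_betw_def K_def inj_on_def)
 have disj: "disjoint_family B"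
  by (auto simp: disjoint_family_on_def B_def finj split: if_splits)
 have Bfin: "emeasure lborel (B i) < \<infinity>" for i
 proof -
  have "emeasure lborel (B i) \<le> emeasure lborel {x. H x \<noteq> 1}"
   by (rule emeasure_mono) (use fV in \<open>auto simp: B_def\<close>)
  then show ?thesis using fm by (rule le_less_trans)
 qed
 have Hsum: "H x - 1 = (\<Sum>i<K. (f i - 1) * indicator (B i) x)" for x
 proof (cases "H x = 1")
  case True
  then have "x \<notin> B i" for i using fV by (auto simp: B_def)
  then show ?thesis using True by simp
 next
  case False
  then have "H x \<in> f ` {..<K}" using f by (auto simp: bij_betw_def K_def)
  then obtain i where i: "i < K" "H x = f i" by auto
  have "(\<Sum>l<K. (f l - 1) * indicator (B l) x) = (\<Sum>l\<in>{i}. (f l - 1) * indicator (B l) x)"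
   using i by (intro sum.mono_neutral_right) (auto simp: B_def finj)
  then show ?thesis using i by (simp add: B_def)
 qed
 have Hprod: "H x = (\<Prod>i<K. f i ^ (if x \<in> B i then 1 else 0))" for x
 proof (cases "H x = 1")
  case True
  then have "x \<notin> B i" for i using fV by (auto simp: B_def)
  then show ?thesis using True by simp
 next
  case False
  then have "H x \<in> f ` {..<K}" using f by (auto simp: bij_betw_def K_def)
  then obtain i where i: "i < K" "H x = f i" by auto
  have "(\<Prod>l<K. f l ^ (if x \<in> B l then 1 else 0)) = (\<Prod>l\<in>{i}. f l ^ (if x \<in> B l then 1 else 0))"
   using i by (intro prod.mono_neutral_right) (auto simp: B_def finj)
  then show ?thesis using i by (simp add: B_def)
 qed
 have fn: "norm (f i) \<le> 1" if "i < K" for i using fV[OF that] H1 by auto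
 have prodn: "(\<Prod>j<n. H (x j)) = (\<Prod>i<K. f i ^ card {j. j < n \<and> x j \<in> B i})" for n and x :: "nat \<Rightarrow> 'a"
 proof -
  have "(\<Prod>j<n. H (x j)) = (\<Prod>i<K. \<Prod>j<n. f i ^ (if x j \<in> B i then 1 else 0))"
   by (subst Hprod) (rule prod.swap)
  also have "\<dots> = (\<Prod>i<K. f i ^ (\<Sum>j<n. if x j \<in> B i then 1 else 0))"
   by (simp only: power_sum)
  also have "\<dots> = (\<Prod>i<K. f i ^ card {j. j < n \<and> x j \<in> B i})"
   by (simp add: sum.If_cases lessThan_def Collect_conj_eq)
  finally show ?thesis .
 qed
 \<comment> \<open>Almost surely all counts are finite, and then the prefix products are eventually
   constant.\<close>
 have "AE z in M. \<forall>i. \<exists>k. point_count u (B i) z = of_nat k"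
  using AE_point_count_nat[OF B Bfin] by (simp add: AE_all_countable)
 then have "AE z in M. (\<lambda>n. \<Prod>j<n. H (u j z)) \<longlonglongrightarrow> (\<Prod>i<K. power_count (f i) (point_count u (B i) z))"
 proof eventually_elim
  case (elim z)
  show ?case unfolding prodn
  proof (intro tendsto_prod)
   fix i
   obtain k where k: "point_count u (B i) z = of_nat k" using elim by blast
   have "\<forall>\<^sub>F n in sequentially. card {j. j < n \<and> u j z \<in> B i} = k"
    using k by (intro eventually_card_prefix) (simp add: point_count_def)
   then show "(\<lambda>n. f i ^ card {j. j < n \<and> u j z \<in> B i}) \<longlonglongrightarrow> power_count (f i) (point_count u (B i) z)"
    unfolding k power_count_of_nat by (intro tendsto_eventually) (auto elim: eventually_mono)
  qed
 qed
 then have "(\<lambda>n. \<integral>z. (\<Prod>j<n. H (u j z)) \<partial>M) \<longlonglongrightarrow>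
   (Mean z. (\<Prod>i<K. power_count (f i) (point_count u (B i) z)))"
  by (intro integral_dominated_convergence[where w="\<lambda>_. 1"])
    (auto simp: prod_norm[symmetric] intro!: prod_le_1 H1)
 also have "(Mean z. (\<Prod>i<K. power_count (f i) (point_count u (B i) z))) =
   (\<Prod>i<K. \<integral>z. power_count (f i) (point_count u (B i) z) \<partial>M)"
 proof (rule indep_vars_lebesgue_integral)
  have "indep_vars (\<lambda>_. borel) (\<lambda>i. point_count u (B i)) UNIV"
   using unit_poisson disj B unfolding unit_poisson_process_def by (auto simp: image_subset_iff)
  then have "indep_vars (\<lambda>_. borel) (\<lambda>i. point_count u (B i)) {..<K}"
   by (rule indep_vars_subset) auto
  then show "indep_vars (\<lambda>_. borel) (\<lambda>i z. power_count (f i) (point_count u (B i) z)) {..<K}"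
   by (rule indep_vars_compose2) auto
  show "integrable M (\<lambda>z. power_count (f i) (point_count u (B i) z))" if "i \<in> {..<K}" for i
   using that fn by (intro integrable_const_bound[of _ 1]) (auto intro: norm_power_count_le)
 qed simp
 also have "\<dots> = (\<Prod>i<K. exp (of_real (measure lborel (B i)) * (f i - 1)))"
  using Bfin by (intro prod.cong refl integral_power_count) (auto simp: fn)
 also have "\<dots> = exp (\<Sum>i<K. of_real (measure lborel (B i)) * (f i - 1))"
  by (simp add: exp_sum)
 also have "(\<Sum>i<K. of_real (measure lborel (B i)) * (f i - 1)) = (Leb x. H x - 1)"
 proof -
  have i: "has_bochner_integral lborel (\<lambda>x. (f i - 1) * indicator (B i) x)
    (of_real (measure lborel (B i)) * (f i - 1))" for i
  proof -
   have "has_bochner_integral lborel (\<lambda>x. indicator (B i) x *\<^sub>R (f i - 1)) (measure lborel (B i) *\<^sub>R (f i - 1))"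
    using Bfin by (intro has_bochner_integral_indicator) auto
   moreover have "(\<lambda>x. indicator (B i) x *\<^sub>R (f i - 1)) = (\<lambda>x. (f i - 1) * indicator (B i) x)"
    by (auto simp: fun_eq_iff split: split_indicator)
   ultimately show ?thesis by (simp add: scaleR_conv_of_real)
  qed
  have "has_bochner_integral lborel (\<lambda>x. \<Sum>i<K. (f i - 1) * indicator (B i) x)
    (\<Sum>i<K. of_real (measure lborel (B i)) * (f i - 1))"
   by (intro has_bochner_integral_sum i)
  then show ?thesis unfolding Hsum by (simp add: has_bochner_integral_iff)
 qed
 finally show ?thesis .
qed

text \<open>H - 1 is approximated in L1 by a simple function. For factors in the unit disc the
  difference of two products is at most the sum of the differences of the factors, whose mean is the
  L1 distance by Campbell's formula; the error is thus uniform in n.\<close>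

lemma generating_functional:
 fixes H :: "'a \<Rightarrow> complex"
 assumes [measurable]: "H \<in> borel_measurable borel" and H1: "\<And>x. norm (H x) \<le> 1"
  and int: "integrable lborel (\<lambda>x. H x - 1)"
 shows "(\<lambda>n. \<integral>y. (\<Prod>j<n. H (u j y)) \<partial>M) \<longlonglongrightarrow> exp (Leb x. H x - 1)"
proof (rule LIMSEQ_I)
 let ?D = "cball 0 1 :: complex set"
 \<comment> \<open>Projection to the closed unit disc: it keeps the approximating factors of modulus
   at most 1, fixes 1 and the values of H, and does not increase distances.\<close>
 define pr where "pr = (\<lambda>z. closest_point ?D z)"
 have pr_norm: "norm (pr z) \<le> 1" for z
  using closest_point_in_set[of ?D z] by (simp add: pr_def)
 have pr_id: "pr z = z" if "norm z \<le> 1" for z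
  using that by (simp add: pr_def closest_point_self)
 have pr_lip: "norm (pr z - pr w) \<le> norm (z - w)" for z w
  using closest_point_lipschitz[of ?D z w] by (simp add: pr_def dist_norm)
 fix e :: real assume e: "e > 0"
 obtain s where s: "\<And>i. Bochner_Integration.simple_bochner_integrable lborel (s i)"
  and slim: "(\<lambda>i. \<integral>\<^sup>+x. norm (H x - 1 - s i x) \<partial>lborel) \<longlonglongrightarrow> 0"
  using int unfolding integrable.simps has_bochner_integral.simps by blast
 define E where "E = exp (Leb x. H x - 1)"
 have "isCont exp (Leb x. H x - 1)" by simp
 then obtain d where d: "d > 0" "\<And>z. norm (z - (Leb x. H x - 1)) < d \<Longrightarrow> norm (exp z - E) < e / 3"
  using e unfolding continuous_at_eps_delta E_def by (metis divide_pos_pos dist_norm zero_less_numeral)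
 have "\<forall>\<^sub>F i in sequentially. (nLeb x. norm (H x - 1 - s i x)) < ennreal (min d (e / 3))"
  using slim d e by (intro order_tendstoD(2)[OF slim]) simp
 then obtain i where i: "(nLeb x. norm (H x - 1 - s i x)) < ennreal (min d (e / 3))"
  using eventually_happens'[OF sequentially_bot] by blast
 define S where "S x = pr (1 + s i x)" for x
 have sf: "simple_function lborel (s i)" and sm: "emeasure lborel {x. s i x \<noteq> 0} \<noteq> \<infinity>"
  using s[of i] by (auto simp: Bochner_Integration.simple_bochner_integrable.simps)
 have [measurable]: "s i \<in> borel_measurable lborel" using sf by (rule borel_measurable_simple_function)
 have Sfin: "finite (range S)"
 proof -
  have "range S = (\<lambda>z. pr (1 + z)) ` range (s i)" by (auto simp: S_def)
  then show ?thesis using sf by (simp add: simple_function_def)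
 qed
 have "simple_function lborel S"
  unfolding S_def by (rule simple_function_compose1[OF sf, of "\<lambda>z. pr (1 + z)"])
 then have Sm [measurable]: "S \<in> borel_measurable borel"
  using borel_measurable_simple_function[of lborel S] by simp
 have S1: "norm (S x) \<le> 1" for x by (simp add: S_def pr_norm)
 have SH: "norm (S x - H x) \<le> norm (H x - 1 - s i x)" for x
 proof -
  have "norm (S x - H x) = norm (pr (1 + s i x) - pr (H x))" by (simp add: S_def pr_id H1)
  also have "\<dots> \<le> norm (1 + s i x - H x)" by (rule pr_lip)
  also have "\<dots> = norm (H x - 1 - s i x)" by (simp add: norm_minus_commute algebra_simps)
  finally show ?thesis .
 qed
 have Sset: "emeasure lborel {x. S x \<noteq> 1} < \<infinity>"
 proof -
  have "emeasure lborel {x. S x \<noteq> 1} \<le> emeasure lborel {x. s i x \<noteq> 0}"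
   by (rule emeasure_mono) (auto simp: S_def pr_id)
  then show ?thesis using sm by (simp add: less_top top_unique)
 qed
 have lim: "(\<lambda>n. \<integral>y. (\<Prod>j<n. S (u j y)) \<partial>M) \<longlonglongrightarrow> exp (Leb x. S x - 1)"
  by (rule generating_functional_finite_range) (use S1 Sfin Sset in auto)
 have SHint: "(nLeb x. ennreal (norm (S x - H x))) < ennreal (min d (e / 3))"
  by (rule le_less_trans[OF nn_integral_mono i]) (use SH in \<open>auto intro: ennreal_leI\<close>)
 have iSH: "integrable lborel (\<lambda>x. S x - H x)"
  by (rule integrableI_bounded) (use SHint in \<open>auto intro: less_le_trans le_less_trans simp: less_top\<close>)
 have nSH: "(Leb x. norm (S x - H x)) < min d (e / 3)"
  using SHint iSH d e
  by (subst (asm) nn_integral_eq_integral) (auto simp: ennreal_less_iff integral_nonneg_AE)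
 have "(Leb x. S x - 1) - (Leb x. H x - 1) = (Leb x. S x - H x)"
 proof -
  have "(Leb x. S x - 1) = (Leb x. (S x - H x) + (H x - 1))" by simp
  also have "\<dots> = (Leb x. S x - H x) + (Leb x. H x - 1)"
   by (rule Bochner_Integration.integral_add[OF iSH int])
  finally show ?thesis by simp
 qed
 then have "norm ((Leb x. S x - 1) - (Leb x. H x - 1)) \<le> (Leb x. norm (S x - H x))"
  by (metis integral_norm_bound)
 then have E1: "norm (exp (Leb x. S x - 1) - E) < e / 3"
  using nSH by (intro d(2)) linarith
 have diff: "norm ((Mean y. (\<Prod>j<n. H (u j y))) - (Mean y. (\<Prod>j<n. S (u j y)))) < e / 3" for n
 proof -
  have int1: "integrable M (\<lambda>y. \<Prod>j<n. H (u j y))" "integrable M (\<lambda>y. \<Prod>j<n. S (u j y))"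
   by (rule integrable_const_bound[of _ 1]; auto simp: prod_norm[symmetric] intro!: prod_le_1 H1 S1)+
  have "ennreal (norm ((Mean y. (\<Prod>j<n. H (u j y))) - (Mean y. (\<Prod>j<n. S (u j y))))) \<le>
    (nMean y. norm ((\<Prod>j<n. H (u j y)) - (\<Prod>j<n. S (u j y))))"
   using integral_norm_bound_ennreal[OF Bochner_integrable_diff[OF int1]]
   by (simp add: Bochner_integral_diff[OF int1])
  also have "\<dots> \<le> (nMean y. (\<Sum>j. ennreal (norm (S (u j y) - H (u j y)))))"
  proof (rule nn_integral_mono)
   fix y
   have "norm ((\<Prod>j<n. H (u j y)) - (\<Prod>j<n. S (u j y))) \<le> (\<Sum>j<n. norm (H (u j y) - S (u j y)))"
    by (rule norm_prod_diff) (auto simp: H1 S1)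
   then have "ennreal (norm ((\<Prod>j<n. H (u j y)) - (\<Prod>j<n. S (u j y)))) \<le>
     (\<Sum>j<n. ennreal (norm (S (u j y) - H (u j y))))"
    by (simp add: sum_ennreal norm_minus_commute ennreal_leI)
   also have "\<dots> \<le> (\<Sum>j. ennreal (norm (S (u j y) - H (u j y))))"
    by (intro sum_le_suminf) auto
   finally show "ennreal (norm ((\<Prod>j<n. H (u j y)) - (\<Prod>j<n. S (u j y)))) \<le>
     (\<Sum>j. ennreal (norm (S (u j y) - H (u j y))))" .
  qed
  also have "\<dots> = (nLeb x. ennreal (norm (S x - H x)))"
   by (rule campbell) measurable
  also have "\<dots> < ennreal (min d (e / 3))" by (rule SHint)
  also have "\<dots> \<le> ennreal (e / 3)" by (intro ennreal_leI) auto
  finally show ?thesis using e by (simp add: ennreal_less_iff)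
 qed
 have "\<forall>\<^sub>F n in sequentially. norm ((Mean y. (\<Prod>j<n. S (u j y))) - exp (Leb x. S x - 1)) < e / 3"
  using tendstoD[OF lim, of "e / 3"] e by (simp add: dist_norm)
 then obtain n0 where n0: "\<And>n. n \<ge> n0 \<Longrightarrow>
   norm ((Mean y. (\<Prod>j<n. S (u j y))) - exp (Leb x. S x - 1)) < e / 3"
  by (auto simp: eventually_sequentially)
 have "norm ((Mean y. (\<Prod>j<n. H (u j y))) - E) < e" if "n \<ge> n0" for n
 proof -
  have tri: "norm (a - E) < e" if "norm (a - b) < e / 3" "norm (b - c) < e / 3" "norm (c - E) < e / 3"
   for a b c :: complex
  proof -
   have "a - E = (a - b) + (b - c) + (c - E)" by simp
   then have "norm (a - E) \<le> norm (a - b) + norm (b - c) + norm (c - E)"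
    by (metis norm_triangle_le norm_triangle_ineq add_right_mono)
   then show ?thesis using that by simp
  qed
  show ?thesis by (rule tri[OF diff n0[OF that] E1])
 qed
 then show "\<exists>n0. \<forall>n\<ge>n0. norm ((Mean y. (\<Prod>j<n. H (u j y))) - exp (Leb x. H x - 1)) < e"
  unfolding E_def by blast
qed

end

subsection \<open>Marked Poisson points and shot noise\<close>


lemma (in prob_space) independent_rvs_nn_integral:
 fixes g :: "'b \<times> 'c \<Rightarrow> ennreal"
 assumes i: "independent_rvs M S X T Y" and [measurable]: "g \<in> borel_measurable (S \<Otimes>\<^sub>M T)"
 shows "(\<integral>\<^sup>+w. g (X w, Y w) \<partial>M) = (\<integral>\<^sup>+w. (\<integral>\<^sup>+w'. g (X w, Y w') \<partial>M) \<partial>M)"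
proof -
 have [measurable]: "X \<in> measurable M S" "Y \<in> measurable M T"
  using i by (auto simp: independent_rvs_def)
 interpret Y: prob_space "distr M T Y" by (rule prob_space_distr) measurable
 have "(\<integral>\<^sup>+w. g (X w, Y w) \<partial>M) = (\<integral>\<^sup>+p. g p \<partial>distr M (S \<Otimes>\<^sub>M T) (\<lambda>w. (X w, Y w)))"
  by (subst nn_integral_distr) auto
 also have "\<dots> = (\<integral>\<^sup>+x. (\<integral>\<^sup>+y. g (x, y) \<partial>distr M T Y) \<partial>distr M S X)"
  unfolding independent_rvs_distr_pair[OF i] by (subst Y.nn_integral_fst[symmetric]) auto
 also have "\<dots> = (\<integral>\<^sup>+w. (\<integral>\<^sup>+w'. g (X w, Y w') \<partial>M) \<partial>M)"
  by (subst nn_integral_distr, measurable, rule nn_integral_cong)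
    (subst nn_integral_distr, auto dest: measurable_space[of X])
 finally show ?thesis .
qed

lemma (in prob_space) independent_rvs_integral:
 fixes g :: "'b \<times> 'c \<Rightarrow> 'd::{banach, second_countable_topology}"
 assumes i: "independent_rvs M S X T Y" and [measurable]: "g \<in> borel_measurable (S \<Otimes>\<^sub>M T)"
  and bdd: "\<And>p. norm (g p) \<le> B"
 shows "(\<integral>w. g (X w, Y w) \<partial>M) = (\<integral>w. (\<integral>w'. g (X w, Y w') \<partial>M) \<partial>M)"
proof -
 have [measurable]: "X \<in> measurable M S" "Y \<in> measurable M T"
  using i by (auto simp: independent_rvs_def)
 interpret X: prob_space "distr M S X" by (rule prob_space_distr) measurable
 interpret Y: prob_space "distr M T Y" by (rule prob_space_distr) measurable
 interpret P: pair_prob_space "distr M S X" "distr M T Y" ..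
 have int: "integrable (distr M S X \<Otimes>\<^sub>M distr M T Y) g"
  by (rule P.P.integrable_const_bound[of _ B]) (auto simp: bdd)
 have "(\<integral>w. g (X w, Y w) \<partial>M) = (\<integral>p. g p \<partial>distr M (S \<Otimes>\<^sub>M T) (\<lambda>w. (X w, Y w)))"
  by (subst integral_distr) auto
 also have "\<dots> = (\<integral>x. (\<integral>y. g (x, y) \<partial>distr M T Y) \<partial>distr M S X)"
  unfolding independent_rvs_distr_pair[OF i] using int by (rule P.integral_fst'[symmetric])
 also have "\<dots> = (\<integral>w. (\<integral>w'. g (X w, Y w') \<partial>M) \<partial>M)"
  by (subst integral_distr, measurable, rule Bochner_integral_cong)
    (auto simp: integral_distr dest: measurable_space[of X])
 finally show ?thesis .
qed

text \<open>Campbell's formula and the generating functional carry the information on the law of the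
  process that the later arguments draw on. In this form marked and unmarked points look alike, with
  different intensities \<open>m\<close>.\<close>

locale poisson_points = prob_space M for M :: "'w measure" +
 fixes m :: "'e measure" and e :: "nat \<Rightarrow> 'w \<Rightarrow> 'e"
 assumes sigma_finite_intensity: "sigma_finite_measure m"
  and measurable_points [measurable]: "\<And>j. e j \<in> measurable M m"
  and campbell: "\<And>f :: 'e \<Rightarrow> ennreal. f \<in> borel_measurable m \<Longrightarrow>
   (\<integral>\<^sup>+\<omega>. (\<Sum>j. f (e j \<omega>)) \<partial>M) = (\<integral>\<^sup>+x. f x \<partial>m)"
  and generating_functional: "\<And>h :: 'e \<Rightarrow> complex. h \<in> borel_measurable m \<Longrightarrow> (\<And>x. norm (h x) \<le> 1) \<Longrightarrow>
   integrable m (\<lambda>x. h x - 1) \<Longrightarrow>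
   (\<lambda>n. \<integral>\<omega>. (\<Prod>j<n. h (e j \<omega>)) \<partial>M) \<longlonglongrightarrow> exp (\<integral>x. h x - 1 \<partial>m)"

text \<open>Marking theorem: given the points, the grains are independent copies of the generic one,
  so averaging over them replaces each factor h(u, grain) by its mean H(u), and the generating
  functional of the unmarked points applies to H.\<close>

lemma (in prob_space) boolean_model_poisson_points:
 fixes u :: "nat \<Rightarrow> 'a \<Rightarrow> 'b::euclidean_space"
 assumes model: "boolean_model M u X Xs"
 shows "poisson_points M (lborel \<Otimes>\<^sub>M distr M fell_borel X) (\<lambda>j w. (u j w, Xs j w))"
proof -
 have [measurable]: "X \<in> measurable M fell_borel" "\<And>j. Xs j \<in> measurable M fell_borel"
  and law: "\<And>j. distr M fell_borel (Xs j) = distr M fell_borel X"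
  and iv: "indep_vars (\<lambda>_. fell_borel) (case_nat X Xs) UNIV"
  and ind: "independent_rvs M (Pi\<^sub>M UNIV (\<lambda>_. borel)) (\<lambda>w j. u j w)
    (Pi\<^sub>M UNIV (\<lambda>_. fell_borel)) (\<lambda>w j. case_nat X Xs j w)"
  using model by (auto simp: boolean_model_def)
 interpret unit_poisson M u
  using model by unfold_locales (auto simp: boolean_model_def)
 interpret Q: prob_space "distr M fell_borel X" by (rule prob_space_distr) measurable
 interpret P: pair_sigma_finite "lborel :: 'b measure" "distr M fell_borel X" ..
 let ?m = "(lborel :: 'b measure) \<Otimes>\<^sub>M distr M fell_borel X"
 show ?thesis
 proof (intro poisson_points.intro poisson_points_axioms.intro)
  show "prob_space M" by (rule prob_space_axioms)
  show "sigma_finite_measure ?m" by (rule P.P.sigma_finite_measure_axioms)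
  show "(\<lambda>w. (u j w, Xs j w)) \<in> measurable M ?m" for j by measurable
  show "(\<integral>\<^sup>+w. (\<Sum>j. f (u j w, Xs j w)) \<partial>M) = (\<integral>\<^sup>+x. f x \<partial>?m)"
   if "f \<in> borel_measurable ?m" for f :: "'b \<times> 'b set \<Rightarrow> ennreal"
  proof -
   have [measurable]: "f \<in> borel_measurable (borel \<Otimes>\<^sub>M fell_borel)"
    using that by simp
   have "(\<integral>\<^sup>+w. f (u j w, Xs j w) \<partial>M) = (\<integral>\<^sup>+w. (\<integral>\<^sup>+F. f (u j w, F) \<partial>distr M fell_borel X) \<partial>M)" for j
   proof -
    have "(\<integral>\<^sup>+w. f (u j w, Xs j w) \<partial>M) = (\<integral>\<^sup>+w. (\<integral>\<^sup>+w'. f (u j w, Xs j w') \<partial>M) \<partial>M)"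
     using independent_rvs_nn_integral[OF ind, of "\<lambda>p. f (fst p j, snd p (Suc j))"] by simp
    also have "\<dots> = (\<integral>\<^sup>+w. (\<integral>\<^sup>+F. f (u j w, F) \<partial>distr M fell_borel (Xs j)) \<partial>M)"
     by (intro nn_integral_cong, subst nn_integral_distr) auto
    finally show ?thesis by (simp add: law)
   qed
   then have "(\<integral>\<^sup>+w. (\<Sum>j. f (u j w, Xs j w)) \<partial>M) = (\<integral>\<^sup>+w. (\<Sum>j. \<integral>\<^sup>+F. f (u j w, F) \<partial>distr M fell_borel X) \<partial>M)"
    by (simp add: nn_integral_suminf)
   also have "\<dots> = (nLeb x. (\<integral>\<^sup>+F. f (x, F) \<partial>distr M fell_borel X))"
    by (rule campbell) measurable
   also have "\<dots> = (\<integral>\<^sup>+x. f x \<partial>?m)"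
    by (rule Q.nn_integral_fst) simp
   finally show ?thesis .
  qed
  show "(\<lambda>n. \<integral>w. (\<Prod>j<n. h (u j w, Xs j w)) \<partial>M) \<longlonglongrightarrow> exp (\<integral>x. h x - 1 \<partial>?m)"
   if hm: "h \<in> borel_measurable ?m" and h1: "\<And>x. norm (h x) \<le> 1" and hi: "integrable ?m (\<lambda>x. h x - 1)"
   for h :: "'b \<times> 'b set \<Rightarrow> complex"
  proof -
   have [measurable]: "h \<in> borel_measurable (borel \<Otimes>\<^sub>M fell_borel)"
    using hm by simp
   define H where "H x = (\<integral>F. h (x, F) \<partial>distr M fell_borel X)" for x
   have [measurable]: "H \<in> borel_measurable borel" unfolding H_def by measurable
   have hb: "integrable (distr M fell_borel X) (\<lambda>F. h (x, F))" for x
    by (rule Q.integrable_const_bound[of _ 1]) (auto simp: h1)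
   have H1: "norm (H x) \<le> 1" for x
    unfolding H_def
    by (rule order_trans[OF integral_norm_bound]) (auto intro!: Q.integral_le_const hb h1)
   have HX: "H x = (\<integral>w. h (x, Xs j w) \<partial>M)" for x j
    unfolding H_def law[of j, symmetric] by (subst integral_distr) auto
   have Hm1: "H x - 1 = (\<integral>F. h (x, F) - 1 \<partial>distr M fell_borel X)" for x
    unfolding H_def using hb Q.prob_space by simp
   have "(\<lambda>n. \<integral>w. (\<Prod>j<n. H (u j w)) \<partial>M) \<longlonglongrightarrow> exp (Leb x. H x - 1)"
    by (rule generating_functional) (auto simp: H1, simp add: Hm1 P.integrable_fst'[OF hi])
   moreover have "(Leb x. H x - 1) = (\<integral>x. h x - 1 \<partial>?m)"
    unfolding Hm1 by (rule P.integral_fst'[OF hi])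
   moreover have "(\<integral>w. (\<Prod>j<n. h (u j w, Xs j w)) \<partial>M) = (\<integral>w. (\<Prod>j<n. H (u j w)) \<partial>M)" for n
   proof -
    have inner: "(\<integral>w'. (\<Prod>j<n. h (x j, Xs j w')) \<partial>M) = (\<Prod>j<n. H (x j))" for x :: "nat \<Rightarrow> 'b"
    proof -
     \<comment> \<open>The independent family is \<open>case_nat X Xs\<close>, in which the grain
       \<open>Xs j\<close> has the index \<open>Suc j\<close>; the product is reindexed
       accordingly.\<close>
     have "(\<integral>w'. (\<Prod>j<n. h (x j, Xs j w')) \<partial>M) =
       (\<integral>w'. (\<Prod>i\<in>Suc ` {..<n}. h (x (i - 1), case_nat X Xs i w')) \<partial>M)"
      by (simp add: prod.reindex)
     also have "\<dots> = (\<Prod>i\<in>Suc ` {..<n}. \<integral>w'. h (x (i - 1), case_nat X Xs i w') \<partial>M)"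
     proof (rule indep_vars_lebesgue_integral)
      have "indep_vars (\<lambda>_. fell_borel) (case_nat X Xs) (Suc ` {..<n})"
       using iv by (rule indep_vars_subset) auto
      then show "indep_vars (\<lambda>_. borel) (\<lambda>i w'. h (x (i - 1), case_nat X Xs i w')) (Suc ` {..<n})"
       by (rule indep_vars_compose2) auto
      show "integrable M (\<lambda>w'. h (x (i - 1), case_nat X Xs i w'))" if "i \<in> Suc ` {..<n}" for i
       using that by (intro integrable_const_bound[of _ 1]) (auto simp: h1)
     qed simp
     also have "\<dots> = (\<Prod>j<n. H (x j))"
      by (simp add: prod.reindex HX[symmetric])
     finally show ?thesis .
    qed
    have "(\<integral>w. (\<Prod>j<n. h (u j w, Xs j w)) \<partial>M) = (\<integral>w. (\<integral>w'. (\<Prod>j<n. h (u j w, Xs j w')) \<partial>M) \<partial>M)"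
    proof -
     define g where "g p = (\<Prod>j<n. h (fst p j, snd p (Suc j)))" for p :: "(nat \<Rightarrow> 'b) \<times> (nat \<Rightarrow> 'b set)"
     have gm: "g \<in> borel_measurable (Pi\<^sub>M UNIV (\<lambda>_. borel) \<Otimes>\<^sub>M Pi\<^sub>M UNIV (\<lambda>_. fell_borel))"
      unfolding g_def by measurable
     have gb: "norm (g p) \<le> 1" for p
      unfolding g_def prod_norm[symmetric] by (intro prod_le_1) (auto simp: h1)
     show ?thesis using independent_rvs_integral[OF ind gm gb] by (simp add: g_def)
    qed
    also have "\<dots> = (\<integral>w. (\<Prod>j<n. H (u j w)) \<partial>M)"
     by (simp only: inner)
    finally show ?thesis .
   qed
   ultimately show ?thesis by simp
  qed
 qed
qed

context poisson_points
begin

sublocale m: sigma_finite_measure m by (rule sigma_finite_intensity)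

text \<open>For h = 1 minus the indicator of W, the prefix products decrease to the indicator that
  no point lies in W.\<close>

lemma prob_no_points:
 assumes [measurable]: "W \<in> sets m" and fin: "emeasure m W < \<infinity>"
 shows "prob {z \<in> space M. \<forall>j. e j z \<notin> W} = exp (- measure m W)"
proof -
 define h :: "'e \<Rightarrow> complex" where "h x = 1 - indicator W x" for x
 have hint: "integrable m (\<lambda>x. h x - 1)" "(\<integral>x. h x - 1 \<partial>m) = - of_real (measure m W)"
 proof -
  have "has_bochner_integral m (\<lambda>x. indicator W x *\<^sub>R (-1 :: complex)) (measure m W *\<^sub>R (-1))"
   by (rule has_bochner_integral_indicator) (use fin in auto)
  moreover have "(\<lambda>x. indicator W x *\<^sub>R (-1 :: complex)) = (\<lambda>x. h x - 1)"
   by (auto simp: h_def fun_eq_iff split: split_indicator)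
  ultimately have "has_bochner_integral m (\<lambda>x. h x - 1) (measure m W *\<^sub>R (-1))"
   by (simp only:)
  then show "integrable m (\<lambda>x. h x - 1)" "(\<integral>x. h x - 1 \<partial>m) = - of_real (measure m W)"
   by (auto simp: has_bochner_integral_iff scaleR_conv_of_real)
 qed
 have [measurable]: "h \<in> borel_measurable m" unfolding h_def by measurable
 have l1: "(\<lambda>n. \<integral>z. (\<Prod>j<n. h (e j z)) \<partial>M) \<longlonglongrightarrow> exp (\<integral>x. h x - 1 \<partial>m)"
  by (rule generating_functional) (auto simp: hint(1), simp add: h_def split: split_indicator)
 have l2: "(\<lambda>n. \<integral>z. (\<Prod>j<n. h (e j z)) \<partial>M) \<longlonglongrightarrow>
   (Mean z. indicator {z \<in> space M. \<forall>j. e j z \<notin> W} z *\<^sub>R 1)"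
 proof (rule integral_dominated_convergence[where w="\<lambda>_. 1"])
  show "AE z in M. (\<lambda>n. \<Prod>j<n. h (e j z)) \<longlonglongrightarrow> indicator {z \<in> space M. \<forall>j. e j z \<notin> W} z *\<^sub>R 1"
   using AE_space
  proof eventually_elim
   case (elim z)
   show ?case
   proof (cases "\<forall>j. e j z \<notin> W")
    case True
    then show ?thesis using elim by (simp add: h_def)
   next
    case False
    then obtain j where "e j z \<in> W" by auto
    then have "(\<Prod>i<n. h (e i z)) = 0" if "n > j" for n
     using that by (intro prod_zero) (auto simp: h_def intro!: bexI[of _ j])
    then have "(\<lambda>n. \<Prod>j<n. h (e j z)) \<longlonglongrightarrow> 0"
     by (intro tendsto_eventually eventually_sequentiallyI[of "Suc j"]) auto
    then show ?thesis using False by simp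
   qed
  qed
  show "AE z in M. norm (\<Prod>j<n. h (e j z)) \<le> 1" for n
   by (auto simp: prod_norm[symmetric] h_def intro!: prod_le_1 AE_I2 split: split_indicator)
 qed auto
 have l3: "(Mean z. indicator {z \<in> space M. \<forall>j. e j z \<notin> W} z *\<^sub>R (1 :: complex)) =
   prob {z \<in> space M. \<forall>j. e j z \<notin> W} *\<^sub>R 1"
  by (intro has_bochner_integral_integral_eq has_bochner_integral_indicator) (auto simp: less_top[symmetric])
 have "of_real (prob {z \<in> space M. \<forall>j. e j z \<notin> W}) = exp (- of_real (measure m W) :: complex)"
  using LIMSEQ_unique[OF l1 l2] unfolding l3 hint(2) by (simp add: scaleR_conv_of_real)
 also have "\<dots> = of_real (exp (- measure m W))"
  by (subst exp_of_real[symmetric]) simp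
 finally show ?thesis by (simp only: of_real_eq_iff)
qed

text \<open>Campbell's formula gives a finite mean, hence summability. The exponential of a sum is a
  product over points, so its mean is the generating functional at h = exp(i \<theta> f), where h -
  1 is bounded by \<bar>\<theta>\<bar> f.\<close>

lemma char_shot_noise:
 assumes [measurable]: "f \<in> borel_measurable m" and f0: "\<And>x. 0 \<le> f x" and fi: "integrable m f"
 shows "AE z in M. summable (\<lambda>j. f (e j z))"
  and "(Mean z. iexp (\<theta> * (\<Sum>j. f (e j z)))) = exp (\<integral>x. iexp (\<theta> * f x) - 1 \<partial>m)"
proof -
 have "(nMean z. (\<Sum>j. ennreal (f (e j z)))) = (\<integral>\<^sup>+x. ennreal (f x) \<partial>m)"
  by (rule campbell) measurable
 also have "\<dots> \<noteq> \<infinity>" using fi f0 by (simp add: nn_integral_eq_integral)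
 finally have fin: "(nMean z. (\<Sum>j. ennreal (f (e j z)))) \<noteq> \<infinity>" .
 have "AE z in M. (\<Sum>j. ennreal (f (e j z))) \<noteq> \<infinity>"
  by (rule nn_integral_PInf_AE[OF _ fin]) measurable
 then show s: "AE z in M. summable (\<lambda>j. f (e j z))"
 proof eventually_elim
  case (elim z)
  show ?case by (rule summable_suminf_not_top) (use f0 elim in simp_all)
 qed
 have "(\<lambda>n. \<integral>z. (\<Prod>j<n. iexp (\<theta> * f (e j z))) \<partial>M) \<longlonglongrightarrow> exp (\<integral>x. iexp (\<theta> * f x) - 1 \<partial>m)"
 proof (rule generating_functional)
  have "norm (iexp (\<theta> * f x) - 1) \<le> norm (\<theta> * f x)" for x
   using iexp_approx1[of "\<theta> * f x" 0] by simp
  then show "integrable m (\<lambda>x. iexp (\<theta> * f x) - 1)"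
   by (intro Bochner_integrable_bound[OF integrable_mult_right[OF fi, of \<theta>]]) auto
 qed auto
 moreover have "(\<lambda>n. \<integral>z. (\<Prod>j<n. iexp (\<theta> * f (e j z))) \<partial>M) \<longlonglongrightarrow> (Mean z. iexp (\<theta> * (\<Sum>j. f (e j z))))"
 proof (rule integral_dominated_convergence[where w="\<lambda>_. 1"])
  show "AE z in M. (\<lambda>n. \<Prod>j<n. iexp (\<theta> * f (e j z))) \<longlonglongrightarrow> iexp (\<theta> * (\<Sum>j. f (e j z)))"
   using s
  proof eventually_elim
   case (elim z)
   have "(\<lambda>n. iexp (\<theta> * (\<Sum>j<n. f (e j z)))) \<longlonglongrightarrow> iexp (\<theta> * (\<Sum>j. f (e j z)))"
    by (intro tendsto_intros summable_LIMSEQ elim)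
   then show ?case by (simp add: sum_distrib_left exp_sum)
  qed
 qed (auto simp: prod_norm[symmetric])
 ultimately show "(Mean z. iexp (\<theta> * (\<Sum>j. f (e j z)))) = exp (\<integral>x. iexp (\<theta> * f x) - 1 \<partial>m)"
  by (rule LIMSEQ_unique[symmetric])
qed

end

subsection \<open>The uncovered volume of a Poisson cover\<close>


lemma norm_integral_le_integral:
 fixes f :: "'x \<Rightarrow> 'y::{banach, second_countable_topology}"
 assumes "integrable M f" "integrable M g" "\<And>x. x \<in> space M \<Longrightarrow> norm (f x) \<le> g x"
 shows "norm (\<integral>x. f x \<partial>M) \<le> (\<integral>x. g x \<partial>M)"
 by (rule order_trans[OF integral_norm_bound]) (intro integral_mono integrable_norm assms)

text \<open>For bounded U the weighted characteristic function is a convergent power series in the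
  mixed moments E(X U^k). Identities proved for all moments thereby transfer to characteristic
  functions.\<close>

lemma (in prob_space) moment_series_char:
 fixes X U :: "'a \<Rightarrow> real"
 assumes [measurable]: "X \<in> borel_measurable M" "U \<in> borel_measurable M"
  and X: "\<And>w. \<bar>X w\<bar> \<le> 1" and U: "\<And>w. \<bar>U w\<bar> \<le> b"
 shows "(\<lambda>k. (\<i> * of_real \<eta>) ^ k / fact k * of_real (\<integral>w. X w * U w ^ k \<partial>M)) sums
  (\<integral>w. of_real (X w) * iexp (\<eta> * U w) \<partial>M)"
proof -
 define f where "f k w = of_real (X w) * ((\<i> * of_real (\<eta> * U w)) ^ k /\<^sub>R fact k)" for k w
 have fs: "(\<lambda>k. f k w) sums (of_real (X w) * iexp (\<eta> * U w))" for w
  unfolding f_def by (intro sums_mult exp_converges)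
 have fn: "norm (f k w) \<le> (\<bar>\<eta>\<bar> * b) ^ k /\<^sub>R fact k" for k w
 proof -
  have "norm (f k w) = \<bar>X w\<bar> * ((\<bar>\<eta>\<bar> * \<bar>U w\<bar>) ^ k /\<^sub>R fact k)"
   by (simp add: f_def norm_mult norm_power abs_mult)
  also have "\<dots> \<le> 1 * ((\<bar>\<eta>\<bar> * b) ^ k /\<^sub>R fact k)"
   by (intro mult_mono X scaleR_left_mono power_mono mult_left_mono U) auto
  finally show ?thesis by simp
 qed
 have [measurable]: "f k \<in> borel_measurable M" for k unfolding f_def by measurable
 have fi: "integrable M (f k)" for k
  by (rule integrable_const_bound[of _ "(\<bar>\<eta>\<bar> * b) ^ k /\<^sub>R fact k"]) (use fn in auto)
 have "(\<lambda>k. \<integral>w. f k w \<partial>M) sums (\<integral>w. (\<Sum>k. f k w) \<partial>M)"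
 proof (rule sums_integral)
  show "AE w in M. summable (\<lambda>k. norm (f k w))"
   by (intro AE_I2 summable_comparison_test'[OF summable_exp_generic[of "\<bar>\<eta>\<bar> * b"], of 0]) (use fn in auto)
  have "(\<integral>w. norm (f k w) \<partial>M) \<le> (\<bar>\<eta>\<bar> * b) ^ k /\<^sub>R fact k" for k
   by (intro integral_le_const integrable_norm fi AE_I2 fn)
  then show "summable (\<lambda>k. \<integral>w. norm (f k w) \<partial>M)"
   by (intro summable_comparison_test'[OF summable_exp_generic[of "\<bar>\<eta>\<bar> * b"], of 0])
     (simp only: real_norm_def abs_of_nonneg[OF integral_nonneg_AE[OF AE_I2[OF norm_ge_zero]]])
 qed (rule fi)
 moreover have "(\<integral>w. f k w \<partial>M) = (\<i> * of_real \<eta>) ^ k / fact k * of_real (\<integral>w. X w * U w ^ k \<partial>M)" for k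
 proof -
  have "f k w = (\<i> * of_real \<eta>) ^ k / fact k * of_real (X w * U w ^ k)" for w
   by (simp add: f_def power_mult_distrib scaleR_conv_of_real field_simps)
  then show ?thesis by (simp del: of_real_mult of_real_power)
 qed
 ultimately show ?thesis using fs by (simp add: sums_iff)
qed

text \<open>Abstracts from grains to sets \<open>C t\<close> of marks. Stationarity is encoded in
  the last two assumptions: the mass of one set is constant, and the mass of an intersection depends
  on the difference of the two points.\<close>

locale poisson_cover = poisson_points M m e
 for M :: "'w measure" and m :: "'e measure" and e +
 fixes C :: "'a::euclidean_space \<Rightarrow> 'e set" and \<mu> :: real and \<rho> :: "'a \<Rightarrow> real"
 assumes pred_C: "Measurable.pred (borel \<Otimes>\<^sub>M m) (\<lambda>p. snd p \<in> C (fst p))"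
  and C_subset: "C t \<subseteq> space m"
  and mu_nonneg: "0 \<le> \<mu>" and rho_nonneg: "0 \<le> \<rho> t"
  and rho_meas [measurable]: "\<rho> \<in> borel_measurable borel"
  and emeasure_C: "emeasure m (C t) = ennreal \<mu>"
  and emeasure_C_Int: "emeasure m (C t \<inter> C s) = ennreal (\<rho> (t - s))"
begin

lemma pred_C' [measurable (raw)]:
 assumes [measurable]: "f \<in> borel_measurable N" "g \<in> measurable N m"
 shows "Measurable.pred N (\<lambda>x. g x \<in> C (f x))"
 using measurable_compose[OF _ pred_C, of "\<lambda>x. (f x, g x)" N] by simp

lemma C_sets [measurable]: "C t \<in> sets m"
proof -
 have "{x \<in> space m. x \<in> C t} \<in> sets m" by measurable
 moreover have "{x \<in> space m. x \<in> C t} = C t" using C_subset by auto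
 ultimately show ?thesis by simp
qed

lemma measure_C: "measure m (C t) = \<mu>"
 using mu_nonneg by (simp add: measure_def emeasure_C)

lemma measure_C_Int: "measure m (C t \<inter> C s) = \<rho> (t - s)"
 using rho_nonneg by (simp add: measure_def emeasure_C_Int)

lemma rho_minus: "\<rho> (t - s) = \<rho> (s - t)"
 using measure_C_Int[of t s] measure_C_Int[of s t] by (simp add: Int_commute)

lemma fmeasurable_C: "C t \<in> fmeasurable m"
 by (auto simp: fmeasurable_def emeasure_C)

lemma rho_le_mu: "\<rho> t \<le> \<mu>"
 using measure_mono_fmeasurable[of "C t \<inter> C 0" "C t" m] fmeasurable_C
 by (simp add: measure_C measure_C_Int)

definition void :: "'e set \<Rightarrow> 'w \<Rightarrow> real" where
 "void W w = (if \<forall>j. e j w \<notin> W then 1 else 0)"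

lemma void_range: "0 \<le> void W w" "void W w \<le> 1" "\<bar>void W w\<bar> \<le> 1"
 by (auto simp: void_def)

lemma void_Un: "void W w * void W' w = void (W \<union> W') w"
 by (auto simp: void_def)

lemma void_antimono: "W \<subseteq> W' \<Longrightarrow> void W' w \<le> void W w"
 by (auto simp: void_def)

lemma void_meas [measurable]:
 assumes [measurable]: "W \<in> sets m"
 shows "void W \<in> borel_measurable M"
 unfolding void_def[abs_def] by measurable

lemma void_integral:
 assumes "W \<in> fmeasurable m"
 shows "(Mean w. void W w) = exp (- measure m W)"
proof -
 have [measurable]: "W \<in> sets m" and fin: "emeasure m W < \<infinity>" using assms by (auto simp: fmeasurable_def)
 have "(Mean w. void W w) = (Mean w. indicator {w \<in> space M. \<forall>j. e j w \<notin> W} w)"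
  by (intro Bochner_integral_cong) (auto simp: void_def)
 also have "\<dots> = prob {w \<in> space M. \<forall>j. e j w \<notin> W}" by simp
 finally show ?thesis by (simp add: prob_no_points[OF _ fin])
qed

lemma void_integrable: "W \<in> sets m \<Longrightarrow> integrable M (void W)"
 by (rule integrable_const_bound[of _ 1]) (auto simp: void_range)

text \<open>For x = \<rho> (s - t) the difference is exp \<mu> times the covariance of the events
  that s and t are uncovered. This is the domination of that covariance by \<rho>.\<close>

lemma exp_diff_le:
 assumes "0 \<le> x" "x \<le> \<mu>"
 shows "exp (- (\<mu> - x)) - exp (- \<mu>) \<le> x" "0 \<le> exp (- (\<mu> - x)) - exp (- \<mu>)"
proof -
 have "exp (- (\<mu> - x)) - exp (- \<mu>) = exp (- (\<mu> - x)) * (1 - exp (- x))"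
  by (simp add: right_diff_distrib flip: exp_add)
 also have "\<dots> \<le> 1 * x"
  using assms exp_ge_add_one_self[of "- x"] by (intro mult_mono) auto
 finally show "exp (- (\<mu> - x)) - exp (- \<mu>) \<le> x" by simp
qed (use assms in simp)

end

section \<open>A fixed window: deleting marks and conditioning on their absence\<close>

locale poisson_cover_window = poisson_cover M m e C \<mu> \<rho>
 for M :: "'w measure" and m :: "'e measure" and e and C :: "'a::euclidean_space \<Rightarrow> 'e set" and \<mu> \<rho> +
 fixes B :: "'a set"
 assumes B_sets [measurable]: "B \<in> sets borel" and B_fin: "emeasure lborel B < \<infinity>"
begin

text \<open>Lebesgue measure weighted by the window instead of restricted to it: the space stays the
  whole of \<open>'a\<close>, and Fubini arguments carry no membership conditions.\<close>

definition LB :: "'a measure" where "LB = density lborel (indicator B)"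

definition b :: real where "b = measure lborel B"

abbreviation integral_LB :: "('a \<Rightarrow> 'c::{banach, second_countable_topology}) \<Rightarrow> 'c"
 (binder "IntB " 10) where "integral_LB f \<equiv> integral\<^sup>L LB f"

abbreviation nn_integral_LB' :: "('a \<Rightarrow> ennreal) \<Rightarrow> ennreal"
 (binder "nIntB " 10) where "nn_integral_LB' f \<equiv> integral\<^sup>N LB f"

lemma sets_LB [measurable_cong, simp]: "sets LB = sets borel" and space_LB [simp]: "space LB = UNIV"
 by (auto simp: LB_def)

lemma nn_integral_LB: "f \<in> borel_measurable borel \<Longrightarrow> (nIntB s. f s) = (nLeb s. indicator B s * f s)"
 unfolding LB_def by (subst nn_integral_density) auto

lemma emeasure_LB: "emeasure LB UNIV = ennreal b"
proof -
 have "emeasure LB UNIV = emeasure lborel B"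
  by (simp add: LB_def emeasure_density)
 also have "\<dots> = ennreal b"
  unfolding b_def by (rule emeasure_eq_ennreal_measure) (use B_fin in auto)
 finally show ?thesis .
qed

sublocale LB: finite_measure LB
 by standard (simp add: emeasure_LB)

sublocale P: pair_sigma_finite M LB ..

sublocale PF: finite_measure "M \<Otimes>\<^sub>M LB"
 by (rule finite_measure_pair_measure) unfold_locales

lemma b_nonneg: "0 \<le> b" by (simp add: b_def)

lemma measure_LB: "measure LB UNIV = b"
 unfolding measure_def emeasure_LB by (simp add: b_nonneg)

lemma nn_integral_LB_translate_le:
 fixes f :: "'a \<Rightarrow> ennreal"
 assumes [measurable]: "f \<in> borel_measurable borel"
 shows "(nIntB s. f (s - t)) \<le> (nLeb w. f w)"
proof -
 have "(nIntB s. f (s - t)) \<le> (nLeb s. f (s - t))"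
  by (subst nn_integral_LB) (auto intro!: nn_integral_mono split: split_indicator)
 also have "\<dots> = (\<integral>\<^sup>+w. f w \<partial>distr lborel borel ((+) (- t)))"
  by (subst nn_integral_distr) auto
 finally show ?thesis by (simp only: lborel_distr_plus)
qed

text \<open>The uncovered volume when just the grains in \<open>V\<close> count. The set is a
  parameter because conditioning on the absence of grains will amount to shrinking it.\<close>

definition U :: "'e set \<Rightarrow> 'w \<Rightarrow> real" where
 "U V w = (IntB s. void (V \<inter> C s) w)"

lemma void_pair_meas [measurable]:
 assumes [measurable]: "V \<in> sets m"
 shows "(\<lambda>p. void (V \<inter> C (snd p)) (fst p)) \<in> borel_measurable (M \<Otimes>\<^sub>M LB)"
 unfolding void_def Int_iff by measurable

lemma void_slice_meas [measurable]:
 assumes [measurable]: "V \<in> sets m" "w \<in> space M"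
 shows "(\<lambda>s. void (V \<inter> C s) w) \<in> borel_measurable borel"
 unfolding void_def Int_iff by measurable

lemma void_slice_integrable: "V \<in> sets m \<Longrightarrow> w \<in> space M \<Longrightarrow> integrable LB (\<lambda>s. void (V \<inter> C s) w)"
 by (rule LB.integrable_const_bound[of _ 1]) (auto simp: void_range)

lemma U_meas [measurable]: "V \<in> sets m \<Longrightarrow> U V \<in> borel_measurable M"
 unfolding U_def[abs_def] using void_pair_meas[of V]
 by (intro LB.borel_measurable_lebesgue_integral) (simp add: split_beta')

lemma U_range: "0 \<le> U V w" "U V w \<le> b"
proof -
 show "0 \<le> U V w" unfolding U_def by (intro integral_nonneg_AE AE_I2 void_range)
 show "U V w \<le> b"
 proof (cases "integrable LB (\<lambda>s. void (V \<inter> C s) w)")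
  case True
  then have "U V w \<le> (IntB s. 1)"
   unfolding U_def by (intro integral_mono) (auto simp: void_range)
  then show ?thesis by (simp add: measure_LB)
 next
  case False
  then show ?thesis by (simp add: U_def not_integrable_integral_eq b_nonneg)
 qed
qed

lemma U_abs: "\<bar>U V w\<bar> \<le> b" using U_range[of V w] by simp

lemma U_power_le: "\<bar>U V w ^ k\<bar> \<le> b ^ k"
 by (simp add: power_abs power_mono U_abs)

lemma integral_U_swap:
 fixes X :: "'w \<Rightarrow> 'c::{banach, second_countable_topology, real_normed_field}"
 assumes [measurable]: "X \<in> borel_measurable M" "V \<in> sets m" and X: "\<And>w. norm (X w) \<le> c"
 shows "(Mean w. of_real (U V w) * X w) = (IntB s. (Mean w. of_real (void (V \<inter> C s) w) * X w))"
  and "integrable LB (\<lambda>s. \<integral>w. of_real (void (V \<inter> C s) w) * X w \<partial>M)"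
proof -
 let ?f = "\<lambda>w s. of_real (void (V \<inter> C s) w) * X w"
 have c: "0 \<le> c" using X[of undefined] norm_ge_zero order_trans by blast
 have [measurable]: "(\<lambda>p. ?f (fst p) (snd p)) \<in> borel_measurable (M \<Otimes>\<^sub>M LB)" by measurable
 have "norm (of_real (void W w) * X w) \<le> c" for W w
  using mult_mono[OF void_range(2) X zero_le_one norm_ge_zero, of W w w] by (simp add: norm_mult void_range)
 then have int: "integrable (M \<Otimes>\<^sub>M LB) (case_prod ?f)"
  by (intro PF.integrable_const_bound[of _ c]) (auto simp: split_beta')
 have "(Mean w. of_real (U V w) * X w) = (Mean w. (IntB s. ?f w s))"
 proof (intro Bochner_integral_cong refl)
  fix w assume "w \<in> space M"
  then have "(of_real (U V w) :: 'c) = (IntB s. of_real (void (V \<inter> C s) w))"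
   unfolding U_def
   by (intro integral_bounded_linear[OF bounded_linear_of_real, symmetric] void_slice_integrable assms)
  then show "of_real (U V w) * X w = (IntB s. ?f w s)" by simp
 qed
 also have "\<dots> = (IntB s. (Mean w. ?f w s))"
  by (rule P.Fubini_integral[OF int, symmetric])
 finally show "(Mean w. of_real (U V w) * X w) = (IntB s. (Mean w. ?f w s))" .
 show "integrable LB (\<lambda>s. \<integral>w. ?f w s \<partial>M)"
  by (rule P.integrable_snd[OF int])
qed

text \<open>Induction on k. One factor \<open>U V\<close> is written as an integral of avoidance
  indicators, each of which merges with \<open>void W\<close>; additivity of m on the disjoint sets
  W and (V - W) \<inter> C s splits off the factor exp(- m W). Both sets change in the process, so
  both are generalised.\<close>

lemma void_U_power:
 assumes "W \<in> fmeasurable m" "V \<in> sets m"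
 shows "(Mean w. void W w * U V w ^ k) = exp (- measure m W) * (Mean w. U (V - W) w ^ k)"
 using assms
proof (induction k arbitrary: W V)
 case 0
 then show ?case by (simp add: void_integral prob_space)
next
 case (Suc k)
 have [measurable]: "W \<in> sets m" "V \<in> sets m" using Suc.prems by (auto simp: fmeasurable_def)
 have fC: "V' \<inter> C s \<in> fmeasurable m" if "V' \<in> sets m" for V' s
  using that fmeasurable_C by (metis fmeasurableI2 inf_le2 C_sets sets.Int)
 have "norm (void W w * U V w ^ k) \<le> 1 * b ^ k" for w
  by (simp only: real_norm_def abs_mult) (intro mult_mono void_range U_power_le; simp)
 note sw = integral_U_swap(1)[OF _ _ this, where V=V, simplified]
 have "(Mean w. void W w * U V w ^ Suc k) = (Mean w. U V w * (void W w * U V w ^ k))"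
  by (simp add: mult_ac)
 also have "\<dots> = (IntB s. (Mean w. void (V \<inter> C s) w * (void W w * U V w ^ k)))"
  by (rule sw) measurable
 also have "\<dots> = (IntB s. (Mean w. void (W \<union> V \<inter> C s) w * U V w ^ k))"
  by (simp add: mult.assoc[symmetric] void_Un Un_commute)
 also have "\<dots> = (IntB s. exp (- measure m (W \<union> V \<inter> C s)) * (Mean w. U (V - (W \<union> V \<inter> C s)) w ^ k))"
  by (intro Bochner_integral_cong refl Suc.IH fmeasurable.Un fC Suc.prems)
 also have "\<dots> = (IntB s. exp (- measure m W) *
   (exp (- measure m ((V - W) \<inter> C s)) * (Mean w. U ((V - W) - (V - W) \<inter> C s) w ^ k)))"
 proof (intro Bochner_integral_cong refl)
  fix s
  have "measure m (W \<union> V \<inter> C s) = measure m (W \<union> (V - W) \<inter> C s)"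
   by (rule arg_cong[of _ _ "measure m"]) auto
  also have "\<dots> = measure m W + measure m ((V - W) \<inter> C s)"
  proof -
   have "W \<inter> ((V - W) \<inter> C s) = {}" by auto
   then show ?thesis
    using Suc.prems fC[of "V - W" s] by (subst measure_Un3) auto
  qed
  finally have 1: "measure m (W \<union> V \<inter> C s) = measure m W + measure m ((V - W) \<inter> C s)" .
  have 2: "V - (W \<union> V \<inter> C s) = (V - W) - (V - W) \<inter> C s" by auto
  show "exp (- measure m (W \<union> V \<inter> C s)) * (Mean w. U (V - (W \<union> V \<inter> C s)) w ^ k) =
   exp (- measure m W) * (exp (- measure m ((V - W) \<inter> C s)) * (Mean w. U ((V - W) - (V - W) \<inter> C s) w ^ k))"
   unfolding 1 2 by (simp add: exp_diff exp_minus field_simps exp_add)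
 qed
 \<comment> \<open>The induction hypothesis for \<open>(V - W) \<inter> C s\<close> and
   \<open>V - W\<close>, read from right to left, restores avoidance indicators, which the next step
   integrates back to a factor \<open>U (V - W)\<close>.\<close>
 also have "\<dots> = exp (- measure m W) * (IntB s. (Mean w. void ((V - W) \<inter> C s) w * U (V - W) w ^ k))"
  by (simp add: Suc.IH fC)
 also have "(IntB s. (Mean w. void ((V - W) \<inter> C s) w * U (V - W) w ^ k)) = (Mean w. U (V - W) w * U (V - W) w ^ k)"
  using integral_U_swap(1)[of "\<lambda>w. U (V - W) w ^ k" "V - W" "b ^ k"] U_power_le by simp
 finally show ?case by simp
qed

text \<open>Only avoidance probabilities of the point process enter this identity: deleting a set \<open>W\<close> of
 marks has the same effect on the uncovered volume as conditioning on the absence of points in \<open>W\<close>.\<close>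

lemma void_U_char:
 assumes "W \<in> fmeasurable m" "V \<in> sets m"
 shows "(Mean w. of_real (void W w) * iexp (\<eta> * U V w)) =
  of_real (exp (- measure m W)) * (Mean w. iexp (\<eta> * U (V - W) w))"
proof -
 have [measurable]: "W \<in> sets m" "V \<in> sets m" using assms by (auto simp: fmeasurable_def)
 have "(\<lambda>k. (\<i> * of_real \<eta>) ^ k / fact k * of_real (Mean w. void W w * U V w ^ k)) sums
  (Mean w. of_real (void W w) * iexp (\<eta> * U V w))"
  by (rule moment_series_char[of _ _ b]) (auto simp: void_range U_abs)
 moreover have "(\<lambda>k. (\<i> * of_real \<eta>) ^ k / fact k * of_real (Mean w. 1 * U (V - W) w ^ k)) sums
  (Mean w. of_real 1 * iexp (\<eta> * U (V - W) w))"
  by (rule moment_series_char[of _ _ b]) (auto simp: U_abs)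
 then have "(\<lambda>k. of_real (exp (- measure m W)) * ((\<i> * of_real \<eta>) ^ k / fact k * of_real (Mean w. 1 * U (V - W) w ^ k))) sums
  (of_real (exp (- measure m W)) * (Mean w. of_real 1 * iexp (\<eta> * U (V - W) w)))"
  by (rule sums_mult)
 ultimately show ?thesis
  using void_U_power[OF assms] by (simp add: sums_iff mult_ac)
qed

lemma fmeasurable_Int_C: "V \<in> sets m \<Longrightarrow> V \<inter> C s \<in> fmeasurable m"
 using fmeasurable_C by (metis fmeasurableI2 inf_le2 C_sets sets.Int)

lemma fmeasurable_C_Diff: "V \<in> sets m \<Longrightarrow> C s - V \<in> fmeasurable m"
 using fmeasurable_C by (metis fmeasurableI2 Diff_subset C_sets sets.Diff)

lemma measure_C_Diff: "V \<in> sets m \<Longrightarrow> measure m (C s - V) = \<mu> - measure m (C s \<inter> V)"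
proof -
 assume V: "V \<in> sets m"
 have "measure m (C s) = measure m ((C s - V) \<union> (V \<inter> C s))"
  by (rule arg_cong[of _ _ "measure m"]) auto
 also have "\<dots> = measure m (C s - V) + measure m (V \<inter> C s)"
 proof -
  have "(C s - V) \<inter> (V \<inter> C s) = {}" by auto
  then show ?thesis using fmeasurable_Int_C[OF V] fmeasurable_C_Diff[OF V]
   by (subst measure_Un3) auto
 qed
 finally show ?thesis by (simp add: measure_C Int_commute)
qed

abbreviation S :: "'e set" where "S \<equiv> space m"

lemma S_Int_C: "S \<inter> C s = C s" "(S - V) \<inter> C s = C s - V"
 using C_subset by auto

lemma integrable_char [simp]:
 assumes [measurable]: "X \<in> borel_measurable M" "V \<in> sets m" and "\<And>w. norm (X w) \<le> c"
 shows "integrable M (\<lambda>w. X w * iexp (\<eta> * U V w))"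
 by (rule integrable_const_bound[of _ c]) (use assms in \<open>auto simp: norm_mult\<close>)

lemma U_mono: "V \<subseteq> V' \<Longrightarrow> V \<in> sets m \<Longrightarrow> V' \<in> sets m \<Longrightarrow> w \<in> space M \<Longrightarrow> U V' w \<le> U V w"
 unfolding U_def by (intro integral_mono void_slice_integrable void_antimono) auto

lemma integrable_U [simp]: "V \<in> sets m \<Longrightarrow> integrable M (U V)"
 by (rule integrable_const_bound[of _ b]) (auto simp: U_abs)

text \<open>A mean uncovered volume is the integral over w of exp(- m(V' \<inter> C w)), so deleting
  \<open>V\<close> raises it by the integral of differences of exponentials, each at most m(C w
  \<inter> V).\<close>

lemma integral_U_diff_le:
 assumes [measurable]: "V \<in> sets m" and f: "\<And>w. measure m (C w \<inter> V) \<le> f w" "integrable LB f"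
 shows "(Mean z. U (S - V) z - U S z) \<le> (IntB w. f w)"
proof -
 have sub: "0 \<le> measure m (C w \<inter> V)" "measure m (C w \<inter> V) \<le> \<mu>" for w
  using measure_mono_fmeasurable[of "C w \<inter> V" "C w" m] fmeasurable_C by (auto simp: measure_C)
 have eq: "(Mean z. U V' z) = (IntB w. exp (- measure m (V' \<inter> C w)))"
  "integrable LB (\<lambda>w. exp (- measure m (V' \<inter> C w)))" if "V' \<in> sets m" for V'
  using integral_U_swap[of "\<lambda>_. 1 :: real" V' 1] that
  by (simp_all add: void_integral fmeasurable_Int_C)
 have "(Mean z. U (S - V) z - U S z) = (Mean z. U (S - V) z) - (Mean z. U S z)"
  by (intro Bochner_integral_diff) auto
 also have "\<dots> = (IntB w. exp (- measure m ((S - V) \<inter> C w)) - exp (- measure m (S \<inter> C w)))"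
  by (subst Bochner_integral_diff) (auto intro!: eq simp: eq measure_C)
 also have "\<dots> \<le> (IntB w. f w)"
 proof (rule integral_mono)
  show "integrable LB (\<lambda>w. exp (- measure m ((S - V) \<inter> C w)) - exp (- measure m (S \<inter> C w)))"
   by (intro Bochner_integrable_diff eq) auto
  show "exp (- measure m ((S - V) \<inter> C w)) - exp (- measure m (S \<inter> C w)) \<le> f w" for w
   unfolding S_Int_C measure_C measure_C_Diff[OF assms(1)]
   using exp_diff_le(1)[OF sub] f(1) by (rule order_trans)
 qed (rule f)
 finally show ?thesis .
qed

lemma cov_kernel_range: "0 \<le> exp (- (\<mu> - \<rho> w)) - exp (- \<mu>)" "exp (- (\<mu> - \<rho> w)) - exp (- \<mu>) \<le> \<rho> w"
 using exp_diff_le[OF rho_nonneg rho_le_mu] by auto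

lemma integrable_LB_rho: "integrable LB (\<lambda>s. \<rho> (s - t))"
 by (rule LB.integrable_const_bound[of _ \<mu>]) (auto simp: rho_nonneg rho_le_mu)

lemma integral_LB_rho_le:
 assumes "integrable lborel \<rho>"
 shows "(IntB s. \<rho> (s - t)) \<le> (Leb w. \<rho> w)"
proof -
 have "ennreal (IntB s. \<rho> (s - t)) = (nIntB s. \<rho> (s - t))"
  by (intro nn_integral_eq_integral[symmetric] integrable_LB_rho) (auto simp: rho_nonneg)
 also have "\<dots> \<le> (nLeb w. \<rho> w)"
  using nn_integral_LB_translate_le[of "\<lambda>w. ennreal (\<rho> w)" t] by simp
 also have "\<dots> = ennreal (Leb w. \<rho> w)"
  by (intro nn_integral_eq_integral assms) (auto simp: rho_nonneg)
 finally show ?thesis by (simp add: integral_nonneg_AE rho_nonneg)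
qed

section \<open>Response of the characteristic function to the deletion of grains\<close>

definition char_U :: "real \<Rightarrow> 'e set \<Rightarrow> complex" where
 "char_U \<eta> V = (Mean w. iexp (\<eta> * U V w))"

text \<open>The exponential is Lipschitz in the uncovered volume, and deletion can only enlarge that
  volume, so the absolute difference is a plain difference, whose mean is already bounded.\<close>

lemma char_U_diff_le:
 assumes [measurable]: "V \<in> sets m" and f: "\<And>w. measure m (C w \<inter> V) \<le> f w" "integrable LB f"
 shows "norm (char_U \<eta> (S - V) - char_U \<eta> S) \<le> \<bar>\<eta>\<bar> * (IntB w. f w)"
proof -
 have "norm (char_U \<eta> (S - V) - char_U \<eta> S) = norm (Mean z. iexp (\<eta> * U (S - V) z) - iexp (\<eta> * U S z))"
  unfolding char_U_def using integrable_char[of "\<lambda>_. 1" S 1 \<eta>] integrable_char[of "\<lambda>_. 1" "S - V" 1 \<eta>]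
  by (subst Bochner_integral_diff) auto
 also have "\<dots> \<le> (Mean z. \<bar>\<eta>\<bar> * (U (S - V) z - U S z))"
 proof (rule norm_integral_le_integral)
  fix z assume w: "z \<in> space M"
  have "norm (iexp (\<eta> * U (S - V) z) - iexp (\<eta> * U S z)) =
    norm (iexp (\<eta> * U S z) * (iexp (\<eta> * (U (S - V) z - U S z)) - 1))"
   by (simp add: algebra_simps flip: exp_add)
  also have "\<dots> \<le> \<bar>\<eta> * (U (S - V) z - U S z)\<bar>"
   using iexp_approx1[of "\<eta> * (U (S - V) z - U S z)" 0] by (simp add: norm_mult)
  also have "\<dots> = \<bar>\<eta>\<bar> * (U (S - V) z - U S z)"
   using U_mono[of "S - V" S z] w by (simp add: abs_mult)
  finally show "norm (iexp (\<eta> * U (S - V) z) - iexp (\<eta> * U S z)) \<le> \<bar>\<eta>\<bar> * (U (S - V) z - U S z)" .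
 qed (use integrable_char[of "\<lambda>_. 1" S 1 \<eta>] integrable_char[of "\<lambda>_. 1" "S - V" 1 \<eta>] in auto)
 also have "\<dots> \<le> \<bar>\<eta>\<bar> * (IntB w. f w)"
  using integral_U_diff_le[OF assms] by (simp add: mult_left_mono)
 finally show ?thesis .
qed

text \<open>Starting without the grains over t, avoidance of \<open>C s - C t\<close> and avoidance
  of \<open>C s\<close> both leave the grains in \<open>S - C t - C s\<close>. The two terms
  therefore share one characteristic function and differ in the weights exp(- (\<mu> - \<rho>)) and
  exp(- \<mu>).\<close>

lemma integral_Diff_U_char:
 "(Mean w. of_real (U (S - C t) w - U S w) * iexp (\<eta> * U (S - C t) w)) =
  (IntB s. of_real (exp (- (\<mu> - \<rho> (s - t))) - exp (- \<mu>)) * char_U \<eta> (S - C t - C s))"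
  (is "?l = ?r")
 "integrable LB (\<lambda>s. of_real (exp (- (\<mu> - \<rho> (s - t))) - exp (- \<mu>)) * char_U \<eta> (S - C t - C s))"
proof -
 let ?X = "\<lambda>w. iexp (\<eta> * U (S - C t) w)"
 have v: "(Mean w. of_real (void ((S - C t) \<inter> C s) w) * ?X w) = of_real (exp (- (\<mu> - \<rho> (s - t)))) * char_U \<eta> (S - C t - C s)"
  "(Mean w. of_real (void (S \<inter> C s) w) * ?X w) = of_real (exp (- \<mu>)) * char_U \<eta> (S - C t - C s)" for s
 proof -
  have "S - C t - (C s - C t) = S - C t - C s" by auto
  then show "(Mean w. of_real (void ((S - C t) \<inter> C s) w) * ?X w) = of_real (exp (- (\<mu> - \<rho> (s - t)))) * char_U \<eta> (S - C t - C s)"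
   unfolding S_Int_C char_U_def
   by (subst void_U_char) (auto intro: fmeasurable_C_Diff simp: measure_C_Diff measure_C_Int)
  show "(Mean w. of_real (void (S \<inter> C s) w) * ?X w) = of_real (exp (- \<mu>)) * char_U \<eta> (S - C t - C s)"
   unfolding S_Int_C char_U_def
   by (subst void_U_char) (auto intro: fmeasurable_C simp: measure_C)
 qed
 have sw: "(Mean w. of_real (U V w) * ?X w) = (IntB s. (Mean w. of_real (void (V \<inter> C s) w) * ?X w))"
  "integrable LB (\<lambda>s. \<integral>w. of_real (void (V \<inter> C s) w) * ?X w \<partial>M)" if "V \<in> sets m" for V
  using integral_U_swap[of ?X V 1] that by auto
 have i: "integrable M (\<lambda>w. of_real (U V w) * ?X w)" if "V \<in> sets m" for V
  using that by (intro integrable_char[of _ _ b]) (auto simp: U_abs)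
 have "?l = (Mean w. of_real (U (S - C t) w) * ?X w) - (Mean w. of_real (U S w) * ?X w)"
 proof -
  have "?l = (Mean w. of_real (U (S - C t) w) * ?X w - of_real (U S w) * ?X w)"
   by (simp add: left_diff_distrib)
  also have "\<dots> = (Mean w. of_real (U (S - C t) w) * ?X w) - (Mean w. of_real (U S w) * ?X w)"
   by (rule Bochner_integral_diff; rule i; simp)
  finally show ?thesis .
 qed
 also have "\<dots> = ?r"
 proof -
  have s1: "(Mean w. of_real (U (S - C t) w) * ?X w) = (IntB s. of_real (exp (- (\<mu> - \<rho> (s - t)))) * char_U \<eta> (S - C t - C s))"
   using sw(1)[of "S - C t"] unfolding v(1) by simp
  have s2: "(Mean w. of_real (U S w) * ?X w) = (IntB s. of_real (exp (- \<mu>)) * char_U \<eta> (S - C t - C s))"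
   using sw(1)[of S] unfolding v(2) by simp
  show ?thesis unfolding s1 s2 of_real_diff left_diff_distrib
   by (rule Bochner_integral_diff[symmetric])
     (rule sw(2)[of "S - C t", unfolded v(1)] sw(2)[of S, unfolded v(2)]; simp)+
 qed
 finally show "?l = ?r" .
 show "integrable LB (\<lambda>s. of_real (exp (- (\<mu> - \<rho> (s - t))) - exp (- \<mu>)) * char_U \<eta> (S - C t - C s))"
  unfolding of_real_diff left_diff_distrib
  by (rule Bochner_integrable_diff)
    (rule sw(2)[of "S - C t", unfolded v(1)] sw(2)[of S, unfolded v(2)]; simp)+
qed

text \<open>Interpolates between two Taylor bounds for an increment x1 + x2 whose part x1 is bounded
  and whose part x2 is to be controlled in mean: the quadratic bound serves if x2 \<le> x1, the
  linear one otherwise.\<close>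

lemma min_quadratic_linear_le:
 fixes x1 x2 v \<eta> :: real
 assumes "0 \<le> x1" "0 \<le> x2" "x1 \<le> v" "y \<le> (\<eta> * (x1 + x2))\<^sup>2 / 2" "y \<le> 2 * \<bar>\<eta> * (x1 + x2)\<bar>"
 shows "y \<le> 2 * \<eta>\<^sup>2 * v\<^sup>2 + 4 * \<bar>\<eta>\<bar> * x2"
proof (cases "x2 \<le> x1")
 case True
 have "y \<le> \<eta>\<^sup>2 * (x1 + x2)\<^sup>2 / 2" using assms(4) by (simp add: power_mult_distrib)
 also have "\<dots> \<le> \<eta>\<^sup>2 * (2 * v)\<^sup>2 / 2"
  using assms True by (intro divide_right_mono mult_left_mono power_mono) auto
 also have "\<dots> = 2 * \<eta>\<^sup>2 * v\<^sup>2" by (simp add: power2_eq_square)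
 also have "\<dots> \<le> 2 * \<eta>\<^sup>2 * v\<^sup>2 + 4 * \<bar>\<eta>\<bar> * x2" using assms by simp
 finally show ?thesis .
next
 case False
 have "y \<le> 2 * \<bar>\<eta>\<bar> * (x1 + x2)" using assms by (simp add: abs_mult)
 also have "\<dots> \<le> 2 * \<bar>\<eta>\<bar> * (2 * x2)" using False by (intro mult_left_mono) auto
 also have "\<dots> \<le> 2 * \<eta>\<^sup>2 * v\<^sup>2 + 4 * \<bar>\<eta>\<bar> * x2" using assms by simp
 finally show ?thesis .
qed

text \<open>The expansion is around the configuration without the grains over t, since in this form
  the linear term is given by \<open>integral_Diff_U_char\<close>. The increment is split at
  distance K from t: its near part is at most the volume of a ball, and its far part has mean at
  most the tail integral of \<rho>.\<close>

lemma char_U_expansion: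
 assumes rho: "integrable lborel \<rho>" and K: "K > 0"
 shows "norm (char_U \<eta> (S - C t) - char_U \<eta> S
   - \<i> * of_real \<eta> * (Mean z. of_real (U (S - C t) z - U S z) * iexp (\<eta> * U (S - C t) z)))
  \<le> 2 * \<eta>\<^sup>2 * (measure lborel (cball (0::'a) K))\<^sup>2 + 4 * \<bar>\<eta>\<bar> * (Leb w. \<rho> w * indicator {w. K < norm w} w)"
proof -
 let ?X = "\<lambda>z. iexp (\<eta> * U (S - C t) z)"
 let ?v = "measure lborel (cball (0::'a) K)" and ?r = "\<integral>w. \<rho> w * indicator {w. K < norm w} w \<partial>lborel"
 \<comment> \<open>\<open>g z s\<close> is 1 exactly if s is covered, but by no grain other than
   those over t; these are the points that deletion of \<open>C t\<close> uncovers.\<close>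
 define g where "g z s = void (C s - C t) z - void (C s) z" for z s
 have g01: "0 \<le> g z s" "g z s \<le> 1" "\<bar>g z s\<bar> \<le> 1" for z s
  by (auto simp: g_def void_def)
 have gpair [measurable]: "(\<lambda>p. g (fst p) (snd p)) \<in> borel_measurable (M \<Otimes>\<^sub>M LB)"
  using void_pair_meas[of "S - C t"] void_pair_meas[of S] unfolding g_def S_Int_C by simp
 have gsl [measurable]: "(\<lambda>s. g z s) \<in> borel_measurable borel" if "z \<in> space M" for z
  using void_slice_meas[of "S - C t" z] void_slice_meas[of S z] that unfolding g_def S_Int_C by simp
 define D1 where "D1 z = (IntB s. indicator (cball t K) s * g z s)" for z
 define D2 where "D2 z = (IntB s. indicator (- cball t K) s * g z s)" for z
 have gi: "integrable LB (\<lambda>s. indicator A s * g z s)" if "z \<in> space M" "A \<in> sets borel" for z A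
  using gsl[OF that(1)] that(2)
  by (intro LB.integrable_const_bound[of _ 1]) (auto simp: abs_mult g01 split: split_indicator)
 have UD: "U (S - C t) z - U S z = D1 z + D2 z" if "z \<in> space M" for z
 proof -
  have "U (S - C t) z - U S z = (IntB s. g z s)"
   unfolding U_def g_def using void_slice_integrable[of "S - C t" z] void_slice_integrable[of S z] that
   by (subst Bochner_integral_diff[symmetric]) (auto simp: S_Int_C)
  also have "\<dots> = (IntB s. indicator (cball t K) s * g z s + indicator (- cball t K) s * g z s)"
   by (intro Bochner_integral_cong) (auto split: split_indicator)
  also have "\<dots> = D1 z + D2 z"
   unfolding D1_def D2_def using that by (intro Bochner_Integration.integral_add gi) auto
  finally show ?thesis .
 qed
 have D0: "0 \<le> D1 z" "0 \<le> D2 z" for z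
  unfolding D1_def D2_def by (intro integral_nonneg_AE AE_I2; simp add: g01)+
 have D1v: "D1 z \<le> ?v" if w: "z \<in> space M" for z
 proof -
  have "D1 z \<le> (IntB s. indicator (cball t K) s)"
   unfolding D1_def using w
   by (intro integral_mono gi integrable_real_indicator) (auto simp: g01 less_top[symmetric] split: split_indicator)
  also have "\<dots> = measure LB (cball t K)" by simp
  also have "\<dots> \<le> ?v"
  proof -
   have "emeasure LB (cball t K) = (nIntB s. indicator (cball 0 K) (s - t))"
   proof -
    have "indicator (cball 0 K) (s - t) = (indicator (cball t K) s :: ennreal)" for s
     by (auto simp: dist_norm norm_minus_commute split: split_indicator)
    then show ?thesis by simp
   qed
   also have "\<dots> \<le> (nLeb w. indicator (cball (0::'a) K) w)"
    by (intro nn_integral_LB_translate_le borel_measurable_indicator) simp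
   finally have "emeasure LB (cball t K) \<le> emeasure lborel (cball (0::'a) K)" by simp
   then show ?thesis
    unfolding measure_def using emeasure_lborel_cball_finite[of "0::'a" K] by (intro enn2real_mono) auto
  qed
  finally show ?thesis .
 qed
 have gint: "integrable (M \<Otimes>\<^sub>M LB) (\<lambda>(z, s). indicator (- cball t K) s * g z s)"
  by (rule PF.integrable_const_bound[of _ 1]) (auto simp: split_beta' abs_mult g01 split: split_indicator)
 have D2_meas [measurable]: "D2 \<in> borel_measurable M"
  unfolding D2_def[abs_def] using borel_measurable_integrable[OF gint]
  by (intro LB.borel_measurable_lebesgue_integral) simp
 have D2_int: "integrable M D2"
  unfolding D2_def[abs_def] by (rule P.integrable_fst[OF gint])
 have ED2: "(Mean z. D2 z) \<le> ?r"
 proof -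
  have "(Mean z. D2 z) = (IntB s. (Mean z. indicator (- cball t K) s * g z s))"
   unfolding D2_def by (rule P.Fubini_integral[OF gint, symmetric])
  also have "\<dots> = (IntB s. indicator (- cball t K) s * (exp (- (\<mu> - \<rho> (s - t))) - exp (- \<mu>)))"
  proof (intro Bochner_integral_cong refl)
   fix s
   have "(Mean z. g z s) = exp (- (\<mu> - \<rho> (s - t))) - exp (- \<mu>)"
    unfolding g_def
    by (subst Bochner_integral_diff)
      (auto simp: void_integrable void_integral fmeasurable_C_Diff fmeasurable_C measure_C measure_C_Diff measure_C_Int)
   then show "(Mean z. indicator (- cball t K) s * g z s) = indicator (- cball t K) s * (exp (- (\<mu> - \<rho> (s - t))) - exp (- \<mu>))"
    by simp
  qed
  also have "\<dots> \<le> (IntB s. \<rho> (s - t) * indicator {w. K < norm w} (s - t))"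
  proof (rule integral_mono)
   show "integrable LB (\<lambda>s. indicator (- cball t K) s * (exp (- (\<mu> - \<rho> (s - t))) - exp (- \<mu>)))"
    using cov_kernel_range(1) order_trans[OF cov_kernel_range(2) rho_le_mu]
    by (intro LB.integrable_const_bound[of _ \<mu>]) (auto simp: abs_mult mu_nonneg split: split_indicator)
   show "integrable LB (\<lambda>s. \<rho> (s - t) * indicator {w. K < norm w} (s - t))"
    by (intro LB.integrable_const_bound[of _ \<mu>])
      (auto simp: abs_mult mu_nonneg rho_le_mu rho_nonneg split: split_indicator)
   show "indicator (- cball t K) s * (exp (- (\<mu> - \<rho> (s - t))) - exp (- \<mu>)) \<le> \<rho> (s - t) * indicator {w. K < norm w} (s - t)" for s
    using cov_kernel_range(2)[of "s - t"]
    by (auto simp: dist_norm norm_minus_commute split: split_indicator)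
  qed
  also have "\<dots> \<le> ?r"
  proof -
   let ?f = "\<lambda>w. \<rho> w * indicator {w. K < norm w} w"
   have f: "integrable lborel ?f"
    by (rule Bochner_integrable_bound[OF rho]) (auto simp: abs_mult rho_nonneg split: split_indicator)
   have fl: "integrable LB (\<lambda>s. ?f (s - t))"
    by (intro LB.integrable_const_bound[of _ \<mu>])
      (auto simp: abs_mult mu_nonneg rho_le_mu rho_nonneg split: split_indicator)
   have "ennreal (IntB s. ?f (s - t)) = (nIntB s. ?f (s - t))"
    by (intro nn_integral_eq_integral[symmetric] fl) (auto simp: rho_nonneg)
   also have "\<dots> \<le> (nLeb w. ?f w)"
    using nn_integral_LB_translate_le[of "\<lambda>w. ennreal (?f w)" t] by simp
   also have "\<dots> = ennreal ?r"
    by (intro nn_integral_eq_integral f) (auto simp: rho_nonneg)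
   finally show ?thesis by (simp add: integral_nonneg_AE rho_nonneg)
  qed
  finally show ?thesis .
 qed
 have i1: "integrable M (\<lambda>z. of_real (U (S - C t) z - U S z) * ?X z)"
 proof (rule integrable_char[where c="2 * b"])
  show "norm (complex_of_real (U (S - C t) z - U S z)) \<le> 2 * b" for z
   using U_abs[of "S - C t" z] U_abs[of S z] by (simp only: norm_of_real)
 qed auto
 have i2: "integrable M (\<lambda>z. iexp (\<eta> * U V z))" if "V \<in> sets m" for V
  using integrable_char[of "\<lambda>_. 1" V 1 \<eta>] that by simp
 have "char_U \<eta> (S - C t) - char_U \<eta> S - \<i> * of_real \<eta> * (Mean z. of_real (U (S - C t) z - U S z) * ?X z) =
   (Mean z. ?X z - iexp (\<eta> * U S z) - \<i> * of_real \<eta> * (of_real (U (S - C t) z - U S z) * ?X z))"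
 proof -
  have SC: "S - C t \<in> sets m" "S \<in> sets m" by measurable
  have "(Mean z. ?X z - iexp (\<eta> * U S z) - \<i> * of_real \<eta> * (of_real (U (S - C t) z - U S z) * ?X z)) =
    (Mean z. ?X z - iexp (\<eta> * U S z)) - (Mean z. \<i> * of_real \<eta> * (of_real (U (S - C t) z - U S z) * ?X z))"
   by (intro Bochner_integral_diff Bochner_integrable_diff i2 integrable_mult_right i1 SC)
  also have "(Mean z. ?X z - iexp (\<eta> * U S z)) = (Mean z. ?X z) - (Mean z. iexp (\<eta> * U S z))"
   by (intro Bochner_integral_diff i2 SC)
  also have "(Mean z. \<i> * of_real \<eta> * (of_real (U (S - C t) z - U S z) * ?X z)) =
    \<i> * of_real \<eta> * (Mean z. of_real (U (S - C t) z - U S z) * ?X z)"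
   by (rule integral_mult_right_zero)
  finally show ?thesis unfolding char_U_def ..
 qed
 also have "norm \<dots> \<le> (Mean z. 2 * \<eta>\<^sup>2 * ?v\<^sup>2 + 4 * \<bar>\<eta>\<bar> * D2 z)"
 proof (rule norm_integral_le_integral)
  show "integrable M (\<lambda>z. 2 * \<eta>\<^sup>2 * ?v\<^sup>2 + 4 * \<bar>\<eta>\<bar> * D2 z)"
   using D2_int by simp
  show "integrable M (\<lambda>z. ?X z - iexp (\<eta> * U S z) - \<i> * of_real \<eta> * (of_real (U (S - C t) z - U S z) * ?X z))"
   by (intro Bochner_integrable_diff i2 integrable_mult_right i1) auto
  fix z assume w: "z \<in> space M"
  \<comment> \<open>Restoring the grains over t lowers the uncovered volume, whence the
    sign.\<close>
  define x where "x = - (\<eta> * (D1 z + D2 z))"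
  have ex: "\<eta> * U S z = \<eta> * U (S - C t) z + x"
   using UD[OF w] by (simp add: x_def algebra_simps)
  have "iexp (\<eta> * U S z) = ?X z * iexp x"
   by (simp only: ex of_real_add distrib_left exp_add)
  then have "?X z - iexp (\<eta> * U S z) - \<i> * of_real \<eta> * (of_real (U (S - C t) z - U S z) * ?X z) =
    - ?X z * (iexp x - (1 + \<i> * of_real x))"
   unfolding UD[OF w] by (simp add: x_def algebra_simps)
  then have "norm (?X z - iexp (\<eta> * U S z) - \<i> * of_real \<eta> * (of_real (U (S - C t) z - U S z) * ?X z)) =
    norm (iexp x - (1 + \<i> * of_real x))"
   by (simp add: norm_mult)
  also have "\<dots> \<le> 2 * \<eta>\<^sup>2 * ?v\<^sup>2 + 4 * \<bar>\<eta>\<bar> * D2 z"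
  proof (rule min_quadratic_linear_le[OF D0 D1v[OF w]])
   show "norm (iexp x - (1 + \<i> * of_real x)) \<le> (\<eta> * (D1 z + D2 z))\<^sup>2 / 2"
    using iexp_approx1[of x 1] by (simp add: x_def numeral_2_eq_2 power2_eq_square)
   show "norm (iexp x - (1 + \<i> * of_real x)) \<le> 2 * \<bar>\<eta> * (D1 z + D2 z)\<bar>"
    using iexp_approx2[of x 1] by (simp add: x_def)
  qed
  finally show "norm (?X z - iexp (\<eta> * U S z) - \<i> * of_real \<eta> * (of_real (U (S - C t) z - U S z) * ?X z))
    \<le> 2 * \<eta>\<^sup>2 * ?v\<^sup>2 + 4 * \<bar>\<eta>\<bar> * D2 z" .
 qed
 also have "\<dots> = 2 * \<eta>\<^sup>2 * ?v\<^sup>2 + 4 * \<bar>\<eta>\<bar> * (Mean z. D2 z)"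
  using D2_int by (simp add: prob_space)
 also have "\<dots> \<le> 2 * \<eta>\<^sup>2 * ?v\<^sup>2 + 4 * \<bar>\<eta>\<bar> * ?r"
  using ED2 by (intro add_left_mono mult_left_mono) auto
 finally show ?thesis .
qed

text \<open>The variance of \<open>U S\<close>, as the double integral over the window of the
  covariances of being uncovered.\<close>

definition var_U :: real where
 "var_U = exp (- \<mu>) * (IntB t. (IntB s. exp (- (\<mu> - \<rho> (s - t))) - exp (- \<mu>)))"

text \<open>The Stein-type identity behind the Gaussian limit: up to the error on the right, the
 characteristic function of the centred uncovered volume solves \<open>\<phi>' = - \<eta> var_U \<phi>\<close>.\<close>

lemma stein_estimate:
 assumes rho: "integrable lborel \<rho>" and K: "K > 0"
 shows "norm ((Mean z. of_real (U S z - exp (- \<mu>) * b) * iexp (\<eta> * U S z)) - \<i> * of_real \<eta> * of_real var_U * char_U \<eta> S)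
  \<le> b * (2 * \<eta>\<^sup>2 * (measure lborel (cball (0::'a) K))\<^sup>2 + 4 * \<bar>\<eta>\<bar> * (Leb w. \<rho> w * indicator {w. K < norm w} w)
   + 2 * \<eta>\<^sup>2 * (Leb w. \<rho> w)\<^sup>2)"
proof -
 let ?X = "\<lambda>z. iexp (\<eta> * U S z)"
 define Kc where "Kc = 2 * \<eta>\<^sup>2 * (measure lborel (cball (0::'a) K))\<^sup>2 + 4 * \<bar>\<eta>\<bar> * (Leb w. \<rho> w * indicator {w. K < norm w} w)"
 define r where "r = (Leb w. \<rho> w)"
 define k where "k t s = exp (- (\<mu> - \<rho> (s - t))) - exp (- \<mu>)" for t s
 define G where "G t = (IntB s. k t s)" for t
 \<comment> \<open>Change of the characteristic function when the grains over t are deleted.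
   Subtracting the mean exp(- \<mu>) b from U is what produces this difference.\<close>
 define Q where "Q t = char_U \<eta> (S - C t) - char_U \<eta> S" for t
 have r0: "0 \<le> r" unfolding r_def by (intro integral_nonneg_AE AE_I2 rho_nonneg)
 have Kc0: "0 \<le> Kc"
  unfolding Kc_def by (intro add_nonneg_nonneg mult_nonneg_nonneg integral_nonneg_AE AE_I2) (auto simp: rho_nonneg)
 have k01: "0 \<le> k t s" "k t s \<le> \<rho> (s - t)" "k t s \<le> \<mu>" for t s
  using cov_kernel_range[of "s - t"] rho_le_mu[of "s - t"] by (auto simp: k_def)
 have ki: "integrable LB (k t)" for t
  unfolding k_def
  by (rule LB.integrable_const_bound[of _ \<mu>]) (use k01 in \<open>auto simp: k_def\<close>)
 have Gr: "0 \<le> G t" "G t \<le> r" for t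
 proof -
  show "0 \<le> G t" unfolding G_def by (intro integral_nonneg_AE AE_I2 k01)
  have "G t \<le> (IntB s. \<rho> (s - t))"
   unfolding G_def by (intro integral_mono ki integrable_LB_rho k01)
  then show "G t \<le> r" unfolding r_def using integral_LB_rho_le[OF rho, of t] by simp
 qed
 have [measurable]: "G \<in> borel_measurable borel"
  unfolding G_def[abs_def] k_def by measurable
 have Gi: "integrable LB G"
  by (rule LB.integrable_const_bound[of _ r]) (use Gr in auto)
 have v: "(Mean z. of_real (void (S \<inter> C t) z) * ?X z) = of_real (exp (- \<mu>)) * char_U \<eta> (S - C t)" for t
  unfolding S_Int_C char_U_def
  by (subst void_U_char) (auto intro: fmeasurable_C simp: measure_C)
 have sw: "(Mean z. of_real (U S z) * ?X z) = (IntB t. of_real (exp (- \<mu>)) * char_U \<eta> (S - C t))"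
  "integrable LB (\<lambda>t. of_real (exp (- \<mu>)) * char_U \<eta> (S - C t))"
  using integral_U_swap[of ?X S 1] unfolding v by simp_all
 have ci: "integrable LB (\<lambda>t. char_U \<eta> (S - C t))"
 proof -
  have e1: "(of_real (exp \<mu>) :: complex) * of_real (exp (- \<mu>)) = 1"
   by (simp add: exp_minus flip: of_real_mult)
  have eq: "(\<lambda>t. char_U \<eta> (S - C t)) = (\<lambda>t. of_real (exp \<mu>) * (of_real (exp (- \<mu>)) * char_U \<eta> (S - C t)))"
   by (simp only: mult.assoc[symmetric] e1 mult_1_left)
  show ?thesis
   by (subst eq) (rule integrable_mult_right[OF sw(2)])
 qed
 have Qi: "integrable LB Q"
  unfolding Q_def by (intro Bochner_integrable_diff ci) simp
 \<comment> \<open>Two errors add up: \<open>Kc\<close> from the expansion, and the cost of putting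
   the full characteristic function in place of the one without the grains over t and s. The latter
   is at most 2 r \<bar>\<eta>\<bar>, integrated against a kernel of mass at most r.\<close>
 have Qb: "norm (Q t - \<i> * of_real \<eta> * of_real (G t) * char_U \<eta> S) \<le> Kc + 2 * \<eta>\<^sup>2 * r\<^sup>2" for t
 proof -
  define I where "I = (IntB s. of_real (k t s) * char_U \<eta> (S - C t - C s))"
  have I: "I = (Mean z. of_real (U (S - C t) z - U S z) * iexp (\<eta> * U (S - C t) z))"
   "integrable LB (\<lambda>s. of_real (k t s) * char_U \<eta> (S - C t - C s))"
   unfolding I_def k_def using integral_Diff_U_char[of t \<eta>] by simp_all
  have 1: "norm (Q t - \<i> * of_real \<eta> * I) \<le> Kc"
   using char_U_expansion[OF rho K, of \<eta> t] by (simp add: Q_def Kc_def I)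
  have "I - of_real (G t) * char_U \<eta> S = (IntB s. of_real (k t s) * char_U \<eta> (S - C t - C s) - of_real (k t s) * char_U \<eta> S)"
  proof -
   have "of_real (G t) * char_U \<eta> S = (IntB s. of_real (k t s) * char_U \<eta> S)"
    by (simp add: G_def)
   then show ?thesis unfolding I_def
    by (simp only:) (intro Bochner_integral_diff[symmetric] I integrable_mult_left integrable_of_real ki)
  qed
  also have "norm \<dots> \<le> (IntB s. k t s * (\<bar>\<eta>\<bar> * (2 * r)))"
  proof (rule norm_integral_le_integral)
   fix s
   have m2: "measure m (C w \<inter> (C t \<union> C s)) \<le> \<rho> (w - t) + \<rho> (w - s)" for w
   proof -
    have "measure m (C w \<inter> (C t \<union> C s)) = measure m (C w \<inter> C t \<union> C w \<inter> C s)"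
     by (simp add: Int_Un_distrib)
    also have "\<dots> \<le> measure m (C w \<inter> C t) + measure m (C w \<inter> C s)"
     by (rule measure_Un_le) auto
    finally show ?thesis by (simp add: measure_C_Int)
   qed
   have "norm (char_U \<eta> (S - C t - C s) - char_U \<eta> S) = norm (char_U \<eta> (S - (C t \<union> C s)) - char_U \<eta> S)"
    by (simp add: Diff_Un Diff_Int2 set_diff_eq conj_assoc)
   also have "\<dots> \<le> \<bar>\<eta>\<bar> * (IntB w. \<rho> (w - t) + \<rho> (w - s))"
    by (rule char_U_diff_le[OF _ m2]) (auto intro!: Bochner_Integration.integrable_add integrable_LB_rho)
   also have "(IntB w. \<rho> (w - t) + \<rho> (w - s)) = (IntB w. \<rho> (w - t)) + (IntB w. \<rho> (w - s))"
    by (intro Bochner_Integration.integral_add integrable_LB_rho)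
   also have "\<dots> \<le> 2 * r"
    using integral_LB_rho_le[OF rho, of t] integral_LB_rho_le[OF rho, of s] by (simp add: r_def)
   finally have "norm (char_U \<eta> (S - C t - C s) - char_U \<eta> S) \<le> \<bar>\<eta>\<bar> * (2 * r)"
    by (simp add: mult_left_mono)
   then show "norm (of_real (k t s) * char_U \<eta> (S - C t - C s) - of_real (k t s) * char_U \<eta> S) \<le> k t s * (\<bar>\<eta>\<bar> * (2 * r))"
    using k01(1)[of t s] by (simp add: norm_mult mult_left_mono flip: right_diff_distrib)
  qed (auto intro!: I integrable_mult_left integrable_of_real ki)
  also have "\<dots> = G t * (\<bar>\<eta>\<bar> * (2 * r))" by (simp add: G_def)
  also have "\<dots> \<le> r * (\<bar>\<eta>\<bar> * (2 * r))"
   using r0 by (intro mult_right_mono Gr) auto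
  finally have 2: "norm (I - of_real (G t) * char_U \<eta> S) \<le> r * (\<bar>\<eta>\<bar> * (2 * r))" .
  have "Q t - \<i> * of_real \<eta> * of_real (G t) * char_U \<eta> S =
    (Q t - \<i> * of_real \<eta> * I) + \<i> * of_real \<eta> * (I - of_real (G t) * char_U \<eta> S)"
   by (simp add: algebra_simps)
  also have "norm \<dots> \<le> Kc + \<bar>\<eta>\<bar> * (r * (\<bar>\<eta>\<bar> * (2 * r)))"
   using 1 2 by (intro norm_triangle_le add_mono) (auto simp: norm_mult mult_left_mono)
  also have "\<bar>\<eta>\<bar> * (r * (\<bar>\<eta>\<bar> * (2 * r))) = 2 * \<eta>\<^sup>2 * r\<^sup>2"
   by (simp add: power2_eq_square algebra_simps flip: abs_mult)
  finally show ?thesis .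
 qed
 have "(Mean z. of_real (U S z - exp (- \<mu>) * b) * ?X z) =
   (Mean z. of_real (U S z) * ?X z - of_real (exp (- \<mu>) * b) * ?X z)"
  by (simp add: left_diff_distrib)
 also have "\<dots> = (Mean z. of_real (U S z) * ?X z) - of_real (exp (- \<mu>) * b) * char_U \<eta> S"
  unfolding char_U_def using integrable_char[of "\<lambda>_. 1" S 1 \<eta>] integrable_char[of "\<lambda>z. of_real (U S z)" S b \<eta>]
  by (subst Bochner_integral_diff) (auto simp: U_abs intro!: integrable_mult_right)
 also have "\<dots> = of_real (exp (- \<mu>)) * (IntB t. Q t)"
  unfolding sw(1) Q_def using ci
  by (simp add: measure_LB algebra_simps scaleR_conv_of_real)
 finally have A: "(Mean z. of_real (U S z - exp (- \<mu>) * b) * ?X z) = of_real (exp (- \<mu>)) * (IntB t. Q t)" .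
 have "\<i> * of_real \<eta> * of_real var_U * char_U \<eta> S = of_real (exp (- \<mu>)) * (IntB t. \<i> * of_real \<eta> * of_real (G t) * char_U \<eta> S)"
  unfolding var_U_def G_def k_def by simp
 moreover have "(IntB t. Q t - \<i> * of_real \<eta> * of_real (G t) * char_U \<eta> S) =
   (IntB t. Q t) - (IntB t. \<i> * of_real \<eta> * of_real (G t) * char_U \<eta> S)"
  by (intro Bochner_integral_diff Qi integrable_mult_left integrable_mult_right integrable_of_real Gi)
 ultimately have "(Mean z. of_real (U S z - exp (- \<mu>) * b) * ?X z) - \<i> * of_real \<eta> * of_real var_U * char_U \<eta> S =
   of_real (exp (- \<mu>)) * (IntB t. Q t - \<i> * of_real \<eta> * of_real (G t) * char_U \<eta> S)"
  unfolding A by (simp only: right_diff_distrib)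
 then have "norm ((Mean z. of_real (U S z - exp (- \<mu>) * b) * ?X z) - \<i> * of_real \<eta> * of_real var_U * char_U \<eta> S) =
   exp (- \<mu>) * norm (IntB t. Q t - \<i> * of_real \<eta> * of_real (G t) * char_U \<eta> S)"
  by (simp only: norm_mult norm_of_real abs_exp_cancel)
 also have "\<dots> \<le> 1 * (IntB t. Kc + 2 * \<eta>\<^sup>2 * r\<^sup>2)"
  using mu_nonneg Qi Gi
  by (intro mult_mono norm_integral_le_integral Qb) (auto intro!: Bochner_integrable_diff integrable_mult_left integrable_mult_right integrable_of_real)
 also have "\<dots> = b * (Kc + 2 * \<eta>\<^sup>2 * r\<^sup>2)"
  by (simp add: measure_LB)
 finally show ?thesis unfolding Kc_def r_def .
qed

end

subsection \<open>Gaussian limit\<close>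


text \<open>The bound on Z makes the second order Taylor remainder at most B^2 h^2 / 2 for every
  outcome, hence also in mean, and this is o(h).\<close>

lemma (in prob_space) char_bounded_has_vector_derivative:
 fixes Z :: "'a \<Rightarrow> real"
 assumes [measurable]: "Z \<in> borel_measurable M" and Z: "\<And>w. \<bar>Z w\<bar> \<le> B"
 shows "((\<lambda>\<theta>. \<integral>w. iexp (\<theta> * Z w) \<partial>M) has_vector_derivative (\<integral>w. \<i> * of_real (Z w) * iexp (\<theta> * Z w) \<partial>M)) (at \<theta>)"
proof -
 let ?D = "\<integral>w. \<i> * of_real (Z w) * iexp (\<theta> * Z w) \<partial>M"
 let ?\<phi> = "\<lambda>\<theta>. \<integral>w. iexp (\<theta> * Z w) \<partial>M"
 have i1: "integrable M (\<lambda>w. iexp (t * Z w))" for t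
  by (rule integrable_const_bound[of _ 1]) auto
 have i2: "integrable M (\<lambda>w. \<i> * of_real (Z w) * iexp (\<theta> * Z w))"
  by (rule integrable_const_bound[of _ B]) (auto simp: norm_mult Z)
 have B0: "0 \<le> B" using Z[of undefined] by simp
 have bound: "norm (?\<phi> (\<theta> + h) - ?\<phi> \<theta> - h *\<^sub>R ?D) \<le> B\<^sup>2 / 2 * h\<^sup>2" for h
 proof -
  have "?\<phi> (\<theta> + h) - ?\<phi> \<theta> - h *\<^sub>R ?D =
    (\<integral>w. iexp ((\<theta> + h) * Z w) - iexp (\<theta> * Z w) - h *\<^sub>R (\<i> * of_real (Z w) * iexp (\<theta> * Z w)) \<partial>M)"
  proof -
   have "(\<integral>w. iexp ((\<theta> + h) * Z w) - iexp (\<theta> * Z w) - h *\<^sub>R (\<i> * of_real (Z w) * iexp (\<theta> * Z w)) \<partial>M) =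
     (\<integral>w. iexp ((\<theta> + h) * Z w) - iexp (\<theta> * Z w) \<partial>M) - (\<integral>w. h *\<^sub>R (\<i> * of_real (Z w) * iexp (\<theta> * Z w)) \<partial>M)"
    by (intro Bochner_integral_diff Bochner_integrable_diff i1 integrable_scaleR_right i2)
   also have "(\<integral>w. iexp ((\<theta> + h) * Z w) - iexp (\<theta> * Z w) \<partial>M) = ?\<phi> (\<theta> + h) - ?\<phi> \<theta>"
    by (intro Bochner_integral_diff i1)
   finally show ?thesis by simp
  qed
  also have "norm \<dots> \<le> (\<integral>w. B\<^sup>2 / 2 * h\<^sup>2 \<partial>M)"
  proof (rule norm_integral_le_integral)
   fix w
   have e: "iexp ((\<theta> + h) * Z w) = iexp (\<theta> * Z w) * iexp (h * Z w)"
    by (simp only: distrib_right of_real_add distrib_left exp_add)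
   have "norm (iexp ((\<theta> + h) * Z w) - iexp (\<theta> * Z w) - h *\<^sub>R (\<i> * of_real (Z w) * iexp (\<theta> * Z w))) =
     norm (iexp (\<theta> * Z w) * (iexp (h * Z w) - (1 + \<i> * of_real (h * Z w))))"
    unfolding e by (rule arg_cong[of _ _ norm]) (simp add: algebra_simps scaleR_conv_of_real)
   also have "\<dots> = norm (iexp (h * Z w) - (1 + \<i> * of_real (h * Z w)))"
    by (simp add: norm_mult)
   also have "\<dots> \<le> (h * Z w)\<^sup>2 / 2"
    using iexp_approx1[of "h * Z w" 1] by (simp add: numeral_2_eq_2)
   also have "\<dots> = h\<^sup>2 * \<bar>Z w\<bar>\<^sup>2 / 2" by (simp add: power_mult_distrib)
   also have "\<dots> \<le> h\<^sup>2 * B\<^sup>2 / 2"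
    by (intro divide_right_mono mult_left_mono power_mono Z) auto
   finally show "norm (iexp ((\<theta> + h) * Z w) - iexp (\<theta> * Z w) - h *\<^sub>R (\<i> * of_real (Z w) * iexp (\<theta> * Z w))) \<le> B\<^sup>2 / 2 * h\<^sup>2"
    by (simp add: mult.commute)
  qed (intro Bochner_integrable_diff i1 integrable_scaleR_right i2, simp)
  finally show ?thesis by (simp add: prob_space)
 qed
 show ?thesis
  unfolding has_vector_derivative_def has_derivative_at
 proof (intro conjI bounded_linear_scaleR_left)
  show "(\<lambda>h. norm (?\<phi> (\<theta> + h) - ?\<phi> \<theta> - h *\<^sub>R ?D) / norm h) \<midarrow>0\<rightarrow> 0"
  proof (rule tendsto_sandwich[OF _ _ tendsto_const])
   show "\<forall>\<^sub>F h in at 0. norm (?\<phi> (\<theta> + h) - ?\<phi> \<theta> - h *\<^sub>R ?D) / norm h \<le> B\<^sup>2 / 2 * \<bar>h\<bar>"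
    unfolding eventually_at
   proof (intro exI[of _ 1] conjI ballI impI)
    fix h :: real assume "h \<noteq> 0 \<and> dist h 0 < 1"
    then show "norm (?\<phi> (\<theta> + h) - ?\<phi> \<theta> - h *\<^sub>R ?D) / norm h \<le> B\<^sup>2 / 2 * \<bar>h\<bar>"
     using bound[of h] by (simp add: divide_le_eq power2_eq_square mult.assoc flip: abs_mult)
   qed simp
   show "(\<lambda>h. B\<^sup>2 / 2 * \<bar>h\<bar>) \<midarrow>0\<rightarrow> 0"
    by (rule tendsto_eq_intros refl | simp)+
  qed simp
 qed
qed

text \<open>Integrating factor: the product of \<phi> and exp(v s^2 / 2) has a derivative of norm at
  most \<epsilon> exp(v T^2 / 2), so it stays close to its value 1 at the origin.\<close>

lemma gaussian_ode_estimate: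
 fixes \<phi> \<phi>' :: "real \<Rightarrow> complex"
 assumes d: "\<And>t. \<bar>t\<bar> \<le> T \<Longrightarrow> (\<phi> has_vector_derivative \<phi>' t) (at t)"
  and e: "\<And>t. \<bar>t\<bar> \<le> T \<Longrightarrow> norm (\<phi>' t + of_real (v * t) * \<phi> t) \<le> \<epsilon>"
  and v: "0 \<le> v" and \<phi>0: "\<phi> 0 = 1" and t: "\<bar>t\<bar> \<le> T"
 shows "norm (\<phi> t * of_real (exp (v * t\<^sup>2 / 2)) - 1) \<le> \<epsilon> * exp (v * T\<^sup>2 / 2) * T"
proof -
 define F where "F s = \<phi> s * of_real (exp (v * s\<^sup>2 / 2))" for s
 define F' where "F' s = (\<phi>' s + of_real (v * s) * \<phi> s) * of_real (exp (v * s\<^sup>2 / 2))" for s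
 have T: "0 \<le> T" and \<epsilon>: "0 \<le> \<epsilon>" using t order_trans[OF norm_ge_zero e[OF t]] by auto
 have FD: "(F has_vector_derivative F' s) (at s within {-T..T})" if "s \<in> {-T..T}" for s
 proof -
  have "((\<lambda>s. exp (v * s\<^sup>2 / 2)) has_vector_derivative (v * s * exp (v * s\<^sup>2 / 2))) (at s)"
   by (auto intro!: derivative_eq_intros simp: has_real_derivative_iff_has_vector_derivative[symmetric])
  then have "((\<lambda>s. of_real (exp (v * s\<^sup>2 / 2)) :: complex) has_vector_derivative of_real (v * s * exp (v * s\<^sup>2 / 2))) (at s)"
   by (rule bounded_linear.has_vector_derivative[OF bounded_linear_of_real])
  then have "(F has_vector_derivative (\<phi> s * of_real (v * s * exp (v * s\<^sup>2 / 2)) + \<phi>' s * of_real (exp (v * s\<^sup>2 / 2)))) (at s)"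
   unfolding F_def[abs_def] using that by (intro has_vector_derivative_mult d) auto
  then show ?thesis
   unfolding F'_def by (rule has_vector_derivative_at_within[THEN has_vector_derivative_eq_rhs]) (simp add: algebra_simps)
 qed
 have "norm (F t - F 0) \<le> (\<epsilon> * exp (v * T\<^sup>2 / 2)) * norm (t - 0)"
 proof (rule differentiable_bound[of "{-T..T}" F "\<lambda>s h. h *\<^sub>R F' s"])
  show "(F has_derivative (\<lambda>h. h *\<^sub>R F' s)) (at s within {-T..T})" if "s \<in> {-T..T}" for s
   using FD[OF that] by (simp add: has_vector_derivative_def)
  show "onorm (\<lambda>h. h *\<^sub>R F' s) \<le> \<epsilon> * exp (v * T\<^sup>2 / 2)" if s: "s \<in> {-T..T}" for s
  proof (rule onorm_le)
   fix h :: real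
   have "s\<^sup>2 \<le> T\<^sup>2" using s by (intro power2_le_iff_abs_le[THEN iffD2]) auto
   then have "norm (F' s) \<le> \<epsilon> * exp (v * T\<^sup>2 / 2)"
    unfolding F'_def norm_mult using s v \<epsilon> by (intro mult_mono e) (auto intro!: mult_left_mono)
   then show "norm (h *\<^sub>R F' s) \<le> \<epsilon> * exp (v * T\<^sup>2 / 2) * norm h"
    by (simp add: mult.commute mult_left_mono)
  qed
 qed (use t T in auto)
 also have "\<dots> \<le> (\<epsilon> * exp (v * T\<^sup>2 / 2)) * T"
  using t \<epsilon> by (intro mult_left_mono) auto
 finally show ?thesis by (simp add: F_def \<phi>0)
qed

section \<open>Scaled windows and their covariogram\<close>

lemma emeasure_lborel_scaleR_vimage:
 fixes A :: "'a::euclidean_space set"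
 assumes [measurable]: "A \<in> sets borel" and c: "c > 0"
 shows "emeasure lborel {x. x /\<^sub>R c \<in> A} = ennreal (c ^ DIM('a)) * emeasure lborel A"
proof -
 have "emeasure lborel {x. x /\<^sub>R c \<in> A} =
   emeasure (density (distr lborel borel (\<lambda>x :: 'a. 0 + c *\<^sub>R x)) (\<lambda>_. ennreal (\<bar>c\<bar> ^ DIM('a)))) {x. x /\<^sub>R c \<in> A}"
  using lborel_affine[of c "0 :: 'a"] c by simp
 also have "\<dots> = (nLeb x. ennreal (c ^ DIM('a)) * indicator A x)"
  using c by (subst emeasure_density, measurable) (subst nn_integral_distr, auto intro!: nn_integral_cong split: split_indicator)
 finally show ?thesis by (simp add: nn_integral_cmult)
qed

lemma scaleR_image_eq_vimage:
 fixes A :: "'a::real_vector set"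
 assumes c: "c > 0"
 shows "(\<lambda>x. c *\<^sub>R x) ` A = {x. x /\<^sub>R c \<in> A}"
proof -
 have "x \<in> (\<lambda>x. c *\<^sub>R x) ` A" if "x /\<^sub>R c \<in> A" for x
  using that c by (intro image_eqI[of _ _ "x /\<^sub>R c"]) auto
 then show ?thesis using c by auto
qed

text \<open>Substituting s = t + w and exchanging the integrals leaves k integrated against the
  covariogram of B.\<close>

lemma nn_integral_double_window:
 fixes k :: "'a::euclidean_space \<Rightarrow> ennreal"
 assumes [measurable]: "k \<in> borel_measurable borel" "B \<in> sets borel"
 shows "(nLeb t. indicator B t * (nLeb s. indicator B s * k (s - t))) =
  (nLeb w. k w * emeasure lborel (B \<inter> {t. t + w \<in> B}))"
proof -
 have "(nLeb s. indicator B s * k (s - t)) = (nLeb w. indicator B (t + w) * k w)" for t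
 proof -
  have "(nLeb s. indicator B s * k (s - t)) = (\<integral>\<^sup>+s. indicator B s * k (s - t) \<partial>distr lborel borel ((+) t))"
   by (simp only: lborel_distr_plus)
  also have "\<dots> = (nLeb w. indicator B (t + w) * k w)"
   by (subst nn_integral_distr) auto
  finally show ?thesis .
 qed
 then have "(nLeb t. indicator B t * (nLeb s. indicator B s * k (s - t))) =
   (nLeb t. (nLeb w. indicator B t * (indicator B (t + w) * k w)))"
  by (simp add: nn_integral_cmult)
 also have "\<dots> = (nLeb w. (nLeb t. indicator B t * (indicator B (t + w) * k w)))"
  by (rule lborel_pair.Fubini') measurable
 also have "\<dots> = (nLeb w. k w * emeasure lborel (B \<inter> {t. t + w \<in> B}))"
 proof (rule nn_integral_cong)
  fix w
  have "(nLeb t. indicator B t * (indicator B (t + w) * k w)) = (nLeb t. k w * indicator (B \<inter> {t. t + w \<in> B}) t)"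
   by (intro nn_integral_cong) (auto split: split_indicator)
  also have "\<dots> = k w * emeasure lborel (B \<inter> {t. t + w \<in> B})"
   by (subst nn_integral_cmult_indicator) auto
  finally show "(nLeb t. indicator B t * (indicator B (t + w) * k w)) = k w * emeasure lborel (B \<inter> {t. t + w \<in> B})" .
 qed
 finally show ?thesis .
qed

text \<open>The covariogram of the scaled window at w is l^d times that of A at w / l. The latter is
  bounded by the measure of A and tends to it, so dominated convergence applies.\<close>

lemma scaled_window_limit:
 fixes k :: "'a::euclidean_space \<Rightarrow> real"
 assumes k: "integrable lborel k" and k0: "\<And>w. 0 \<le> k w"
  and A [measurable]: "A \<in> sets borel" and bdd: "bounded A"
 shows "((\<lambda>l. enn2real (nLeb w. k w * emeasure lborel ((\<lambda>x. l *\<^sub>R x) ` A \<inter> {t. t + w \<in> (\<lambda>x. l *\<^sub>R x) ` A})) / l ^ DIM('a))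
  \<longlongrightarrow> measure lborel A * (Leb w. k w)) at_top"
proof -
 define g where "g w = measure lborel (A \<inter> {x. x + w \<in> A})" for w
 have Afin: "emeasure lborel A < \<infinity>" by (rule emeasure_bounded_finite[OF bdd])
 have Ifin: "emeasure lborel (A \<inter> {x. x + w \<in> A}) < \<infinity>" for w
  by (rule le_less_trans[OF emeasure_mono Afin]) auto
 have [measurable]: "g \<in> borel_measurable borel"
 proof -
  have "g = (\<lambda>w. enn2real (nLeb x. indicator A x * indicator A (x + w)))"
  proof
   fix w
   have "emeasure lborel (A \<inter> {x. x + w \<in> A}) = (nLeb x. indicator (A \<inter> {x. x + w \<in> A}) x)"
    by simp
   also have "\<dots> = (nLeb x. indicator A x * indicator A (x + w))"
    by (intro nn_integral_cong) (auto split: split_indicator)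
   finally show "g w = enn2real (nLeb x. indicator A x * indicator A (x + w))"
    unfolding g_def measure_def by simp
  qed
  then show ?thesis by simp
 qed
 have g1: "0 \<le> g w" "g w \<le> measure lborel A" for w
  unfolding g_def using Afin by (auto intro!: measure_mono_fmeasurable simp: fmeasurable_def)
 have "((\<lambda>l. \<integral>w. k w * g (w /\<^sub>R l) \<partial>lborel) \<longlongrightarrow> (Leb w. k w * measure lborel A)) at_top"
 proof (rule integral_dominated_convergence_at_top[where w="\<lambda>w. k w * measure lborel A"])
  show "AE w in lborel. ((\<lambda>l. k w * g (w /\<^sub>R l)) \<longlongrightarrow> k w * measure lborel A) at_top"
  proof (intro AE_I2 tendsto_mult tendsto_const)
   fix w :: 'a
   have "((\<lambda>l. inverse l *\<^sub>R w) \<longlongrightarrow> 0 *\<^sub>R w) at_top"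
    by (intro tendsto_intros tendsto_inverse_0_at_top filterlim_ident)
   then have "filterlim (\<lambda>l. w /\<^sub>R l) (nhds 0) at_top" by simp
   from filterlim_compose[OF measure_lborel_Int_translate_tendsto[OF A bdd] this]
   show "((\<lambda>l. g (w /\<^sub>R l)) \<longlongrightarrow> measure lborel A) at_top"
    unfolding g_def .
  qed
  show "\<forall>\<^sub>F l in at_top. AE w in lborel. norm (k w * g (w /\<^sub>R l)) \<le> k w * measure lborel A"
   by (intro always_eventually allI AE_I2) (auto simp: abs_mult k0 g1 intro!: mult_left_mono)
 qed (use k in auto)
 then have "((\<lambda>l. \<integral>w. k w * g (w /\<^sub>R l) \<partial>lborel) \<longlongrightarrow> measure lborel A * (Leb w. k w)) at_top"
  by (simp add: mult.commute)
 then show ?thesis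
 proof (rule Lim_transform_eventually, intro eventually_mono[OF eventually_gt_at_top[of 0]])
  fix l :: real assume l: "0 < l"
  have e: "emeasure lborel ((\<lambda>x. l *\<^sub>R x) ` A \<inter> {t. t + w \<in> (\<lambda>x. l *\<^sub>R x) ` A}) = ennreal (l ^ DIM('a) * g (w /\<^sub>R l))" for w
  proof -
   have "(\<lambda>x. l *\<^sub>R x) ` A \<inter> {t. t + w \<in> (\<lambda>x. l *\<^sub>R x) ` A} = {x. x /\<^sub>R l \<in> A \<inter> {x. x + w /\<^sub>R l \<in> A}}"
    using l by (auto simp: scaleR_image_eq_vimage scaleR_add_right)
   then have "emeasure lborel ((\<lambda>x. l *\<^sub>R x) ` A \<inter> {t. t + w \<in> (\<lambda>x. l *\<^sub>R x) ` A}) =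
     ennreal (l ^ DIM('a)) * emeasure lborel (A \<inter> {x. x + w /\<^sub>R l \<in> A})"
    using emeasure_lborel_scaleR_vimage[of "A \<inter> {x. x + w /\<^sub>R l \<in> A}" l] l by simp
   also have "emeasure lborel (A \<inter> {x. x + w /\<^sub>R l \<in> A}) = ennreal (g (w /\<^sub>R l))"
    unfolding g_def by (rule emeasure_eq_ennreal_measure) (use Ifin[of "w /\<^sub>R l"] in simp)
   finally show ?thesis using l g1 by (simp add: ennreal_mult)
  qed
  have "(nLeb w. k w * emeasure lborel ((\<lambda>x. l *\<^sub>R x) ` A \<inter> {t. t + w \<in> (\<lambda>x. l *\<^sub>R x) ` A})) =
    (nLeb w. ennreal (l ^ DIM('a) * (k w * g (w /\<^sub>R l))))"
   unfolding e using l k0 g1 by (intro nn_integral_cong) (simp add: mult_ac flip: ennreal_mult)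
  then have "enn2real (nLeb w. k w * emeasure lborel ((\<lambda>x. l *\<^sub>R x) ` A \<inter> {t. t + w \<in> (\<lambda>x. l *\<^sub>R x) ` A})) =
    (Leb w. l ^ DIM('a) * (k w * g (w /\<^sub>R l)))"
   using l k0 g1 k by (subst integral_eq_nn_integral) auto
  then show "(Leb w. k w * g (w /\<^sub>R l)) =
    enn2real (nLeb w. k w * emeasure lborel ((\<lambda>x. l *\<^sub>R x) ` A \<inter> {t. t + w \<in> (\<lambda>x. l *\<^sub>R x) ` A})) / l ^ DIM('a)"
   using l by simp
 qed
qed

lemma (in poisson_cover_window) var_U_eq:
 "var_U = exp (- \<mu>) * enn2real (nLeb w. ennreal (exp (- (\<mu> - \<rho> w)) - exp (- \<mu>)) * emeasure lborel (B \<inter> {t. t + w \<in> B}))"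
proof -
 define k where "k w = exp (- (\<mu> - \<rho> w)) - exp (- \<mu>)" for w
 have k: "0 \<le> k w" "k w \<le> \<mu>" for w
  using cov_kernel_range[of w] rho_le_mu[of w] by (auto simp: k_def)
 have [measurable]: "k \<in> borel_measurable borel" unfolding k_def by measurable
 have ki: "integrable LB (\<lambda>s. k (s - t))" for t
  by (rule LB.integrable_const_bound[of _ \<mu>]) (use k in auto)
 have i0: "0 \<le> (IntB s. k (s - t))" for t by (intro integral_nonneg_AE AE_I2 k)
 have "(IntB t. (IntB s. k (s - t))) = enn2real (nIntB t. ennreal (IntB s. k (s - t)))"
  by (rule integral_eq_nn_integral) (auto simp: i0)
 also have "(nIntB t. ennreal (IntB s. k (s - t))) = (nIntB t. (nIntB s. k (s - t)))"
  by (intro nn_integral_cong nn_integral_eq_integral[symmetric] ki) (auto simp: k)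
 also have "\<dots> = (nLeb t. indicator B t * (nLeb s. indicator B s * ennreal (k (s - t))))"
  by (subst nn_integral_LB, measurable) (simp add: nn_integral_LB)
 also have "\<dots> = (nLeb w. k w * emeasure lborel (B \<inter> {t. t + w \<in> B}))"
  by (rule nn_integral_double_window) auto
 finally show ?thesis unfolding var_U_def k_def by simp
qed

text \<open>Takes the window as an argument, outside the locale that fixes one, so that limits over
  growing windows can be stated.\<close>

definition (in poisson_cover) uncovered :: "'a set \<Rightarrow> 'w \<Rightarrow> real" where
 "uncovered B w = measure lborel {s \<in> B. \<forall>j. e j w \<notin> C s}"

lemma (in poisson_cover_window) uncovered_eq:
 assumes "w \<in> space M"
 shows "uncovered B w = U S w"
proof -
 have [measurable]: "{s \<in> B. \<forall>j. e j w \<notin> C s} \<in> sets borel"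
  using assms by measurable
 have "U S w = (IntB s. indicator {s. \<forall>j. e j w \<notin> C s} s)"
  unfolding U_def S_Int_C void_def by (intro Bochner_integral_cong) auto
 also have "\<dots> = (Leb s. indicator B s * indicator {s. \<forall>j. e j w \<notin> C s} s)"
 proof -
  have "LB = density lborel (\<lambda>x. ennreal (indicator B x))" by (simp add: LB_def ennreal_indicator)
  moreover have "{s. \<forall>j. e j w \<notin> C s} \<in> sets borel" using assms by measurable
  ultimately show ?thesis by (subst (1) \<open>LB = _\<close>, subst integral_density) auto
 qed
 also have "\<dots> = (Leb s. indicator {s \<in> B. \<forall>j. e j w \<notin> C s} s)"
  by (intro Bochner_integral_cong) (auto split: split_indicator)
 finally show ?thesis by (simp add: uncovered_def)
qed

text \<open>The Stein estimate at the frequency \<eta> = t c supplies the differential inequality.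
  The window enters the bound through c^2 b and c^2 times the variance alone, and both stay bounded
  for c = l^(-d/2).\<close>

lemma (in poisson_cover_window) char_window_estimate:
 fixes c T K \<theta> :: real
 defines "\<phi> \<equiv> \<lambda>t. \<integral>z. iexp (t * (c * (U S z - exp (- \<mu>) * b))) \<partial>M"
 assumes rho: "integrable lborel \<rho>" and K: "K > 0" and c: "c > 0" and \<theta>: "\<bar>\<theta>\<bar> \<le> T"
 shows "norm (\<phi> \<theta> * of_real (exp (c\<^sup>2 * var_U * \<theta>\<^sup>2 / 2)) - 1) \<le>
  (c\<^sup>2 * b * (2 * T\<^sup>2 * c * (measure lborel (cball (0::'a) K))\<^sup>2 + 4 * T * (Leb w. \<rho> w * indicator {w. K < norm w} w)
   + 2 * T\<^sup>2 * c * (Leb w. \<rho> w)\<^sup>2)) * exp (c\<^sup>2 * var_U * T\<^sup>2 / 2) * T"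
proof -
 define Z where "Z z = c * (U S z - exp (- \<mu>) * b)" for z
 define v where "v = measure lborel (cball (0::'a) K)"
 define rK where "rK = (Leb w. \<rho> w * indicator {w. K < norm w} w)"
 define r where "r = (Leb w. \<rho> w)"
 have T: "0 \<le> T" using \<theta> by simp
 have rK0: "0 \<le> rK" unfolding rK_def by (intro integral_nonneg_AE AE_I2) (auto simp: rho_nonneg)
 have [measurable]: "Z \<in> borel_measurable M" unfolding Z_def by measurable
 have "exp (- \<mu>) * b \<le> 1 * b" using mu_nonneg b_nonneg by (intro mult_right_mono) auto
 then have UB: "\<bar>U S z - exp (- \<mu>) * b\<bar> \<le> b" for z
  using U_range[of S z] b_nonneg by (auto simp: abs_le_iff) (smt (verit) exp_gt_zero mult_nonneg_nonneg)
 have ZB: "\<bar>Z z\<bar> \<le> c * b" for z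
  using UB[of z] c by (simp add: Z_def abs_mult)
 have var0: "0 \<le> var_U"
  unfolding var_U_def by (intro mult_nonneg_nonneg integral_nonneg_AE AE_I2 cov_kernel_range) auto
 have \<phi>: "\<phi> = (\<lambda>t. \<integral>z. iexp (t * Z z) \<partial>M)" by (simp add: \<phi>_def Z_def)
 show ?thesis unfolding v_def[symmetric] rK_def[symmetric] r_def[symmetric]
 proof (rule gaussian_ode_estimate[OF _ _ _ _ \<theta>])
  show "(\<phi> has_vector_derivative (\<integral>z. \<i> * of_real (Z z) * iexp (t * Z z) \<partial>M)) (at t)" for t
   unfolding \<phi> by (rule char_bounded_has_vector_derivative[OF _ ZB]) measurable
  show "norm ((\<integral>z. \<i> * of_real (Z z) * iexp (t * Z z) \<partial>M) + of_real (c\<^sup>2 * var_U * t) * \<phi> t) \<le>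
    c\<^sup>2 * b * (2 * T\<^sup>2 * c * v\<^sup>2 + 4 * T * rK + 2 * T\<^sup>2 * c * r\<^sup>2)" if t: "\<bar>t\<bar> \<le> T" for t
  proof -
   define \<eta> where "\<eta> = t * c"
   define ph where "ph = iexp (- (\<eta> * (exp (- \<mu>) * b)))"
   define I where "I = (\<integral>z. of_real (U S z - exp (- \<mu>) * b) * iexp (\<eta> * U S z) \<partial>M)"
   have eZ: "iexp (t * Z z) = ph * iexp (\<eta> * U S z)" for z
   proof -
    have "t * Z z = - (\<eta> * (exp (- \<mu>) * b)) + \<eta> * U S z" by (simp add: Z_def \<eta>_def algebra_simps)
    then show ?thesis unfolding ph_def by (simp only: of_real_add distrib_left exp_add)
   qed
   have 1: "\<phi> t = ph * char_U \<eta> S" unfolding \<phi> char_U_def eZ by simp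
   have 2: "(\<integral>z. \<i> * of_real (Z z) * iexp (t * Z z) \<partial>M) = \<i> * of_real c * ph * I"
   proof -
    have "\<i> * of_real (Z z) * iexp (t * Z z) = \<i> * of_real c * ph * (of_real (U S z - exp (- \<mu>) * b) * iexp (\<eta> * U S z))" for z
     unfolding eZ by (simp add: Z_def algebra_simps)
    then show ?thesis unfolding I_def by (simp only: integral_mult_right_zero)
   qed
   have "(\<integral>z. \<i> * of_real (Z z) * iexp (t * Z z) \<partial>M) + of_real (c\<^sup>2 * var_U * t) * \<phi> t =
     \<i> * of_real c * ph * (I - \<i> * of_real \<eta> * of_real var_U * char_U \<eta> S)"
    unfolding 1 2 by (simp add: \<eta>_def algebra_simps power2_eq_square)
   then have "norm ((\<integral>z. \<i> * of_real (Z z) * iexp (t * Z z) \<partial>M) + of_real (c\<^sup>2 * var_U * t) * \<phi> t) =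
     c * norm (I - \<i> * of_real \<eta> * of_real var_U * char_U \<eta> S)"
    using c by (simp add: norm_mult ph_def)
   also have "\<dots> \<le> c * (b * (2 * \<eta>\<^sup>2 * v\<^sup>2 + 4 * \<bar>\<eta>\<bar> * rK + 2 * \<eta>\<^sup>2 * r\<^sup>2))"
    using stein_estimate[OF rho K, of \<eta>] c unfolding I_def v_def rK_def r_def by (intro mult_left_mono) auto
   also have "\<dots> = c\<^sup>2 * b * (2 * \<bar>t\<bar>\<^sup>2 * c * v\<^sup>2 + 4 * \<bar>t\<bar> * rK + 2 * \<bar>t\<bar>\<^sup>2 * c * r\<^sup>2)"
    using c by (simp add: \<eta>_def abs_mult power_mult_distrib power2_eq_square algebra_simps)
   also have "\<dots> \<le> c\<^sup>2 * b * (2 * T\<^sup>2 * c * v\<^sup>2 + 4 * T * rK + 2 * T\<^sup>2 * c * r\<^sup>2)"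
    using t c b_nonneg rK0 by (intro mult_left_mono add_mono mult_right_mono power_mono) auto
   finally show ?thesis .
  qed
 qed (use var0 c in \<open>auto simp: \<phi> prob_space\<close>)
qed

context poisson_cover
begin

text \<open>Two successive limits. For c = l^(-d/2) the product c^2 b is the measure of A; terms
  with a further factor c vanish as l grows, while the term with the tail of \<rho> is made small by
  choosing K beforehand. The factor exp(vl \<theta>^2 / 2) is divided out at the end.\<close>

lemma gaussian_limit:
 fixes A :: "'a set"
 assumes rho: "integrable lborel \<rho>" and A [measurable]: "A \<in> sets borel" and bdd: "bounded A"
 shows "((\<lambda>l. \<integral>z. iexp (\<theta> * (l powr (- (DIM('a) / 2)) *
    (uncovered ((\<lambda>x. l *\<^sub>R x) ` A) z - exp (- \<mu>) * (l ^ DIM('a) * measure lborel A)))) \<partial>M)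
   \<longlongrightarrow> of_real (exp (- (exp (- \<mu>) * (measure lborel A * (Leb w. exp (- (\<mu> - \<rho> w)) - exp (- \<mu>))) * \<theta>\<^sup>2 / 2)))) at_top"
proof -
 let ?d = "DIM('a)"
 define k where "k w = exp (- (\<mu> - \<rho> w)) - exp (- \<mu>)" for w
 define a where "a = measure lborel A"
 define v0 where "v0 = exp (- \<mu>) * (a * (Leb w. k w))"
 define B where "B l = (\<lambda>x. l *\<^sub>R x) ` A" for l
 define vl where "vl l = exp (- \<mu>) * (enn2real (nLeb w. ennreal (k w) * emeasure lborel (B l \<inter> {t. t + w \<in> B l})) / l ^ ?d)" for l
 define c where "c l = l powr (- (?d / 2))" for l :: real
 define T where "T = \<bar>\<theta>\<bar>"
 define rK where "rK K = (Leb w. \<rho> w * indicator {w. K < norm w} w)" for K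
 define r where "r = (Leb w. \<rho> w)"
 define v where "v K = measure lborel (cball (0::'a) K)" for K
 define \<phi> where "\<phi> l = (Mean z. iexp (\<theta> * (c l * (uncovered (B l) z - exp (- \<mu>) * (l ^ ?d * a)))))" for l
 have kr: "0 \<le> k w" "k w \<le> \<rho> w" for w
  using exp_diff_le[OF rho_nonneg rho_le_mu] by (auto simp: k_def)
 have [measurable]: "k \<in> borel_measurable borel" unfolding k_def by measurable
 have ki: "integrable lborel k"
  by (rule Bochner_integrable_bound[OF rho]) (use kr rho_nonneg in auto)
 have vlim: "(vl \<longlongrightarrow> v0) at_top"
  unfolding vl_def[abs_def] v0_def a_def B_def
  by (intro tendsto_mult tendsto_const scaled_window_limit[OF ki kr(1) A bdd])
 have c2: "(c l)\<^sup>2 = 1 / l ^ ?d" if "l > 0" for l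
  using that by (simp add: c_def power2_eq_square powr_minus powr_realpow field_simps flip: powr_add)
 have clim: "(c \<longlongrightarrow> 0) at_top"
  unfolding c_def by (intro tendsto_neg_powr filterlim_ident) simp
 have rKlim: "(rK \<longlongrightarrow> 0) at_top"
 proof -
  have "((\<lambda>K. \<integral>w. \<rho> w * indicator {w. K < norm w} w \<partial>lborel) \<longlongrightarrow> (\<integral>w. 0 \<partial>(lborel :: 'a measure))) at_top"
  proof (rule integral_dominated_convergence_at_top[where w=\<rho>])
   show "AE w in lborel. ((\<lambda>K. \<rho> w * indicator {w. K < norm w} w) \<longlongrightarrow> 0) at_top"
   proof (rule AE_I2)
    fix w :: 'a
    show "((\<lambda>K. \<rho> w * indicator {w. K < norm w} w) \<longlongrightarrow> 0) at_top"
     by (intro tendsto_eventually eventually_mono[OF eventually_gt_at_top[of "norm w"]]) auto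
   qed
  qed (use rho rho_nonneg in \<open>auto split: split_indicator\<close>)
  then show ?thesis by (simp add: rK_def[abs_def])
 qed
 have bound: "norm (\<phi> l * of_real (exp (vl l * \<theta>\<^sup>2 / 2)) - 1) \<le>
   (a * (2 * T\<^sup>2 * c l * (v K)\<^sup>2 + 4 * T * rK K + 2 * T\<^sup>2 * c l * r\<^sup>2)) * exp (vl l * T\<^sup>2 / 2) * T"
  if l: "l > 0" and K: "K > 0" for l K
 proof -
  have Bm: "B l = {x. x /\<^sub>R l \<in> A}" unfolding B_def by (rule scaleR_image_eq_vimage[OF l])
  have Be: "emeasure lborel (B l) = ennreal (l ^ ?d) * emeasure lborel A"
   unfolding Bm by (rule emeasure_lborel_scaleR_vimage[OF A l])
  interpret W: poisson_cover_window M m e C \<mu> \<rho> "B l"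
  proof
   show "B l \<in> sets borel" unfolding Bm by measurable
   show "emeasure lborel (B l) < \<infinity>"
    unfolding Be using emeasure_bounded_finite[OF bdd] by (simp add: ennreal_mult_less_top)
  qed
  have b: "W.b = l ^ ?d * a"
   unfolding W.b_def a_def measure_def Be using l by (simp add: enn2real_mult)
  have c2v: "(c l)\<^sup>2 * W.var_U = vl l" "(c l)\<^sup>2 * W.b = a"
   unfolding W.var_U_eq vl_def k_def c2[OF l] b using l by simp_all
  have "\<phi> l = (Mean z. iexp (\<theta> * (c l * (W.U (space m) z - exp (- \<mu>) * W.b))))"
   unfolding \<phi>_def b by (intro Bochner_integral_cong) (simp_all add: W.uncovered_eq)
  moreover have "c l > 0" using l by (simp add: c_def)
  ultimately show ?thesis
   using W.char_window_estimate[OF rho K, of "c l" \<theta> T]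
   unfolding c2v v_def rK_def r_def by (simp add: T_def)
 qed
 have "((\<lambda>l. \<phi> l * of_real (exp (vl l * \<theta>\<^sup>2 / 2))) \<longlongrightarrow> 1) at_top"
 proof (rule tendstoI)
  fix \<epsilon> :: real assume \<epsilon>: "\<epsilon> > 0"
  have "((\<lambda>K. (a * (4 * T * rK K)) * exp (v0 * T\<^sup>2 / 2) * T) \<longlongrightarrow> (a * (4 * T * 0)) * exp (v0 * T\<^sup>2 / 2) * T) at_top"
   by (intro tendsto_intros rKlim)
  then have "\<forall>\<^sub>F K in at_top. (a * (4 * T * rK K)) * exp (v0 * T\<^sup>2 / 2) * T < \<epsilon>"
   using \<epsilon> by (intro order_tendstoD) auto
  then have "\<forall>\<^sub>F K in at_top. K > 0 \<and> (a * (4 * T * rK K)) * exp (v0 * T\<^sup>2 / 2) * T < \<epsilon>"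
   using eventually_gt_at_top[of 0] by eventually_elim auto
  then obtain K where K: "K > 0" "(a * (4 * T * rK K)) * exp (v0 * T\<^sup>2 / 2) * T < \<epsilon>"
   using eventually_happens'[OF trivial_limit_at_top_linorder] by blast
  have "((\<lambda>l. (a * (2 * T\<^sup>2 * c l * (v K)\<^sup>2 + 4 * T * rK K + 2 * T\<^sup>2 * c l * r\<^sup>2)) * exp (vl l * T\<^sup>2 / 2) * T)
    \<longlongrightarrow> (a * (2 * T\<^sup>2 * 0 * (v K)\<^sup>2 + 4 * T * rK K + 2 * T\<^sup>2 * 0 * r\<^sup>2)) * exp (v0 * T\<^sup>2 / 2) * T) at_top"
   by (intro tendsto_intros clim vlim) auto
  then have "\<forall>\<^sub>F l in at_top. (a * (2 * T\<^sup>2 * c l * (v K)\<^sup>2 + 4 * T * rK K + 2 * T\<^sup>2 * c l * r\<^sup>2)) * exp (vl l * T\<^sup>2 / 2) * T < \<epsilon>"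
   by (rule order_tendstoD) (use K in simp)
  then show "\<forall>\<^sub>F l in at_top. dist (\<phi> l * of_real (exp (vl l * \<theta>\<^sup>2 / 2))) 1 < \<epsilon>"
   using eventually_gt_at_top[of 0]
  proof eventually_elim
   case (elim l)
   then show ?case using le_less_trans[OF bound[OF elim(2) K(1)] elim(1)] by (simp only: dist_norm)
  qed
 qed
 moreover have "((\<lambda>l. of_real (exp (- (vl l * \<theta>\<^sup>2 / 2))) :: complex) \<longlongrightarrow> of_real (exp (- (v0 * \<theta>\<^sup>2 / 2)))) at_top"
  by (intro tendsto_intros vlim) auto
 ultimately have "((\<lambda>l. \<phi> l * of_real (exp (vl l * \<theta>\<^sup>2 / 2)) * of_real (exp (- (vl l * \<theta>\<^sup>2 / 2))))
   \<longlongrightarrow> 1 * of_real (exp (- (v0 * \<theta>\<^sup>2 / 2)))) at_top"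
  by (rule tendsto_mult)
 moreover have "\<phi> l * of_real (exp (vl l * \<theta>\<^sup>2 / 2)) * of_real (exp (- (vl l * \<theta>\<^sup>2 / 2))) = \<phi> l" for l
  by (simp add: exp_minus mult.assoc flip: of_real_mult)
 ultimately have "(\<phi> \<longlongrightarrow> of_real (exp (- (v0 * \<theta>\<^sup>2 / 2)))) at_top"
  by (simp only: mult_1_left)
 then show ?thesis
  unfolding \<phi>_def[abs_def] c_def B_def v0_def a_def k_def .
qed

end

subsection \<open>Comparison of the uncovered volume with the shot noise\<close>


lemma suminf_indicator_finite:
 fixes x :: "nat \<Rightarrow> 'x"
 assumes "(\<Sum>j. indicator B (x j) :: ennreal) \<noteq> \<infinity>"
 shows "finite {j. x j \<in> B}" "(\<Sum>j. indicator B (x j) :: ennreal) = of_nat (card {j. x j \<in> B})"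
proof -
 let ?J = "{j. x j \<in> B}"
 have "(\<Sum>j. indicator B (x j) :: ennreal) = (\<integral>\<^sup>+j. indicator ?J j \<partial>count_space UNIV)"
  by (subst nn_integral_count_space_nat) (auto intro!: suminf_cong simp: indicator_def)
 also have "\<dots> = emeasure (count_space UNIV) ?J" by simp
 finally have e: "(\<Sum>j. indicator B (x j) :: ennreal) = emeasure (count_space UNIV) ?J" .
 show fin: "finite ?J" by (rule ccontr) (use e assms in simp)
 show "(\<Sum>j. indicator B (x j) :: ennreal) = of_nat (card ?J)"
  using fin e by (simp add: emeasure_count_space_finite)
qed

section \<open>Avoidance after independent thinning\<close>

context poisson_cover
begin

text \<open>The conditional probability that no grain over t survives if every grain is kept with
  probability \<epsilon>. At \<epsilon> = 1 it is the avoidance indicator, and its derivative at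
  \<epsilon> = 0 is minus the number of grains over t, so it interpolates between the uncovered
  volume and the shot noise.\<close>

definition thin :: "real \<Rightarrow> 'a \<Rightarrow> 'w \<Rightarrow> real" where
 "thin \<epsilon> t w = lim (\<lambda>n. \<Prod>j<n. 1 - \<epsilon> * indicator (C t) (e j w))"

lemma thin_factor:
 fixes \<epsilon> :: real
 assumes "0 \<le> \<epsilon>" "\<epsilon> \<le> 1"
 shows "0 \<le> 1 - \<epsilon> * indicator A x" "1 - \<epsilon> * indicator A x \<le> 1"
 using assms by (auto split: split_indicator)

lemma thin_tendsto:
 assumes "0 \<le> \<epsilon>" "\<epsilon> \<le> 1"
 shows "(\<lambda>n. \<Prod>j<n. 1 - \<epsilon> * indicator (C t) (e j w)) \<longlonglongrightarrow> thin \<epsilon> t w"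
proof -
 let ?p = "\<lambda>n. \<Prod>j<n. 1 - \<epsilon> * indicator (C t) (e j w)"
 have p0: "0 \<le> ?p n" for n by (intro prod_nonneg thin_factor assms)
 have "decseq ?p"
  by (intro decseq_SucI) (simp only: prod.lessThan_Suc, intro mult_left_le thin_factor assms p0)
 then obtain L where "?p \<longlonglongrightarrow> L"
  using p0 by (elim decseq_convergent[of ?p 0]) auto
 then have "convergent ?p" by (rule convergentI)
 then show ?thesis unfolding thin_def by (simp add: convergent_LIMSEQ_iff)
qed

lemma thin_range:
 assumes "0 \<le> \<epsilon>" "\<epsilon> \<le> 1"
 shows "0 \<le> thin \<epsilon> t w" "thin \<epsilon> t w \<le> 1"
 using LIMSEQ_le_const[OF thin_tendsto[OF assms, of t w], of 0] LIMSEQ_le_const2[OF thin_tendsto[OF assms, of t w], of 1]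
  thin_factor[OF assms] by (force intro!: prod_nonneg prod_le_1)+

lemma thin_zero: "thin 0 t w = 1"
 using thin_tendsto[of 0 t w] by (simp add: LIMSEQ_const_iff)

lemma thin_one: "thin 1 t w = void (C t) w"
proof (cases "\<forall>j. e j w \<notin> C t")
 case True
 then show ?thesis using thin_tendsto[of 1 t w] by (simp add: void_def LIMSEQ_const_iff)
next
 case False
 then obtain i where "e i w \<in> C t" by auto
 then have "(\<Prod>j<n. 1 - indicator (C t) (e j w)) = (0 :: real)" if "n > i" for n
  using that by (intro prod_zero) (auto intro!: bexI[of _ i])
 then have "(\<lambda>n. \<Prod>j<n. 1 - indicator (C t) (e j w) :: real) \<longlonglongrightarrow> 0"
  by (intro tendsto_eventually eventually_sequentiallyI[of "Suc i"]) auto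
 then show ?thesis using False LIMSEQ_unique[OF thin_tendsto[of 1 t w]] by (simp add: void_def)
qed

lemma thin_finite:
 assumes "0 \<le> \<epsilon>" "\<epsilon> \<le> 1" and fin: "finite {j. e j w \<in> C t}"
 shows "thin \<epsilon> t w = (1 - \<epsilon>) ^ card {j. e j w \<in> C t}"
proof -
 let ?J = "{j. e j w \<in> C t}"
 obtain N where N: "\<forall>j\<in>?J. j < N" using fin finite_nat_set_iff_bounded by blast
 have "(\<Prod>j<n. 1 - \<epsilon> * indicator (C t) (e j w)) = (1 - \<epsilon>) ^ card ?J" if "n \<ge> N" for n
 proof -
  have "(\<Prod>j<n. 1 - \<epsilon> * indicator (C t) (e j w)) = (\<Prod>j\<in>?J. 1 - \<epsilon> * indicator (C t) (e j w))"
   using N that by (intro prod.mono_neutral_right) auto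
  also have "\<dots> = (1 - \<epsilon>) ^ card ?J" by simp
  finally show ?thesis .
 qed
 then have "(\<lambda>n. \<Prod>j<n. 1 - \<epsilon> * indicator (C t) (e j w)) \<longlonglongrightarrow> (1 - \<epsilon>) ^ card ?J"
  by (intro tendsto_eventually eventually_sequentiallyI[of N]) auto
 then show ?thesis using LIMSEQ_unique[OF thin_tendsto[OF assms(1,2)]] by blast
qed

lemma thin_meas [measurable (raw)]:
 assumes [measurable]: "f \<in> borel_measurable N" "g \<in> measurable N M"
 shows "(\<lambda>x. thin \<epsilon> (f x) (g x)) \<in> borel_measurable N"
 unfolding thin_def by measurable

text \<open>The generating functional is applied to the product of the two thinning factors;
  subtracting 1 leaves a combination of the indicators of C t, C s and their intersection, whose
  masses are known.\<close>

lemma thin_moment: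
 assumes \<epsilon>: "0 \<le> \<epsilon>" "\<epsilon> \<le> 1" and \<delta>: "0 \<le> \<delta>" "\<delta> \<le> 1"
 shows "(Mean z. thin \<epsilon> t z * thin \<delta> s z) = exp (- (\<epsilon> * \<mu>) - \<delta> * \<mu> + \<epsilon> * \<delta> * \<rho> (s - t))"
proof -
 define h where "h x = (1 - \<epsilon> * indicator (C t) x) * (1 - \<delta> * indicator (C s) x)" for x
 have h01: "0 \<le> h x" "h x \<le> 1" for x
  unfolding h_def by (intro mult_nonneg_nonneg mult_le_one thin_factor \<epsilon> \<delta>)+
 have [measurable]: "h \<in> borel_measurable m" unfolding h_def by measurable
 have fC: "emeasure m (C t) < \<infinity>" "emeasure m (C s) < \<infinity>" "emeasure m (C t \<inter> C s) < \<infinity>"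
  by (simp_all add: emeasure_C emeasure_C_Int)
 have "has_bochner_integral m (\<lambda>x. - (\<epsilon> * indicator (C t) x) - \<delta> * indicator (C s) x + \<epsilon> * \<delta> * indicator (C t \<inter> C s) x)
   (- (\<epsilon> * measure m (C t)) - \<delta> * measure m (C s) + \<epsilon> * \<delta> * measure m (C t \<inter> C s))"
  using fC by (intro has_bochner_integral_add has_bochner_integral_diff has_bochner_integral_minus
    has_bochner_integral_mult_right has_bochner_integral_real_indicator) auto
 moreover have "(\<lambda>x. - (\<epsilon> * indicator (C t) x) - \<delta> * indicator (C s) x + \<epsilon> * \<delta> * indicator (C t \<inter> C s) x) = (\<lambda>x. h x - 1)"
  by (auto simp: h_def fun_eq_iff algebra_simps split: split_indicator)
 ultimately have hb: "has_bochner_integral m (\<lambda>x. h x - 1) (- (\<epsilon> * \<mu>) - \<delta> * \<mu> + \<epsilon> * \<delta> * \<rho> (s - t))"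
  by (simp add: measure_C measure_C_Int rho_minus)
 then have hc: "has_bochner_integral m (\<lambda>x. of_real (h x) - (1 :: complex)) (of_real (- (\<epsilon> * \<mu>) - \<delta> * \<mu> + \<epsilon> * \<delta> * \<rho> (s - t)))"
  using has_bochner_integral_of_real[OF hb, where 'a=complex] by (simp only: of_real_diff of_real_1)
 have "(\<lambda>n. \<integral>z. (\<Prod>j<n. of_real (h (e j z)) :: complex) \<partial>M) \<longlonglongrightarrow> exp (\<integral>x. of_real (h x) - 1 \<partial>m)"
  by (rule generating_functional) (use h01 hc in \<open>auto simp: has_bochner_integral_iff\<close>)
 also have "(\<lambda>n. \<integral>z. (\<Prod>j<n. of_real (h (e j z)) :: complex) \<partial>M) = (\<lambda>n. of_real (Mean z. (\<Prod>j<n. h (e j z))))"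
  by (simp flip: of_real_prod)
 also have "exp (\<integral>x. of_real (h x) - 1 \<partial>m) = (of_real (exp (- (\<epsilon> * \<mu>) - \<delta> * \<mu> + \<epsilon> * \<delta> * \<rho> (s - t))) :: complex)"
  using hc by (simp only: has_bochner_integral_iff exp_of_real)
 finally have l1: "(\<lambda>n. \<integral>z. (\<Prod>j<n. h (e j z)) \<partial>M) \<longlonglongrightarrow> exp (- (\<epsilon> * \<mu>) - \<delta> * \<mu> + \<epsilon> * \<delta> * \<rho> (s - t))"
  by (simp only: tendsto_of_real_iff)
 have l2: "(\<lambda>n. \<integral>z. (\<Prod>j<n. h (e j z)) \<partial>M) \<longlonglongrightarrow> (Mean z. thin \<epsilon> t z * thin \<delta> s z)"
 proof (rule integral_dominated_convergence[where w="\<lambda>_. 1"])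
  show "AE z in M. (\<lambda>n. \<Prod>j<n. h (e j z)) \<longlonglongrightarrow> thin \<epsilon> t z * thin \<delta> s z"
   unfolding h_def prod.distrib by (intro AE_I2 tendsto_mult thin_tendsto \<epsilon> \<delta>)
  show "AE z in M. norm (\<Prod>j<n. h (e j z)) \<le> 1" for n
   using h01 by (intro AE_I2) (auto simp: abs_prod intro!: prod_le_1)
 qed auto
 show ?thesis by (rule LIMSEQ_unique[OF l2 l1])
qed

text \<open>Division by the mean exp(- \<epsilon> \<mu>) before centring gives covariances the
  closed form exp(\<epsilon> \<delta> \<rho>) - 1.\<close>

definition thin_centred :: "real \<Rightarrow> 'a \<Rightarrow> 'w \<Rightarrow> real" where
 "thin_centred \<epsilon> t w = exp (\<epsilon> * \<mu>) * thin \<epsilon> t w - 1"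

lemma thin_centred_moment:
 assumes \<epsilon>: "0 \<le> \<epsilon>" "\<epsilon> \<le> 1" and \<delta>: "0 \<le> \<delta>" "\<delta> \<le> 1"
 shows "(Mean w. thin_centred \<epsilon> t w * thin_centred \<delta> s w) = exp (\<epsilon> * \<delta> * \<rho> (s - t)) - 1"
  and "integrable M (\<lambda>w. thin_centred \<epsilon> t w * thin_centred \<delta> s w)"
proof -
 have i: "integrable M (\<lambda>w. thin \<epsilon>' t' w * thin \<delta>' s' w)"
  if "0 \<le> \<epsilon>'" "\<epsilon>' \<le> 1" "0 \<le> \<delta>'" "\<delta>' \<le> 1" for \<epsilon>' \<delta>' t' s'
  using thin_range[of \<epsilon>'] thin_range[of \<delta>'] that
  by (intro integrable_const_bound[of _ 1]) (auto simp: abs_mult intro!: mult_le_one)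
 have one: "(Mean w. thin \<epsilon>' t' w) = exp (- (\<epsilon>' * \<mu>))" "integrable M (thin \<epsilon>' t')"
  if "0 \<le> \<epsilon>'" "\<epsilon>' \<le> 1" for \<epsilon>' t'
  using thin_moment[OF that, of 0 t' t'] i[OF that, of 0 t' t'] by (simp_all add: thin_zero)
 have eq: "thin_centred \<epsilon> t w * thin_centred \<delta> s w = exp (\<epsilon> * \<mu>) * exp (\<delta> * \<mu>) * (thin \<epsilon> t w * thin \<delta> s w)
   - exp (\<epsilon> * \<mu>) * thin \<epsilon> t w - exp (\<delta> * \<mu>) * thin \<delta> s w + 1" for w
  by (simp add: thin_centred_def algebra_simps)
 show "integrable M (\<lambda>w. thin_centred \<epsilon> t w * thin_centred \<delta> s w)"
  unfolding eq using i[OF \<epsilon> \<delta>] one(2)[OF \<epsilon>] one(2)[OF \<delta>]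
  by (intro Bochner_Integration.integrable_add Bochner_integrable_diff integrable_mult_right) auto
 have "(Mean w. thin_centred \<epsilon> t w * thin_centred \<delta> s w) =
   exp (\<epsilon> * \<mu>) * exp (\<delta> * \<mu>) * exp (- (\<epsilon> * \<mu>) - \<delta> * \<mu> + \<epsilon> * \<delta> * \<rho> (s - t))
   - exp (\<epsilon> * \<mu>) * exp (- (\<epsilon> * \<mu>)) - exp (\<delta> * \<mu>) * exp (- (\<delta> * \<mu>)) + 1"
  unfolding eq using i[OF \<epsilon> \<delta>, of t s] one[OF \<epsilon>, of t] one[OF \<delta>, of s] thin_moment[OF \<epsilon> \<delta>, of t s]
  by (simp add: prob_space)
 also have "\<dots> = exp (\<epsilon> * \<delta> * \<rho> (s - t)) - 1"
  by (simp flip: exp_add)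
 finally show "(Mean w. thin_centred \<epsilon> t w * thin_centred \<delta> s w) = exp (\<epsilon> * \<delta> * \<rho> (s - t)) - 1" .
qed

end

lemma exp_quadratic_remainder:
 fixes x :: real
 assumes "0 \<le> x"
 shows "exp x - 1 - x \<le> x\<^sup>2 * exp x / 2"
proof -
 obtain t where t: "\<bar>t\<bar> \<le> \<bar>x\<bar>" "exp x = (\<Sum>m<2. x ^ m / fact m) + exp t / fact 2 * x ^ 2"
  using Maclaurin_exp_le[of x 2] by blast
 have "t \<le> x" using t(1) assms by simp
 then have "exp t \<le> exp x" by simp
 then have "exp t / fact 2 * x ^ 2 \<le> x\<^sup>2 * exp x / 2"
  by (simp add: fact_numeral mult_right_mono mult.commute)
 then show ?thesis using t(2) by (simp add: numeral_2_eq_2)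
qed

text \<open>The left side is the covariance, at two points with \<rho> = r, of the centred avoidance
  functional minus 1 / \<epsilon> times the thinned one. Its first order terms r - 2 r + r
  cancel.\<close>

lemma thinning_covariance_bound:
 fixes r :: real
 assumes r: "0 \<le> r" and \<epsilon>: "0 < \<epsilon>" "\<epsilon> \<le> 1"
 shows "(exp r - 1) - 2 * (exp (\<epsilon> * r) - 1) / \<epsilon> + (exp (\<epsilon> * \<epsilon> * r) - 1) / (\<epsilon> * \<epsilon>) \<le> r\<^sup>2 * exp r"
proof -
 have 1: "exp r - 1 \<le> r + r\<^sup>2 * exp r / 2" using exp_quadratic_remainder[OF r] by simp
 have "r * \<epsilon> \<le> exp (\<epsilon> * r) - 1" using exp_ge_add_one_self[of "\<epsilon> * r"] by (subst mult.commute) linarith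
 then have "r \<le> (exp (\<epsilon> * r) - 1) / \<epsilon>"
  by (subst pos_le_divide_eq) (use \<epsilon> in auto)
 then have 2: "2 * r \<le> 2 * (exp (\<epsilon> * r) - 1) / \<epsilon>"
  by (simp only: times_divide_eq_right[symmetric])
 have e2: "\<epsilon> * \<epsilon> \<le> 1" using \<epsilon> by (simp add: mult_le_one)
 have "exp (\<epsilon> * \<epsilon> * r) - 1 \<le> \<epsilon> * \<epsilon> * r + (\<epsilon> * \<epsilon> * r)\<^sup>2 * exp (\<epsilon> * \<epsilon> * r) / 2"
  using exp_quadratic_remainder[of "\<epsilon> * \<epsilon> * r"] r \<epsilon> by simp
 also have "\<dots> \<le> \<epsilon> * \<epsilon> * r + (\<epsilon> * \<epsilon>) * (r\<^sup>2 * exp r / 2)"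
 proof -
  have "(\<epsilon> * \<epsilon> * r)\<^sup>2 * exp (\<epsilon> * \<epsilon> * r) / 2 = (\<epsilon> * \<epsilon>) * ((\<epsilon> * \<epsilon>) * r\<^sup>2 * exp (\<epsilon> * \<epsilon> * r) / 2)"
   by (simp add: power2_eq_square)
  also have "\<dots> \<le> (\<epsilon> * \<epsilon>) * (1 * r\<^sup>2 * exp r / 2)"
   using e2 r \<epsilon> by (intro mult_left_mono divide_right_mono mult_mono) (auto simp: mult_left_le_one_le)
  finally show ?thesis by simp
 qed
 finally have "(exp (\<epsilon> * \<epsilon> * r) - 1) / (\<epsilon> * \<epsilon>) \<le> r + r\<^sup>2 * exp r / 2"
  using \<epsilon> by (simp add: divide_le_eq algebra_simps)
 then show ?thesis using 1 2 by simp
qed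

text \<open>The difference quotient at 0 of exp(h \<mu>) (1 - h)^n along h = 1 / Suc k.\<close>

lemma thinning_derivative:
 fixes \<mu> :: real
 shows "(\<lambda>k. real (Suc k) * (exp (\<mu> / Suc k) * (1 - 1 / real (Suc k)) ^ n - 1)) \<longlonglongrightarrow> \<mu> - real n"
proof -
 have "((\<lambda>x. exp (x * \<mu>) * (1 - x) ^ n) has_real_derivative (\<mu> - real n)) (at 0)"
  by (auto intro!: derivative_eq_intros)
 then have "((\<lambda>h. (exp (h * \<mu>) * (1 - h) ^ n - 1) / h) \<longlongrightarrow> \<mu> - real n) (at 0)"
  by (simp add: DERIV_def)
 moreover have "filterlim (\<lambda>k. 1 / real (Suc k)) (at 0) sequentially"
  by (intro filterlim_atI LIMSEQ_Suc[OF lim_1_over_n]) simp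
 ultimately have "(\<lambda>k. (exp (1 / real (Suc k) * \<mu>) * (1 - 1 / real (Suc k)) ^ n - 1) / (1 / real (Suc k))) \<longlonglongrightarrow> \<mu> - real n"
  by (rule filterlim_compose)
 then show ?thesis by (simp add: mult.commute)
qed

section \<open>Second moment of the residual\<close>

context poisson_cover_window
begin

definition shot :: "'e \<Rightarrow> real" where
 "shot x = measure LB {t. x \<in> C t}"

lemma sets_shot: "x \<in> S \<Longrightarrow> {t. x \<in> C t} \<in> sets borel"
 by measurable

lemma shot_meas [measurable]: "shot \<in> borel_measurable m"
proof -
 have "(\<lambda>x. enn2real (nIntB t. indicator {p. snd p \<in> C (fst p)} (t, x))) \<in> borel_measurable m"
  by measurable
 moreover have "shot x = enn2real (nIntB t. indicator {p. snd p \<in> C (fst p)} (t, x))" if "x \<in> space m" for x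
 proof -
  have "(nIntB t. indicator {p. snd p \<in> C (fst p)} (t, x)) = (nIntB t. indicator {t. x \<in> C t} t)"
   by (intro nn_integral_cong) (auto split: split_indicator)
  then show ?thesis unfolding shot_def measure_def using sets_shot[OF that] by simp
 qed
 ultimately show ?thesis by (subst measurable_cong) auto
qed

lemma shot_range: "0 \<le> shot x" "shot x \<le> b"
 using LB.finite_measure_mono[of "{t. x \<in> C t}" UNIV] by (auto simp: shot_def measure_LB)

lemma shot_integral: "has_bochner_integral m shot (\<mu> * b)"
proof (rule has_bochner_integral_nn_integral)
 have "(\<integral>\<^sup>+x. ennreal (shot x) \<partial>m) = (\<integral>\<^sup>+x. (nIntB t. indicator {p. snd p \<in> C (fst p)} (t, x)) \<partial>m)"
 proof (rule nn_integral_cong)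
  fix x assume x: "x \<in> space m"
  have "(nIntB t. indicator {p. snd p \<in> C (fst p)} (t, x)) = (nIntB t. indicator {t. x \<in> C t} t)"
   by (intro nn_integral_cong) (auto split: split_indicator)
  then show "ennreal (shot x) = (nIntB t. indicator {p. snd p \<in> C (fst p)} (t, x))"
   using sets_shot[OF x] by (simp add: shot_def LB.emeasure_eq_measure)
 qed
 also have "\<dots> = (nIntB t. (\<integral>\<^sup>+x. indicator {p. snd p \<in> C (fst p)} (t, x) \<partial>m))"
 proof -
  interpret Q: pair_sigma_finite LB m ..
  show ?thesis by (rule Q.Fubini') measurable
 qed
 also have "\<dots> = (nIntB t. ennreal \<mu>)"
 proof (rule nn_integral_cong)
  fix t
  have "(\<integral>\<^sup>+x. indicator {p. snd p \<in> C (fst p)} (t, x) \<partial>m) = (\<integral>\<^sup>+x. indicator (C t) x \<partial>m)"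
   by (intro nn_integral_cong) (auto split: split_indicator)
  then show "(\<integral>\<^sup>+x. indicator {p. snd p \<in> C (fst p)} (t, x) \<partial>m) = ennreal \<mu>"
   by (simp add: emeasure_C)
 qed
 also have "\<dots> = ennreal (\<mu> * b)"
  using mu_nonneg b_nonneg by (simp add: emeasure_LB ennreal_mult)
 finally show "(\<integral>\<^sup>+x. ennreal (shot x) \<partial>m) = ennreal (\<mu> * b)" .
qed (use mu_nonneg b_nonneg shot_range in auto)

text \<open>The residual is the almost sure limit of \<open>J k\<close>, the window integral of the
  centred avoidance functional minus the rescaled thinned one. The second moment of
  \<open>J k\<close> is a double integral of covariances, each at most exp \<mu> times \<rho>
  squared, uniformly in k; Fatou's lemma carries the bound to the limit.\<close>

lemma residual_bound:
 "(nMean z. ennreal ((exp \<mu> * U S z - b + ((\<Sum>j. shot (e j z)) - \<mu> * b))\<^sup>2)) \<le>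
  ennreal (exp \<mu> * (IntB t. (IntB s. (\<rho> (s - t))\<^sup>2)))"
proof -
 \<comment> \<open>The reciprocal of the thinning probability; the shift by one keeps it
   positive.\<close>
 define K where "K k = real (Suc k)" for k
 define g where "g k t z = thin_centred 1 t z - K k * thin_centred (1 / K k) t z" for k t z
 define J where "J k z = (IntB t. g k t z)" for k z
 define D where "D k = (exp \<mu> + 1) * (1 + K k)" for k
 have K: "1 \<le> K k" "0 < K k" "0 \<le> 1 / K k" "1 / K k \<le> 1" for k by (auto simp: K_def)
 have tc: "\<bar>thin_centred \<epsilon> t z\<bar> \<le> exp \<mu> + 1" if "0 \<le> \<epsilon>" "\<epsilon> \<le> 1" for \<epsilon> t z
 proof -
  have "exp (\<epsilon> * \<mu>) * thin \<epsilon> t z \<le> exp \<mu> * 1"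
   using that mu_nonneg thin_range[OF that] by (intro mult_mono) (auto simp: mult_left_le_one_le)
  moreover have "0 \<le> exp (\<epsilon> * \<mu>) * thin \<epsilon> t z" using thin_range[OF that] by simp
  ultimately show ?thesis unfolding thin_centred_def by (simp add: abs_le_iff)
 qed
 have gD: "\<bar>g k t z\<bar> \<le> D k" for k t z
 proof -
  have "\<bar>g k t z\<bar> \<le> \<bar>thin_centred 1 t z\<bar> + K k * \<bar>thin_centred (1 / K k) t z\<bar>"
   unfolding g_def using K(2)[of k] by (intro order_trans[OF abs_triangle_ineq4]) (simp add: abs_mult)
  also have "\<dots> \<le> (exp \<mu> + 1) + K k * (exp \<mu> + 1)"
   using K(2)[of k] by (intro add_mono mult_left_mono tc K) auto
  finally show ?thesis by (simp add: D_def algebra_simps)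
 qed
 have D0: "0 \<le> D k" for k using gD[of k undefined undefined] by simp
 have [measurable]: "(\<lambda>p. g k (f p) (h p)) \<in> borel_measurable N"
  if [measurable]: "f \<in> borel_measurable N" "h \<in> measurable N M" for N :: "'q measure" and f h k
  unfolding g_def thin_centred_def by measurable
 have g_pair [measurable]: "(\<lambda>p. g k (snd p) (fst p)) \<in> borel_measurable (M \<Otimes>\<^sub>M LB)" for k
  unfolding g_def thin_centred_def by measurable
 have g_slice [measurable]: "(\<lambda>t. g k t z) \<in> borel_measurable borel" if [measurable]: "z \<in> space M" for k z
  unfolding g_def thin_centred_def by measurable
 have g_t [measurable]: "g k t \<in> borel_measurable M" for k t
  unfolding g_def[abs_def] thin_centred_def by measurable
 have J_meas [measurable]: "J k \<in> borel_measurable M" for k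
  unfolding J_def[abs_def] using g_pair[of k]
  by (intro LB.borel_measurable_lebesgue_integral) (simp add: split_beta')
 have JD: "\<bar>J k z\<bar> \<le> D k * b" for k z
 proof (cases "integrable LB (\<lambda>t. g k t z)")
  case True
  then have "norm (J k z) \<le> (IntB t. D k)"
   unfolding J_def using gD by (intro norm_integral_le_integral) auto
  then show ?thesis by (simp add: measure_LB mult.commute)
 qed (use D0[of k] b_nonneg in \<open>simp add: J_def not_integrable_integral_eq\<close>)
 have EJ: "(Mean z. (J k z)\<^sup>2) = (IntB t. (IntB s. (Mean z. g k t z * g k s z)))" for k
 proof -
  have i1: "integrable (M \<Otimes>\<^sub>M LB) (\<lambda>(z, t). g k t z * J k z)"
   by (rule PF.integrable_const_bound[of _ "D k * (D k * b)"])
     (auto simp: split_beta' abs_mult intro!: mult_mono gD JD D0 AE_I2)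
  have i2: "integrable (M \<Otimes>\<^sub>M LB) (\<lambda>(z, s). g k t z * g k s z)" for t
   by (rule PF.integrable_const_bound[of _ "D k * D k"])
     (auto simp: split_beta' abs_mult intro!: mult_mono gD D0 AE_I2)
  have "(Mean z. (J k z)\<^sup>2) = (Mean z. (IntB t. g k t z * J k z))"
   by (simp add: J_def power2_eq_square)
  also have "\<dots> = (IntB t. (Mean z. g k t z * J k z))"
   by (rule P.Fubini_integral[OF i1, symmetric])
  also have "\<dots> = (IntB t. (Mean z. (IntB s. g k t z * g k s z)))"
   by (simp add: J_def)
  also have "\<dots> = (IntB t. (IntB s. (Mean z. g k t z * g k s z)))"
   by (intro Bochner_integral_cong refl P.Fubini_integral[OF i2, symmetric])
  finally show ?thesis .
 qed
 define cv where "cv k t s = (exp (\<rho> (s - t)) - 1) - 2 * (exp ((1 / K k) * \<rho> (s - t)) - 1) / (1 / K k)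
   + (exp ((1 / K k) * (1 / K k) * \<rho> (s - t)) - 1) / ((1 / K k) * (1 / K k))" for k t s
 have Egg: "(Mean z. g k t z * g k s z) = cv k t s" for k t s
 proof -
  have "g k t z * g k s z = thin_centred 1 t z * thin_centred 1 s z - K k * (thin_centred 1 t z * thin_centred (1 / K k) s z)
    - K k * (thin_centred (1 / K k) t z * thin_centred 1 s z) + K k * K k * (thin_centred (1 / K k) t z * thin_centred (1 / K k) s z)" for z
   by (simp add: g_def algebra_simps)
  moreover have hb: "has_bochner_integral M (\<lambda>z. thin_centred x t z * thin_centred y s z) (exp (x * y * \<rho> (s - t)) - 1)"
   if "x \<in> {1, 1 / K k}" "y \<in> {1, 1 / K k}" for x y
   using thin_centred_moment[of x y t s] that K[of k] by (auto simp: has_bochner_integral_iff)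
  have "has_bochner_integral M (\<lambda>z. thin_centred 1 t z * thin_centred 1 s z - K k * (thin_centred 1 t z * thin_centred (1 / K k) s z)
    - K k * (thin_centred (1 / K k) t z * thin_centred 1 s z) + K k * K k * (thin_centred (1 / K k) t z * thin_centred (1 / K k) s z))
    ((exp (1 * 1 * \<rho> (s - t)) - 1) - K k * (exp (1 * (1 / K k) * \<rho> (s - t)) - 1)
    - K k * (exp ((1 / K k) * 1 * \<rho> (s - t)) - 1) + K k * K k * (exp ((1 / K k) * (1 / K k) * \<rho> (s - t)) - 1))"
   by (intro has_bochner_integral_add has_bochner_integral_diff has_bochner_integral_mult_right hb) auto
  ultimately have "(Mean z. g k t z * g k s z) = (exp (1 * 1 * \<rho> (s - t)) - 1) - K k * (exp (1 * (1 / K k) * \<rho> (s - t)) - 1)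
    - K k * (exp ((1 / K k) * 1 * \<rho> (s - t)) - 1) + K k * K k * (exp ((1 / K k) * (1 / K k) * \<rho> (s - t)) - 1)"
   by (simp only: has_bochner_integral_iff)
  then show ?thesis using K[of k] by (simp add: cv_def field_simps)
 qed
 have cvb: "cv k t s \<le> exp \<mu> * (\<rho> (s - t))\<^sup>2" for k t s
 proof -
  have "cv k t s \<le> (\<rho> (s - t))\<^sup>2 * exp (\<rho> (s - t))"
   unfolding cv_def using K[of k] by (intro thinning_covariance_bound) (auto simp: rho_nonneg)
  also have "\<dots> \<le> (\<rho> (s - t))\<^sup>2 * exp \<mu>"
   by (intro mult_left_mono) (auto simp: rho_le_mu)
  finally show ?thesis by (simp add: mult.commute)
 qed
 have rho2: "\<bar>exp \<mu> * (\<rho> w)\<^sup>2\<bar> \<le> exp \<mu> * \<mu>\<^sup>2" for w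
  by (simp add: abs_mult power_mono rho_nonneg rho_le_mu)
 have EJb: "(Mean z. (J k z)\<^sup>2) \<le> exp \<mu> * (IntB t. (IntB s. (\<rho> (s - t))\<^sup>2))" for k
 proof -
  have cvD: "\<bar>cv k t s\<bar> \<le> D k * D k" for t s
   unfolding Egg[symmetric]
   by (rule order_trans[OF integral_abs_bound integral_le_const])
     (auto simp: abs_mult intro!: AE_I2 mult_mono gD D0 integrable_const_bound[of _ "D k * D k"])
  have [measurable]: "(\<lambda>p. cv k (fst p) (snd p)) \<in> borel_measurable (borel \<Otimes>\<^sub>M borel)" "(\<lambda>s. cv k t s) \<in> borel_measurable borel" for t
   unfolding cv_def by measurable
  have [measurable]: "(\<lambda>t. \<integral>s. cv k t s \<partial>LB) \<in> borel_measurable borel"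
   by (intro LB.borel_measurable_lebesgue_integral) (simp add: split_beta')
  have ic1: "integrable LB (\<lambda>s. cv k t s)" for t
   by (rule LB.integrable_const_bound[of _ "D k * D k"]) (use cvD in auto)
  have ic2: "integrable LB (\<lambda>s. exp \<mu> * (\<rho> (s - t))\<^sup>2)" for t
   by (rule LB.integrable_const_bound[of _ "exp \<mu> * \<mu>\<^sup>2"]) (use rho2 in \<open>simp_all only: real_norm_def AE_I2\<close>, measurable)
  note ic = ic1 ic2
  have "(IntB t. (IntB s. cv k t s)) \<le> (IntB t. (IntB s. exp \<mu> * (\<rho> (s - t))\<^sup>2))"
  proof (intro integral_mono ic cvb)
   show "integrable LB (\<lambda>t. \<integral>s. cv k t s \<partial>LB)"
   proof (rule LB.integrable_const_bound[of _ "D k * D k * b"])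
    show "AE t in LB. norm (IntB s. cv k t s) \<le> D k * D k * b"
    proof (rule AE_I2)
     fix t
     have "norm (IntB s. cv k t s) \<le> (IntB s. D k * D k)"
      using cvD by (intro norm_integral_le_integral ic) auto
     also have "\<dots> = D k * D k * b" by (simp add: measure_LB)
     finally show "norm (IntB s. cv k t s) \<le> D k * D k * b" .
    qed
   qed simp
   show "integrable LB (\<lambda>t. \<integral>s. exp \<mu> * (\<rho> (s - t))\<^sup>2 \<partial>LB)"
   proof (rule LB.integrable_const_bound[of _ "exp \<mu> * \<mu>\<^sup>2 * b"])
    have "norm (IntB s. exp \<mu> * (\<rho> (s - t))\<^sup>2) \<le> (IntB s. exp \<mu> * \<mu>\<^sup>2)" for t
     using rho2 by (intro norm_integral_le_integral ic) auto
    then show "AE t in LB. norm (IntB s. exp \<mu> * (\<rho> (s - t))\<^sup>2) \<le> exp \<mu> * \<mu>\<^sup>2 * b"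
     by (simp add: measure_LB mult.commute)
   qed measurable
  qed
  then show ?thesis unfolding EJ Egg by simp
 qed
 have "AE z in M. summable (\<lambda>j. shot (e j z))"
  using shot_integral by (intro char_shot_noise(1)) (auto simp: has_bochner_integral_iff shot_range)
 then have lim: "AE z in M. (\<lambda>k. J k z) \<longlonglongrightarrow> exp \<mu> * U S z - b + ((\<Sum>j. shot (e j z)) - \<mu> * b)"
  using AE_space
 proof eventually_elim
  case (elim z)
  have w [measurable]: "z \<in> space M" by fact
  have eS: "e j z \<in> S" for j using measurable_space[OF measurable_points w] .
  \<comment> \<open>The number of grains over t for this outcome. Its window integral is the shot
    noise, so it is finite for almost every t and its real version is part of an integrable
    majorant.\<close>
  define N where "N t = (\<Sum>j. indicator (C t) (e j z) :: ennreal)" for t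
  define n where "n t = enn2real (N t)" for t
  have ind: "indicator (C t) (e j z) = (indicator {t. e j z \<in> C t} t :: ennreal)" for t j
   by (auto split: split_indicator)
  have [measurable]: "{t. e j z \<in> C t} \<in> sets borel" for j by (rule sets_shot[OF eS])
  have Nm [measurable]: "N \<in> borel_measurable borel"
   unfolding N_def[abs_def] ind by measurable
  have nm [measurable]: "n \<in> borel_measurable borel" unfolding n_def[abs_def] by measurable
  have "(nIntB t. N t) = (\<Sum>j. \<integral>\<^sup>+t. indicator {t. e j z \<in> C t} t \<partial>LB)"
   unfolding N_def ind by (rule nn_integral_suminf) measurable
  also have "\<dots> = (\<Sum>j. ennreal (shot (e j z)))"
   by (simp add: shot_def LB.emeasure_eq_measure)
  also have "\<dots> = ennreal (\<Sum>j. shot (e j z))"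
   using elim by (intro suminf_ennreal2) (auto simp: shot_range)
  finally have NI: "(nIntB t. N t) = ennreal (\<Sum>j. shot (e j z))" .
  have Nfin: "AE t in LB. N t \<noteq> \<infinity>"
   by (rule nn_integral_PInf_AE) (auto simp: NI)
  have nhb: "has_bochner_integral LB n (\<Sum>j. shot (e j z))"
  proof (rule has_bochner_integral_nn_integral)
   have "(nIntB t. ennreal (n t)) = (nIntB t. N t)"
    by (rule nn_integral_cong_AE) (use Nfin in eventually_elim, auto simp: n_def less_top[symmetric])
   then show "(nIntB t. ennreal (n t)) = ennreal (\<Sum>j. shot (e j z))" using NI by simp
   show "0 \<le> (\<Sum>j. shot (e j z))" using elim by (intro suminf_nonneg) (auto simp: shot_range)
  qed (auto simp: n_def)
  have tc1: "integrable LB (\<lambda>t. thin_centred 1 t z)" "(IntB t. thin_centred 1 t z) = exp \<mu> * U S z - b"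
  proof -
   have "integrable LB (\<lambda>t. void (S \<inter> C t) z)" by (rule void_slice_integrable) (use w in auto)
   then have iv: "integrable LB (\<lambda>t. void (C t) z)" unfolding S_Int_C .
   show "integrable LB (\<lambda>t. thin_centred 1 t z)"
    unfolding thin_centred_def thin_one using iv by simp
   have "(IntB t. thin_centred 1 t z) = exp \<mu> * (IntB t. void (C t) z) - b"
    unfolding thin_centred_def thin_one using iv by (simp add: measure_LB)
   then show "(IntB t. thin_centred 1 t z) = exp \<mu> * U S z - b" unfolding U_def S_Int_C .
  qed
  have "(\<lambda>k. J k z) \<longlonglongrightarrow> (IntB t. thin_centred 1 t z - (\<mu> - n t))"
   unfolding J_def
  proof (rule integral_dominated_convergence[where w="\<lambda>t. exp \<mu> + 1 + (\<mu> * exp \<mu> + n t)"])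
   show "integrable LB (\<lambda>t. exp \<mu> + 1 + (\<mu> * exp \<mu> + n t))"
    using nhb by (simp add: has_bochner_integral_iff)
   show "AE t in LB. (\<lambda>k. g k t z) \<longlonglongrightarrow> thin_centred 1 t z - (\<mu> - n t)"
    using Nfin
   proof eventually_elim
    case (elim t)
    have J: "finite {j. e j z \<in> C t}" "N t = of_nat (card {j. e j z \<in> C t})"
     using suminf_indicator_finite[of "C t" "\<lambda>j. e j z"] elim by (auto simp: N_def)
    have "n t = real (card {j. e j z \<in> C t})" by (simp add: n_def J(2) ennreal_of_nat_eq_real_of_nat)
    moreover have "thin (1 / K k) t z = (1 - 1 / K k) ^ card {j. e j z \<in> C t}" for k
     by (rule thin_finite[OF K(3,4) J(1)])
    ultimately have "(\<lambda>k. K k * thin_centred (1 / K k) t z) \<longlonglongrightarrow> \<mu> - n t"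
     using thinning_derivative[of \<mu> "card {j. e j z \<in> C t}"]
     by (simp only: thin_centred_def K_def) (simp add: field_simps)
    then show ?case unfolding g_def by (intro tendsto_diff tendsto_const)
   qed
   show "AE t in LB. norm (g k t z) \<le> exp \<mu> + 1 + (\<mu> * exp \<mu> + n t)" for k
    using Nfin
   proof eventually_elim
    case (elim t)
    define c where "c = card {j. e j z \<in> C t}"
    have J: "finite {j. e j z \<in> C t}" "N t = of_nat c"
     using suminf_indicator_finite[of "C t" "\<lambda>j. e j z"] elim by (auto simp: N_def c_def)
    have nt: "n t = real c" by (simp add: n_def J(2) ennreal_of_nat_eq_real_of_nat)
    define \<theta> where "\<theta> = (1 - 1 / K k) ^ c"
    have th: "thin (1 / K k) t z = \<theta>" unfolding \<theta>_def c_def by (rule thin_finite[OF K(3,4) J(1)])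
    \<comment> \<open>Bernoulli's inequality bounds the loss by thinning by the number of grains
      divided by \<open>K k\<close>, which makes the majorant uniform in k.\<close>
    have \<theta>: "0 \<le> \<theta>" "\<theta> \<le> 1" "1 - \<theta> \<le> real c / K k"
     using Bernoulli_inequality[of "- (1 / K k)" c] K[of k] by (auto simp: \<theta>_def power_le_one)
    have "K k * thin_centred (1 / K k) t z = K k * (exp (\<mu> / K k) - 1) * \<theta> - K k * (1 - \<theta>)"
     by (simp add: thin_centred_def th algebra_simps)
    also have "\<bar>\<dots>\<bar> \<le> \<bar>K k * (exp (\<mu> / K k) - 1) * \<theta>\<bar> + \<bar>K k * (1 - \<theta>)\<bar>"
     by (rule abs_triangle_ineq4)
    also have "\<bar>K k * (exp (\<mu> / K k) - 1) * \<theta>\<bar> \<le> \<mu> * exp \<mu>"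
    proof -
     define x where "x = \<mu> / K k"
     have x: "0 \<le> x" "x \<le> \<mu>" using K[of k] mu_nonneg mult_left_mono[OF K(1)[of k] mu_nonneg] by (auto simp: x_def divide_le_eq)
     have "exp x - 1 = exp x * (1 - exp (- x))" by (simp add: right_diff_distrib flip: exp_add)
     also have "\<dots> \<le> exp \<mu> * x"
      using x exp_ge_add_one_self[of "- x"] by (intro mult_mono) auto
     finally have 1: "exp x - 1 \<le> exp \<mu> * x" .
     have "K k * (exp x - 1) * \<theta> \<le> K k * (exp \<mu> * x) * 1"
      using 1 x \<theta> K[of k] by (intro mult_mono) auto
     also have "\<dots> = \<mu> * exp \<mu>" using K[of k] by (simp add: x_def)
     finally show ?thesis using x \<theta> K[of k] by (simp add: x_def abs_mult)
    qed
    also have "\<bar>K k * (1 - \<theta>)\<bar> \<le> n t"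
     using \<theta> K[of k] by (simp add: abs_mult nt field_simps)
    finally have "\<bar>K k * thin_centred (1 / K k) t z\<bar> \<le> \<mu> * exp \<mu> + n t" by simp
    moreover have "\<bar>thin_centred 1 t z\<bar> \<le> exp \<mu> + 1" by (rule tc) auto
    ultimately show ?case unfolding g_def by (simp add: abs_le_iff)
   qed
  qed (use tc1 in \<open>auto simp: borel_measurable_integrable\<close>)
  also have "(IntB t. thin_centred 1 t z - (\<mu> - n t)) = exp \<mu> * U S z - b + ((\<Sum>j. shot (e j z)) - \<mu> * b)"
   using tc1 nhb by (simp add: has_bochner_integral_iff measure_LB)
  finally show ?case .
 qed
 let ?L = "\<lambda>z. exp \<mu> * U S z - b + ((\<Sum>j. shot (e j z)) - \<mu> * b)"
 have "(nMean z. ennreal ((?L z)\<^sup>2)) = (nMean z. liminf (\<lambda>k. ennreal ((J k z)\<^sup>2)))"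
 proof (rule nn_integral_cong_AE)
  show "AE z in M. ennreal ((?L z)\<^sup>2) = liminf (\<lambda>k. ennreal ((J k z)\<^sup>2))"
   using lim
  proof eventually_elim
   case (elim z)
   have "(\<lambda>k. ennreal ((J k z)\<^sup>2)) \<longlonglongrightarrow> ennreal ((?L z)\<^sup>2)"
    by (intro tendsto_ennrealI tendsto_power elim)
   then show ?case by (intro lim_imp_Liminf[symmetric]) auto
  qed
 qed
 also have "\<dots> \<le> liminf (\<lambda>k. \<integral>\<^sup>+z. ennreal ((J k z)\<^sup>2) \<partial>M)"
  by (rule nn_integral_liminf) measurable
 also have "\<dots> \<le> liminf (\<lambda>k :: nat. ennreal (exp \<mu> * (IntB t. (IntB s. (\<rho> (s - t))\<^sup>2))))"
 proof (intro Liminf_mono always_eventually allI)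
  fix k
  have "integrable M (\<lambda>z. (J k z)\<^sup>2)"
   by (rule integrable_const_bound[of _ "(D k * b)\<^sup>2"]) (auto intro!: AE_I2 power2_le_iff_abs_le[THEN iffD2] JD mult_nonneg_nonneg D0 b_nonneg)
  then have "(nMean z. ennreal ((J k z)\<^sup>2)) = ennreal (Mean z. (J k z)\<^sup>2)"
   by (intro nn_integral_eq_integral) auto
  also have "\<dots> \<le> ennreal (exp \<mu> * (IntB t. (IntB s. (\<rho> (s - t))\<^sup>2)))"
   by (intro ennreal_leI EJb)
  finally show "(nMean z. ennreal ((J k z)\<^sup>2)) \<le> ennreal (exp \<mu> * (IntB t. (IntB s. (\<rho> (s - t))\<^sup>2)))" .
 qed
 also have "\<dots> = ennreal (exp \<mu> * (IntB t. (IntB s. (\<rho> (s - t))\<^sup>2)))"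
  by (simp add: Liminf_const)
 finally show ?thesis .
qed

end

subsection \<open>Moments in the stable regime\<close>


definition stable_kernel :: "real \<Rightarrow> real \<Rightarrow> real \<Rightarrow> complex" where
 "stable_kernel p \<theta> x = (iexp (\<theta> * x) - 1) * of_real (x powr (- p))"

text \<open>Near 0 the kernel is at most \<bar>\<theta>\<bar> x^(1-p), integrable because p < 2;
  beyond 1 it is at most 2 x^(-p), integrable because p > 1.\<close>

lemma stable_kernel_integrable:
 assumes p: "1 < p" "p < 2"
 shows "integrable lborel (\<lambda>x. indicator {0<..} x *\<^sub>R stable_kernel p \<theta> x)"
proof -
 define w where "w x = \<bar>\<theta>\<bar> * (x powr (1 - p) * indicator {0..1} x) + 2 * (x powr (- p) * indicator {1..} x)" for x :: real
 have I1: "((\<lambda>x. x powr (1 - p)) has_integral 1 / (2 - p)) {0..1}"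
  using has_integral_powr_from_0[of "1 - p" 1] p by simp
 have I2: "((\<lambda>x. x powr (- p)) has_integral 1 / (p - 1)) {1..}"
  using has_integral_powr_to_inf[of "- p" 1] p by (simp add: minus_divide_right)
 have 1: "integrable lborel (\<lambda>x. x powr (1 - p) * indicator {0..1} x)"
  using p nn_integral_has_integral_lebesgue'[OF _ I1]
  by (intro integrableI_nn_integral_finite[of _ _ "1 / (2 - p)"]) (auto simp: ennreal_mult'' ennreal_indicator)
 have 2: "integrable lborel (\<lambda>x. x powr (- p) * indicator {1..} x)"
  using p nn_integral_has_integral_lebesgue'[OF _ I2]
  by (intro integrableI_nn_integral_finite[of _ _ "1 / (p - 1)"]) (auto simp: ennreal_mult'' ennreal_indicator)
 have wi: "integrable lborel w" unfolding w_def using 1 2 by simp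
 show ?thesis
 proof (rule Bochner_integrable_bound[OF wi])
  show "AE x in lborel. norm (indicator {0<..} x *\<^sub>R stable_kernel p \<theta> x) \<le> norm (w x)"
  proof (rule AE_I2)
   fix x :: real
   have w0: "0 \<le> w x" by (simp add: w_def)
   show "norm (indicator {0<..} x *\<^sub>R stable_kernel p \<theta> x) \<le> norm (w x)"
   proof (cases "0 < x")
    case True
    have "norm (stable_kernel p \<theta> x) \<le> w x"
    proof (cases "x \<le> 1")
     case le: True
     have "norm (stable_kernel p \<theta> x) \<le> \<bar>\<theta> * x\<bar> * x powr (- p)"
      using iexp_approx1[of "\<theta> * x" 0] by (simp add: stable_kernel_def norm_mult mult_right_mono)
     also have "\<dots> = \<bar>\<theta>\<bar> * (x powr 1 * x powr (- p))" using True by (simp add: abs_mult)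
     also have "x powr 1 * x powr (- p) = x powr (1 - p)" by (simp only: powr_add[symmetric]) simp
     also have "\<bar>\<theta>\<bar> * x powr (1 - p) \<le> w x" using True le by (simp add: w_def)
     finally show ?thesis .
    next
     case False
     have "norm (iexp (\<theta> * x) - 1) \<le> 2"
      by (rule order_trans[OF norm_triangle_ineq4]) simp
     then have "norm (stable_kernel p \<theta> x) \<le> 2 * x powr (- p)"
      by (simp add: stable_kernel_def norm_mult mult_right_mono)
     then show ?thesis using False by (simp add: w_def)
    qed
    then show ?thesis using True w0 by simp
   qed simp
  qed
 qed (simp add: stable_kernel_def)
qed

text \<open>Writes the compensated exponential as an integral from 0, so that the layer cake
  argument works for this complex function: tails of the variable then meet the kernel exp(i
  \<theta> x) - 1.\<close>

lemma iexp_second_remainder_integral: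
 assumes z: "0 \<le> z"
 shows "(Leb x. indicator {0<..<z} x *\<^sub>R (\<i> * of_real \<theta> * (iexp (\<theta> * x) - 1))) =
  iexp (\<theta> * z) - 1 - \<i> * of_real (\<theta> * z)"
proof -
 have "(Leb x. indicator {0..z} x *\<^sub>R (\<i> * of_real \<theta> * (iexp (\<theta> * x) - 1))) =
   (iexp (\<theta> * z) - \<i> * of_real (\<theta> * z)) - (iexp (\<theta> * 0) - \<i> * of_real (\<theta> * 0))"
 proof (rule integral_FTC_Icc[OF z])
  fix x
  show "((\<lambda>x. iexp (\<theta> * x) - \<i> * of_real (\<theta> * x)) has_vector_derivative (\<i> * of_real \<theta> * (iexp (\<theta> * x) - 1))) (at x within {0..z})"
   by (auto intro!: derivative_eq_intros has_vector_derivative_real_field simp: algebra_simps)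
 qed (intro continuous_intros)
 moreover have "(Leb x. indicator {0<..<z} x *\<^sub>R (\<i> * of_real \<theta> * (iexp (\<theta> * x) - 1))) =
   (Leb x. indicator {0..z} x *\<^sub>R (\<i> * of_real \<theta> * (iexp (\<theta> * x) - 1)))"
 proof (rule integral_cong_AE)
  have "AE x in lborel. x \<noteq> 0 \<and> x \<noteq> z" by (intro AE_conjI AE_lborel_singleton)
  then show "AE x in lborel. indicator {0<..<z} x *\<^sub>R (\<i> * of_real \<theta> * (iexp (\<theta> * x) - 1)) =
    indicator {0..z} x *\<^sub>R (\<i> * of_real \<theta> * (iexp (\<theta> * x) - 1))"
   by eventually_elim (auto split: split_indicator)
 qed auto
 ultimately show ?thesis by simp
qed

locale stable_regime = regularly_varying_tail M R \<alpha> c for M :: "'w measure" and R \<alpha> c +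
 fixes q :: real
 assumes q: "0 < q" "q < 1" and \<alpha>1: "1 < \<alpha>" and \<alpha>q: "\<alpha> < 1 + q"
begin

text \<open>The stable index \<open>\<alpha>\<^sub>0\<close> of the theorem once q is the ratio of
  the dimensions.\<close>

definition p :: real where "p = 1 + (\<alpha> - 1) / q"

lemma p12: "1 < p" "p < 2"
 using q \<alpha>1 \<alpha>q by (auto simp: p_def divide_less_eq)

lemma pq: "p * q = \<alpha> - (1 - q)" using q by (simp add: p_def field_simps)

text \<open>A rate of grains with section above x: R^(1-q) is the order of the set of heights at
  which a grain meets the hyperplane, and \<tau> R^q the size of its section.\<close>

definition tail_part :: "real \<Rightarrow> real \<Rightarrow> real" where
 "tail_part \<tau> x = (Mean w. R w powr (1 - q) * indicator {x<..} (\<tau> * R w powr q))"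

lemma threshold_iff:
 assumes "0 < y" "0 < \<tau>" "0 < x"
 shows "x < \<tau> * y powr q \<longleftrightarrow> (x / \<tau>) powr (1 / q) < y"
proof -
 let ?t = "(x / \<tau>) powr (1 / q)"
 have t: "?t powr q = x / \<tau>" using assms q by (simp add: powr_powr)
 have "x < \<tau> * y powr q \<longleftrightarrow> ?t powr q < y powr q"
  unfolding t using assms by (simp add: divide_less_eq mult.commute)
 also have "\<dots> \<longleftrightarrow> ?t < y"
  using powr_less_mono2[of q ?t y] powr_mono2[of q y ?t] assms q by (auto simp: not_less[symmetric])
 finally show ?thesis .
qed

lemma tail_part_eq:
 assumes "0 < \<tau>" "0 < x"
 shows "tail_part \<tau> x = tail_moment (1 - q) ((x / \<tau>) powr (1 / q))"
  "(nMean w. ennreal (R w powr (1 - q) * indicator {x<..} (\<tau> * R w powr q))) =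
   (nMean w. ennreal (R w powr (1 - q)) * indicator {(x / \<tau>) powr (1 / q)<..} (R w))"
proof -
 have ae: "AE w in M. x < \<tau> * R w powr q \<longleftrightarrow> (x / \<tau>) powr (1 / q) < R w"
  using R_pos by eventually_elim (rule threshold_iff[OF _ assms])
 show "tail_part \<tau> x = tail_moment (1 - q) ((x / \<tau>) powr (1 / q))"
  unfolding tail_part_def tail_moment_def
  by (rule integral_cong_AE) (use ae in \<open>auto simp: indicator_def\<close>)
 show "(nMean w. ennreal (R w powr (1 - q) * indicator {x<..} (\<tau> * R w powr q))) =
   (nMean w. ennreal (R w powr (1 - q)) * indicator {(x / \<tau>) powr (1 / q)<..} (R w))"
  by (rule nn_integral_cong_AE) (use ae in \<open>auto simp: indicator_def\<close>)
qed

lemma tail_part_bound: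
 "\<exists>C>0. \<forall>\<tau>>0. \<forall>x>0. (nMean w. ennreal (R w powr (1 - q) * indicator {x<..} (\<tau> * R w powr q)))
   \<le> ennreal (C * \<tau> powr p * x powr (- p))"
proof -
 obtain C where C: "C > 0" "\<And>x. x > 0 \<Longrightarrow>
   (nMean w. ennreal (R w powr (1 - q)) * indicator {x<..} (R w)) \<le> ennreal (C * x powr ((1 - q) - \<alpha>))"
  using nn_integral_powr_tail_bound[of "1 - q"] q \<alpha>1 by auto
 have "(nMean w. ennreal (R w powr (1 - q) * indicator {x<..} (\<tau> * R w powr q)))
   \<le> ennreal (C * \<tau> powr p * x powr (- p))" if "\<tau> > 0" "x > 0" for \<tau> x
 proof -
  have "((x / \<tau>) powr (1 / q)) powr ((1 - q) - \<alpha>) = (x / \<tau>) powr (- p)"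
  proof -
   \<comment> \<open>The threshold for R is the power 1 / q of x / \<tau>, so the exponent (1 - q) -
     \<alpha> in R becomes -p in x / \<tau>.\<close>
   have "(1 / q) * ((1 - q) - \<alpha>) = - p" using q by (simp add: p_def field_simps)
   then show ?thesis by (simp only: powr_powr)
  qed
  also have "\<dots> = \<tau> powr p * x powr (- p)"
   using that by (simp add: powr_divide powr_minus field_simps)
  finally show ?thesis
   unfolding tail_part_eq(2)[OF that] using C(2)[of "(x / \<tau>) powr (1 / q)"] that by (simp add: mult.assoc)
 qed
 then show ?thesis using C(1) by blast
qed

text \<open>Karamata's theorem for the moment of order 1 - q at the threshold (x l)^(1/q). As
  \<alpha> - (1 - q) = p q, the constant is c \<alpha> / (q p).\<close>

lemma tail_part_limit:
 assumes x: "0 < x"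
 shows "((\<lambda>l. l powr p * tail_part (1 / l) x) \<longlongrightarrow> c * \<alpha> / (q * p) * x powr (- p)) at_top"
proof -
 have s: "0 < 1 - q" "1 - q < \<alpha>" using q \<alpha>1 by auto
 have "filterlim (\<lambda>l. (x * l) powr (1 / q)) at_top at_top"
 proof (rule filterlim_compose[of "\<lambda>y. y powr (1 / q)"])
  show "filterlim (\<lambda>y :: real. y powr (1 / q)) at_top at_top"
   using q by real_asymp
  show "filterlim (\<lambda>l. x * l) at_top at_top"
   using x by (intro filterlim_tendsto_pos_mult_at_top[OF tendsto_const] filterlim_ident)
 qed
 from filterlim_compose[OF tail_moment_limit[OF s] this]
 have "((\<lambda>l. tail_moment (1 - q) ((x * l) powr (1 / q)) * ((x * l) powr (1 / q)) powr (\<alpha> - (1 - q)) * x powr (- p))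
   \<longlongrightarrow> c * \<alpha> / (\<alpha> - (1 - q)) * x powr (- p)) at_top"
  by (intro tendsto_intros)
 then have "((\<lambda>l. tail_moment (1 - q) ((x * l) powr (1 / q)) * ((x * l) powr (1 / q)) powr (\<alpha> - (1 - q)) * x powr (- p))
   \<longlongrightarrow> c * \<alpha> / (q * p) * x powr (- p)) at_top"
  using pq by (simp add: mult.commute)
 then show ?thesis
 proof (rule Lim_transform_eventually, intro eventually_mono[OF eventually_gt_at_top[of 0]])
  fix l :: real assume l: "0 < l"
  have "((x * l) powr (1 / q)) powr (\<alpha> - (1 - q)) = (x * l) powr p"
   unfolding pq[symmetric] using q by (simp add: powr_powr)
  also have "\<dots> = x powr p * l powr p" using x l by (simp add: powr_mult)
  finally show "tail_moment (1 - q) ((x * l) powr (1 / q)) * ((x * l) powr (1 / q)) powr (\<alpha> - (1 - q)) * x powr (- p) =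
    l powr p * tail_part (1 / l) x"
   using x l by (simp add: tail_part_eq powr_minus field_simps)
 qed
qed

text \<open>The term linear in \<theta> is subtracted because the shot noise is centred by its
  mean.\<close>

definition stable_moment :: "real \<Rightarrow> real \<Rightarrow> complex" where
 "stable_moment \<theta> \<tau> = (Mean w. of_real (R w powr (1 - q)) *
   (iexp (\<theta> * (\<tau> * R w powr q)) - 1 - \<i> * of_real (\<theta> * (\<tau> * R w powr q))))"

lemma tail_part_meas [measurable]: "tail_part \<tau> \<in> borel_measurable borel"
 unfolding tail_part_def[abs_def] by measurable

lemma tail_part_nonneg: "0 \<le> tail_part \<tau> x"
 unfolding tail_part_def by (intro integral_nonneg_AE AE_I2) simp

lemma tail_part_le:
 "\<exists>C>0. \<forall>\<tau>>0. \<forall>x>0. tail_part \<tau> x \<le> C * \<tau> powr p * x powr (- p)"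
proof -
 obtain C where C: "C > 0" "\<And>\<tau> x. \<tau> > 0 \<Longrightarrow> x > 0 \<Longrightarrow> (nMean w. ennreal (R w powr (1 - q) * indicator {x<..} (\<tau> * R w powr q)))
   \<le> ennreal (C * \<tau> powr p * x powr (- p))"
  using tail_part_bound by blast
 have "tail_part \<tau> x \<le> C * \<tau> powr p * x powr (- p)" if "\<tau> > 0" "x > 0" for \<tau> x
  using C(2)[OF that] C(1) unfolding tail_part_def
  by (subst integral_eq_nn_integral) (auto intro!: enn2real_leI)
 then show ?thesis using C(1) by blast
qed

text \<open>Layer cake with the integral form of the compensated exponential. The tail bound of
  order x^(-p) against exp(i \<theta> x) - 1 provides the absolute integrability for Fubini.\<close>

lemma stable_moment_eq:
 assumes \<tau>: "0 < \<tau>"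
 shows "stable_moment \<theta> \<tau> = (Leb x. (indicator {0<..} x * tail_part \<tau> x) *\<^sub>R (\<i> * of_real \<theta> * (iexp (\<theta> * x) - 1)))"
proof -
 let ?k = "\<lambda>x. \<i> * of_real \<theta> * (iexp (\<theta> * x) - 1)"
 define F where "F w x = (R w powr (1 - q) * indicator {x<..} (\<tau> * R w powr q)) *\<^sub>R (indicator {0<..} x *\<^sub>R ?k x)" for w x
 interpret PL: pair_sigma_finite M "lborel :: real measure" ..
 have [measurable]: "(\<lambda>p. F (fst p) (snd p)) \<in> borel_measurable (M \<Otimes>\<^sub>M lborel)"
  unfolding F_def by measurable
 obtain C where C: "C > 0" "\<And>\<tau> x. \<tau> > 0 \<Longrightarrow> x > 0 \<Longrightarrow> (nMean w. ennreal (R w powr (1 - q) * indicator {x<..} (\<tau> * R w powr q)))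
   \<le> ennreal (C * \<tau> powr p * x powr (- p))"
  using tail_part_bound by blast
 have Fi: "integrable (M \<Otimes>\<^sub>M lborel) (\<lambda>(w, x). F w x)"
 proof (rule integrableI_bounded)
  show "(\<lambda>(w, x). F w x) \<in> borel_measurable (M \<Otimes>\<^sub>M lborel)" by (simp add: split_beta')
  have "(\<integral>\<^sup>+p. ennreal (norm ((\<lambda>(w, x). F w x) p)) \<partial>(M \<Otimes>\<^sub>M lborel)) = (nLeb x. (nMean w. ennreal (norm (F w x))))"
   by (subst PL.nn_integral_snd[symmetric]) (auto simp: split_beta')
  also have "\<dots> \<le> (nLeb x. ennreal (C * \<tau> powr p * \<bar>\<theta>\<bar> * norm (indicator {0<..} x *\<^sub>R stable_kernel p \<theta> x)))"
  proof (rule nn_integral_mono)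
   fix x :: real
   show "(nMean w. ennreal (norm (F w x))) \<le> ennreal (C * \<tau> powr p * \<bar>\<theta>\<bar> * norm (indicator {0<..} x *\<^sub>R stable_kernel p \<theta> x))"
   proof (cases "0 < x")
    case True
    have "(nMean w. ennreal (norm (F w x))) = (nMean w. ennreal (norm (?k x)) * ennreal (R w powr (1 - q) * indicator {x<..} (\<tau> * R w powr q)))"
     using True by (intro nn_integral_cong) (simp add: F_def mult.commute flip: ennreal_mult)
    also have "\<dots> \<le> ennreal (norm (?k x)) * ennreal (C * \<tau> powr p * x powr (- p))"
     by (subst nn_integral_cmult) (auto intro!: mult_left_mono C \<tau> True)
    also have "\<dots> = ennreal (C * \<tau> powr p * \<bar>\<theta>\<bar> * norm (indicator {0<..} x *\<^sub>R stable_kernel p \<theta> x))"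
     using True C by (simp add: stable_kernel_def norm_mult mult_ac flip: ennreal_mult)
    finally show ?thesis .
   qed (simp add: F_def)
  qed
  also have "\<dots> < \<infinity>"
  proof -
   have "integrable lborel (\<lambda>x. C * \<tau> powr p * \<bar>\<theta>\<bar> * norm (indicator {0<..} x *\<^sub>R stable_kernel p \<theta> x))"
    by (intro integrable_mult_right integrable_norm stable_kernel_integrable p12)
   then show ?thesis
    using C by (subst nn_integral_eq_integral) auto
  qed
  finally show "(\<integral>\<^sup>+p. ennreal (norm ((\<lambda>(w, x). F w x) p)) \<partial>(M \<Otimes>\<^sub>M lborel)) < \<infinity>" .
 qed
 have "stable_moment \<theta> \<tau> = (Mean w. (Leb x. F w x))"
  unfolding stable_moment_def
 proof (intro Bochner_integral_cong refl)
  fix w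
  define z where "z = \<tau> * R w powr q"
  have z: "0 \<le> z" using \<tau> by (simp add: z_def)
  have Feq: "F w x = (R w powr (1 - q)) *\<^sub>R (indicator {0<..<z} x *\<^sub>R ?k x)" for x
   unfolding F_def z_def[symmetric] by (auto split: split_indicator)
  have "(Leb x. F w x) = (R w powr (1 - q)) *\<^sub>R (iexp (\<theta> * z) - 1 - \<i> * of_real (\<theta> * z))"
   unfolding Feq integral_scaleR_right iexp_second_remainder_integral[OF z] ..
  then show "of_real (R w powr (1 - q)) * (iexp (\<theta> * (\<tau> * R w powr q)) - 1 - \<i> * of_real (\<theta> * (\<tau> * R w powr q))) = (Leb x. F w x)"
   by (simp only: z_def scaleR_conv_of_real)
 qed
 also have "\<dots> = (Leb x. (Mean w. F w x))"
  by (rule PL.Fubini_integral[OF Fi, symmetric])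
 also have "\<dots> = (Leb x. (indicator {0<..} x * tail_part \<tau> x) *\<^sub>R ?k x)"
 proof (intro Bochner_integral_cong refl)
  fix x :: real
  have "(Mean w. F w x) = tail_part \<tau> x *\<^sub>R (indicator {0<..} x *\<^sub>R ?k x)"
   unfolding F_def tail_part_def
  proof (cases "0 < x")
   case True
   have "integrable M (\<lambda>w. R w powr (1 - q) * indicator {x<..} (\<tau> * R w powr q))"
    using C(2)[OF \<tau> True] by (intro integrableI_nonneg) (auto intro: le_less_trans)
   then show "(Mean w. (R w powr (1 - q) * indicator {x<..} (\<tau> * R w powr q)) *\<^sub>R (indicator {0<..} x *\<^sub>R ?k x)) =
     (Mean w. R w powr (1 - q) * indicator {x<..} (\<tau> * R w powr q)) *\<^sub>R (indicator {0<..} x *\<^sub>R ?k x)"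
    by (intro integral_scaleR_left)
  qed simp
  then show "(Mean w. F w x) = (indicator {0<..} x * tail_part \<tau> x) *\<^sub>R ?k x" by simp
 qed
 finally show ?thesis .
qed

text \<open>Uniform in \<tau>, so that it can serve as majorant when \<tau> is a random section
  volume.\<close>

lemma stable_moment_bound: "\<exists>C>0. \<forall>\<tau>>0. norm (stable_moment \<theta> \<tau>) \<le> C * \<tau> powr p"
proof -
 obtain C where C: "C > 0" "\<And>\<tau> x. \<tau> > 0 \<Longrightarrow> x > 0 \<Longrightarrow> tail_part \<tau> x \<le> C * \<tau> powr p * x powr (- p)"
  using tail_part_le by blast
 define I where "I = (Leb x. norm (indicator {0<..} x *\<^sub>R stable_kernel p \<theta> x))"
 have I0: "0 \<le> I" unfolding I_def by simp
 \<comment> \<open>The summand 1 keeps the constant positive also for \<theta> = 0.\<close>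
 have "norm (stable_moment \<theta> \<tau>) \<le> (C * \<bar>\<theta>\<bar> * I + 1) * \<tau> powr p" if \<tau>: "\<tau> > 0" for \<tau>
 proof -
  have "norm (stable_moment \<theta> \<tau>) \<le> (Leb x. norm ((indicator {0<..} x * tail_part \<tau> x) *\<^sub>R (\<i> * of_real \<theta> * (iexp (\<theta> * x) - 1))))"
   unfolding stable_moment_eq[OF \<tau>] by (rule integral_norm_bound)
  also have "\<dots> \<le> (Leb x. C * \<tau> powr p * \<bar>\<theta>\<bar> * norm (indicator {0<..} x *\<^sub>R stable_kernel p \<theta> x))"
  proof (rule integral_mono')
   show "integrable lborel (\<lambda>x. C * \<tau> powr p * \<bar>\<theta>\<bar> * norm (indicator {0<..} x *\<^sub>R stable_kernel p \<theta> x))"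
    by (intro integrable_mult_right integrable_norm stable_kernel_integrable p12)
   fix x :: real
   show "norm ((indicator {0<..} x * tail_part \<tau> x) *\<^sub>R (\<i> * of_real \<theta> * (iexp (\<theta> * x) - 1))) \<le>
     C * \<tau> powr p * \<bar>\<theta>\<bar> * norm (indicator {0<..} x *\<^sub>R stable_kernel p \<theta> x)"
   proof (cases "0 < x")
    case True
    have "norm ((indicator {0<..} x * tail_part \<tau> x) *\<^sub>R (\<i> * of_real \<theta> * (iexp (\<theta> * x) - 1))) =
      tail_part \<tau> x * (\<bar>\<theta>\<bar> * norm (iexp (\<theta> * x) - 1))"
     using True tail_part_nonneg[of \<tau> x] by (simp add: norm_mult)
    also have "\<dots> \<le> (C * \<tau> powr p * x powr (- p)) * (\<bar>\<theta>\<bar> * norm (iexp (\<theta> * x) - 1))"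
     by (intro mult_right_mono C \<tau> True) simp
    finally show ?thesis using True by (simp add: stable_kernel_def norm_mult mult_ac)
   qed simp
   show "0 \<le> C * \<tau> powr p * \<bar>\<theta>\<bar> * norm (indicator {0<..} x *\<^sub>R stable_kernel p \<theta> x)"
    using C(1) by simp
  qed
  also have "\<dots> = C * \<tau> powr p * \<bar>\<theta>\<bar> * I" unfolding I_def by simp
  also have "\<dots> \<le> (C * \<bar>\<theta>\<bar> * I + 1) * \<tau> powr p" by (simp add: algebra_simps)
  finally show ?thesis .
 qed
 moreover have "C * \<bar>\<theta>\<bar> * I + 1 > 0" using C(1) I0 by (intro add_nonneg_pos) auto
 ultimately show ?thesis by blast
qed

text \<open>The exponent of the limit law per unit of window volume and unit section moment.\<close>

definition stable_constant :: "real \<Rightarrow> complex" where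
 "stable_constant \<theta> = \<i> * of_real (c * \<alpha> / (q * p)) * of_real \<theta> * (Leb x. indicator {0<..} x *\<^sub>R stable_kernel p \<theta> x)"

text \<open>Dominated convergence in the layer cake form: l^p times the tail part at scale 1 / l
  tends to a multiple of x^(-p), and the uniform tail bound makes the stable kernel the
  majorant.\<close>

lemma stable_moment_limit:
 "((\<lambda>l. of_real (l powr p) * stable_moment \<theta> (1 / l)) \<longlongrightarrow> stable_constant \<theta>) at_top"
proof -
 obtain C where C: "C > 0" "\<And>\<tau> x. \<tau> > 0 \<Longrightarrow> x > 0 \<Longrightarrow> tail_part \<tau> x \<le> C * \<tau> powr p * x powr (- p)"
  using tail_part_le by blast
 let ?k = "\<lambda>x. \<i> * of_real \<theta> * (iexp (\<theta> * x) - 1)"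
 define c' where "c' = c * \<alpha> / (q * p)"
 have "((\<lambda>l. \<integral>x. (indicator {0<..} x * (l powr p * tail_part (1 / l) x)) *\<^sub>R ?k x \<partial>lborel) \<longlongrightarrow>
   (Leb x. (indicator {0<..} x * (c' * x powr (- p))) *\<^sub>R ?k x)) at_top"
 proof (rule integral_dominated_convergence_at_top[where w="\<lambda>x. C * \<bar>\<theta>\<bar> * norm (indicator {0<..} x *\<^sub>R stable_kernel p \<theta> x)"])
  show "integrable lborel (\<lambda>x. C * \<bar>\<theta>\<bar> * norm (indicator {0<..} x *\<^sub>R stable_kernel p \<theta> x))"
   by (intro integrable_mult_right integrable_norm stable_kernel_integrable p12)
  show "AE x in lborel. ((\<lambda>l. (indicator {0<..} x * (l powr p * tail_part (1 / l) x)) *\<^sub>R ?k x) \<longlongrightarrow> (indicator {0<..} x * (c' * x powr (- p))) *\<^sub>R ?k x) at_top"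
  proof (rule AE_I2)
   fix x :: real
   show "((\<lambda>l. (indicator {0<..} x * (l powr p * tail_part (1 / l) x)) *\<^sub>R ?k x) \<longlongrightarrow> (indicator {0<..} x * (c' * x powr (- p))) *\<^sub>R ?k x) at_top"
   proof (cases "0 < x")
    case True
    show ?thesis
     by (intro tendsto_scaleR tendsto_mult tendsto_const tail_part_limit[OF True, folded c'_def])
   qed simp
  qed
  show "\<forall>\<^sub>F l in at_top. AE x in lborel. norm ((indicator {0<..} x * (l powr p * tail_part (1 / l) x)) *\<^sub>R ?k x) \<le> C * \<bar>\<theta>\<bar> * norm (indicator {0<..} x *\<^sub>R stable_kernel p \<theta> x)"
  proof (intro eventually_mono[OF eventually_gt_at_top[of 0]] AE_I2)
   fix l x :: real assume l: "0 < l"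
   show "norm ((indicator {0<..} x * (l powr p * tail_part (1 / l) x)) *\<^sub>R ?k x) \<le> C * \<bar>\<theta>\<bar> * norm (indicator {0<..} x *\<^sub>R stable_kernel p \<theta> x)"
   proof (cases "0 < x")
    case True
    have "l powr p * tail_part (1 / l) x \<le> l powr p * (C * (1 / l) powr p * x powr (- p))"
     using l by (intro mult_left_mono C True) auto
    also have "\<dots> = C * x powr (- p)" using l by (simp add: powr_divide)
    finally have "(l powr p * tail_part (1 / l) x) * norm (?k x) \<le> (C * x powr (- p)) * norm (?k x)"
     by (intro mult_right_mono) auto
    then show ?thesis using True tail_part_nonneg[of "1 / l" x]
     by (simp add: stable_kernel_def norm_mult mult_ac)
   qed simp
  qed
 qed auto
 also have "(Leb x. (indicator {0<..} x * (c' * x powr (- p))) *\<^sub>R ?k x) = stable_constant \<theta>"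
 proof -
  have eq: "(indicator {0<..} x * (c' * x powr (- p))) *\<^sub>R ?k x = (\<i> * of_real c' * of_real \<theta>) * (indicator {0<..} x *\<^sub>R stable_kernel p \<theta> x)" for x
   by (simp add: stable_kernel_def scaleR_conv_of_real algebra_simps)
  show ?thesis unfolding eq stable_constant_def c'_def[symmetric] by (simp only: integral_mult_right_zero)
 qed
 finally show ?thesis
 proof (rule Lim_transform_eventually, intro eventually_mono[OF eventually_gt_at_top[of 0]])
  fix l :: real assume l: "0 < l"
  have "of_real (l powr p) * stable_moment \<theta> (1 / l) = (Leb x. of_real (l powr p) * ((indicator {0<..} x * tail_part (1 / l) x) *\<^sub>R ?k x))"
   using l by (simp only: stable_moment_eq divide_pos_pos zero_less_one integral_mult_right_zero)
  also have "\<dots> = (Leb x. (indicator {0<..} x * (l powr p * tail_part (1 / l) x)) *\<^sub>R ?k x)"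
   by (intro Bochner_integral_cong refl) (simp add: scaleR_conv_of_real)
  finally show "(Leb x. (indicator {0<..} x * (l powr p * tail_part (1 / l) x)) *\<^sub>R ?k x) = of_real (l powr p) * stable_moment \<theta> (1 / l)" ..
 qed
qed

end

subsection \<open>The scaled grain model\<close>


lemma emeasure_lborel_reflect:
 fixes F :: "'a::euclidean_space set"
 assumes [measurable]: "F \<in> sets borel"
 shows "emeasure lborel {x. a - x \<in> F} = emeasure lborel F"
proof -
 have "emeasure lborel F = emeasure (density (distr lborel borel (\<lambda>x :: 'a. a + (-1) *\<^sub>R x)) (\<lambda>_. ennreal (\<bar>-1\<bar> ^ DIM('a)))) F"
  by (subst lborel_affine[of "-1" a, symmetric]) auto
 also have "\<dots> = emeasure (distr lborel borel (\<lambda>x. a - x)) F"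
  by (simp add: emeasure_density)
 finally show ?thesis by (simp add: emeasure_distr vimage_def)
qed

lemma nn_integral_lborel_prod_swap:
 fixes f :: "'a::euclidean_space \<times> 'b::euclidean_space \<Rightarrow> ennreal"
 assumes "f \<in> borel_measurable lborel"
 shows "(nLeb x. f x) = (nLeb s. (nLeb v. f (v, s)))"
proof -
 have "f \<in> borel_measurable (lborel \<Otimes>\<^sub>M lborel)" using assms by (simp only: lborel_prod)
 then show ?thesis
  unfolding lborel_prod[symmetric] by (rule lborel_pair.nn_integral_snd[symmetric])
qed

locale scaled_grain_model = regularly_varying_tail M R \<alpha> c
 for M :: "'w measure" and R \<alpha> c +
 fixes u :: "nat \<Rightarrow> 'w \<Rightarrow> 'a::euclidean_space \<times> 'b::euclidean_space"
  and Xi0 Xi :: "'w \<Rightarrow> ('a \<times> 'b) set" and Xis :: "nat \<Rightarrow> 'w \<Rightarrow> ('a \<times> 'b) set"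
  and \<nu>\<^sub>0 \<nu> :: real
 assumes nu: "\<nu>\<^sub>0 = real DIM('a)" "\<nu> = real (DIM('a) + DIM('b))"
  and Xi: "Xi = (\<lambda>\<omega>. (\<lambda>t. (R \<omega> powr (1 / \<nu>)) *\<^sub>R t) ` Xi0 \<omega>)"
  and \<alpha>12: "1 < \<alpha>" "\<alpha> < 2"
  and Xi0_closed [measurable]: "Xi0 \<in> measurable M fell_borel"
  and Xi0_ball: "AE \<omega> in M. Xi0 \<omega> \<subseteq> {t. norm t \<le> 1}"
  and Xi0_pos: "AE \<omega> in M. 0 < emeasure lborel (Xi0 \<omega>)"
  and indep: "independent_rvs M borel R fell_borel Xi0"
  and model: "boolean_model M u Xi Xis"
begin

definition q :: real where "q = \<nu>\<^sub>0 / \<nu>"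

lemma nu_pos: "0 < \<nu>\<^sub>0" "0 < \<nu>" "\<nu>\<^sub>0 < \<nu>"
 using DIM_positive[where 'a='a] DIM_positive[where 'a='b] by (simp_all add: nu add_pos_pos)

lemma q01: "0 < q" "q < 1"
 using nu_pos by (auto simp: q_def)

definition rad :: "'w \<Rightarrow> real" where "rad w = R w powr (1 / \<nu>)"

lemma rad_meas [measurable]: "rad \<in> borel_measurable M"
 unfolding rad_def[abs_def] by measurable

lemma rad_nonneg: "0 \<le> rad w" by (simp add: rad_def)

text \<open>The linear scale is R^(1/\<nu>), so volumes in the whole space, in the hyperplane and in
  the complementary directions scale as R, R^q and R^(1-q). The moment conditions below come from
  these powers.\<close>

lemma rad_power:
 assumes "0 < R w"
 shows "0 < rad w" "rad w ^ (DIM('a) + DIM('b)) = R w" "rad w ^ DIM('a) = R w powr q" "rad w ^ DIM('b) = R w powr (1 - q)"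
proof -
 show r: "0 < rad w" using assms by (simp add: rad_def)
 have p: "rad w ^ n = R w powr (real n / \<nu>)" for n
  using r assms by (simp add: rad_def powr_powr flip: powr_realpow)
 show "rad w ^ (DIM('a) + DIM('b)) = R w"   proof -
  have "real (DIM('a) + DIM('b)) / \<nu> = 1" unfolding nu(2)[symmetric] using nu_pos by simp
  then show ?thesis unfolding p using assms by simp
 qed
 show "rad w ^ DIM('a) = R w powr q" unfolding p q_def by (simp only: nu(1))
 have bb: "real DIM('b) = \<nu> - \<nu>\<^sub>0" by (simp add: nu)
 have "real DIM('b) / \<nu> = 1 - q" unfolding bb q_def using nu_pos by (simp add: diff_divide_distrib)
 then show "rad w ^ DIM('b) = R w powr (1 - q)" unfolding p by simp
qed

lemma Xi_meas [measurable]: "Xi \<in> measurable M fell_borel"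
 using model by (auto simp: boolean_model_def)

lemma Xis_meas [measurable]: "Xis j \<in> measurable M fell_borel"
 using model by (auto simp: boolean_model_def)

lemma u_meas [measurable]: "u j \<in> borel_measurable M"
 using model by (auto simp: boolean_model_def unit_poisson_process_def)

lemma closed_Xi: "w \<in> space M \<Longrightarrow> closed (Xi w)"
 using measurable_space[OF Xi_meas, of w] by simp

lemma closed_Xi0: "w \<in> space M \<Longrightarrow> closed (Xi0 w)"
 using measurable_space[OF Xi0_closed, of w] by simp

lemma mem_Xi_iff: "0 < R w \<Longrightarrow> y \<in> Xi w \<longleftrightarrow> y /\<^sub>R rad w \<in> Xi0 w"
 unfolding Xi rad_def[symmetric] using rad_power(1)[of w] by (subst scaleR_image_eq_vimage) auto

definition m :: "(('a \<times> 'b) \<times> ('a \<times> 'b) set) measure" where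
 "m = lborel \<Otimes>\<^sub>M distr M fell_borel Xi"

definition e :: "nat \<Rightarrow> 'w \<Rightarrow> ('a \<times> 'b) \<times> ('a \<times> 'b) set" where
 "e j w = (u j w, Xis j w)"

text \<open>The marks (u, F) whose translate u + F contains (t, 0). The closedness conjunct keeps
  the set inside the space of the intensity measure.\<close>

definition C :: "'a \<Rightarrow> (('a \<times> 'b) \<times> ('a \<times> 'b) set) set" where
 "C t = {x. closed (snd x) \<and> (t, 0) - fst x \<in> snd x}"

lemma sets_m [measurable_cong]: "sets m = sets (borel \<Otimes>\<^sub>M fell_borel)"
 unfolding m_def by (intro sets_pair_measure_cong) auto

lemma space_m: "space m = UNIV \<times> {F. closed F}"
 by (simp add: m_def space_pair_measure)

lemma mem_meas [measurable (raw)]: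
 assumes [measurable]: "f \<in> borel_measurable N" "g \<in> measurable N fell_borel"
 shows "Measurable.pred N (\<lambda>x. (f x :: 'z::euclidean_space) \<in> g x)"
 using measurable_compose[OF _ pred_mem_fell, of "\<lambda>x. (f x, g x)" N] by simp

lemma nn_integral_m:
 fixes f :: "('a \<times> 'b) \<times> ('a \<times> 'b) set \<Rightarrow> ennreal"
 assumes [measurable]: "f \<in> borel_measurable (borel \<Otimes>\<^sub>M fell_borel)"
 shows "(\<integral>\<^sup>+x. f x \<partial>m) = (nMean w. (nLeb x. f (x, Xi w)))"
proof -
 interpret Q: prob_space "distr M fell_borel Xi" by (rule prob_space_distr) measurable
 interpret P: pair_sigma_finite "lborel :: ('a \<times> 'b) measure" "distr M fell_borel Xi" ..
 have "(\<integral>\<^sup>+x. f x \<partial>m) = (\<integral>\<^sup>+F. (nLeb x. f (x, F)) \<partial>distr M fell_borel Xi)"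
  unfolding m_def by (rule P.nn_integral_snd[symmetric]) (simp add: split_beta')
 also have "\<dots> = (nMean w. (nLeb x. f (x, Xi w)))"
  by (subst nn_integral_distr) auto
 finally show ?thesis .
qed

lemma integral_m:
 fixes f :: "('a \<times> 'b) \<times> ('a \<times> 'b) set \<Rightarrow> complex"
 assumes "integrable m f"
 shows "(\<integral>x. f x \<partial>m) = (Mean w. (Leb x. f (x, Xi w)))"
proof -
 interpret Q: prob_space "distr M fell_borel Xi" by (rule prob_space_distr) measurable
 interpret P: pair_sigma_finite "lborel :: ('a \<times> 'b) measure" "distr M fell_borel Xi" ..
 have i: "integrable (lborel \<Otimes>\<^sub>M distr M fell_borel Xi) f" using assms by (simp add: m_def)
 have [measurable]: "f \<in> borel_measurable (borel \<Otimes>\<^sub>M fell_borel)"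
  using borel_measurable_integrable[OF assms] by (simp cong: measurable_cong_sets add: sets_m)
 have "(\<integral>x. f x \<partial>m) = (\<integral>F. (Leb x. f (x, F)) \<partial>distr M fell_borel Xi)"
  unfolding m_def using P.integral_snd[of "\<lambda>x F. f (x, F)"] i by simp
 also have "\<dots> = (Mean w. (Leb x. f (x, Xi w)))"
  by (subst integral_distr) auto
 finally show ?thesis .
qed

lemma emeasure_m:
 assumes [measurable]: "Measurable.pred (borel \<Otimes>\<^sub>M fell_borel) (\<lambda>x. x \<in> A)" and A: "A \<subseteq> space m"
 shows "emeasure m A = (nMean w. emeasure lborel {x. (x, Xi w) \<in> A})"
proof -
 have "{x \<in> space m. x \<in> A} \<in> sets m" unfolding sets_m
  by (subst sets_eq_imp_space_eq[OF sets_m]) measurable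
 moreover have "{x \<in> space m. x \<in> A} = A" using A by auto
 ultimately have "A \<in> sets m" by simp
 then have "emeasure m A = (\<integral>\<^sup>+x. indicator A x \<partial>m)" by simp
 also have "\<dots> = (nMean w. (nLeb x. indicator A (x, Xi w)))"
  by (rule nn_integral_m) measurable
 also have "\<dots> = (nMean w. emeasure lborel {x. (x, Xi w) \<in> A})"
 proof (rule nn_integral_cong)
  fix w assume [measurable]: "w \<in> space M"
  have "Measurable.pred borel (\<lambda>x. (x, Xi w) \<in> A)"
   using measurable_compose[OF _ assms(1), of "\<lambda>x. (x, Xi w)" borel] by measurable
  then have "{x. (x, Xi w) \<in> A} \<in> sets lborel" by (simp add: pred_def)
  moreover have "(nLeb x. indicator A (x, Xi w)) = (nLeb x. indicator {x. (x, Xi w) \<in> A} x)"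
   by (intro nn_integral_cong) (auto split: split_indicator)
  ultimately show "(nLeb x. indicator A (x, Xi w)) = emeasure lborel {x. (x, Xi w) \<in> A}" by simp
 qed
 finally show ?thesis .
qed

lemma pred_C_fell: "Measurable.pred (borel \<Otimes>\<^sub>M (borel \<Otimes>\<^sub>M fell_borel)) (\<lambda>p. snd p \<in> C (fst p))"
proof -
 have "(\<lambda>p :: 'a \<times> ('a \<times> 'b) \<times> ('a \<times> 'b) set. ((fst p, 0) - fst (snd p), snd (snd p))) \<in> measurable (borel \<Otimes>\<^sub>M (borel \<Otimes>\<^sub>M fell_borel)) (borel \<Otimes>\<^sub>M fell_borel)"
  by measurable
 from measurable_compose[OF this pred_mem_fell]
 have "Measurable.pred (borel \<Otimes>\<^sub>M (borel \<Otimes>\<^sub>M fell_borel)) (\<lambda>p :: 'a \<times> ('a \<times> 'b) \<times> ('a \<times> 'b) set. (fst p, 0) - fst (snd p) \<in> snd (snd p))"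
  by simp
 then show ?thesis
  by (rule measurable_cong[THEN iffD1, rotated]) (auto simp: C_def space_pair_measure)
qed

lemma pred_C_slice [measurable]: "Measurable.pred (borel \<Otimes>\<^sub>M fell_borel) (\<lambda>x. x \<in> C t)"
 using measurable_compose[OF _ pred_C_fell, of "\<lambda>x. (t, x)" "borel \<Otimes>\<^sub>M fell_borel"] by simp

definition \<mu> :: real where "\<mu> = mean_volume M Xi"

definition \<rho> :: "'a \<Rightarrow> real" where "\<rho> w = measure m (C w \<inter> C 0)"

lemma emeasure_Xi_meas [measurable]: "(\<lambda>w. emeasure lborel (Xi w)) \<in> borel_measurable M"
proof -
 have "(\<lambda>w. \<integral>\<^sup>+x. indicator {p. fst p \<in> snd p} (x, Xi w) \<partial>lborel) \<in> borel_measurable M"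
  by measurable
 moreover have "(nLeb x. indicator {p. fst p \<in> snd p} (x, Xi w)) = emeasure lborel (Xi w)" if "w \<in> space M" for w
 proof -
  have "(nLeb x. indicator {p. fst p \<in> snd p} (x, Xi w)) = (nLeb x. indicator (Xi w) x)"
   by (intro nn_integral_cong) (auto split: split_indicator)
  then show ?thesis using closed_Xi[OF that] by simp
 qed
 ultimately show ?thesis by (simp cong: measurable_cong)
qed

lemma mu_eq: "(nMean w. emeasure lborel (Xi w)) = ennreal \<mu>" "0 \<le> \<mu>"
proof -
 have fin: "(nMean w. emeasure lborel (Xi w)) \<noteq> \<infinity>"
  using model by (auto simp: boolean_model_def)
 have "\<mu> = enn2real (nMean w. ennreal (measure lborel (Xi w)))"
  unfolding \<mu>_def mean_volume_def
 proof (rule integral_eq_nn_integral)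
  have "(\<lambda>w. enn2real (emeasure lborel (Xi w))) \<in> borel_measurable M" by measurable
  then show "(\<lambda>w. measure lborel (Xi w)) \<in> borel_measurable M" by (simp add: measure_def)
 qed simp
 also have "(nMean w. ennreal (measure lborel (Xi w))) = (nMean w. emeasure lborel (Xi w))"
 proof (rule nn_integral_cong_AE)
  have "AE w in M. emeasure lborel (Xi w) \<noteq> \<infinity>"
   by (rule nn_integral_PInf_AE[OF _ fin]) measurable
  then show "AE w in M. ennreal (measure lborel (Xi w)) = emeasure lborel (Xi w)"
   by eventually_elim (simp add: emeasure_eq_ennreal_measure)
 qed
 finally show "(nMean w. emeasure lborel (Xi w)) = ennreal \<mu>" using fin by (simp add: less_top)
 show "0 \<le> \<mu>" by (simp add: \<mu>_def mean_volume_def)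
qed

lemma C_subset': "C t \<subseteq> space m" by (auto simp: C_def space_m)

lemma emeasure_C': "emeasure m (C t) = ennreal \<mu>"
proof -
 have "emeasure m (C t) = (nMean z. emeasure lborel {x. (x, Xi z) \<in> C t})"
  by (rule emeasure_m[OF pred_C_slice C_subset'])
 also have "\<dots> = (nMean z. emeasure lborel (Xi z))"
 proof (rule nn_integral_cong)
  fix z assume w: "z \<in> space M"
  have "{x. (x, Xi z) \<in> C t} = {x. (t, 0) - x \<in> Xi z}" using closed_Xi[OF w] by (auto simp: C_def)
  then show "emeasure lborel {x. (x, Xi z) \<in> C t} = emeasure lborel (Xi z)"
   using closed_Xi[OF w] by (simp add: emeasure_lborel_reflect)
 qed
 finally show ?thesis by (simp add: mu_eq)
qed

text \<open>Translating the grain position by (s, 0) shows dependence on t - s alone, which is the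
  stationarity that \<open>poisson_cover\<close> asks for.\<close>

lemma emeasure_C_Int_eq:
 "emeasure m (C t \<inter> C s) = (nMean z. emeasure lborel {x. (t - s, 0) - x \<in> Xi z \<and> (0, 0) - x \<in> Xi z})"
proof -
 have "emeasure m (C t \<inter> C s) = (nMean z. emeasure lborel {x. (x, Xi z) \<in> C t \<inter> C s})"
 proof (rule emeasure_m)
  show "Measurable.pred (borel \<Otimes>\<^sub>M fell_borel) (\<lambda>x. x \<in> C t \<inter> C s)" unfolding Int_iff by measurable
 qed (use C_subset'[of t] in auto)
 also have "\<dots> = (nMean z. emeasure lborel {x. (t - s, 0) - x \<in> Xi z \<and> (0, 0) - x \<in> Xi z})"
 proof (rule nn_integral_cong)
  fix z assume w: "z \<in> space M"
  have [measurable]: "Xi z \<in> sets borel" using closed_Xi[OF w] by simp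
  let ?S = "{x. (t, 0) - x \<in> Xi z \<and> (s, 0) - x \<in> Xi z}"
  have "{x. (x, Xi z) \<in> C t \<inter> C s} = ?S" using closed_Xi[OF w] by (auto simp: C_def)
  moreover have "{x. (t - s, 0) - x \<in> Xi z \<and> (0, 0) - x \<in> Xi z} = {x. x + (s, 0) \<in> ?S}"
   by (auto simp: algebra_simps)
  moreover have "?S \<in> sets borel" by measurable
  ultimately show "emeasure lborel {x. (x, Xi z) \<in> C t \<inter> C s} =
    emeasure lborel {x. (t - s, 0) - x \<in> Xi z \<and> (0, 0) - x \<in> Xi z}"
   using emeasure_lborel_translate[of ?S "(s, 0)"] by simp
 qed
 finally show ?thesis .
qed

lemma emeasure_C_Int': "emeasure m (C t \<inter> C s) = ennreal (\<rho> (t - s))"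
proof -
 have e: "emeasure m (C t \<inter> C s) = emeasure m (C (t - s) \<inter> C 0)"
  unfolding emeasure_C_Int_eq by simp
 have "emeasure m (C (t - s) \<inter> C 0) \<le> emeasure m (C 0)"
 proof (rule emeasure_mono)
  have "{x \<in> space m. x \<in> C 0} \<in> sets m" unfolding sets_m
   by (subst sets_eq_imp_space_eq[OF sets_m]) measurable
  moreover have "{x \<in> space m. x \<in> C 0} = C 0" using C_subset' by auto
  ultimately show "C 0 \<in> sets m" by simp
 qed simp
 then have "emeasure m (C (t - s) \<inter> C 0) < top"
  unfolding emeasure_C' by (rule le_less_trans) simp
 then have "emeasure m (C (t - s) \<inter> C 0) \<noteq> top" by simp
 then show ?thesis unfolding e \<rho>_def by (simp add: emeasure_eq_ennreal_measure)
qed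

sublocale poisson_cover M m e C \<mu> \<rho>
proof (intro poisson_cover.intro poisson_cover_axioms.intro)
 show "poisson_points M m e"
  using boolean_model_poisson_points[OF model] by (simp add: m_def e_def[abs_def])
 then interpret pp: poisson_points M m e .
 have mc: "sets (borel \<Otimes>\<^sub>M m) = sets (borel \<Otimes>\<^sub>M (borel \<Otimes>\<^sub>M fell_borel))"
  by (intro sets_pair_measure_cong sets_m) simp
 show pC: "Measurable.pred (borel \<Otimes>\<^sub>M m) (\<lambda>p. snd p \<in> C (fst p))"
  using pred_C_fell by (simp cong: measurable_cong_sets add: mc)
 have pC2: "Measurable.pred (borel \<Otimes>\<^sub>M m) (\<lambda>p. snd p \<in> C (fst p) \<inter> C 0)"
 proof -
  have "Measurable.pred (borel \<Otimes>\<^sub>M (borel \<Otimes>\<^sub>M fell_borel)) (\<lambda>p. snd p \<in> C (fst p) \<inter> C 0)"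
   unfolding Int_iff
   by (intro pred_intros_logic pred_C_fell measurable_compose[OF measurable_snd pred_C_slice])
  then show ?thesis by (simp cong: measurable_cong_sets add: mc)
 qed
 have "(\<lambda>w. \<integral>\<^sup>+x. indicator {p. snd p \<in> C (fst p) \<inter> C 0} (w, x) \<partial>m) \<in> borel_measurable borel"
  using pC2 by measurable
 moreover have "(\<integral>\<^sup>+x. indicator {p. snd p \<in> C (fst p) \<inter> C 0} (w, x) \<partial>m) = ennreal (\<rho> w)" for w
 proof -
  have "(\<integral>\<^sup>+x. indicator {p. snd p \<in> C (fst p) \<inter> C 0} (w, x) \<partial>m) = (\<integral>\<^sup>+x. indicator (C w \<inter> C 0) x \<partial>m)"
   by (intro nn_integral_cong) (auto split: split_indicator)
  also have "\<dots> = emeasure m (C w \<inter> C 0)"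
  proof (rule nn_integral_indicator)
   have "{x \<in> space m. x \<in> C w \<inter> C 0} \<in> sets m" unfolding sets_m Int_iff
    by (subst sets_eq_imp_space_eq[OF sets_m]) measurable
   moreover have "{x \<in> space m. x \<in> C w \<inter> C 0} = C w \<inter> C 0" using C_subset' by auto
   ultimately show "C w \<inter> C 0 \<in> sets m" by (simp only:)
  qed
  finally show ?thesis using emeasure_C_Int'[of w 0] by simp
 qed
 ultimately have "(\<lambda>w. enn2real (ennreal (\<rho> w))) \<in> borel_measurable borel" by simp
 moreover have "(\<lambda>w. enn2real (ennreal (\<rho> w))) = \<rho>" by (simp add: fun_eq_iff \<rho>_def)
 ultimately show "\<rho> \<in> borel_measurable borel" by (simp only:)
qed (auto simp: mu_eq emeasure_C' emeasure_C_Int' C_subset'[THEN subsetD] \<rho>_def)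

section \<open>Decay of the two-point function and its integral\<close>

lemma AE_grain:
 "AE w in M. w \<in> space M \<and> 0 < R w \<and> Xi0 w \<subseteq> {t. norm t \<le> 1} \<and> 0 < emeasure lborel (Xi0 w)"
 using AE_space R_pos Xi0_ball Xi0_pos by eventually_elim auto

lemma Xi_subset:
 assumes "0 < R w" "Xi0 w \<subseteq> {t. norm t \<le> 1}" "y \<in> Xi w"
 shows "norm y \<le> rad w"
proof -
 have "norm (y /\<^sub>R rad w) \<le> 1" using assms mem_Xi_iff by blast
 then show ?thesis using rad_power(1)[OF assms(1)] by (simp add: field_simps)
qed

lemma emeasure_ball_rad:
 assumes "0 < R w"
 shows "emeasure lborel (cball (0 :: 'a \<times> 'b) (rad w)) = ennreal (unit_ball_vol (real (DIM('a) + DIM('b))) * R w)"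
 using emeasure_cball[OF rad_nonneg, where 'a="'a \<times> 'b"] rad_power(2)[OF assms] by simp

text \<open>A grain containing two points at distance norm w has radius at least half of it, so R
  exceeds a multiple of the power \<nu> of norm w, while the admissible positions fill at most a
  ball of volume proportional to R. The tail moment E(R; R > x), of order x^(1-\<alpha>), gives the
  rate.\<close>

lemma rho_bound:
 "\<exists>K>0. \<forall>w. w \<noteq> 0 \<longrightarrow> \<rho> w \<le> K * norm w powr (- (\<nu> * (\<alpha> - 1)))"
proof -
 define V where "V = unit_ball_vol (real (DIM('a) + DIM('b)))"
 have V: "V > 0" unfolding V_def by simp
 obtain C where C: "C > 0" "\<And>x. x > 0 \<Longrightarrow>
   (nMean v. ennreal (R v powr 1) * indicator {x<..} (R v)) \<le> ennreal (C * x powr (1 - \<alpha>))"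
  using nn_integral_powr_tail_bound[of 1] \<alpha>12 by auto
 define K where "K = V * C * (1 / (4 powr \<nu>)) powr (1 - \<alpha>)"
 have K: "K > 0" using V C(1) by (simp add: K_def)
 have "\<rho> w \<le> K * norm w powr (- (\<nu> * (\<alpha> - 1)))" if w: "w \<noteq> 0" for w
 proof -
  \<comment> \<open>A quarter of the distance instead of a half makes the resulting bound on R
    strict, as the indicator of \<open>{x<..}\<close> demands.\<close>
  define x where "x = (norm w / 4) powr \<nu>"
  have x: "x > 0" using w by (simp add: x_def)
  have "ennreal (\<rho> w) = (nMean v. emeasure lborel {x. (w, 0) - x \<in> Xi v \<and> (0, 0) - x \<in> Xi v})"
   using emeasure_C_Int'[of w 0] emeasure_C_Int_eq[of w 0] by simp
  also have "\<dots> \<le> (nMean v. ennreal V * (ennreal (R v powr 1) * indicator {x<..} (R v)))"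
  proof (rule nn_integral_mono_AE)
   show "AE v in M. emeasure lborel {x. (w, 0) - x \<in> Xi v \<and> (0, 0) - x \<in> Xi v} \<le> ennreal V * (ennreal (R v powr 1) * indicator {x<..} (R v))"
    using AE_grain
   proof eventually_elim
    case (elim v)
    let ?A = "{x. (w, 0) - x \<in> Xi v \<and> (0, 0) - x \<in> Xi v}"
    show ?case
    proof (cases "?A = {}")
     case False
     then obtain z where z: "(w, 0) - z \<in> Xi v" "(0, 0) - z \<in> Xi v" by auto
     have "norm w = norm ((w, 0 :: 'b))" by (simp add: norm_Pair)
     also have "\<dots> = norm (((w, 0) - z) - ((0, 0) - z))" by simp
     also have "\<dots> \<le> norm ((w, 0) - z) + norm ((0, 0) - z)" by (rule norm_triangle_ineq4)
     also have "\<dots> \<le> rad v + rad v" using elim z by (intro add_mono Xi_subset) auto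
     finally have "norm w \<le> rad v + rad v" .
     moreover have "0 < norm w" using w by simp
     ultimately have "norm w / 4 < rad v" by linarith
     then have "x < rad v powr \<nu>" unfolding x_def using nu_pos by (intro powr_less_mono2) auto
     then have "x < R v" using elim nu_pos by (simp add: rad_def powr_powr)
     have "?A \<subseteq> cball 0 (rad v)"
     proof
      fix y assume "y \<in> ?A"
      then have "norm ((0, 0) - y) \<le> rad v" using elim Xi_subset by blast
      then show "y \<in> cball 0 (rad v)" by (simp flip: zero_prod_def)
     qed
     then have "emeasure lborel ?A \<le> emeasure lborel (cball (0 :: 'a \<times> 'b) (rad v))"
      by (intro emeasure_mono) auto
     also have "\<dots> = ennreal V * (ennreal (R v powr 1) * indicator {x<..} (R v))"
      using elim \<open>x < R v\<close> V by (subst emeasure_ball_rad) (auto simp: V_def ennreal_mult)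
     finally show ?thesis .
    next
     case True
     then show ?thesis by (simp only: emeasure_empty zero_le)
    qed
   qed
  qed
  also have "\<dots> \<le> ennreal V * ennreal (C * x powr (1 - \<alpha>))"
   by (subst nn_integral_cmult, measurable) (intro mult_left_mono C x, simp)
  also have "\<dots> = ennreal (K * norm w powr (- (\<nu> * (\<alpha> - 1))))"
  proof -
   have "x = norm w powr \<nu> * (1 / (4 powr \<nu>))" by (simp add: x_def powr_divide)
   then have "x powr (1 - \<alpha>) = (norm w powr \<nu>) powr (1 - \<alpha>) * (1 / (4 powr \<nu>)) powr (1 - \<alpha>)"
    by (simp only: powr_mult)
   also have "(norm w powr \<nu>) powr (1 - \<alpha>) = norm w powr (- (\<nu> * (\<alpha> - 1)))"
    by (simp add: powr_powr algebra_simps)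
   finally show ?thesis using V C(1) by (simp add: K_def mult_ac flip: ennreal_mult)
  qed
  finally show ?thesis using K by (simp add: ennreal_le_iff)
 qed
 then show ?thesis using K by blast
qed

text \<open>Extended valued, so that Tonelli applies before sections are known to be finite.\<close>

definition section_em :: "'w \<Rightarrow> 'b \<Rightarrow> ennreal" where
 "section_em z s = emeasure lborel {w. (w, s) \<in> Xi z}"

lemma sets_section [measurable]: "z \<in> space M \<Longrightarrow> {w. (w, s) \<in> Xi z} \<in> sets borel"
proof -
 assume "z \<in> space M"
 then have [measurable]: "Xi z \<in> sets borel" using closed_Xi by simp
 have "(\<lambda>w :: 'a. (w, s)) -` Xi z \<inter> space borel \<in> sets borel"
  by (rule measurable_sets[of _ _ borel]) measurable
 then show ?thesis by (simp add: vimage_def)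
qed

lemma section_em_eq: "z \<in> space M \<Longrightarrow> section_em z s = (nLeb w. indicator {p. fst p \<in> snd p} ((w, s), Xi z))"
proof -
 assume w: "z \<in> space M"
 have "(nLeb w. indicator {p. fst p \<in> snd p} ((w, s), Xi z)) = (nLeb v. indicator {v. (v, s) \<in> Xi z} v)"
  by (intro nn_integral_cong) (auto split: split_indicator)
 then show ?thesis using sets_section[OF w] by (simp add: section_em_def)
qed

lemma section_em_meas [measurable]: "(\<lambda>p. section_em (fst p) (snd p)) \<in> borel_measurable (M \<Otimes>\<^sub>M borel)"
proof -
 have "(\<lambda>p. \<integral>\<^sup>+w. indicator {p. fst p \<in> snd p} ((w, snd p), Xi (fst p)) \<partial>lborel) \<in> borel_measurable (M \<Otimes>\<^sub>M borel)"
  by measurable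
 then show ?thesis
  by (rule measurable_cong[THEN iffD1, rotated]) (auto simp: section_em_eq space_pair_measure)
qed

lemma section_em_slice_meas [measurable]: "w \<in> space M \<Longrightarrow> section_em w \<in> borel_measurable borel"
 using measurable_compose[OF _ section_em_meas, of "\<lambda>s. (w, s)" borel] by simp

text \<open>Integrating over w moves the first of the two points across the whole section at its
  height, so the two membership conditions decouple into a product of section volumes. The condition
  1 + q < \<alpha> originates here.\<close>

lemma nn_integral_rho:
 "(nLeb w. ennreal (\<rho> w)) = (nMean z. (nLeb s. section_em z s * section_em z s))"
proof -
 define F where "F z w x = (indicator {p. fst p \<in> snd p} ((w, 0) - x, Xi z) * indicator {p. fst p \<in> snd p} (- x, Xi z) :: ennreal)"
  for z and w :: 'a and x :: "'a \<times> 'b"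
 interpret PM: pair_sigma_finite M "lborel :: 'a measure" ..
 have Fm [measurable]: "(\<lambda>p. F (f p) (g p) (h p)) \<in> borel_measurable N"
  if [measurable]: "f \<in> measurable N M" "g \<in> borel_measurable N" "h \<in> borel_measurable N" for N :: "'z measure" and f g h
 proof -
  have [measurable]: "(\<lambda>p. (g p, 0) - h p) \<in> borel_measurable N" by measurable
  show ?thesis unfolding F_def by measurable
 qed
 have "ennreal (\<rho> w) = (nMean z. (nLeb x. F z w x))" for w
 proof -
  have "ennreal (\<rho> w) = (nMean z. emeasure lborel {x. (w, 0) - x \<in> Xi z \<and> (0, 0) - x \<in> Xi z})"
   using emeasure_C_Int'[of w 0] emeasure_C_Int_eq[of w 0] by simp
  also have "\<dots> = (nMean z. (nLeb x. F z w x))"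
  proof (rule nn_integral_cong)
   fix z assume w: "z \<in> space M"
   have [measurable]: "Xi z \<in> sets borel" using closed_Xi[OF w] by simp
   let ?A = "{x. (w, 0) - x \<in> Xi z \<and> (0, 0) - x \<in> Xi z}"
   have "?A \<in> sets borel" by measurable
   moreover have "(nLeb x. F z w x) = (nLeb x. indicator ?A x)"
    by (intro nn_integral_cong) (auto simp: F_def zero_prod_def[symmetric] split: split_indicator)
   ultimately show "emeasure lborel ?A = (nLeb x. F z w x)" by simp
  qed
  finally show ?thesis .
 qed
 then have "(nLeb w. ennreal (\<rho> w)) = (nLeb w. (nMean z. (nLeb x. F z w x)))" by simp
 also have "\<dots> = (nMean z. (nLeb w. (nLeb x. F z w x)))"
  by (rule PM.Fubini') measurable
 also have "\<dots> = (nMean z. (nLeb s. section_em z s * section_em z s))"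
 proof (rule nn_integral_cong)
  fix z assume w [measurable]: "z \<in> space M"
  have [measurable]: "Xi z \<in> sets borel" using closed_Xi[OF w] by simp
  have "(nLeb w. (nLeb x. F z w x)) = (nLeb x. (nLeb w. F z w x))"
   by (rule lborel_pair.Fubini') measurable
  also have "\<dots> = (nLeb x. indicator {p. fst p \<in> snd p} (- x, Xi z) * section_em z (- snd x))"
  proof (rule nn_integral_cong)
   fix x :: "'a \<times> 'b"
   have "(nLeb w. F z w x) = indicator {p. fst p \<in> snd p} (- x, Xi z) * (nLeb w. indicator {v. v + (- fst x) \<in> {v. (v, - snd x) \<in> Xi z}} w)"
   proof (subst nn_integral_cmult[symmetric])
    have "{v. v + (- fst x) \<in> {v. (v, - snd x) \<in> Xi z}} \<in> sets borel"
     using sets_section[OF w, of "- snd x"] by measurable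
    then show "indicator {v. v + (- fst x) \<in> {v. (v, - snd x) \<in> Xi z}} \<in> borel_measurable lborel" by simp
    show "(nLeb w. F z w x) = (nLeb w. indicator {p. fst p \<in> snd p} (- x, Xi z) * indicator {v. v + (- fst x) \<in> {v. (v, - snd x) \<in> Xi z}} w)"
     by (intro nn_integral_cong) (cases x, auto simp: F_def split: split_indicator)
   qed
   also have "(nLeb w. indicator {v. v + (- fst x) \<in> {v. (v, - snd x) \<in> Xi z}} w) = section_em z (- snd x)"
   proof -
    have "{v. v + (- fst x) \<in> {v. (v, - snd x) \<in> Xi z}} \<in> sets borel"
     using sets_section[OF w, of "- snd x"] by measurable
    then show ?thesis
     using emeasure_lborel_translate[OF sets_section[OF w, of "- snd x"], of "- fst x"] by (simp add: section_em_def)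
   qed
   finally show "(nLeb w. F z w x) = indicator {p. fst p \<in> snd p} (- x, Xi z) * section_em z (- snd x)" .
  qed
  also have "\<dots> = (nLeb x. indicator {p. fst p \<in> snd p} (x, Xi z) * section_em z (snd x))"
  proof -
   have "(snd :: 'a \<times> 'b \<Rightarrow> 'b) \<in> borel_measurable borel"
    by (intro borel_measurable_continuous_onI continuous_intros)
   from measurable_compose[OF this section_em_slice_meas[OF w]]
   have [measurable]: "(\<lambda>x :: 'a \<times> 'b. section_em z (snd x)) \<in> borel_measurable borel" .
   have "(lborel :: ('a \<times> 'b) measure) = distr lborel borel uminus"
   proof -
    have "(lborel :: ('a \<times> 'b) measure) = density (distr lborel borel (\<lambda>x. 0 + (-1) *\<^sub>R x)) (\<lambda>_. ennreal (\<bar>-1\<bar> ^ DIM('a \<times> 'b)))"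
     by (rule lborel_affine) simp
    then show ?thesis by (simp add: density_1)
   qed
   then have "(\<integral>\<^sup>+x. indicator {p. fst p \<in> snd p} (x, Xi z) * section_em z (snd x) \<partial>(lborel :: ('a \<times> 'b) measure)) =
     (\<integral>\<^sup>+x. indicator {p. fst p \<in> snd p} (x, Xi z) * section_em z (snd x) \<partial>distr (lborel :: ('a \<times> 'b) measure) borel uminus)"
    by simp
   also have "\<dots> = (nLeb x. indicator {p. fst p \<in> snd p} (- x, Xi z) * section_em z (snd (- x)))"
    by (subst nn_integral_distr) (auto intro!: borel_measurable_times_ennreal)
   finally show ?thesis by simp
  qed
  also have "\<dots> = (nLeb s. (nLeb v. indicator {p. fst p \<in> snd p} ((v, s), Xi z) * section_em z s))"
  proof -
   have "(snd :: 'a \<times> 'b \<Rightarrow> 'b) \<in> borel_measurable borel"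
    by (intro borel_measurable_continuous_onI continuous_intros)
   from measurable_compose[OF this section_em_slice_meas[OF w]]
   have [measurable]: "(\<lambda>x :: 'a \<times> 'b. section_em z (snd x)) \<in> borel_measurable borel" .
   have "(\<lambda>x. indicator {p. fst p \<in> snd p} (x, Xi z) * section_em z (snd x)) \<in> borel_measurable (lborel :: ('a \<times> 'b) measure)"
    by measurable
   from nn_integral_lborel_prod_swap[OF this] show ?thesis by simp
  qed
  also have "\<dots> = (nLeb s. section_em z s * section_em z s)"
   by (intro nn_integral_cong) (simp add: nn_integral_multc section_em_eq[OF w])
  finally show "(nLeb w. (nLeb x. F z w x)) = (nLeb s. section_em z s * section_em z s)" .
 qed
 finally show ?thesis .
qed

end


text \<open>Layer cake in the radius: the power -a of norm w is the integral of a r^(-a-1) over r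
  \<ge> norm w, and Tonelli leaves the volumes of balls of radius \<open>min r L\<close>.\<close>

lemma nn_integral_norm_powr_cball:
 fixes a :: real
 assumes a: "0 < a" "a < DIM('a::euclidean_space)"
 shows "\<exists>K>0. \<forall>L>0. (nLeb w. ennreal (norm w powr (- a)) * indicator (cball (0::'a) L) w) \<le> ennreal (K * L powr (DIM('a) - a))"
proof -
 let ?d = "real DIM('a)"
 define v where "v = unit_ball_vol ?d"
 have v: "v > 0" by (simp add: v_def)
 \<comment> \<open>The summand a / (d - a) comes from the radii r \<le> L, the summand 1 from r >
   L.\<close>
 define K where "K = v * (a / (?d - a) + 1)"
 have K: "K > 0" using v a by (simp add: K_def add_pos_pos)
 have "(nLeb w. ennreal (norm w powr (- a)) * indicator (cball (0::'a) L) w) \<le> ennreal (K * L powr (?d - a))"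
  if L: "L > 0" for L
 proof -
  have pw: "ennreal (norm w powr (- a)) \<le> (nLeb r. ennreal (a * r powr (- a - 1)) * indicator {norm w..} r * indicator {0<..} r)" for w :: 'a
  proof (cases "w = 0")
   case False
   have "((\<lambda>r. r powr (- a - 1)) has_integral (norm w powr (- a) / a)) {norm w..}"
    using has_integral_powr_to_inf[of "- a - 1" "norm w"] a False by simp
   then have "((\<lambda>r. a * r powr (- a - 1)) has_integral (a * (norm w powr (- a) / a))) {norm w..}"
    by (rule has_integral_mult_right)
   then have "(nLeb r. ennreal (a * r powr (- a - 1)) * indicator {norm w..} r) = ennreal (a * (norm w powr (- a) / a))"
    using a by (intro nn_integral_has_integral_lebesgue') auto
   moreover have "(nLeb r. ennreal (a * r powr (- a - 1)) * indicator {norm w..} r) =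
     (nLeb r. ennreal (a * r powr (- a - 1)) * indicator {norm w..} r * indicator {0<..} r)"
   proof (rule nn_integral_cong)
    fix r :: real
    have "0 < r" if "norm w \<le> r" using False that by (meson less_le_trans zero_less_norm_iff)
    then show "ennreal (a * r powr (- a - 1)) * indicator {norm w..} r = ennreal (a * r powr (- a - 1)) * indicator {norm w..} r * indicator {0<..} r"
     by (auto split: split_indicator)
   qed
   ultimately show ?thesis using a by simp
  qed simp
  have "(nLeb w. ennreal (norm w powr (- a)) * indicator (cball (0::'a) L) w) \<le>
    (nLeb w. (nLeb r. ennreal (a * r powr (- a - 1)) * indicator {norm w..} r * indicator {0<..} r) * indicator (cball (0::'a) L) w)"
   by (intro nn_integral_mono mult_right_mono pw) auto
  also have "\<dots> = (\<integral>\<^sup>+w. (nLeb r. ennreal (a * r powr (- a - 1)) * indicator {0<..} r * indicator {p. norm (fst p) \<le> snd p \<and> norm (fst p) \<le> L} (w, r)) \<partial>(lborel :: 'a measure))"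
  proof (rule nn_integral_cong)
   fix w :: 'a
   have [measurable]: "(\<lambda>r. ennreal (a * r powr (- a - 1)) * indicator {norm w..} r * indicator {0<..} r) \<in> borel_measurable lborel" by measurable
   show "(nLeb r. ennreal (a * r powr (- a - 1)) * indicator {norm w..} r * indicator {0<..} r) * indicator (cball (0::'a) L) w =
     (nLeb r. ennreal (a * r powr (- a - 1)) * indicator {0<..} r * indicator {p. norm (fst p) \<le> snd p \<and> norm (fst p) \<le> L} (w, r))"
    by (subst nn_integral_multc[symmetric], measurable) (auto intro!: nn_integral_cong split: split_indicator)
  qed
  also have "\<dots> = (nLeb r. (\<integral>\<^sup>+w. ennreal (a * r powr (- a - 1)) * indicator {0<..} r * indicator {p. norm (fst p) \<le> snd p \<and> norm (fst p) \<le> L} (w, r) \<partial>(lborel :: 'a measure)))"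
   by (rule lborel_pair.Fubini'[symmetric]) measurable
  also have "\<dots> \<le> (nLeb r. ennreal (a * v) * (ennreal (r powr (?d - a - 1)) * indicator {0..L} r) + ennreal (a * v * L powr ?d) * (ennreal (r powr (- a - 1)) * indicator {L..} r))"
  proof (rule nn_integral_mono)
   fix r :: real
   show "(\<integral>\<^sup>+w. ennreal (a * r powr (- a - 1)) * indicator {0<..} r * indicator {p. norm (fst p) \<le> snd p \<and> norm (fst p) \<le> L} (w, r) \<partial>(lborel :: 'a measure))
     \<le> ennreal (a * v) * (ennreal (r powr (?d - a - 1)) * indicator {0..L} r) + ennreal (a * v * L powr ?d) * (ennreal (r powr (- a - 1)) * indicator {L..} r)"
   proof (cases "0 < r")
    case True
    have "(\<integral>\<^sup>+w. ennreal (a * r powr (- a - 1)) * indicator {0<..} r * indicator {p. norm (fst p) \<le> snd p \<and> norm (fst p) \<le> L} (w, r) \<partial>(lborel :: 'a measure)) =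
      (\<integral>\<^sup>+w. ennreal (a * r powr (- a - 1)) * indicator (cball 0 (min r L)) w \<partial>(lborel :: 'a measure))"
     using True by (intro nn_integral_cong) (auto split: split_indicator)
    also have "\<dots> = ennreal (a * r powr (- a - 1)) * emeasure lborel (cball (0 :: 'a) (min r L))"
     by (subst nn_integral_cmult_indicator) auto
    also have "\<dots> = ennreal (a * r powr (- a - 1) * (v * min r L powr ?d))"
     using True L a v by (subst emeasure_cball) (auto simp: v_def powr_realpow simp flip: ennreal_mult)
    also have "\<dots> \<le> ennreal (a * v) * (ennreal (r powr (?d - a - 1)) * indicator {0..L} r) + ennreal (a * v * L powr ?d) * (ennreal (r powr (- a - 1)) * indicator {L..} r)"
    proof (cases "r \<le> L")
     case rL: True
     have "r powr (- a - 1) * r powr ?d = r powr (?d - a - 1)"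
      by (simp flip: powr_add add: algebra_simps)
     then have "a * r powr (- a - 1) * (v * min r L powr ?d) = a * v * r powr (?d - a - 1)"
      using rL by (simp add: min_def mult_ac)
     then have "ennreal (a * r powr (- a - 1) * (v * min r L powr ?d)) = ennreal (a * v) * (ennreal (r powr (?d - a - 1)) * indicator {0..L} r)"
      using rL True a v by (simp flip: ennreal_mult)
     then show ?thesis by simp
    next
     case False
     then have "ennreal (a * r powr (- a - 1) * (v * min r L powr ?d)) = ennreal (a * v * L powr ?d) * (ennreal (r powr (- a - 1)) * indicator {L..} r)"
      using a v by (simp add: min_def mult_ac flip: ennreal_mult)
     then show ?thesis by simp
    qed
    finally show ?thesis .
   qed simp
  qed
  also have "\<dots> = ennreal (a * v) * ennreal (L powr (?d - a) / (?d - a)) + ennreal (a * v * L powr ?d) * ennreal (L powr (- a) / a)"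
  proof -
   have "((\<lambda>r. r powr (?d - a - 1)) has_integral L powr (?d - a) / (?d - a)) {0..L}"
    using has_integral_powr_from_0[of "?d - a - 1" L] a L by simp
   then have 1: "(nLeb r. ennreal (r powr (?d - a - 1)) * indicator {0..L} r) = ennreal (L powr (?d - a) / (?d - a))"
    by (intro nn_integral_has_integral_lebesgue') auto
   have "((\<lambda>r. r powr (- a - 1)) has_integral L powr (- a) / a) {L..}"
    using has_integral_powr_to_inf[of "- a - 1" L] a L by simp
   then have 2: "(nLeb r. ennreal (r powr (- a - 1)) * indicator {L..} r) = ennreal (L powr (- a) / a)"
    by (intro nn_integral_has_integral_lebesgue') auto
   show ?thesis by (subst nn_integral_add, measurable) (simp add: nn_integral_cmult 1 2)
  qed
  also have "\<dots> = ennreal (K * L powr (?d - a))"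
  proof -
   have "L powr ?d * L powr (- a) = L powr (?d - a)" by (simp flip: powr_add add: add.commute)
   then have "a * v * (L powr (?d - a) / (?d - a)) + a * v * L powr ?d * (L powr (- a) / a) = K * L powr (?d - a)"
    using a by (simp add: K_def field_simps)
   then show ?thesis using a v by (simp flip: ennreal_mult ennreal_plus)
  qed
  finally show ?thesis .
 qed
 then show ?thesis using K by blast
qed

section \<open>Integrability and positivity of the two-point function\<close>

context scaled_grain_model
begin

lemma emeasure_Xi_sections: "z \<in> space M \<Longrightarrow> emeasure lborel (Xi z) = (nLeb s. section_em z s)"
proof -
 assume w [measurable]: "z \<in> space M"
 have "emeasure lborel (Xi z) = (nLeb x. indicator {p. fst p \<in> snd p} (x, Xi z))"
 proof -
  have "(nLeb x. indicator {p. fst p \<in> snd p} (x, Xi z)) = (nLeb x. indicator (Xi z) x)"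
   by (intro nn_integral_cong) (auto split: split_indicator)
  then show ?thesis using closed_Xi[OF w] by simp
 qed
 also have "\<dots> = (nLeb s. (nLeb v. indicator {p. fst p \<in> snd p} ((v, s), Xi z)))"
  by (rule nn_integral_lborel_prod_swap) measurable
 finally show ?thesis by (simp add: section_em_eq[OF w])
qed

lemma emeasure_Xi_pos: "AE w in M. 0 < emeasure lborel (Xi w)"
 using AE_grain
proof eventually_elim
 case (elim w)
 have "Xi w = {y. y /\<^sub>R rad w \<in> Xi0 w}" using mem_Xi_iff elim by auto
 then have "emeasure lborel (Xi w) = ennreal (rad w ^ DIM('a \<times> 'b)) * emeasure lborel (Xi0 w)"
  using emeasure_lborel_scaleR_vimage[of "Xi0 w" "rad w"] closed_Xi0 rad_power(1) elim by simp
 then show ?case using elim rad_power(1)[of w] by (simp add: ennreal_zero_less_mult_iff)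
qed

definition vol_a :: real where "vol_a = unit_ball_vol (real DIM('a))"
definition vol_b :: real where "vol_b = unit_ball_vol (real DIM('b))"

lemma vol_pos: "0 < vol_a" "0 < vol_b"
 by (simp_all add: vol_a_def vol_b_def)

lemma section_em_le:
 assumes "0 < R z" "Xi0 z \<subseteq> {t. norm t \<le> 1}"
 shows "section_em z s \<le> ennreal (vol_a * R z powr q) * indicator (cball 0 (rad z)) s"
proof (cases "norm s \<le> rad z")
 case True
 have "{w. (w, s) \<in> Xi z} \<subseteq> cball 0 (rad z)"
  using Xi_subset[OF assms] norm_fst_le order_trans by (fastforce simp: norm_minus_commute)
 then have "section_em z s \<le> emeasure lborel (cball (0 :: 'a) (rad z))"
  unfolding section_em_def by (intro emeasure_mono) auto
 also have "\<dots> = ennreal (vol_a * R z powr q)"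
  using emeasure_cball[OF rad_nonneg, where 'a='a] rad_power(3)[OF assms(1)] by (simp add: vol_a_def)
 finally show ?thesis using True by simp
next
 case False
 have "{w. (w, s) \<in> Xi z} = {}"
 proof (rule ccontr)
  assume "{w. (w, s) \<in> Xi z} \<noteq> {}"
  then obtain w where "(w, s) \<in> Xi z" by auto
  then have "norm (w, s) \<le> rad z" using Xi_subset[OF assms] by blast
  then show False using False norm_snd_le[of s w] by simp
 qed
 then show ?thesis by (simp add: section_em_def)
qed

lemma emeasure_cball_b:
 assumes "0 < R w"
 shows "emeasure lborel (cball (0 :: 'b) (rad w)) = ennreal (vol_b * R w powr (1 - q))"
 using emeasure_cball[OF rad_nonneg, where 'a='b] rad_power(4)[OF assms] by (simp add: vol_b_def)

text \<open>A squared section is of order R^(2q) on a range of heights of order R^(1-q), so the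
  integral of \<rho> is at most a multiple of 1 + E(R^(1+q); R > 1), finite for 1 + q <
  \<alpha>.\<close>

lemma rho_integrable:
 assumes "1 + q < \<alpha>"
 shows "integrable lborel \<rho>"
proof (rule integrableI_nonneg)
 obtain C where C: "C > 0" "\<And>x. x > 0 \<Longrightarrow>
   (nMean z. ennreal (R z powr (1 + q)) * indicator {x<..} (R z)) \<le> ennreal (C * x powr (1 + q - \<alpha>))"
  using nn_integral_powr_tail_bound[of "1 + q"] assms q01 by auto
 have "(nLeb w. ennreal (\<rho> w)) = (nMean z. (nLeb s. section_em z s * section_em z s))"
  by (rule nn_integral_rho)
 also have "\<dots> \<le> (nMean z. ennreal (vol_a * vol_a * vol_b) * (1 + ennreal (R z powr (1 + q)) * indicator {1<..} (R z)))"
 proof (rule nn_integral_mono_AE)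
  show "AE z in M. (nLeb s. section_em z s * section_em z s) \<le>
    ennreal (vol_a * vol_a * vol_b) * (1 + ennreal (R z powr (1 + q)) * indicator {1<..} (R z))"
   using AE_grain
  proof eventually_elim
   case (elim z)
   have "(nLeb s. section_em z s * section_em z s) \<le>
     (nLeb s. ennreal ((vol_a * R z powr q) * (vol_a * R z powr q)) * indicator (cball (0 :: 'b) (rad z)) s)"
   proof (rule nn_integral_mono)
    fix s
    have "section_em z s * section_em z s \<le> (ennreal (vol_a * R z powr q) * indicator (cball 0 (rad z)) s) * (ennreal (vol_a * R z powr q) * indicator (cball 0 (rad z)) s)"
     using section_em_le[of z s] elim by (intro mult_mono) auto
    also have "\<dots> = ennreal ((vol_a * R z powr q) * (vol_a * R z powr q)) * indicator (cball 0 (rad z)) s"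
     using vol_pos by (auto simp: ennreal_mult split: split_indicator)
    finally show "section_em z s * section_em z s \<le> ennreal ((vol_a * R z powr q) * (vol_a * R z powr q)) * indicator (cball 0 (rad z)) s" .
   qed
   also have "\<dots> = ennreal ((vol_a * R z powr q) * (vol_a * R z powr q)) * ennreal (vol_b * R z powr (1 - q))"
    using elim by (subst nn_integral_cmult_indicator) (auto simp: emeasure_cball_b)
   also have "\<dots> = ennreal (vol_a * vol_a * vol_b * R z powr (1 + q))"
   proof -
    have "R z powr q * R z powr q * R z powr (1 - q) = R z powr (1 + q)"
     by (simp flip: powr_add add: add.commute)
    then show ?thesis using vol_pos by (simp add: mult_ac flip: ennreal_mult)
   qed
   also have "\<dots> \<le> ennreal (vol_a * vol_a * vol_b) * (1 + ennreal (R z powr (1 + q)) * indicator {1<..} (R z))"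
   proof (cases "1 < R z")
    case True
    then show ?thesis using vol_pos by (simp add: ennreal_mult distrib_left)
   next
    case False
    then have "R z powr (1 + q) \<le> 1" using elim q01 by (intro powr_le1) auto
    then have "vol_a * vol_a * vol_b * R z powr (1 + q) \<le> vol_a * vol_a * vol_b * 1"
     using vol_pos by (intro mult_left_mono) auto
    then show ?thesis using False by (simp add: ennreal_leI)
   qed
   finally show ?case .
  qed
 qed
 also have "\<dots> \<le> ennreal (vol_a * vol_a * vol_b) * (1 + ennreal (C * 1 powr (1 + q - \<alpha>)))"
  by (subst nn_integral_cmult, measurable, subst nn_integral_add)
    (auto intro!: mult_left_mono add_left_mono C(2)[of 1, simplified] simp: emeasure_space_1)
 also have "\<dots> < \<infinity>" by (simp add: ennreal_mult_less_top)
 finally show "(nLeb w. ennreal (\<rho> w)) < \<infinity>" .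
qed (auto simp: rho_nonneg)

text \<open>Guarantees a nondegenerate Gaussian limit. If the integral vanished, almost every
  section of almost every grain would be null, and hence the grain itself, against the positive
  volume of the grains.\<close>

lemma rho_integral_pos:
 assumes "integrable lborel \<rho>"
 shows "0 < (Leb w. \<rho> w)"
proof (rule ccontr)
 assume "\<not> ?thesis"
 moreover have "0 \<le> (Leb w. \<rho> w)"
  by (intro integral_nonneg_AE AE_I2 rho_nonneg)
 ultimately have "(Leb w. \<rho> w) = 0" by simp
 then have "(nLeb w. ennreal (\<rho> w)) = 0"
  using assms by (subst nn_integral_eq_integral) (auto simp: rho_nonneg)
 then have z: "(nMean y. (nLeb s. section_em y s * section_em y s)) = 0"
  by (simp add: nn_integral_rho)
 have "AE y in M. (nLeb s. section_em y s * section_em y s) = 0"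
 proof (subst nn_integral_0_iff_AE[symmetric])
  show "(\<lambda>y. \<integral>\<^sup>+s. section_em y s * section_em y s \<partial>lborel) \<in> borel_measurable M"
   by measurable
 qed (rule z)
 then have "AE y in M. False"
  using emeasure_Xi_pos AE_space
 proof eventually_elim
  case (elim y)
  have [measurable]: "y \<in> space M" by fact
  have "AE s in lborel. section_em y s * section_em y s = 0"
   using elim(1) by (subst (asm) nn_integral_0_iff_AE) auto
  then have "AE s in lborel. section_em y s = 0" by eventually_elim auto
  then have "(nLeb s. section_em y s) = 0"
   by (subst nn_integral_0_iff_AE) auto
  then show False using elim emeasure_Xi_sections[of y] by simp
 qed
 then show False by (simp add: AE_False)
qed

end

subsection \<open>Stable limit\<close>


text \<open>For integrable instead of bounded integrands, and with X averaged first: the scale R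
  will be averaged for a fixed shape of the grain.\<close>

lemma (in prob_space) independent_rvs_integral_iterated:
 fixes g :: "'b \<times> 'c \<Rightarrow> 'd::{banach, second_countable_topology}"
 assumes i: "independent_rvs M S X T Y" and [measurable]: "g \<in> borel_measurable (S \<Otimes>\<^sub>M T)"
  and int: "integrable M (\<lambda>w. g (X w, Y w))"
 shows "(\<integral>w. g (X w, Y w) \<partial>M) = (\<integral>w'. (\<integral>w. g (X w, Y w') \<partial>M) \<partial>M)"
proof -
 have [measurable]: "X \<in> measurable M S" "Y \<in> measurable M T"
  using i by (auto simp: independent_rvs_def)
 interpret X: prob_space "distr M S X" by (rule prob_space_distr) measurable
 interpret Y: prob_space "distr M T Y" by (rule prob_space_distr) measurable
 interpret P: pair_prob_space "distr M S X" "distr M T Y" ..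
 have gi: "integrable (distr M S X \<Otimes>\<^sub>M distr M T Y) (\<lambda>(x, y). g (x, y))"
  unfolding independent_rvs_distr_pair[OF i, symmetric] using int by (subst integrable_distr_eq) auto
 have "(\<integral>w. g (X w, Y w) \<partial>M) = (\<integral>p. g p \<partial>distr M (S \<Otimes>\<^sub>M T) (\<lambda>w. (X w, Y w)))"
  by (subst integral_distr) auto
 also have "\<dots> = (\<integral>y. (\<integral>x. g (x, y) \<partial>distr M S X) \<partial>distr M T Y)"
  unfolding independent_rvs_distr_pair[OF i] using P.integral_snd[OF gi] by simp
 also have "\<dots> = (\<integral>w'. (\<integral>w. g (X w, Y w') \<partial>M) \<partial>M)"
  by (subst integral_distr, measurable, rule Bochner_integral_cong)
    (auto simp: integral_distr dest: measurable_space[of Y])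
 finally show ?thesis .
qed

text \<open>The integrand of a centred Poisson integral; the subtracted linear term belongs to the
  centring of the shot noise.\<close>

definition comp_exp :: "real \<Rightarrow> real \<Rightarrow> complex" where
 "comp_exp \<theta> z = iexp (\<theta> * z) - 1 - \<i> * of_real (\<theta> * z)"

lemma comp_exp_meas [measurable]: "comp_exp \<theta> \<in> borel_measurable borel"
 unfolding comp_exp_def[abs_def] by measurable

lemma comp_exp_0 [simp]: "comp_exp \<theta> 0 = 0"
 by (simp add: comp_exp_def)

lemma norm_comp_exp_le: "norm (comp_exp \<theta> z) \<le> 2 * \<bar>\<theta> * z\<bar>" "norm (comp_exp \<theta> z) \<le> (\<theta> * z)\<^sup>2 / 2"
proof -
 have e: "comp_exp \<theta> z = iexp (\<theta> * z) - (1 + \<i> * of_real (\<theta> * z))" by (simp add: comp_exp_def)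
 show "norm (comp_exp \<theta> z) \<le> 2 * \<bar>\<theta> * z\<bar>"
  unfolding e using iexp_approx2[of "\<theta> * z" 1] by simp
 show "norm (comp_exp \<theta> z) \<le> (\<theta> * z)\<^sup>2 / 2"
  unfolding e using iexp_approx1[of "\<theta> * z" 1] by (simp add: numeral_2_eq_2)
qed

text \<open>The derivative i \<theta> (exp(i \<theta> z) - 1) is small for small z, which improves
  the Lipschitz constant by the factor \<open>min 2 (\<bar>\<theta>\<bar> * h)\<close>. Because of
  this gain, boundary errors are of order a^p instead of a.\<close>

lemma comp_exp_diff_le:
 assumes "0 \<le> z" "z \<le> h" "0 \<le> z'" "z' \<le> h"
 shows "norm (comp_exp \<theta> z - comp_exp \<theta> z') \<le> 2 * \<bar>\<theta>\<bar> * \<bar>z - z'\<bar> * min 2 (\<bar>\<theta>\<bar> * h)"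
proof -
 define d where "d = z - z'"
 have d: "\<bar>d\<bar> \<le> h" using assms by (auto simp: d_def)
 have z: "\<theta> * z = \<theta> * z' + \<theta> * d" by (simp add: d_def algebra_simps)
 have n: "norm (\<i> * of_real c * w) = \<bar>c\<bar> * norm w" for c and w :: complex
  by (simp add: norm_mult)
 have ez: "iexp (\<theta> * z) = iexp (\<theta> * z') * iexp (\<theta> * d)"
  unfolding z by (simp only: of_real_add distrib_left exp_add)
 have "comp_exp \<theta> z - comp_exp \<theta> z' = iexp (\<theta> * z') * comp_exp \<theta> d + \<i> * of_real (\<theta> * d) * (iexp (\<theta> * z') - 1)"
  unfolding comp_exp_def ez by (simp add: d_def algebra_simps)
 also have "norm \<dots> \<le> norm (comp_exp \<theta> d) + \<bar>\<theta> * d\<bar> * norm (iexp (\<theta> * z') - 1)"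
 proof (rule norm_triangle_le, rule add_mono)
  show "norm (iexp (\<theta> * z') * comp_exp \<theta> d) \<le> norm (comp_exp \<theta> d)"
   by (simp add: norm_mult)
  show "norm (\<i> * of_real (\<theta> * d) * (iexp (\<theta> * z') - 1)) \<le> \<bar>\<theta> * d\<bar> * norm (iexp (\<theta> * z') - 1)"
   using n[of "\<theta> * d" "iexp (\<theta> * z') - 1"] by (rule eq_refl)
 qed
 also have "\<dots> \<le> \<bar>\<theta> * d\<bar> * min 2 (\<bar>\<theta>\<bar> * h) + \<bar>\<theta> * d\<bar> * min 2 (\<bar>\<theta>\<bar> * h)"
 proof (intro add_mono mult_left_mono)
  have "\<bar>\<theta> * d\<bar> \<le> \<bar>\<theta>\<bar> * h" using d by (simp add: abs_mult mult_left_mono)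
  then have "\<bar>\<theta> * d\<bar> * \<bar>\<theta> * d\<bar> \<le> \<bar>\<theta> * d\<bar> * (\<bar>\<theta>\<bar> * h)" by (rule mult_left_mono) simp
  moreover have "(\<theta> * d)\<^sup>2 = \<bar>\<theta> * d\<bar> * \<bar>\<theta> * d\<bar>" unfolding power2_eq_square by (simp only: abs_mult_self_eq)
  moreover have "0 \<le> (\<theta> * d)\<^sup>2" by (rule zero_le_power2)
  ultimately have "(\<theta> * d)\<^sup>2 / 2 \<le> \<bar>\<theta> * d\<bar> * (\<bar>\<theta>\<bar> * h)" by linarith
  then have "norm (comp_exp \<theta> d) \<le> \<bar>\<theta> * d\<bar> * (\<bar>\<theta>\<bar> * h)"
   using norm_comp_exp_le(2)[of \<theta> d] by (rule order_trans[rotated])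
  moreover have "norm (comp_exp \<theta> d) \<le> \<bar>\<theta> * d\<bar> * 2"
   using norm_comp_exp_le(1)[of \<theta> d] by (simp only: mult.commute)
  ultimately show "norm (comp_exp \<theta> d) \<le> \<bar>\<theta> * d\<bar> * min 2 (\<bar>\<theta>\<bar> * h)"
   by (cases "2 \<le> \<bar>\<theta>\<bar> * h") (simp_all only: min_absorb1 min_absorb2 linear not_le less_imp_le)
  have "norm (iexp (\<theta> * z') - 1) \<le> 2" by (rule order_trans[OF norm_triangle_ineq4]) simp
  moreover have "norm (iexp (\<theta> * z') - 1) \<le> \<bar>\<theta>\<bar> * z'"
   using iexp_approx1[of "\<theta> * z'" 0] assms by (simp add: abs_mult)
  moreover have "\<bar>\<theta>\<bar> * z' \<le> \<bar>\<theta>\<bar> * h" using assms by (intro mult_left_mono) auto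
  ultimately show "norm (iexp (\<theta> * z') - 1) \<le> min 2 (\<bar>\<theta>\<bar> * h)" by simp
 qed simp
 also have "\<dots> = 2 * \<bar>\<theta>\<bar> * \<bar>z - z'\<bar> * min 2 (\<bar>\<theta>\<bar> * h)"
  unfolding abs_mult d_def[symmetric] by (simp only: mult_2 distrib_right)
 finally show ?thesis .
qed

text \<open>The two halves of the symmetric difference of B and its translate have the same measure,
  whence the factor 2.\<close>

lemma nn_integral_indicator_translate_diff:
 fixes B :: "'a::euclidean_space set"
 assumes [measurable]: "B \<in> sets borel" and fin: "emeasure lborel B < \<infinity>"
 shows "(nLeb v. ennreal \<bar>indicator B (v + w) - indicator B v\<bar>) =
  ennreal (2 * (measure lborel B - measure lborel (B \<inter> {x. x + w \<in> B})))"
proof -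
 let ?T = "{x. x + w \<in> B}"
 have eT: "emeasure lborel ?T = emeasure lborel B" by (rule emeasure_lborel_translate) fact
 have fm: "B \<in> fmeasurable lborel" "?T \<in> fmeasurable lborel"
  using fin eT by (auto simp: fmeasurable_def)
 have mT: "measure lborel ?T = measure lborel B" by (simp add: measure_def eT)
 have "(nLeb v. ennreal \<bar>indicator B (v + w) - indicator B v\<bar>) =
   (nLeb v. indicator (B - B \<inter> ?T) v + indicator (?T - B \<inter> ?T) v)"
  by (intro nn_integral_cong) (auto split: split_indicator)
 also have "\<dots> = emeasure lborel (B - B \<inter> ?T) + emeasure lborel (?T - B \<inter> ?T)"
  by (subst nn_integral_add) auto
 also have "\<dots> = ennreal (measure lborel (B - B \<inter> ?T)) + ennreal (measure lborel (?T - B \<inter> ?T))"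
  using fm by (simp add: emeasure_eq_measure2 fmeasurable.Diff fmeasurable.Int)
 also have "measure lborel (B - B \<inter> ?T) = measure lborel B - measure lborel (B \<inter> ?T)"
  using fm fin by (intro measure_Diff) auto
 also have "measure lborel (?T - B \<inter> ?T) = measure lborel ?T - measure lborel (B \<inter> ?T)"
  using fm fin eT by (intro measure_Diff) auto
 finally have e: "(nLeb v. ennreal \<bar>indicator B (v + w) - indicator B v\<bar>) =
   ennreal (measure lborel B - measure lborel (B \<inter> ?T)) + ennreal (measure lborel B - measure lborel (B \<inter> ?T))"
  by (simp add: mT)
 have "measure lborel (B \<inter> ?T) \<le> measure lborel B"
  using fm by (intro measure_mono_fmeasurable) auto
 then show ?thesis unfolding e by (simp flip: ennreal_plus)
qed

section \<open>Section volumes of a grain and of its unscaled shape\<close>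

context scaled_grain_model
begin

definition hsec :: "'w \<Rightarrow> 'b \<Rightarrow> real" where
 "hsec z s = measure lborel {w. (w, s) \<in> Xi z}"

lemma hsec_nonneg: "0 \<le> hsec w s" by (simp add: hsec_def)

lemma hsec_meas [measurable]: "(\<lambda>p. hsec (fst p) (snd p)) \<in> borel_measurable (M \<Otimes>\<^sub>M borel)"
proof -
 have "(\<lambda>p. enn2real (section_em (fst p) (snd p))) \<in> borel_measurable (M \<Otimes>\<^sub>M borel)" by measurable
 then show ?thesis by (simp add: hsec_def section_em_def measure_def)
qed

lemma hsec_meas' [measurable (raw)]:
 assumes "f \<in> measurable N M" "g \<in> borel_measurable N"
 shows "(\<lambda>x. hsec (f x) (g x)) \<in> borel_measurable N"
 using measurable_compose[OF _ hsec_meas, of "\<lambda>x. (f x, g x)" N] assms by simp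

lemma hsec_le:
 assumes "0 < R w" "Xi0 w \<subseteq> {t. norm t \<le> 1}"
 shows "ennreal (hsec w s) = section_em w s" "hsec w s \<le> vol_a * R w powr q"
proof -
 have le: "section_em w s \<le> ennreal (vol_a * R w powr q)"
  by (rule order_trans[OF section_em_le[OF assms]]) (auto split: split_indicator)
 then have "section_em w s < top" by (rule le_less_trans) simp
 then show e: "ennreal (hsec w s) = section_em w s"
  by (simp add: hsec_def section_em_def measure_def)
 show "hsec w s \<le> vol_a * R w powr q"
  using le vol_pos unfolding e[symmetric] by (simp add: ennreal_le_iff)
qed

lemma hsec_scale:
 assumes "0 < R z" and w: "z \<in> space M"
 shows "hsec z s = R z powr q * section_volume (Xi0 z) (s /\<^sub>R rad z)"
proof -
 have "{w. (w, s) \<in> Xi z} = {w. w /\<^sub>R rad z \<in> {t'. (t', s /\<^sub>R rad z) \<in> Xi0 z}}"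
  using mem_Xi_iff[OF assms(1)] by auto
 moreover have "{t'. (t', s /\<^sub>R rad z) \<in> Xi0 z} \<in> sets borel"
 proof -
  have [measurable]: "Xi0 z \<in> sets borel" using closed_Xi0[OF w] by simp
  have "(\<lambda>w :: 'a. (w, s /\<^sub>R rad z)) -` Xi0 z \<inter> space borel \<in> sets borel"
   by (rule measurable_sets[of _ _ borel]) measurable
  then show ?thesis by (simp add: vimage_def)
 qed
 ultimately have "emeasure lborel {w. (w, s) \<in> Xi z} = ennreal (rad z ^ DIM('a)) * emeasure lborel {t'. (t', s /\<^sub>R rad z) \<in> Xi0 z}"
  using emeasure_lborel_scaleR_vimage[of "{t'. (t', s /\<^sub>R rad z) \<in> Xi0 z}" "rad z"] rad_power(1)[OF assms(1)] by simp
 then show ?thesis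
  unfolding hsec_def section_volume_def measure_def
  using rad_power(3)[OF assms(1)] by (simp add: enn2real_mult)
qed

lemma section_volume_meas:
 "(\<lambda>p. section_volume (fst p) (snd p) :: real) \<in> borel_measurable ((fell_borel :: ('a \<times> 'b) set measure) \<Otimes>\<^sub>M borel)"
proof -
 have "(\<lambda>p. enn2real (nLeb w. indicator {p. fst p \<in> snd p} ((w :: 'a, snd p :: 'b), fst p))) \<in> borel_measurable (fell_borel \<Otimes>\<^sub>M borel)"
  by measurable
 moreover have "section_volume (fst p) (snd p) = enn2real (nLeb w. indicator {p. fst p \<in> snd p} ((w, snd p), fst p))"
  if "p \<in> space ((fell_borel :: ('a \<times> 'b) set measure) \<Otimes>\<^sub>M borel)" for p
 proof -
  have [measurable]: "fst p \<in> sets borel" using that by (auto simp: space_pair_measure)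
  have "(\<lambda>w :: 'a. (w, snd p)) -` fst p \<inter> space borel \<in> sets borel"
   by (rule measurable_sets[of _ _ borel]) measurable
  then have m: "{w. (w, snd p) \<in> fst p} \<in> sets borel" by (simp add: vimage_def)
  have "(nLeb w. indicator {p. fst p \<in> snd p} ((w, snd p), fst p)) = (nLeb w. indicator {w. (w, snd p) \<in> fst p} w)"
   by (intro nn_integral_cong) (auto split: split_indicator)
  then show ?thesis using m by (simp add: section_volume_def measure_def)
 qed
 ultimately show ?thesis by (simp cong: measurable_cong)
qed

lemma section_volume_meas' [measurable (raw)]:
 fixes f :: "'z \<Rightarrow> ('a \<times> 'b) set"
 assumes "f \<in> measurable N fell_borel" "g \<in> borel_measurable N"
 shows "(\<lambda>x. section_volume (f x) (g x)) \<in> borel_measurable N"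
 using measurable_compose[OF _ section_volume_meas, of "\<lambda>x. (f x, g x)" N] assms by simp

lemma section_volume_le:
 assumes "(F :: ('a \<times> 'b) set) \<subseteq> {t. norm t \<le> 1}"
 shows "section_volume F s \<le> vol_a * indicator (cball 0 1) s"
proof (cases "norm s \<le> 1")
 case True
 have "{t'. (t', s) \<in> F} \<subseteq> cball 0 1"
 proof
  fix t' assume "t' \<in> {t'. (t', s) \<in> F}"
  then have "norm (t', s) \<le> 1" using assms by blast
  then show "t' \<in> cball 0 1" using norm_fst_le[of t' s] by simp
 qed
 moreover have "{t'. (t', s) \<in> F} \<subseteq> cball 0 1 \<Longrightarrow> measure lborel {t'. (t', s) \<in> F} \<le> vol_a"
 proof -
  assume sub: "{t'. (t', s) \<in> F} \<subseteq> cball 0 1"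
  have "emeasure lborel {t'. (t', s) \<in> F} \<le> emeasure lborel (cball (0 :: 'a) 1)"
   by (rule emeasure_mono) (use sub in auto)
  also have "\<dots> = ennreal vol_a" using emeasure_cball[of 1 "0 :: 'a"] by (simp add: vol_a_def)
  finally show ?thesis unfolding measure_def using vol_pos by (intro enn2real_leI) auto
 qed
 ultimately show ?thesis using True by (simp add: section_volume_def)
next
 case False
 have "{t'. (t', s) \<in> F} = {}"
 proof (rule ccontr)
  assume "{t'. (t', s) \<in> F} \<noteq> {}"
  then obtain w where "(w, s) \<in> F" by auto
  then have "norm (w, s) \<le> 1" using assms by blast
  then show False using False norm_snd_le[of s w] by simp
 qed
 then show ?thesis using False by (simp add: section_volume_def)
qed

end


text \<open>For fixed v the difference of the indicators has one sign for all w, so the absolute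
  value may be moved inside the integral over W.\<close>

lemma measure_translate_Int_diff:
 fixes W B :: "'a::euclidean_space set"
 assumes [measurable]: "W \<in> sets borel" "B \<in> sets borel" and fin: "emeasure lborel W < \<infinity>"
 shows "ennreal \<bar>measure lborel (W \<inter> {w. w + v \<in> B}) - measure lborel W * indicator B v\<bar> =
  (nLeb w. indicator W w * ennreal \<bar>indicator B (w + v) - indicator B v\<bar>)"
proof -
 let ?T = "W \<inter> {w. w + v \<in> B}"
 have "emeasure lborel ?T \<le> emeasure lborel W" by (intro emeasure_mono) auto
 then have fT: "emeasure lborel ?T < \<infinity>" using fin by (rule le_less_trans)
 have fm: "W \<in> fmeasurable lborel" "?T \<in> fmeasurable lborel"
  using fin fT by (auto simp: fmeasurable_def)
 show ?thesis
 proof (cases "v \<in> B")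
  case True
  have "(nLeb w. indicator W w * ennreal \<bar>indicator B (w + v) - indicator B v\<bar>) = (nLeb w. indicator (W - ?T) w)"
   using True by (intro nn_integral_cong) (auto split: split_indicator)
  also have "\<dots> = emeasure lborel (W - ?T)" by simp
  also have "\<dots> = ennreal (measure lborel (W - ?T))" using fm by (intro emeasure_eq_measure2) auto
  also have "measure lborel (W - ?T) = measure lborel W - measure lborel ?T"
   using fm fin by (intro measure_Diff) auto
  also have "\<dots> = \<bar>measure lborel ?T - measure lborel W * indicator B v\<bar>"
   using True measure_mono_fmeasurable[of ?T W lborel] fm by auto
  finally show ?thesis by simp
 next
  case False
  have "(nLeb w. indicator W w * ennreal \<bar>indicator B (w + v) - indicator B v\<bar>) = (nLeb w. indicator ?T w)"
   using False by (intro nn_integral_cong) (auto split: split_indicator)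
  also have "\<dots> = emeasure lborel ?T" by simp
  also have "\<dots> = ennreal (measure lborel ?T)" using fm by (intro emeasure_eq_measure2) auto
  finally show ?thesis using False by simp
 qed
qed

lemma integral_lborel_scaleR:
 fixes f :: "'a::euclidean_space \<Rightarrow> 'c::{banach, second_countable_topology}"
 assumes [measurable]: "f \<in> borel_measurable borel" and c: "c \<noteq> 0"
 shows "(Leb x. f x) = \<bar>c\<bar> ^ DIM('a) *\<^sub>R (Leb x. f (c *\<^sub>R x))"
proof -
 have "(Leb x. f x) = (\<integral>x. f x \<partial>density (distr lborel borel (\<lambda>x :: 'a. 0 + c *\<^sub>R x)) (\<lambda>_. ennreal (\<bar>c\<bar> ^ DIM('a))))"
  by (subst lborel_affine[of c "0 :: 'a"]) (use c in auto)
 also have "\<dots> = (\<integral>x. \<bar>c\<bar> ^ DIM('a) *\<^sub>R f x \<partial>distr lborel borel (\<lambda>x :: 'a. 0 + c *\<^sub>R x))"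
  by (subst integral_density) auto
 finally show ?thesis by (simp add: integral_distr)
qed

section \<open>Boundary effects of the window\<close>

context scaled_grain_model
begin

definition cover_volume :: "'a set \<Rightarrow> ('a \<times> 'b) \<times> ('a \<times> 'b) set \<Rightarrow> real" where
 "cover_volume B x = measure lborel (B \<inter> {t. x \<in> C t})"

text \<open>Approximates \<open>cover_volume B\<close> by ignoring the boundary of the window: a grain whose centre
 projects into the window contributes its whole section.\<close>

definition strip_volume :: "'a set \<Rightarrow> ('a \<times> 'b) \<times> ('a \<times> 'b) set \<Rightarrow> real" where
 "strip_volume B x = section_volume (snd x) (- snd (fst x)) * indicator B (fst (fst x))"

lemma strip_volume_meas [measurable]:
 assumes [measurable]: "B \<in> sets borel"
 shows "strip_volume B \<in> borel_measurable (borel \<Otimes>\<^sub>M fell_borel)"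
 unfolding strip_volume_def[abs_def] borel_prod[symmetric] by measurable

lemma cover_volume_nonneg: "0 \<le> cover_volume B x" by (simp add: cover_volume_def)

lemma shot_eq_cover_volume:
 assumes "poisson_cover_window M m e C \<mu> \<rho> B" "x \<in> space m"
 shows "poisson_cover_window.shot C B x = cover_volume B x"
proof -
 interpret W: poisson_cover_window M m e C \<mu> \<rho> B by fact
 have [measurable]: "{t. x \<in> C t} \<in> sets borel" using assms(2) by (rule W.sets_shot)
 have "emeasure W.LB {t. x \<in> C t} = (nLeb t. indicator B t * indicator {t. x \<in> C t} t)"
  unfolding W.LB_def by (subst emeasure_density) auto
 also have "\<dots> = (nLeb t. indicator (B \<inter> {t. x \<in> C t}) t)"
  by (intro nn_integral_cong) (auto split: split_indicator)
 also have "\<dots> = emeasure lborel (B \<inter> {t. x \<in> C t})" by simp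
 finally show ?thesis unfolding W.shot_def cover_volume_def measure_def by simp
qed

lemma cover_volume_integrable:
 assumes "B \<in> sets borel" "emeasure lborel B < \<infinity>"
 shows "has_bochner_integral m (cover_volume B) (\<mu> * measure lborel B)"
proof -
 interpret W: poisson_cover_window M m e C \<mu> \<rho> B
  using assms by unfold_locales
 have "has_bochner_integral m W.shot (\<mu> * W.b)" by (rule W.shot_integral)
 then show ?thesis
  unfolding W.b_def
  by (rule has_bochner_integral_cong[THEN iffD1, rotated -1])
    (auto intro: shot_eq_cover_volume[OF W.poisson_cover_window_axioms])
qed

lemma cover_volume_Xi:
 assumes w: "z \<in> space M" and [measurable]: "B \<in> sets borel"
 shows "cover_volume B ((v, r), Xi z) = measure lborel ({w. (w, - r) \<in> Xi z} \<inter> {w. w + v \<in> B})"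
proof -
 let ?S = "B \<inter> {t. ((v, r), Xi z) \<in> C t}"
 have S: "?S = B \<inter> {t. t - v \<in> {w. (w, - r) \<in> Xi z}}"
  using closed_Xi[OF w] by (auto simp: C_def)
 have [measurable]: "{w. (w, - r) \<in> Xi z} \<in> sets borel" by (rule sets_section[OF w])
 have "?S \<in> sets borel" unfolding S by measurable
 from emeasure_lborel_translate[OF this, of v]
 have "emeasure lborel ?S = emeasure lborel {x. x + v \<in> ?S}" by simp
 also have "{x. x + v \<in> ?S} = {w. (w, - r) \<in> Xi z} \<inter> {w. w + v \<in> B}" unfolding S by auto
 finally show ?thesis by (simp add: cover_volume_def measure_def)
qed

text \<open>For one grain shape the error is integrated over all positions. With the order
  exchanged, a point w of a section contributes twice the volume that the window loses when shifted
  by w, at most 2 D. Section volumes of order R^q over heights of order R^(1-q) yield the factor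
  R.\<close>

lemma boundary_error:
 assumes good: "y \<in> space M" "0 < R y" "Xi0 y \<subseteq> {t. norm t \<le> 1}"
  and B [measurable]: "B \<in> sets borel" and Bf: "emeasure lborel B < \<infinity>" and a: "0 < a"
  and D: "\<And>w. norm w \<le> rad y \<Longrightarrow> measure lborel B - measure lborel (B \<inter> {x. x + w \<in> B}) \<le> D"
 shows "(nLeb x. ennreal (norm (comp_exp \<theta> (a * cover_volume B (x, Xi y)) - comp_exp \<theta> (a * strip_volume B (x, Xi y)))))
  \<le> ennreal (4 * \<bar>\<theta>\<bar> * a * vol_a * vol_b * (D * (R y * min 2 (\<bar>\<theta>\<bar> * (a * (vol_a * R y powr q))))))"
proof -
 define h where "h = vol_a * R y powr q"
 define k where "k = 2 * \<bar>\<theta>\<bar> * a * min 2 (\<bar>\<theta>\<bar> * (a * h))"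
 have h0: "0 \<le> h" and k0: "0 \<le> k" using a vol_pos by (auto simp: h_def k_def)
 have D0: "0 \<le> D"
 proof -
  have "B \<inter> {x. x + 0 \<in> B} = B" by auto
  then show ?thesis using D[of 0] rad_nonneg by simp
 qed
 have Xm [measurable]: "Xi y \<in> sets borel" using closed_Xi[OF good(1)] by simp
 have sec: "emeasure lborel {w. (w, s) \<in> Xi y} \<le> ennreal h * indicator (cball 0 (rad y)) s" for s
  using section_em_le[OF good(2,3), of s] by (simp add: section_em_def h_def)
 have secf: "emeasure lborel {w. (w, s) \<in> Xi y} < \<infinity>" for s
  by (rule le_less_trans[OF sec]) (auto split: split_indicator)
 define F where "F v r w = indicator (Xi y) (w, - r) * ennreal \<bar>indicator B (w + v) - indicator B v\<bar>" for v r w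
 have Fm [measurable]: "(\<lambda>p. F (f p) (g p) (i p)) \<in> borel_measurable N"
  if [measurable]: "f \<in> borel_measurable N" "g \<in> borel_measurable N" "i \<in> borel_measurable N" for N :: "'z measure" and f g i
  unfolding F_def by measurable
 have pt: "ennreal (norm (comp_exp \<theta> (a * cover_volume B ((v, r), Xi y)) - comp_exp \<theta> (a * strip_volume B ((v, r), Xi y))))
   \<le> ennreal k * (nLeb w. F v r w)" for v r
 proof -
  let ?W = "{w. (w, - r) \<in> Xi y}"
  have Wm: "?W \<in> sets borel" by (rule sets_section[OF good(1)])
  define z where "z = cover_volume B ((v, r), Xi y)"
  define z' where "z' = strip_volume B ((v, r), Xi y)"
  have zz: "z = measure lborel (?W \<inter> {w. w + v \<in> B})" "z' = measure lborel ?W * indicator B v"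
   by (simp_all add: z_def z'_def cover_volume_Xi good(1) strip_volume_def section_volume_def)
  have W: "measure lborel ?W \<le> h"
  proof -
   have "emeasure lborel ?W \<le> ennreal h" by (rule order_trans[OF sec]) (auto split: split_indicator)
   then show ?thesis unfolding measure_def using h0 by (intro enn2real_leI)
  qed
  have WT: "measure lborel (?W \<inter> {w. w + v \<in> B}) \<le> measure lborel ?W"
   using Wm secf by (intro measure_mono_fmeasurable) (auto simp: fmeasurable_def)
  have rng: "0 \<le> z" "z \<le> h" "0 \<le> z'" "z' \<le> h"
   using W WT h0 unfolding zz by (auto split: split_indicator)
  have "norm (comp_exp \<theta> (a * z) - comp_exp \<theta> (a * z')) \<le> 2 * \<bar>\<theta>\<bar> * \<bar>a * z - a * z'\<bar> * min 2 (\<bar>\<theta>\<bar> * (a * h))"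
   using rng a by (intro comp_exp_diff_le) auto
  also have "\<bar>a * z - a * z'\<bar> = a * \<bar>z - z'\<bar>"
   using a by (simp add: abs_mult flip: right_diff_distrib)
  finally have "norm (comp_exp \<theta> (a * z) - comp_exp \<theta> (a * z')) \<le> k * \<bar>z - z'\<bar>"
   by (simp only: k_def mult_ac)
  then have "ennreal (norm (comp_exp \<theta> (a * z) - comp_exp \<theta> (a * z'))) \<le> ennreal k * ennreal \<bar>z - z'\<bar>"
   using k0 by (simp flip: ennreal_mult)
  also have "ennreal \<bar>z - z'\<bar> = (nLeb w. indicator ?W w * ennreal \<bar>indicator B (w + v) - indicator B v\<bar>)"
   unfolding zz by (rule measure_translate_Int_diff[OF Wm B secf])
  also have "\<dots> = (nLeb w. F v r w)"
   unfolding F_def by (intro nn_integral_cong) (auto split: split_indicator)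
  finally show ?thesis unfolding z_def z'_def .
 qed
 have inner: "(nLeb v. (nLeb w. F v r w)) \<le> ennreal (2 * D * h) * indicator (cball 0 (rad y)) r" for r
 proof -
  have "(nLeb v. (nLeb w. F v r w)) = (nLeb w. (nLeb v. F v r w))"
   by (rule lborel_pair.Fubini') measurable
  also have "\<dots> \<le> (nLeb w. ennreal (2 * D) * indicator {w. (w, - r) \<in> Xi y} w)"
  proof (rule nn_integral_mono)
   fix w
   show "(nLeb v. F v r w) \<le> ennreal (2 * D) * indicator {w. (w, - r) \<in> Xi y} w"
   proof (cases "(w, - r) \<in> Xi y")
    case True
    have "norm (w, - r) \<le> rad y" by (rule Xi_subset[OF good(2,3) True])
    then have nw: "norm w \<le> rad y" using norm_fst_le[of w "- r"] by simp
    have "(nLeb v. F v r w) = (nLeb v. ennreal \<bar>indicator B (v + w) - indicator B v\<bar>)"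
     using True by (simp add: F_def add.commute)
    also have "\<dots> \<le> ennreal (2 * D)"
     unfolding nn_integral_indicator_translate_diff[OF B Bf] using D[OF nw] by (intro ennreal_leI) simp
    finally show ?thesis using True by simp
   qed (simp add: F_def)
  qed
  also have "\<dots> = ennreal (2 * D) * emeasure lborel {w. (w, - r) \<in> Xi y}"
   using sets_section[OF good(1)] by (subst nn_integral_cmult_indicator) auto
  also have "\<dots> \<le> ennreal (2 * D) * (ennreal h * indicator (cball 0 (rad y)) (- r))"
   by (intro mult_left_mono sec) simp
  also have "\<dots> = ennreal (2 * D * h) * indicator (cball 0 (rad y)) r"
   using D0 h0 by (auto simp: ennreal_mult split: split_indicator)
  finally show ?thesis .
 qed
 have "(\<lambda>x. \<integral>\<^sup>+w. F (fst x) (snd x) w \<partial>lborel) \<in> borel_measurable ((borel :: 'a measure) \<Otimes>\<^sub>M (borel :: 'b measure))"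
  by measurable
 then have [measurable]: "(\<lambda>x. \<integral>\<^sup>+w. F (fst x) (snd x) w \<partial>lborel) \<in> borel_measurable borel"
  by (simp only: borel_prod)
 have "(nLeb x. ennreal (norm (comp_exp \<theta> (a * cover_volume B (x, Xi y)) - comp_exp \<theta> (a * strip_volume B (x, Xi y)))))
   \<le> (nLeb x. ennreal k * (nLeb w. F (fst x) (snd x) w))"
  by (intro nn_integral_mono) (use pt in \<open>auto simp: split_paired_all\<close>)
 also have "\<dots> = (nLeb r. (nLeb v. ennreal k * (nLeb w. F v r w)))"
  by (subst nn_integral_lborel_prod_swap) simp_all
 also have "\<dots> \<le> (nLeb r. ennreal k * (ennreal (2 * D * h) * indicator (cball (0 :: 'b) (rad y)) r))"
 proof (rule nn_integral_mono)
  fix r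
  have "(nLeb v. ennreal k * (nLeb w. F v r w)) = ennreal k * (nLeb v. (nLeb w. F v r w))"
   by (rule nn_integral_cmult) measurable
  then show "(nLeb v. ennreal k * (nLeb w. F v r w)) \<le> ennreal k * (ennreal (2 * D * h) * indicator (cball 0 (rad y)) r)"
   using mult_left_mono[OF inner[of r], of "ennreal k"] by simp
 qed
 also have "\<dots> = ennreal k * (ennreal (2 * D * h) * emeasure lborel (cball (0 :: 'b) (rad y)))"
  by (simp add: nn_integral_cmult)
 also have "\<dots> = ennreal (k * (2 * D * h * (vol_b * R y powr (1 - q))))"
  using k0 h0 D0 vol_pos by (simp add: emeasure_cball_b[OF good(2)] flip: ennreal_mult)
 also have "k * (2 * D * h * (vol_b * R y powr (1 - q))) = 4 * \<bar>\<theta>\<bar> * a * vol_a * vol_b * (D * ((R y powr q * R y powr (1 - q)) * min 2 (\<bar>\<theta>\<bar> * (a * h))))"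
  by (simp add: k_def h_def mult_ac)
 also have "R y powr q * R y powr (1 - q) = R y"
  using good(2) by (simp flip: powr_add)
 finally show ?thesis unfolding h_def .
qed

end


context scaled_grain_model
begin

lemma scaled_window:
 fixes A :: "'a set"
 assumes A [measurable]: "A \<in> sets borel" and l: "0 < l"
 shows "(\<lambda>x. l *\<^sub>R x) ` A \<in> sets borel"
  and "emeasure lborel ((\<lambda>x. l *\<^sub>R x) ` A) = ennreal (l ^ DIM('a)) * emeasure lborel A"
  and "measure lborel ((\<lambda>x. l *\<^sub>R x) ` A) = l powr \<nu>\<^sub>0 * measure lborel A"
  and "measure lborel ((\<lambda>x. l *\<^sub>R x) ` A \<inter> {x. x + w \<in> (\<lambda>x. l *\<^sub>R x) ` A}) =
   l powr \<nu>\<^sub>0 * measure lborel (A \<inter> {x. x + w /\<^sub>R l \<in> A})"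
proof -
 have e: "(\<lambda>x. l *\<^sub>R x) ` A = {x. x /\<^sub>R l \<in> A}" by (rule scaleR_image_eq_vimage[OF l])
 have "(\<lambda>x. x /\<^sub>R l) -` A \<inter> space borel \<in> sets borel" by (rule measurable_sets[of _ _ borel]) measurable
 then show "(\<lambda>x. l *\<^sub>R x) ` A \<in> sets borel" unfolding e by (simp add: vimage_def)
 have d: "l ^ DIM('a) = l powr \<nu>\<^sub>0" using l by (simp add: nu powr_realpow)
 have mm: "measure lborel {x. x /\<^sub>R l \<in> A'} = l powr \<nu>\<^sub>0 * measure lborel A'" if "A' \<in> sets borel" for A' :: "'a set"
  using emeasure_lborel_scaleR_vimage[OF that l] by (simp add: measure_def enn2real_mult d)
 show "emeasure lborel ((\<lambda>x. l *\<^sub>R x) ` A) = ennreal (l ^ DIM('a)) * emeasure lborel A"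
  unfolding e by (rule emeasure_lborel_scaleR_vimage[OF A l])
 show "measure lborel ((\<lambda>x. l *\<^sub>R x) ` A) = l powr \<nu>\<^sub>0 * measure lborel A"
  unfolding e by (rule mm[OF A])
 have "{x. x /\<^sub>R l \<in> A} \<inter> {x. x + w \<in> {x. x /\<^sub>R l \<in> A}} = {x. x /\<^sub>R l \<in> A \<inter> {x. x + w /\<^sub>R l \<in> A}}"
  by (auto simp: algebra_simps)
 then show "measure lborel ((\<lambda>x. l *\<^sub>R x) ` A \<inter> {x. x + w \<in> (\<lambda>x. l *\<^sub>R x) ` A}) =
   l powr \<nu>\<^sub>0 * measure lborel (A \<inter> {x. x + w /\<^sub>R l \<in> A})"
  unfolding e using mm[of "A \<inter> {x. x + w /\<^sub>R l \<in> A}"] by (simp only:) measurable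
qed

end

locale stable_grain_model = scaled_grain_model M R \<alpha> c u Xi0 Xi Xis \<nu>\<^sub>0 \<nu>
 for M :: "'w measure" and R \<alpha> c and u :: "nat \<Rightarrow> 'w \<Rightarrow> 'a::euclidean_space \<times> 'b::euclidean_space"
  and Xi0 Xi Xis \<nu>\<^sub>0 \<nu> +
 assumes \<alpha>q: "\<alpha> < 1 + q"
begin

sublocale sr: stable_regime M R \<alpha> c q
 using q01 \<alpha>12 \<alpha>q by unfold_locales auto

text \<open>The truncation level \<open>y\<close> balances the two branches of the minimum: \<open>a * y powr q = 1\<close>.\<close>

lemma moment_min_bound:
 assumes k: "0 \<le> k"
 shows "\<exists>C>0. \<forall>a>0. (nMean w. ennreal (R w * min 2 (k * (a * R w powr q)))) \<le> ennreal (C * a powr (sr.p - 1))"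
proof -
 obtain C1 where C1: "C1 > 0" "\<And>x. x > 0 \<Longrightarrow>
   (nMean w. ennreal (R w powr (1 + q)) * indicator {..x} (R w)) \<le> ennreal (C1 * x powr (1 + q - \<alpha>))"
  using nn_integral_powr_trunc_bound[of "1 + q"] \<alpha>q by auto
 obtain C2 where C2: "C2 > 0" "\<And>x. x > 0 \<Longrightarrow>
   (nMean w. ennreal (R w powr 1) * indicator {x<..} (R w)) \<le> ennreal (C2 * x powr (1 - \<alpha>))"
  using nn_integral_powr_tail_bound[of 1] \<alpha>12 by auto
 have "(nMean w. ennreal (R w * min 2 (k * (a * R w powr q)))) \<le> ennreal ((k * C1 + 2 * C2) * a powr (sr.p - 1))"
  if a: "0 < a" for a
 proof -
  define y where "y = a powr (- 1 / q)"
  have y: "y > 0" using a by (simp add: y_def)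
  have "a * y powr (1 + q - \<alpha>) = a powr 1 * a powr ((- 1 / q) * (1 + q - \<alpha>))"
   unfolding y_def powr_powr using a by simp
  also have "\<dots> = a powr (1 + (- 1 / q) * (1 + q - \<alpha>))" by (simp only: powr_add)
  also have "1 + (- 1 / q) * (1 + q - \<alpha>) = sr.p - 1" using q01 by (simp add: sr.p_def field_simps)
  finally have y1: "a * y powr (1 + q - \<alpha>) = a powr (sr.p - 1)" .
  have "(- 1 / q) * (1 - \<alpha>) = sr.p - 1" using q01 by (simp add: sr.p_def field_simps)
  then have y2: "y powr (1 - \<alpha>) = a powr (sr.p - 1)" unfolding y_def powr_powr by (simp only:)
  have "(nMean w. ennreal (R w * min 2 (k * (a * R w powr q)))) \<le>
    (nMean w. ennreal (k * a) * (ennreal (R w powr (1 + q)) * indicator {..y} (R w)) +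
     ennreal 2 * (ennreal (R w powr 1) * indicator {y<..} (R w)))"
  proof (rule nn_integral_mono_AE)
   show "AE w in M. ennreal (R w * min 2 (k * (a * R w powr q))) \<le>
     ennreal (k * a) * (ennreal (R w powr (1 + q)) * indicator {..y} (R w)) +
     ennreal 2 * (ennreal (R w powr 1) * indicator {y<..} (R w))"
    using R_pos
   proof eventually_elim
    case (elim w)
    show ?case
    proof (cases "R w \<le> y")
     case True
     have "R w * min 2 (k * (a * R w powr q)) \<le> R w * (k * (a * R w powr q))"
      using elim by (intro mult_left_mono) auto
     also have "\<dots> = k * a * (R w powr 1 * R w powr q)" using elim by simp
     also have "R w powr 1 * R w powr q = R w powr (1 + q)" by (simp only: powr_add)
     finally have "ennreal (R w * min 2 (k * (a * R w powr q))) \<le> ennreal (k * a) * ennreal (R w powr (1 + q))"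
      using k a by (simp add: ennreal_leI flip: ennreal_mult)
     then show ?thesis using True by simp
    next
     case False
     have "R w * min 2 (k * (a * R w powr q)) \<le> R w * 2"
      using elim by (intro mult_left_mono) auto
     then have "ennreal (R w * min 2 (k * (a * R w powr q))) \<le> ennreal (2 * R w powr 1)"
      using elim by (intro ennreal_leI) simp
     then have "ennreal (R w * min 2 (k * (a * R w powr q))) \<le> ennreal 2 * ennreal (R w powr 1)"
      by (subst ennreal_mult[symmetric]) auto
     then show ?thesis using False by simp
    qed
   qed
  qed
  also have "\<dots> = ennreal (k * a) * (nMean w. ennreal (R w powr (1 + q)) * indicator {..y} (R w)) +
    ennreal 2 * (nMean w. ennreal (R w powr 1) * indicator {y<..} (R w))"
   by (subst nn_integral_add, measurable, measurable, subst (1 2) nn_integral_cmult, measurable)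
  also have "\<dots> \<le> ennreal (k * a) * ennreal (C1 * y powr (1 + q - \<alpha>)) + ennreal 2 * ennreal (C2 * y powr (1 - \<alpha>))"
   by (intro add_mono mult_left_mono C1 C2 y) auto
  also have "\<dots> = ennreal (k * C1 * (a * y powr (1 + q - \<alpha>)) + 2 * C2 * y powr (1 - \<alpha>))"
  proof -
   have "ennreal (k * a) * ennreal (C1 * y powr (1 + q - \<alpha>)) = ennreal (k * C1 * (a * y powr (1 + q - \<alpha>)))"
    using k a C1(1) by (subst ennreal_mult[symmetric]) (auto simp: mult_ac)
   moreover have "ennreal 2 * ennreal (C2 * y powr (1 - \<alpha>)) = ennreal (2 * C2 * y powr (1 - \<alpha>))"
    using C2(1) by (subst ennreal_mult[symmetric]) (auto simp: mult_ac)
   ultimately show ?thesis using k a C1(1) C2(1) by (simp add: ennreal_plus)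
  qed
  also have "\<dots> = ennreal ((k * C1 + 2 * C2) * a powr (sr.p - 1))"
   unfolding y1 y2 by (simp only: distrib_right)
  finally show ?thesis .
 qed
 moreover have "0 < k * C1 + 2 * C2" using k C1(1) C2(1) by (intro add_nonneg_pos) auto
 ultimately show ?thesis by blast
qed

lemma cover_volume_meas [measurable]:
 "B \<in> sets borel \<Longrightarrow> emeasure lborel B < \<infinity> \<Longrightarrow> cover_volume B \<in> borel_measurable m"
 by (rule borel_measurable_integrable[OF integrable.intros[OF cover_volume_integrable]])

text \<open>A grain of radius at most \<delta> shifts the window so little that \<epsilon> bounds
  the loss, and the moment with the minimum gives a^p. For larger grains the loss is at most the
  volume of B, and the tail moment of R beyond \<delta>^\<nu> gives the exponent \<nu> (1 -
  \<alpha>) of \<delta>.\<close>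

lemma strip_error:
 "\<exists>C>0. \<forall>B a \<epsilon> \<delta>. B \<in> sets borel \<longrightarrow> emeasure lborel B < \<infinity> \<longrightarrow> 0 < a \<longrightarrow> 0 \<le> \<epsilon> \<longrightarrow> 0 < \<delta> \<longrightarrow>
  (\<forall>w. norm w \<le> \<delta> \<longrightarrow> measure lborel B - measure lborel (B \<inter> {x. x + w \<in> B}) \<le> \<epsilon>) \<longrightarrow>
  (\<integral>\<^sup>+x. ennreal (norm (comp_exp \<theta> (a * cover_volume B x) - comp_exp \<theta> (a * strip_volume B x))) \<partial>m)
   \<le> ennreal (C * (\<epsilon> * a powr sr.p + measure lborel B * a * \<delta> powr (\<nu> * (1 - \<alpha>))))"
proof -
 define k where "k = \<bar>\<theta>\<bar> * vol_a"
 have k: "0 \<le> k" using vol_pos by (simp add: k_def)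
 obtain C1 where C1: "C1 > 0" "\<And>a. a > 0 \<Longrightarrow> (nMean z. ennreal (R z * min 2 (k * (a * R z powr q)))) \<le> ennreal (C1 * a powr (sr.p - 1))"
  using moment_min_bound[OF k] by auto
 obtain C2 where C2: "C2 > 0" "\<And>x. x > 0 \<Longrightarrow>
   (nMean z. ennreal (R z powr 1) * indicator {x<..} (R z)) \<le> ennreal (C2 * x powr (1 - \<alpha>))"
  using nn_integral_powr_tail_bound[of 1] \<alpha>12 by auto
 define c1 where "c1 = 4 * \<bar>\<theta>\<bar> * vol_a * vol_b"
 have c1: "0 \<le> c1" using vol_pos by (simp add: c1_def)
 \<comment> \<open>Dominates the constants of both contributions; the summand 1 keeps it positive
   when \<theta> = 0.\<close>
 define C where "C = c1 * (C1 + 2 * C2) + 1"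
 have "0 \<le> c1 * (C1 + 2 * C2)" using c1 C1(1) C2(1) by (intro mult_nonneg_nonneg) auto
 then have "C > 0" unfolding C_def by (rule add_nonneg_pos) simp
 moreover have "c1 * C1 \<le> C" "c1 * (2 * C2) \<le> C"
  using c1 C1(1) C2(1) mult_nonneg_nonneg[of c1 C1] mult_nonneg_nonneg[of c1 C2] by (auto simp: C_def distrib_left)
 ultimately have C: "C > 0" "c1 * C1 \<le> C" "c1 * (2 * C2) \<le> C" by auto
 have "(\<integral>\<^sup>+x. ennreal (norm (comp_exp \<theta> (a * cover_volume B x) - comp_exp \<theta> (a * strip_volume B x))) \<partial>m)
   \<le> ennreal (C * (\<epsilon> * a powr sr.p + measure lborel B * a * \<delta> powr (\<nu> * (1 - \<alpha>))))"
  if B [measurable]: "B \<in> sets borel" and Bf: "emeasure lborel B < \<infinity>" and a: "0 < a" and e: "0 \<le> \<epsilon>" and d: "0 < \<delta>"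
   and D: "\<And>w. norm w \<le> \<delta> \<Longrightarrow> measure lborel B - measure lborel (B \<inter> {x. x + w \<in> B}) \<le> \<epsilon>" for B a \<epsilon> \<delta>
 proof -
  let ?b = "measure lborel B"
  let ?E = "\<lambda>x. ennreal (norm (comp_exp \<theta> (a * cover_volume B x) - comp_exp \<theta> (a * strip_volume B x)))"
  define y where "y = \<delta> powr \<nu>"
  have y: "y > 0" using d by (simp add: y_def)
  have "cover_volume B \<in> borel_measurable m" using B Bf by measurable
  then have [measurable]: "cover_volume B \<in> borel_measurable (borel \<Otimes>\<^sub>M fell_borel)"
   by (simp cong: measurable_cong_sets add: sets_m)
  have "(\<integral>\<^sup>+x. ?E x \<partial>m) = (nMean z. (nLeb x. ?E (x, Xi z)))"
   by (rule nn_integral_m) measurable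
  also have "\<dots> \<le> (nMean z. ennreal (c1 * a * \<epsilon>) * ennreal (R z * min 2 (k * (a * R z powr q))) +
    ennreal (c1 * a * ?b * 2) * (ennreal (R z powr 1) * indicator {y<..} (R z)))"
  proof (rule nn_integral_mono_AE)
   show "AE z in M. (nLeb x. ?E (x, Xi z)) \<le> ennreal (c1 * a * \<epsilon>) * ennreal (R z * min 2 (k * (a * R z powr q))) +
     ennreal (c1 * a * ?b * 2) * (ennreal (R z powr 1) * indicator {y<..} (R z))"
    using AE_grain
   proof eventually_elim
    case (elim z)
    define r where "r = R z * min 2 (k * (a * R z powr q))"
    \<comment> \<open>The loss allowed for this grain: \<epsilon>, plus the trivial bound
      \<open>?b\<close> if its radius exceeds \<delta>.\<close>
    define D' where "D' = \<epsilon> + ?b * indicator {y<..} (R z)"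
    have r: "0 \<le> r" "r \<le> R z * 2" using elim k a unfolding r_def by (auto intro!: mult_nonneg_nonneg mult_left_mono)
    have "(nLeb x. ?E (x, Xi z))
      \<le> ennreal (4 * \<bar>\<theta>\<bar> * a * vol_a * vol_b * (D' * (R z * min 2 (\<bar>\<theta>\<bar> * (a * (vol_a * R z powr q))))))"
    proof (rule boundary_error)
     fix w :: 'a assume w: "norm w \<le> rad z"
     show "?b - measure lborel (B \<inter> {x. x + w \<in> B}) \<le> D'"
     proof (cases "R z \<le> y")
      case True
      have "rad z \<le> y powr (1 / \<nu>)" unfolding rad_def using True elim nu_pos by (intro powr_mono2) auto
      also have "\<dots> = \<delta>" using d nu_pos by (simp add: y_def powr_powr)
      finally have "norm w \<le> \<delta>" using w by simp
      from D[OF this] True show ?thesis by (simp add: D'_def)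
     next
      case False
      then show ?thesis using e by (simp add: D'_def add_increasing)
     qed
    qed (use elim a Bf in auto)
    also have "4 * \<bar>\<theta>\<bar> * a * vol_a * vol_b * (D' * (R z * min 2 (\<bar>\<theta>\<bar> * (a * (vol_a * R z powr q))))) = c1 * a * (D' * r)"
     by (simp add: c1_def r_def k_def mult_ac)
    also have "c1 * a * (D' * r) \<le> c1 * a * \<epsilon> * r + c1 * a * ?b * 2 * (R z * indicator {y<..} (R z))"
    proof -
     have "D' * r = \<epsilon> * r + ?b * (r * indicator {y<..} (R z))" by (simp add: D'_def algebra_simps)
     also have "\<dots> \<le> \<epsilon> * r + ?b * ((R z * 2) * indicator {y<..} (R z))"
      using r by (intro add_left_mono mult_left_mono mult_right_mono) auto
     finally have "c1 * a * (D' * r) \<le> c1 * a * (\<epsilon> * r + ?b * ((R z * 2) * indicator {y<..} (R z)))"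
      using c1 a by (intro mult_left_mono) auto
     then show ?thesis by (simp add: algebra_simps)
    qed
    also have "ennreal (c1 * a * \<epsilon> * r + c1 * a * ?b * 2 * (R z * indicator {y<..} (R z))) =
      ennreal (c1 * a * \<epsilon>) * ennreal r + ennreal (c1 * a * ?b * 2) * (ennreal (R z powr 1) * indicator {y<..} (R z))"
     using c1 a e r elim
     by (subst ennreal_plus) (auto simp: ennreal_mult split: split_indicator)
    finally show ?case unfolding r_def by (simp add: ennreal_leI)
   qed
  qed
  also have "\<dots> = ennreal (c1 * a * \<epsilon>) * (nMean z. ennreal (R z * min 2 (k * (a * R z powr q)))) +
    ennreal (c1 * a * ?b * 2) * (nMean z. ennreal (R z powr 1) * indicator {y<..} (R z))"
   by (subst nn_integral_add, measurable, measurable, subst (1 2) nn_integral_cmult, measurable)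
  also have "\<dots> \<le> ennreal (c1 * a * \<epsilon>) * ennreal (C1 * a powr (sr.p - 1)) + ennreal (c1 * a * ?b * 2) * ennreal (C2 * y powr (1 - \<alpha>))"
   by (intro add_mono mult_left_mono C1 C2 y a) auto
  also have "\<dots> = ennreal (c1 * a * \<epsilon> * (C1 * a powr (sr.p - 1)) + c1 * a * ?b * 2 * (C2 * y powr (1 - \<alpha>)))"
  proof -
   have n: "0 \<le> c1 * a * \<epsilon>" "0 \<le> c1 * a * ?b * 2" "0 \<le> C1 * a powr (sr.p - 1)" "0 \<le> C2 * y powr (1 - \<alpha>)"
    using c1 a e C1(1) C2(1) by auto
   show ?thesis unfolding ennreal_mult[OF n(1,3), symmetric] ennreal_mult[OF n(2,4), symmetric]
    by (rule ennreal_plus[symmetric]) (intro mult_nonneg_nonneg n)+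
  qed
  also have "c1 * a * \<epsilon> * (C1 * a powr (sr.p - 1)) + c1 * a * ?b * 2 * (C2 * y powr (1 - \<alpha>)) =
    c1 * C1 * (\<epsilon> * a powr sr.p) + c1 * (2 * C2) * (?b * a * \<delta> powr (\<nu> * (1 - \<alpha>)))"
  proof -
   have "a powr sr.p = a powr (1 + (sr.p - 1))" by simp
   also have "\<dots> = a * a powr (sr.p - 1)" using a by (simp only: powr_add) simp
   finally show ?thesis by (simp add: y_def powr_powr mult_ac)
  qed
  also have "\<dots> \<le> C * (\<epsilon> * a powr sr.p) + C * (?b * a * \<delta> powr (\<nu> * (1 - \<alpha>)))"
   using C e a by (intro add_mono mult_right_mono) auto
  finally show ?thesis by (simp add: distrib_left ennreal_leI)
 qed
 then show ?thesis using C(1) by blast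
qed

text \<open>For a = \<open>l powr (- (\<nu>\<^sub>0 / sr.p))\<close> the power a^p cancels the
  growth of the window, so the first error term is a fixed multiple of \<epsilon>. The radius
  threshold is taken proportional to l; the second term then decays like l^e0.\<close>

lemma strip_error_limit:
 assumes A [measurable]: "A \<in> sets borel" and bdd: "bounded A" and \<eta>: "0 < \<eta>"
 shows "\<forall>\<^sub>F l in at_top. (\<integral>\<^sup>+x. ennreal (norm (comp_exp \<theta> (l powr (- (\<nu>\<^sub>0 / sr.p)) * cover_volume ((\<lambda>x. l *\<^sub>R x) ` A) x) -
   comp_exp \<theta> (l powr (- (\<nu>\<^sub>0 / sr.p)) * strip_volume ((\<lambda>x. l *\<^sub>R x) ` A) x))) \<partial>m) \<le> ennreal \<eta>"
proof -
 obtain C where C: "C > 0" "\<And>B a \<epsilon> \<delta>. B \<in> sets borel \<Longrightarrow> emeasure lborel B < \<infinity> \<Longrightarrow> 0 < a \<Longrightarrow> 0 \<le> \<epsilon> \<Longrightarrow> 0 < \<delta> \<Longrightarrow>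
  (\<And>w. norm w \<le> \<delta> \<Longrightarrow> measure lborel B - measure lborel (B \<inter> {x. x + w \<in> B}) \<le> \<epsilon>) \<Longrightarrow>
  (\<integral>\<^sup>+x. ennreal (norm (comp_exp \<theta> (a * cover_volume B x) - comp_exp \<theta> (a * strip_volume B x))) \<partial>m)
   \<le> ennreal (C * (\<epsilon> * a powr sr.p + measure lborel B * a * \<delta> powr (\<nu> * (1 - \<alpha>))))"
  using strip_error[of \<theta>] by (elim exE conjE) blast
 have Afin: "emeasure lborel A < \<infinity>" by (rule emeasure_bounded_finite[OF bdd])
 \<comment> \<open>Leaves one half of \<eta> for the small grains and one half for the large
   ones.\<close>
 define \<epsilon> where "\<epsilon> = \<eta> / (2 * C)"
 have \<epsilon>: "\<epsilon> > 0" using \<eta> C(1) by (simp add: \<epsilon>_def)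
 have "\<forall>\<^sub>F h in nhds 0. dist (measure lborel (A \<inter> {x. x + h \<in> A})) (measure lborel A) < \<epsilon>"
  by (rule tendstoD[OF measure_lborel_Int_translate_tendsto[OF A bdd] \<epsilon>])
 then obtain d where d: "d > 0" "\<And>h. norm h < d \<Longrightarrow> dist (measure lborel (A \<inter> {x. x + h \<in> A})) (measure lborel A) < \<epsilon>"
  unfolding eventually_nhds_metric by auto
 define \<delta> where "\<delta> = d / 2"
 have \<delta>: "\<delta> > 0" using d by (simp add: \<delta>_def)
 have shift: "measure lborel A - measure lborel (A \<inter> {x. x + h \<in> A}) \<le> \<epsilon>" if "norm h \<le> \<delta>" for h
  using d(2)[of h] that d(1) unfolding \<delta>_def by (simp add: dist_real_def abs_if split: if_splits)
 \<comment> \<open>The exponent of l in the term of the large grains. It is negative because it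
   equals \<open>\<nu>\<^sub>0 * ((sr.p - 1) * (1 / sr.p - 1))\<close>.\<close>
 define e0 where "e0 = \<nu>\<^sub>0 + - (\<nu>\<^sub>0 / sr.p) + \<nu> * (1 - \<alpha>)"
 have e0: "e0 < 0"
 proof -
  have p1: "sr.p - 1 = (\<alpha> - 1) / q" by (simp add: sr.p_def)
  have "\<nu> * (1 - \<alpha>) = - (\<nu>\<^sub>0 * ((\<alpha> - 1) / (\<nu>\<^sub>0 / \<nu>)))"
   using nu_pos by (simp add: field_simps)
  then have "\<nu> * (1 - \<alpha>) = - (\<nu>\<^sub>0 * (sr.p - 1))"
   unfolding p1 q_def[symmetric] .
  then have "e0 = \<nu>\<^sub>0 + - (\<nu>\<^sub>0 / sr.p) + - (\<nu>\<^sub>0 * (sr.p - 1))" unfolding e0_def by (simp only:)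
  also have "\<dots> = \<nu>\<^sub>0 * ((sr.p - 1) * (1 / sr.p - 1))"
   using sr.p12 by (simp add: field_simps)
  finally have "e0 = \<nu>\<^sub>0 * ((sr.p - 1) * (1 / sr.p - 1))" .
  moreover have "(sr.p - 1) * (1 / sr.p - 1) < 0"
   using sr.p12 by (intro mult_pos_neg) (auto simp: field_simps)
  ultimately show ?thesis using nu_pos by (simp add: mult_pos_neg)
 qed
 define K where "K = C * (measure lborel A * \<delta> powr (\<nu> * (1 - \<alpha>)))"
 have "((\<lambda>l. K * l powr e0) \<longlongrightarrow> K * 0) at_top"
  by (intro tendsto_intros tendsto_neg_powr[OF e0] filterlim_ident)
 then have "((\<lambda>l. K * l powr e0) \<longlongrightarrow> 0) at_top" by simp
 from order_tendstoD(2)[OF this, of "\<eta> / 2"] have "\<forall>\<^sub>F l in at_top. K * l powr e0 < \<eta> / 2" using \<eta> by simp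
 then show ?thesis using eventually_gt_at_top[of 0]
 proof eventually_elim
  case (elim l)
  let ?B = "(\<lambda>x. l *\<^sub>R x) ` A"
  define a where "a = l powr (- (\<nu>\<^sub>0 / sr.p))"
  have l: "0 < l" and a: "0 < a" using elim by (auto simp: a_def)
  note sw = scaled_window[OF A l]
  have "(\<integral>\<^sup>+x. ennreal (norm (comp_exp \<theta> (a * cover_volume ?B x) - comp_exp \<theta> (a * strip_volume ?B x))) \<partial>m)
   \<le> ennreal (C * ((l powr \<nu>\<^sub>0 * \<epsilon>) * a powr sr.p + measure lborel ?B * a * (l * \<delta>) powr (\<nu> * (1 - \<alpha>))))"
  proof (rule C(2))
   show "emeasure lborel ?B < \<infinity>" unfolding sw(2) using Afin by (simp add: ennreal_mult_less_top)
   fix w :: 'a assume "norm w \<le> l * \<delta>"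
   then have "norm (w /\<^sub>R l) \<le> \<delta>" using l by (simp add: field_simps)
   from shift[OF this] show "measure lborel ?B - measure lborel (?B \<inter> {x. x + w \<in> ?B}) \<le> l powr \<nu>\<^sub>0 * \<epsilon>"
    unfolding sw(3,4) right_diff_distrib[symmetric] by (intro mult_left_mono) auto
  qed (use sw a l \<epsilon> \<delta> in auto)
  also have "C * ((l powr \<nu>\<^sub>0 * \<epsilon>) * a powr sr.p + measure lborel ?B * a * (l * \<delta>) powr (\<nu> * (1 - \<alpha>))) =
    C * (\<epsilon> * (l powr \<nu>\<^sub>0 * a powr sr.p)) + K * (l powr \<nu>\<^sub>0 * a * l powr (\<nu> * (1 - \<alpha>)))"
   using l \<delta> by (simp add: K_def sw(3) powr_mult algebra_simps)
  also have "l powr \<nu>\<^sub>0 * a powr sr.p = 1"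
  proof -
   have "a powr sr.p = l powr (- \<nu>\<^sub>0)" using sr.p12 by (simp add: a_def powr_powr)
   then show ?thesis using l by (simp add: powr_minus)
  qed
  also have "l powr \<nu>\<^sub>0 * a * l powr (\<nu> * (1 - \<alpha>)) = l powr e0"
   unfolding a_def e0_def by (simp only: powr_add)
  also have "C * (\<epsilon> * 1) = \<eta> / 2" using C(1) by (simp add: \<epsilon>_def)
  also have "ennreal (\<eta> / 2 + K * l powr e0) \<le> ennreal \<eta>" using elim by (intro ennreal_leI) simp
  finally show ?case unfolding a_def .
 qed
qed

end


section \<open>The exponent of the strip approximation\<close>

context stable_grain_model
begin

lemma R_integral_finite: "(nMean w. ennreal (R w)) < \<infinity>"
proof -
 obtain C2 where C2: "C2 > 0" "\<And>x. x > 0 \<Longrightarrow>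
   (nMean w. ennreal (R w powr 1) * indicator {x<..} (R w)) \<le> ennreal (C2 * x powr (1 - \<alpha>))"
  using nn_integral_powr_tail_bound[of 1] \<alpha>12 by auto
 have "(nMean w. ennreal (R w)) \<le> (nMean w. 1 + ennreal (R w powr 1) * indicator {1<..} (R w))"
  by (intro nn_integral_mono) (auto split: split_indicator)
 also have "\<dots> = 1 + (nMean w. ennreal (R w powr 1) * indicator {1<..} (R w))"
  by (subst nn_integral_add) (auto simp: emeasure_space_1)
 also have "\<dots> < \<infinity>" using C2(2)[of 1] by (simp add: le_less_trans)
 finally show ?thesis .
qed

lemma stable_moment_comp_exp:
 "sr.stable_moment \<theta> \<tau> = (Mean w. of_real (R w powr (1 - q)) * comp_exp \<theta> (\<tau> * R w powr q))"
 unfolding sr.stable_moment_def comp_exp_def ..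

text \<open>The contribution of height s, measured in units of the grain radius; the factor r^(1-q)
  is the Jacobian of that rescaling.\<close>

definition grain_kernel :: "real \<Rightarrow> real \<Rightarrow> real \<Rightarrow> ('a \<times> 'b) set \<Rightarrow> 'b \<Rightarrow> complex" where
 "grain_kernel \<theta> a r F s = of_real (r powr (1 - q)) * comp_exp \<theta> (a * section_volume F s * r powr q)"

lemma grain_kernel_meas [measurable (raw)]:
 assumes [measurable]: "f \<in> borel_measurable N" "g \<in> measurable N fell_borel" "h \<in> borel_measurable N"
 shows "(\<lambda>x. grain_kernel \<theta> a (f x) (g x) (h x)) \<in> borel_measurable N"
 unfolding grain_kernel_def by measurable

lemma grain_kernel_le:
 assumes "0 < r" "F \<subseteq> {t. norm t \<le> 1}" "0 < a"
 shows "norm (grain_kernel \<theta> a r F s) \<le> 2 * \<bar>\<theta>\<bar> * a * vol_a * r * indicator (cball 0 1) s"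
proof -
 have sv0: "0 \<le> section_volume F s" by (simp add: section_volume_def)
 have "norm (grain_kernel \<theta> a r F s) \<le> r powr (1 - q) * (2 * \<bar>\<theta> * (a * section_volume F s * r powr q)\<bar>)"
  unfolding grain_kernel_def norm_mult by (intro mult_mono norm_comp_exp_le(1)) auto
 also have "\<dots> = 2 * \<bar>\<theta>\<bar> * a * (r powr (1 - q) * r powr q) * section_volume F s"
  using assms sv0 by (simp add: abs_mult)
 also have "r powr (1 - q) * r powr q = r" using assms(1) by (simp flip: powr_add)
 also have "2 * \<bar>\<theta>\<bar> * a * r * section_volume F s \<le> 2 * \<bar>\<theta>\<bar> * a * r * (vol_a * indicator (cball 0 1) s)"
  using assms by (intro mult_left_mono section_volume_le) auto
 finally show ?thesis by (simp add: mult_ac)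
qed

text \<open>The strip volume is the indicator of the window at the projected position times a
  function of the height, so the integral over positions factorises. Measuring heights in units of
  the radius, with reversed sign, moves the scaling into R.\<close>

lemma strip_slice_integral:
 assumes good: "w \<in> space M" "0 < R w" "Xi0 w \<subseteq> {t. norm t \<le> 1}"
  and B [measurable]: "B \<in> sets borel" and Bf: "emeasure lborel B < \<infinity>"
 shows "(Leb x. comp_exp \<theta> (a * strip_volume B (x, Xi w))) =
  measure lborel B *\<^sub>R (Leb s. grain_kernel \<theta> a (R w) (Xi0 w) s)"
proof -
 define h where "h = vol_a * R w powr q"
 define \<Phi> where "\<Phi> r = comp_exp \<theta> (a * hsec w (- r))" for r
 have [measurable]: "Xi w \<in> space fell_borel" using measurable_space[OF Xi_meas good(1)] .
 have hm [measurable]: "(\<lambda>s. hsec w s) \<in> borel_measurable borel"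
  using good(1) by (intro hsec_meas') auto
 have \<Phi>m [measurable]: "\<Phi> \<in> borel_measurable borel" unfolding \<Phi>_def[abs_def] by measurable
 have hh: "hsec w s = 0" if "norm s > rad w" for s
 proof -
  have "ennreal (hsec w s) = 0"
   using section_em_le[OF good(2,3), of s] that by (simp add: hsec_le(1)[OF good(2,3)])
  then show ?thesis using hsec_nonneg[of w s] by simp
 qed
 have eq: "comp_exp \<theta> (a * strip_volume B ((v, r), Xi w)) = indicator B v *\<^sub>R \<Phi> r" for v r
  by (auto simp: strip_volume_def \<Phi>_def hsec_def section_volume_def split: split_indicator)
 have int: "integrable (lborel \<Otimes>\<^sub>M lborel) (\<lambda>(v, r). indicator B v *\<^sub>R \<Phi> r)"
 proof (rule integrableI_bounded_set[of "B \<times> cball (0 :: 'b) (rad w)" _ _ "2 * \<bar>\<theta>\<bar> * (\<bar>a\<bar> * h)"])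
  have "emeasure (lborel \<Otimes>\<^sub>M lborel) (B \<times> cball (0 :: 'b) (rad w)) = emeasure lborel B * emeasure lborel (cball (0 :: 'b) (rad w))"
   by (rule lborel.emeasure_pair_measure_Times) auto
  also have "\<dots> < \<infinity>" using Bf emeasure_bounded_finite[of "cball (0 :: 'b) (rad w)"] by (simp add: ennreal_mult_less_top)
  finally show "emeasure (lborel \<Otimes>\<^sub>M lborel) (B \<times> cball (0 :: 'b) (rad w)) < \<infinity>" .
  show "AE x in lborel \<Otimes>\<^sub>M lborel. x \<in> B \<times> cball (0 :: 'b) (rad w) \<longrightarrow> norm ((\<lambda>(v, r). indicator B v *\<^sub>R \<Phi> r) x) \<le> 2 * \<bar>\<theta>\<bar> * (\<bar>a\<bar> * h)"
  proof (rule AE_I2, clarify)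
   fix v r assume "v \<in> B"
   have "norm (\<Phi> r) \<le> 2 * \<bar>\<theta> * (a * hsec w (- r))\<bar>" unfolding \<Phi>_def by (rule norm_comp_exp_le)
   also have "\<dots> = 2 * \<bar>\<theta>\<bar> * (\<bar>a\<bar> * hsec w (- r))" using hsec_nonneg[of w "- r"] by (simp add: abs_mult)
   also have "\<dots> \<le> 2 * \<bar>\<theta>\<bar> * (\<bar>a\<bar> * h)"
    unfolding h_def using hsec_le(2)[OF good(2,3), of "- r"] by (intro mult_left_mono) auto
   finally show "norm (indicator B v *\<^sub>R \<Phi> r) \<le> 2 * \<bar>\<theta>\<bar> * (\<bar>a\<bar> * h)" using \<open>v \<in> B\<close> by simp
  qed
  show "AE x in lborel \<Otimes>\<^sub>M lborel. x \<notin> B \<times> cball (0 :: 'b) (rad w) \<longrightarrow> (\<lambda>(v, r). indicator B v *\<^sub>R \<Phi> r) x = 0"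
  proof (rule AE_I2)
   fix x :: "'a \<times> 'b"
   obtain v r where x: "x = (v, r)" by (cases x)
   show "x \<notin> B \<times> cball 0 (rad w) \<longrightarrow> (\<lambda>(v, r). indicator B v *\<^sub>R \<Phi> r) x = 0"
    using hh[of "- r"] by (cases "v \<in> B") (auto simp: x \<Phi>_def)
  qed
 qed auto
 have "(Leb x. comp_exp \<theta> (a * strip_volume B (x, Xi w))) = (\<integral>x. (\<lambda>(v, r). indicator B v *\<^sub>R \<Phi> r) x \<partial>(lborel \<Otimes>\<^sub>M lborel))"
  unfolding lborel_prod by (intro Bochner_integral_cong) (auto simp: eq)
 also have "\<dots> = (Leb r. (Leb v. indicator B v *\<^sub>R \<Phi> r))"
  using lborel_pair.integral_snd[OF int] by simp
 also have "\<dots> = (Leb r. measure lborel B *\<^sub>R \<Phi> r)"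
  using Bf by simp
 also have "\<dots> = measure lborel B *\<^sub>R (Leb r. \<Phi> r)" by simp
 also have "(Leb r. \<Phi> r) = rad w ^ DIM('b) *\<^sub>R (Leb s. \<Phi> ((- rad w) *\<^sub>R s))"
  using integral_lborel_scaleR[OF \<Phi>m, of "- rad w"] rad_power(1)[OF good(2)] by simp
 also have "\<dots> = (Leb s. rad w ^ DIM('b) *\<^sub>R \<Phi> ((- rad w) *\<^sub>R s))" by simp
 also have "\<dots> = (Leb s. grain_kernel \<theta> a (R w) (Xi0 w) s)"
 proof (intro Bochner_integral_cong refl)
  fix s :: 'b
  have "hsec w (rad w *\<^sub>R s) = R w powr q * section_volume (Xi0 w) s"
   using hsec_scale[OF good(2,1), of "rad w *\<^sub>R s"] rad_power(1)[OF good(2)] by simp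
  then show "rad w ^ DIM('b) *\<^sub>R \<Phi> ((- rad w) *\<^sub>R s) = grain_kernel \<theta> a (R w) (Xi0 w) s"
   by (simp add: \<Phi>_def grain_kernel_def rad_power(4)[OF good(2)] mult_ac scaleR_conv_of_real)
 qed
 finally show ?thesis .
qed

text \<open>Fubini moves the height outside. For fixed s, independence of R and Xi0 lets R be
  averaged first, which gives the stable moment at a times the section volume of Xi0.\<close>

lemma grain_kernel_integral:
 assumes a: "0 < a"
 shows "(Mean w. (Leb s. grain_kernel \<theta> a (R w) (Xi0 w) s)) =
  (Leb s. (Mean w. sr.stable_moment \<theta> (a * section_volume (Xi0 w) s)))"
proof -
 let ?G = "\<lambda>w s. grain_kernel \<theta> a (R w) (Xi0 w) s"
 define k where "k = 2 * \<bar>\<theta>\<bar> * a * vol_a"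
 have k: "0 \<le> k" using a vol_pos by (simp add: k_def)
 interpret PL: pair_sigma_finite M "lborel :: 'b measure" ..
 have [measurable]: "(\<lambda>(w, s). ?G w s) \<in> borel_measurable (M \<Otimes>\<^sub>M lborel)" by measurable
 have le: "AE w in M. \<forall>s. norm (?G w s) \<le> k * R w * indicator (cball 0 1) s"
  using AE_grain unfolding k_def by eventually_elim (intro allI grain_kernel_le a, auto)
 have int: "integrable (M \<Otimes>\<^sub>M lborel) (\<lambda>(w, s). ?G w s)"
 proof (rule integrableI_bounded)
  have "(\<integral>\<^sup>+x. ennreal (norm ((\<lambda>(w, s). ?G w s) x)) \<partial>(M \<Otimes>\<^sub>M lborel)) = (nMean w. (nLeb s. ennreal (norm (?G w s))))"
   by (subst lborel.nn_integral_fst[symmetric]) (auto simp: split_beta')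
  also have "\<dots> \<le> (nMean w. ennreal k * emeasure lborel (cball (0 :: 'b) 1) * ennreal (R w))"
  proof (rule nn_integral_mono_AE)
   show "AE w in M. (nLeb s. ennreal (norm (?G w s))) \<le> ennreal k * emeasure lborel (cball (0 :: 'b) 1) * ennreal (R w)"
    using le R_pos
   proof eventually_elim
    case (elim w)
    have "(nLeb s. ennreal (norm (?G w s))) \<le> (nLeb s. ennreal (k * R w) * indicator (cball (0 :: 'b) 1) s)"
    proof (rule nn_integral_mono)
     fix s :: 'b
     show "ennreal (norm (?G w s)) \<le> ennreal (k * R w) * indicator (cball (0 :: 'b) 1) s"
      using elim(1)[rule_format, of s] by (cases "s \<in> cball 0 1") (auto intro!: ennreal_leI)
    qed
    also have "\<dots> = ennreal (k * R w) * emeasure lborel (cball (0 :: 'b) 1)"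
     by (subst nn_integral_cmult_indicator) auto
    finally show ?case using k elim by (simp add: ennreal_mult mult_ac)
   qed
  qed
  also have "\<dots> = ennreal k * emeasure lborel (cball (0 :: 'b) 1) * (nMean w. ennreal (R w))"
   by (rule nn_integral_cmult) measurable
  also have "\<dots> < \<infinity>"
   using R_integral_finite emeasure_bounded_finite[of "cball (0 :: 'b) 1"] by (simp add: ennreal_mult_less_top)
  finally show "(\<integral>\<^sup>+x. ennreal (norm ((\<lambda>(w, s). ?G w s) x)) \<partial>(M \<Otimes>\<^sub>M lborel)) < \<infinity>" .
 qed measurable
 have "(Mean w. (Leb s. ?G w s)) = (Leb s. (Mean w. ?G w s))"
  using PL.Fubini_integral[OF int] by simp
 also have "\<dots> = (Leb s. (Mean w. sr.stable_moment \<theta> (a * section_volume (Xi0 w) s)))"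
 proof (rule Bochner_integral_cong[OF refl])
  fix s :: 'b
  have Ri: "integrable M R"
   using R_integral_finite R_pos by (intro integrableI_nonneg) (auto elim: eventually_mono)
  have "integrable M (\<lambda>w. ?G w s)"
  proof (rule Bochner_integrable_bound[OF integrable_mult_right[OF Ri, of k]])
   show "AE w in M. norm (?G w s) \<le> norm (k * R w)"
    using le R_pos
   proof eventually_elim
    case (elim w)
    have "norm (?G w s) \<le> k * R w * indicator (cball 0 1) s" using elim by blast
    also have "\<dots> \<le> k * R w * 1" using elim k by (intro mult_left_mono) (auto split: split_indicator)
    finally show ?case using elim k by simp
   qed
  qed measurable
  then show "(Mean w. ?G w s) = (Mean w. sr.stable_moment \<theta> (a * section_volume (Xi0 w) s))"
   using independent_rvs_integral_iterated[OF indep, of "\<lambda>x. grain_kernel \<theta> a (fst x) (snd x) s"]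
   unfolding stable_moment_comp_exp by (simp add: grain_kernel_def)
 qed
 finally show ?thesis .
qed

lemma strip_integral:
 assumes B: "B \<in> sets borel" "emeasure lborel B < \<infinity>" and a: "0 < a"
  and int: "integrable m (\<lambda>x. comp_exp \<theta> (a * strip_volume B x))"
 shows "(\<integral>x. comp_exp \<theta> (a * strip_volume B x) \<partial>m) =
  of_real (measure lborel B) * (Leb s. (Mean w. sr.stable_moment \<theta> (a * section_volume (Xi0 w) s)))"
proof -
 have [measurable]: "B \<in> sets borel" by fact
 have "(\<integral>x. comp_exp \<theta> (a * strip_volume B x) \<partial>m) = (Mean w. (Leb x. comp_exp \<theta> (a * strip_volume B (x, Xi w))))"
  by (rule integral_m[OF int])
 also have "\<dots> = (Mean w. measure lborel B *\<^sub>R (Leb s. grain_kernel \<theta> a (R w) (Xi0 w) s))"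
 proof (rule integral_cong_AE)
  show "AE w in M. (Leb x. comp_exp \<theta> (a * strip_volume B (x, Xi w))) =
    measure lborel B *\<^sub>R (Leb s. grain_kernel \<theta> a (R w) (Xi0 w) s)"
   using AE_grain by eventually_elim (intro strip_slice_integral B, auto)
 qed measurable
 also have "\<dots> = of_real (measure lborel B) * (Mean w. (Leb s. grain_kernel \<theta> a (R w) (Xi0 w) s))"
  by (simp add: scaleR_conv_of_real)
 finally show ?thesis unfolding grain_kernel_integral[OF a] .
qed

lemma stable_moment_meas [measurable]: "sr.stable_moment \<theta> \<in> borel_measurable borel"
 unfolding sr.stable_moment_def[abs_def] by measurable

text \<open>The integral over sections in the constant \<open>c\<^sub>0\<close> of the
  theorem.\<close>

definition section_moment :: real where
 "section_moment = (Leb s. (Mean w. section_volume (Xi0 w) s powr sr.p))"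

text \<open>For a section of volume v > 0 the limit of the stable moment is taken along l / v, which
  produces the factor v^p; empty sections contribute 0. Dominated convergence is used for the mean
  over shapes and again for the heights, which the unit ball confines.\<close>

lemma stable_moment_section_limit:
 "((\<lambda>l. of_real (l powr sr.p) * (Leb s. (Mean z. sr.stable_moment \<theta> (1 / l * section_volume (Xi0 z) s))))
  \<longlongrightarrow> of_real section_moment * sr.stable_constant \<theta>) at_top"
proof -
 let ?v = "\<lambda>z s. section_volume (Xi0 z) s"
 define F where "F l z s = of_real (l powr sr.p) * sr.stable_moment \<theta> (1 / l * ?v z s)" for l z s
 have v0: "0 \<le> ?v z s" for z s by (simp add: section_volume_def)
 obtain C where C: "C > 0" "\<And>\<tau>. \<tau> > 0 \<Longrightarrow> norm (sr.stable_moment \<theta> \<tau>) \<le> C * \<tau> powr sr.p"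
  using sr.stable_moment_bound by blast
 have sm0: "sr.stable_moment \<theta> 0 = 0" by (simp add: sr.stable_moment_def)
 have Fm [measurable]: "(\<lambda>x. F (f x) (g x) (h x)) \<in> borel_measurable N"
  if [measurable]: "f \<in> borel_measurable N" "g \<in> measurable N M" "h \<in> borel_measurable N" for N :: "'z measure" and f g h
  unfolding F_def by measurable
 define K where "K = C * vol_a powr sr.p"
 have K: "0 \<le> K" using C by (simp add: K_def)
 have Fle: "norm (F l z s) \<le> K * indicator (cball 0 1) s" if l: "0 < l" and sub: "Xi0 z \<subseteq> {t. norm t \<le> 1}" for l z s
 proof (cases "?v z s = 0")
  case True
  then show ?thesis using K by (simp add: F_def sm0)
 next
  case False
  then have v: "0 < ?v z s" using v0[of z s] by simp
  then have i: "indicator (cball 0 1) s = (1 :: real)" using section_volume_le[OF sub, of s] by (cases "s \<in> cball 0 1") auto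
  have "norm (F l z s) \<le> l powr sr.p * (C * (1 / l * ?v z s) powr sr.p)"
   unfolding F_def norm_mult using l v by (intro mult_mono C) auto
  also have "(1 / l * ?v z s) powr sr.p = (1 / l) powr sr.p * ?v z s powr sr.p"
   using l v by (intro powr_mult)
  also have "l powr sr.p * (C * ((1 / l) powr sr.p * ?v z s powr sr.p)) = C * ?v z s powr sr.p"
   using l by (simp add: powr_divide)
  also have "\<dots> \<le> K"
   unfolding K_def using C(1) v section_volume_le[OF sub, of s] i sr.p12 by (intro mult_left_mono powr_mono2) auto
  finally show ?thesis using i by simp
 qed
 have Flim: "((\<lambda>l. F l z s) \<longlongrightarrow> of_real (?v z s powr sr.p) * sr.stable_constant \<theta>) at_top" for z s
 proof (cases "?v z s = 0")
  case True
  then show ?thesis using sr.p12 by (simp add: F_def sm0)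
 next
  case False
  then have v: "0 < ?v z s" using v0[of z s] by simp
  have "filterlim (\<lambda>l. (1 / ?v z s) * l) at_top at_top"
   using v by (intro filterlim_tendsto_pos_mult_at_top[OF tendsto_const] filterlim_ident) auto
  from filterlim_compose[OF sr.stable_moment_limit this]
  have "((\<lambda>l. of_real (((1 / ?v z s) * l) powr sr.p) * sr.stable_moment \<theta> (1 / ((1 / ?v z s) * l))) \<longlongrightarrow> sr.stable_constant \<theta>) at_top" .
  then have "((\<lambda>l. of_real (?v z s powr sr.p) * (of_real (((1 / ?v z s) * l) powr sr.p) * sr.stable_moment \<theta> (1 / ((1 / ?v z s) * l)))) \<longlongrightarrow>
    of_real (?v z s powr sr.p) * sr.stable_constant \<theta>) at_top"
   by (intro tendsto_intros)
  then show ?thesis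
  proof (rule Lim_transform_eventually, intro eventually_mono[OF eventually_gt_at_top[of 0]])
   fix l :: real assume l: "0 < l"
   have "?v z s powr sr.p * ((1 / ?v z s) * l) powr sr.p = (?v z s * ((1 / ?v z s) * l)) powr sr.p"
    using l v by (intro powr_mult[symmetric])
   also have "?v z s * ((1 / ?v z s) * l) = l" using v by simp
   finally have "of_real (?v z s powr sr.p) * of_real (((1 / ?v z s) * l) powr sr.p) = (of_real (l powr sr.p) :: complex)"
    by (simp only: of_real_mult[symmetric])
   moreover have "1 / ((1 / ?v z s) * l) = 1 / l * ?v z s" using v l by simp
   ultimately show "of_real (?v z s powr sr.p) * (of_real (((1 / ?v z s) * l) powr sr.p) * sr.stable_moment \<theta> (1 / ((1 / ?v z s) * l))) = F l z s"
    unfolding F_def by (simp only: mult.assoc[symmetric])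
  qed
 qed
 have AEb: "AE z in M. \<forall>l>0. \<forall>s. norm (F l z s) \<le> K * indicator (cball 0 1) s"
  using AE_grain by eventually_elim (auto intro!: Fle)
 have inner: "((\<lambda>l. \<integral>z. F l z s \<partial>M) \<longlongrightarrow> (Mean z. of_real (?v z s powr sr.p) * sr.stable_constant \<theta>)) at_top" for s
 proof (rule integral_dominated_convergence_at_top[where w="\<lambda>_. K"])
  show "\<forall>\<^sub>F l in at_top. AE z in M. norm (F l z s) \<le> K"
   using eventually_gt_at_top[of 0]
  proof eventually_elim
   case (elim l)
   show ?case using AEb
   proof eventually_elim
    case (elim z)
    have "norm (F l z s) \<le> K * indicator (cball 0 1) s" using elim \<open>0 < l\<close> by blast
    also have "\<dots> \<le> K" using K by (auto split: split_indicator)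
    finally show ?case .
   qed
  qed
  show "AE z in M. ((\<lambda>l. F l z s) \<longlongrightarrow> of_real (?v z s powr sr.p) * sr.stable_constant \<theta>) at_top"
   by (intro AE_I2 Flim)
  show "(\<lambda>z. F l z s) \<in> borel_measurable M" for l by measurable
 qed auto
 have outer: "((\<lambda>l. \<integral>s. (Mean z. F l z s) \<partial>lborel) \<longlongrightarrow>
   (Leb s. (Mean z. of_real (?v z s powr sr.p) * sr.stable_constant \<theta>))) at_top"
 proof (rule integral_dominated_convergence_at_top[where w="\<lambda>s. K * indicator (cball 0 1) s"])
  show "\<forall>\<^sub>F l in at_top. AE s in lborel. norm (Mean z. F l z s) \<le> K * indicator (cball 0 1) s"
   using eventually_gt_at_top[of 0]
  proof eventually_elim
   case (elim l)
   show ?case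
   proof (rule AE_I2)
    fix s :: 'b
    have "norm (Mean z. F l z s) \<le> (Mean z. norm (F l z s))" by (rule integral_norm_bound)
    also have "\<dots> \<le> (Mean z. K * indicator (cball 0 1) s)"
    proof (rule integral_mono_AE')
     show "AE z in M. norm (F l z s) \<le> K * indicator (cball 0 1) s"
      using AEb by eventually_elim (use elim in blast)
    qed (use K in \<open>auto split: split_indicator\<close>)
    finally show "norm (Mean z. F l z s) \<le> K * indicator (cball 0 1) s" by (simp add: prob_space)
   qed
  qed
  show "integrable lborel (\<lambda>s. K * indicator (cball (0 :: 'b) 1) s)"
   using emeasure_bounded_finite[of "cball (0 :: 'b) 1"] by (intro integrable_mult_right) auto
 qed (use inner in \<open>auto intro!: borel_measurable_lebesgue_integral\<close>)
 moreover have "(Leb s. (Mean z. of_real (?v z s powr sr.p) * sr.stable_constant \<theta>)) =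
   of_real section_moment * sr.stable_constant \<theta>"
  unfolding section_moment_def by (simp add: integral_complex_of_real)
 moreover have "(Leb s. (Mean z. F l z s)) =
   of_real (l powr sr.p) * (Leb s. (Mean z. sr.stable_moment \<theta> (1 / l * ?v z s)))" for l
  unfolding F_def by simp
 ultimately show ?thesis by (simp only:)
qed

text \<open>The strip exponent has a closed form with 1 / a l as scale, whose p-th power is the
  volume growth of the window. Passing to the cover volume costs an arbitrarily small error.\<close>

lemma cover_exponent_limit:
 assumes A [measurable]: "A \<in> sets borel" and bdd: "bounded A"
 shows "((\<lambda>l. \<integral>x. comp_exp \<theta> (l powr (- (\<nu>\<^sub>0 / sr.p)) * cover_volume ((\<lambda>x. l *\<^sub>R x) ` A) x) \<partial>m) \<longlongrightarrow>
  of_real (measure lborel A) * (of_real section_moment * sr.stable_constant \<theta>)) at_top"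
proof -
 have Afin: "emeasure lborel A < \<infinity>" by (rule emeasure_bounded_finite[OF bdd])
 define a where "a l = l powr (- (\<nu>\<^sub>0 / sr.p))" for l :: real
 let ?B = "\<lambda>l. (\<lambda>x. l *\<^sub>R x) ` A"
 let ?f = "\<lambda>l x. comp_exp \<theta> (a l * cover_volume (?B l) x)"
 let ?g = "\<lambda>l x. comp_exp \<theta> (a l * strip_volume (?B l) x)"
 define main where "main l = of_real (measure lborel A) * (of_real ((1 / a l) powr sr.p) *
   (Leb s. (Mean w. sr.stable_moment \<theta> (1 / (1 / a l) * section_volume (Xi0 w) s))))" for l
 have "filterlim (\<lambda>l. l powr (\<nu>\<^sub>0 / sr.p)) at_top at_top"
 proof -
  have "0 < \<nu>\<^sub>0 / sr.p" using nu_pos sr.p12 by simp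
  then show ?thesis by real_asymp
 qed
 moreover have ainv: "l powr (\<nu>\<^sub>0 / sr.p) = 1 / a l" for l by (simp add: a_def powr_minus_divide)
 ultimately have "filterlim (\<lambda>l. 1 / a l) at_top at_top" by (simp only:)
 from filterlim_compose[OF stable_moment_section_limit[of \<theta>] this]
 have main: "(main \<longlongrightarrow> of_real (measure lborel A) * (of_real section_moment * sr.stable_constant \<theta>)) at_top"
  unfolding main_def by (rule tendsto_mult[OF tendsto_const])
 have close: "\<forall>\<^sub>F l in at_top. norm ((\<integral>x. ?f l x \<partial>m) - main l) \<le> \<eta>" if \<eta>: "0 < \<eta>" for \<eta>
  using strip_error_limit[OF A bdd \<eta>, of \<theta>] eventually_gt_at_top[of 0]
 proof eventually_elim
  case (elim l)
  note sw = scaled_window[OF A elim(2)]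
  have B: "?B l \<in> sets borel" "emeasure lborel (?B l) < \<infinity>"
   using sw(1,2) Afin by (auto simp: ennreal_mult_less_top)
  have al: "0 < a l" using elim by (simp add: a_def)
  have hb: "has_bochner_integral m (cover_volume (?B l)) (\<mu> * measure lborel (?B l))"
   by (rule cover_volume_integrable[OF B])
  then have ci: "integrable m (cover_volume (?B l))" by (rule integrable.intros)
  have [measurable]: "cover_volume (?B l) \<in> borel_measurable m" using ci by auto
  have sm: "strip_volume (?B l) \<in> borel_measurable m"
   using strip_volume_meas[OF B(1)] by (simp cong: measurable_cong_sets add: sets_m)
  note sm [measurable]
  have fi: "integrable m (?f l)"
  proof (rule Bochner_integrable_bound)
   show "integrable m (\<lambda>x. 2 * \<bar>\<theta>\<bar> * a l * cover_volume (?B l) x)" using ci by simp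
   show "AE x in m. norm (?f l x) \<le> norm (2 * \<bar>\<theta>\<bar> * a l * cover_volume (?B l) x)"
    using norm_comp_exp_le(1)[of \<theta>] by (intro AE_I2) (auto intro!: order_trans[OF norm_comp_exp_le(1)] simp: abs_mult)
  qed measurable
  have di: "integrable m (\<lambda>x. ?f l x - ?g l x)"
  proof (rule integrableI_bounded)
   show "(\<integral>\<^sup>+x. ennreal (norm (?f l x - ?g l x)) \<partial>m) < \<infinity>"
    using elim(1) unfolding a_def by (rule le_less_trans) simp
  qed measurable
  \<comment> \<open>Integrability of the strip integrand is inherited from the cover integrand and
    from their difference.\<close>
  have gi: "integrable m (?g l)"
   using Bochner_integrable_diff[OF fi di] by simp
  have "ennreal (norm (\<integral>x. ?f l x - ?g l x \<partial>m)) \<le> (\<integral>\<^sup>+x. ennreal (norm (?f l x - ?g l x)) \<partial>m)"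
   by (rule integral_norm_bound_ennreal[OF di])
  also have "\<dots> \<le> ennreal \<eta>" using elim(1) unfolding a_def .
  finally have n: "norm (\<integral>x. ?f l x - ?g l x \<partial>m) \<le> \<eta>" using \<eta> by (simp add: ennreal_le_iff)
  have "(\<integral>x. ?g l x \<partial>m) = main l"
  proof -
   have "(1 / a l) powr sr.p = l powr \<nu>\<^sub>0"
    unfolding ainv[symmetric] powr_powr using sr.p12 by simp
   then show ?thesis
    unfolding strip_integral[OF B al gi] main_def sw(3) using al by (simp add: mult_ac)
  qed
  then show ?case using n fi gi by simp
 qed
 have "((\<lambda>l. (\<integral>x. ?f l x \<partial>m) - main l) \<longlongrightarrow> 0) at_top"
 proof (rule tendstoI)
  fix e :: real assume "0 < e"
  then have "\<forall>\<^sub>F l in at_top. norm ((\<integral>x. ?f l x \<partial>m) - main l) \<le> e / 2" by (intro close) simp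
  then show "\<forall>\<^sub>F l in at_top. dist ((\<integral>x. ?f l x \<partial>m) - main l) 0 < e"
   by eventually_elim (use \<open>0 < e\<close> in simp)
 qed
 from tendsto_add[OF this main] show ?thesis unfolding a_def by simp
qed

end


text \<open>Covers the non-integrable case as well, where the Bochner integral is 0.\<close>

lemma ennreal_integral_le:
 fixes f :: "'x \<Rightarrow> real"
 assumes "f \<in> borel_measurable N" "\<And>x. 0 \<le> f x"
 shows "ennreal (\<integral>x. f x \<partial>N) \<le> (\<integral>\<^sup>+x. ennreal (f x) \<partial>N)"
proof -
 have "(\<integral>x. f x \<partial>N) = enn2real (\<integral>\<^sup>+x. ennreal (f x) \<partial>N)"
  using assms by (intro integral_eq_nn_integral) auto
 then show ?thesis by (cases "\<integral>\<^sup>+x. ennreal (f x) \<partial>N") auto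
qed

lemma norm_iexp_diff_le: "norm (iexp x - iexp y) \<le> \<bar>x - y\<bar>"
proof -
 have "iexp x = iexp y * iexp (x - y)"
  unfolding exp_add[symmetric] by (simp add: algebra_simps)
 then have "iexp x - iexp y = iexp y * (iexp (x - y) - 1)" by (simp add: right_diff_distrib)
 then have "norm (iexp x - iexp y) = norm (iexp (x - y) - 1)" by (simp only: norm_mult norm_exp_i_times mult_1)
 also have "\<dots> \<le> \<bar>x - y\<bar>" using iexp_approx1[of "x - y" 0] by simp
 finally show ?thesis .
qed

text \<open>Trades a first moment for a second one with a free parameter \<epsilon>, since the
  residual is controlled in mean square.\<close>

lemma abs_le_add_square_divide: "0 < \<epsilon> \<Longrightarrow> \<bar>x\<bar> \<le> \<epsilon> + x\<^sup>2 / \<epsilon>" for x \<epsilon> :: real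
proof (cases "\<bar>x\<bar> \<le> \<epsilon>")
 case False
 assume e: "0 < \<epsilon>"
 have "\<bar>x\<bar> * \<epsilon> \<le> \<bar>x\<bar> * \<bar>x\<bar>" using False by (intro mult_left_mono) auto
 then have "\<bar>x\<bar> \<le> x\<^sup>2 / \<epsilon>" using e by (simp add: power2_eq_square pos_le_divide_eq)
 then show ?thesis using e by simp
qed (simp add: add_increasing2)

section \<open>Negligibility of the residual and convergence to the stable exponent\<close>

context stable_grain_model
begin

lemma nu_beta: "\<nu> * (\<alpha> - 1) = \<nu>\<^sub>0 * (sr.p - 1)"
proof -
 have p1: "sr.p - 1 = (\<alpha> - 1) / q" by (simp add: sr.p_def)
 have "\<nu> * (\<alpha> - 1) = \<nu>\<^sub>0 * ((\<alpha> - 1) / (\<nu>\<^sub>0 / \<nu>))" using nu_pos by (simp add: field_simps)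
 then show ?thesis unfolding p1 q_def[symmetric] .
qed

text \<open>Interpolating between \<open>\<rho> \<le> \<mu>\<close> and the power bound yields an exponent for which the square is
 integrable at the origin and still decays fast enough.\<close>

lemma rho_square_bound:
 "\<exists>t K. 0 < t \<and> t < 1 \<and> 2 - t - 2 / sr.p < 0 \<and> 0 < K \<and> (\<forall>w. w \<noteq> 0 \<longrightarrow> (\<rho> w)\<^sup>2 \<le> K * norm w powr (- (\<nu>\<^sub>0 * t)))"
proof -
 obtain K where K: "K > 0" "\<And>w. w \<noteq> 0 \<Longrightarrow> \<rho> w \<le> K * norm w powr (- (\<nu> * (\<alpha> - 1)))"
  using rho_bound by blast
 define p where "p = sr.p"
 define \<beta> where "\<beta> = p - 1"
 have p: "1 < p" "p < 2" using sr.p12 by (auto simp: p_def)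
 have \<beta>: "0 < \<beta>" "\<beta> < 1" using p by (auto simp: \<beta>_def)
 define L where "L = 2 - 2 / p"
 have L: "0 < L" "L < 1" using p by (auto simp: L_def field_simps)
 have "\<beta> * 1 < \<beta> * p" using \<beta> p by (intro mult_strict_left_mono) auto
 then have "\<beta> / p < \<beta>" using p by (simp add: divide_less_eq)
 moreover have "L = 2 * (\<beta> / p)" using p by (simp add: L_def \<beta>_def field_simps)
 ultimately have L2: "L < 2 * \<beta>" by simp
 \<comment> \<open>The midpoint of the two constraints: t > L makes 2 - t - 2 / p negative, t < 1
   makes the power of the norm integrable at the origin, and t < 2 \<beta> keeps \<sigma> below
   2.\<close>
 define t where "t = (L + min 1 (2 * \<beta>)) / 2"
 have t: "0 < t" "t < 1" "t < 2 * \<beta>" "L < t" using L L2 \<beta> by (auto simp: t_def min_def)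
 define \<sigma> where "\<sigma> = t / \<beta>"
 have \<sigma>: "0 < \<sigma>" "\<sigma> < 2" using t \<beta> by (auto simp: \<sigma>_def divide_less_eq)
 \<comment> \<open>\<mu> + 1 in place of \<mu> keeps the constant positive.\<close>
 define K' where "K' = (\<mu> + 1) powr (2 - \<sigma>) * K powr \<sigma>"
 have mu0: "0 \<le> \<mu>" by (rule mu_nonneg)
 have "(\<rho> w)\<^sup>2 \<le> K' * norm w powr (- (\<nu>\<^sub>0 * t))" if w: "w \<noteq> 0" for w
 proof -
  have r: "0 \<le> \<rho> w" "\<rho> w \<le> \<mu>" by (rule rho_nonneg, rule rho_le_mu)
  have "(\<rho> w)\<^sup>2 = \<rho> w powr ((2 - \<sigma>) + \<sigma>)"
   using r by (cases "\<rho> w = 0") auto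
  also have "\<dots> = \<rho> w powr (2 - \<sigma>) * \<rho> w powr \<sigma>" by (rule powr_add)
  also have "\<dots> \<le> (\<mu> + 1) powr (2 - \<sigma>) * (K * norm w powr (- (\<nu> * (\<alpha> - 1)))) powr \<sigma>"
   using r \<sigma> K(2)[OF w] by (intro mult_mono powr_mono2) auto
  also have "(K * norm w powr (- (\<nu> * (\<alpha> - 1)))) powr \<sigma> = K powr \<sigma> * norm w powr (- (\<nu> * (\<alpha> - 1)) * \<sigma>)"
   using K(1) by (simp add: powr_mult powr_powr)
  also have "- (\<nu> * (\<alpha> - 1)) * \<sigma> = - (\<nu>\<^sub>0 * t)"
   unfolding nu_beta p_def[symmetric] \<beta>_def[symmetric] \<sigma>_def using \<beta> by simp
  finally show ?thesis by (simp add: K'_def mult_ac)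
 qed
 moreover have "0 < K'" using K(1) mu0 by (simp add: K'_def)
 ultimately show ?thesis using t unfolding L_def p_def by (intro exI[of _ t] exI[of _ K']) auto
qed

text \<open>The double integral is at most the window volume times the integral of the squared
  \<rho> over a ball of radius 2 c0 l, which contains all differences of points of the window. With
  the normalisation the exponent of l is \<open>\<nu>\<^sub>0 * (2 - t - 2 / sr.p)\<close>, which is
  negative.\<close>

lemma residual_decay:
 assumes A [measurable]: "A \<in> sets borel" and bdd: "bounded A"
 shows "\<exists>K e0. 0 < K \<and> e0 < 0 \<and> (\<forall>l>0. ennreal (l powr (- (2 * \<nu>\<^sub>0 / sr.p))) *
  (nLeb t. indicator ((\<lambda>x. l *\<^sub>R x) ` A) t * (nLeb s. indicator ((\<lambda>x. l *\<^sub>R x) ` A) s * ennreal ((\<rho> (s - t))\<^sup>2)))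
   \<le> ennreal (K * l powr e0))"
proof -
 obtain t K where t: "0 < t" "t < 1" "2 - t - 2 / sr.p < 0" and K: "0 < K"
  and rho: "\<And>w. w \<noteq> 0 \<Longrightarrow> (\<rho> w)\<^sup>2 \<le> K * norm w powr (- (\<nu>\<^sub>0 * t))"
  using rho_square_bound by blast
 have "0 < \<nu>\<^sub>0 * t" "\<nu>\<^sub>0 * t < real DIM('a)" using t nu_pos by (auto simp: nu(1)[symmetric])
 from nn_integral_norm_powr_cball[where 'a='a, OF this] obtain K2 where K2: "K2 > 0"
  "\<And>L. L > 0 \<Longrightarrow> (nLeb w. ennreal (norm w powr (- (\<nu>\<^sub>0 * t))) * indicator (cball (0 :: 'a) L) w) \<le> ennreal (K2 * L powr (\<nu>\<^sub>0 - \<nu>\<^sub>0 * t))"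
  unfolding nu(1)[symmetric] by blast
 obtain c0 where c0: "c0 > 0" "\<And>x. x \<in> A \<Longrightarrow> norm x \<le> c0" using bdd unfolding bounded_pos by blast
 have Afin: "emeasure lborel A < \<infinity>" by (rule emeasure_bounded_finite[OF bdd])
 define e0 where "e0 = - (2 * \<nu>\<^sub>0 / sr.p) + (\<nu>\<^sub>0 + (\<nu>\<^sub>0 - \<nu>\<^sub>0 * t))"
 have "e0 = \<nu>\<^sub>0 * (2 - t - 2 / sr.p)" by (simp add: e0_def algebra_simps)
 then have e0: "e0 < 0" using t(3) nu_pos by (simp add: mult_pos_neg)
 define K3 where "K3 = measure lborel A * K * K2 * (2 * c0) powr (\<nu>\<^sub>0 - \<nu>\<^sub>0 * t)"
 have K30: "0 \<le> K3" using K K2(1) by (simp add: K3_def)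
 have "ennreal (l powr (- (2 * \<nu>\<^sub>0 / sr.p))) *
  (nLeb t. indicator ((\<lambda>x. l *\<^sub>R x) ` A) t * (nLeb s. indicator ((\<lambda>x. l *\<^sub>R x) ` A) s * ennreal ((\<rho> (s - t))\<^sup>2)))
   \<le> ennreal ((K3 + 1) * l powr e0)" if l: "0 < l" for l
 proof -
  let ?B = "(\<lambda>x. l *\<^sub>R x) ` A"
  let ?b = "l powr \<nu>\<^sub>0 * measure lborel A"
  note sw = scaled_window[OF A l]
  have Bf: "emeasure lborel ?B < \<infinity>" using sw(2) Afin by (simp add: ennreal_mult_less_top)
  have eB: "emeasure lborel ?B = ennreal ?b" unfolding sw(3)[symmetric] using Bf by (intro emeasure_eq_ennreal_measure) auto
  have [measurable]: "?B \<in> sets borel" by (rule sw(1))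
  have "(nLeb t. indicator ?B t * (nLeb s. indicator ?B s * ennreal ((\<rho> (s - t))\<^sup>2))) =
    (nLeb w. ennreal ((\<rho> w)\<^sup>2) * emeasure lborel (?B \<inter> {t. t + w \<in> ?B}))"
   by (rule nn_integral_double_window) measurable
  also have "\<dots> \<le> (nLeb w. ennreal (K * ?b) * (ennreal (norm w powr (- (\<nu>\<^sub>0 * t))) * indicator (cball (0 :: 'a) (2 * c0 * l)) w))"
  proof (rule nn_integral_mono_AE)
   show "AE w in lborel. ennreal ((\<rho> w)\<^sup>2) * emeasure lborel (?B \<inter> {t. t + w \<in> ?B}) \<le>
     ennreal (K * ?b) * (ennreal (norm w powr (- (\<nu>\<^sub>0 * t))) * indicator (cball (0 :: 'a) (2 * c0 * l)) w)"
    using AE_lborel_singleton[of "0 :: 'a"]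
   proof eventually_elim
    case (elim w)
    show ?case
    proof (cases "?B \<inter> {t. t + w \<in> ?B} = {}")
     case False
     then obtain x y where xy: "x \<in> A" "y \<in> A" "l *\<^sub>R x + w = l *\<^sub>R y" by auto
     have "w = l *\<^sub>R (y - x)" using xy(3) by (simp add: algebra_simps eq_diff_eq)
     then have "norm w = l * norm (y - x)" using l by simp
     also have "\<dots> \<le> l * (c0 + c0)"
      using c0(2)[OF xy(1)] c0(2)[OF xy(2)] norm_triangle_ineq4[of y x] l by (intro mult_left_mono) auto
     finally have nw: "w \<in> cball 0 (2 * c0 * l)" by (simp add: algebra_simps)
     have "emeasure lborel (?B \<inter> {t. t + w \<in> ?B}) \<le> ennreal ?b"
      unfolding eB[symmetric] by (intro emeasure_mono) auto
     then have "ennreal ((\<rho> w)\<^sup>2) * emeasure lborel (?B \<inter> {t. t + w \<in> ?B}) \<le> ennreal (K * norm w powr (- (\<nu>\<^sub>0 * t))) * ennreal ?b"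
      using rho[OF elim] by (intro mult_mono ennreal_leI) auto
     also have "\<dots> = ennreal (K * ?b) * ennreal (norm w powr (- (\<nu>\<^sub>0 * t)))"
      using K by (simp add: mult_ac flip: ennreal_mult)
     finally show ?thesis using nw by simp
    next
     case True
     then show ?thesis by (simp only: emeasure_empty mult_zero_right zero_le)
    qed
   qed
  qed
  also have "\<dots> \<le> ennreal (K * ?b) * ennreal (K2 * (2 * c0 * l) powr (\<nu>\<^sub>0 - \<nu>\<^sub>0 * t))"
   using c0 l by (subst nn_integral_cmult, measurable) (intro mult_left_mono K2, auto)
  finally have "ennreal (l powr (- (2 * \<nu>\<^sub>0 / sr.p))) *
    (nLeb t. indicator ?B t * (nLeb s. indicator ?B s * ennreal ((\<rho> (s - t))\<^sup>2))) \<le>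
    ennreal (l powr (- (2 * \<nu>\<^sub>0 / sr.p))) * (ennreal (K * ?b) * ennreal (K2 * (2 * c0 * l) powr (\<nu>\<^sub>0 - \<nu>\<^sub>0 * t)))"
   by (rule mult_left_mono) simp
  also have "\<dots> = ennreal (l powr (- (2 * \<nu>\<^sub>0 / sr.p)) * (K * ?b * (K2 * (2 * c0 * l) powr (\<nu>\<^sub>0 - \<nu>\<^sub>0 * t))))"
   using K K2(1) by (simp flip: ennreal_mult)
  also have "l powr (- (2 * \<nu>\<^sub>0 / sr.p)) * (K * ?b * (K2 * (2 * c0 * l) powr (\<nu>\<^sub>0 - \<nu>\<^sub>0 * t))) =
    K3 * (l powr (- (2 * \<nu>\<^sub>0 / sr.p)) * (l powr \<nu>\<^sub>0 * l powr (\<nu>\<^sub>0 - \<nu>\<^sub>0 * t)))"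
   using c0 l by (simp add: K3_def powr_mult mult_ac)
  also have "l powr (- (2 * \<nu>\<^sub>0 / sr.p)) * (l powr \<nu>\<^sub>0 * l powr (\<nu>\<^sub>0 - \<nu>\<^sub>0 * t)) = l powr e0"
   unfolding e0_def by (simp only: powr_add)
  also have "ennreal (K3 * l powr e0) \<le> ennreal ((K3 + 1) * l powr e0)"
   by (intro ennreal_leI mult_right_mono) auto
  finally show ?thesis .
 qed
 moreover have "0 < K3 + 1" using K30 by simp
 ultimately show ?thesis using e0 by blast
qed

text \<open>The centring contributes exactly the linear term that turns exp(i \<theta> f) - 1 into
  the compensated exponential.\<close>

lemma shot_noise_char:
 assumes B: "B \<in> sets borel" "emeasure lborel B < \<infinity>"
 shows "(Mean w. iexp (\<theta> * (a * ((\<Sum>j. cover_volume B (e j w)) - \<mu> * measure lborel B)))) =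
  exp (\<integral>x. comp_exp \<theta> (a * cover_volume B x) \<partial>m)"
proof -
 let ?b = "measure lborel B" and ?f = "cover_volume B"
 have hb: "has_bochner_integral m ?f (\<mu> * ?b)" by (rule cover_volume_integrable[OF B])
 then have ci: "integrable m ?f" by (rule integrable.intros)
 have [measurable]: "?f \<in> borel_measurable m" using ci by auto
 have "integrable m (\<lambda>x. iexp ((\<theta> * a) * ?f x) - 1)"
 proof (rule Bochner_integrable_bound)
  show "integrable m (\<lambda>x. \<bar>\<theta> * a\<bar> * ?f x)" using ci by simp
  show "AE x in m. norm (iexp ((\<theta> * a) * ?f x) - 1) \<le> norm (\<bar>\<theta> * a\<bar> * ?f x)"
  proof (rule AE_I2)
   fix x
   have "norm (iexp ((\<theta> * a) * ?f x) - iexp 0) \<le> \<bar>(\<theta> * a) * ?f x - 0\<bar>" by (rule norm_iexp_diff_le)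
   then show "norm (iexp ((\<theta> * a) * ?f x) - 1) \<le> norm (\<bar>\<theta> * a\<bar> * ?f x)" by (simp add: abs_mult)
  qed
 qed measurable
 then have "(\<integral>x. comp_exp \<theta> (a * ?f x) \<partial>m) =
   (\<integral>x. iexp ((\<theta> * a) * ?f x) - 1 \<partial>m) - (\<integral>x. \<i> * of_real ((\<theta> * a) * ?f x) \<partial>m)"
  unfolding comp_exp_def using ci by (subst Bochner_integral_diff[symmetric]) (auto simp: mult_ac)
 also have "(\<integral>x. \<i> * of_real ((\<theta> * a) * ?f x) \<partial>m) = \<i> * of_real ((\<theta> * a) * (\<mu> * ?b))"
  using has_bochner_integral_integral_eq[OF hb] by (simp only: integral_mult_right_zero integral_complex_of_real)
 finally have "exp (\<integral>x. comp_exp \<theta> (a * ?f x) \<partial>m) =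
   exp (\<integral>x. iexp ((\<theta> * a) * ?f x) - 1 \<partial>m) * exp (- (\<i> * of_real ((\<theta> * a) * (\<mu> * ?b))))"
  by (simp only: diff_conv_add_uminus exp_add)
 also have "\<dots> = (Mean w. iexp ((\<theta> * a) * (\<Sum>j. ?f (e j w))) * exp (- (\<i> * of_real ((\<theta> * a) * (\<mu> * ?b)))))"
  using char_shot_noise(2)[of ?f "\<theta> * a"] ci cover_volume_nonneg by (simp only: integral_mult_left_zero) auto
 also have "\<dots> = (Mean w. iexp (\<theta> * (a * ((\<Sum>j. ?f (e j w)) - \<mu> * ?b))))"
  by (intro Bochner_integral_cong refl) (simp add: algebra_simps flip: exp_add)
 finally show ?thesis by (rule sym)
qed

text \<open>Up to exp(- \<mu>) times the residual, exp(- \<mu>) b - U is exp(- \<mu>) times the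
  centred shot noise, which is why the frequency becomes \<theta>' = \<theta> exp(- \<mu>). The
  residual scaled by a vanishes in mean square, so both characteristic functions have the same
  limit.\<close>

lemma stable_limit:
 assumes A [measurable]: "A \<in> sets borel" and bdd: "bounded A"
 shows "((\<lambda>l. \<integral>w. iexp (\<theta> * (l powr (- (\<nu>\<^sub>0 / sr.p)) *
    (exp (- \<mu>) * (l powr \<nu>\<^sub>0 * measure lborel A) - uncovered ((\<lambda>x. l *\<^sub>R x) ` A) w))) \<partial>M)
  \<longlongrightarrow> exp (of_real (measure lborel A) * (of_real section_moment * sr.stable_constant (\<theta> * exp (- \<mu>))))) at_top"
proof -
 have Afin: "emeasure lborel A < \<infinity>" by (rule emeasure_bounded_finite[OF bdd])
 define \<theta>' where "\<theta>' = \<theta> * exp (- \<mu>)"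
 define a where "a l = l powr (- (\<nu>\<^sub>0 / sr.p))" for l :: real
 let ?B = "\<lambda>l. (\<lambda>x. l *\<^sub>R x) ` A"
 obtain K e0 where K: "0 < K" and e0: "e0 < 0" and res: "\<And>l. 0 < l \<Longrightarrow> ennreal (l powr (- (2 * \<nu>\<^sub>0 / sr.p))) *
  (nLeb t. indicator (?B l) t * (nLeb s. indicator (?B l) s * ennreal ((\<rho> (s - t))\<^sup>2)))
   \<le> ennreal (K * l powr e0)"
  using residual_decay[OF A bdd] by blast
 define Y where "Y l w = (\<Sum>j. cover_volume (?B l) (e j w)) - \<mu> * measure lborel (?B l)" for l w
 define \<phi> where "\<phi> l = (Mean w. iexp (\<theta> * (a l * (exp (- \<mu>) * (l powr \<nu>\<^sub>0 * measure lborel A) - uncovered (?B l) w))))" for l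
 define \<psi> where "\<psi> l = (Mean w. iexp (\<theta>' * (a l * Y l w)))" for l
 have "((\<lambda>l. exp (\<integral>x. comp_exp \<theta>' (a l * cover_volume (?B l) x) \<partial>m)) \<longlongrightarrow>
   exp (of_real (measure lborel A) * (of_real section_moment * sr.stable_constant \<theta>'))) at_top"
  unfolding a_def by (intro tendsto_exp cover_exponent_limit A bdd)
 then have \<psi>: "(\<psi> \<longlongrightarrow> exp (of_real (measure lborel A) * (of_real section_moment * sr.stable_constant \<theta>'))) at_top"
 proof (rule Lim_transform_eventually, intro eventually_mono[OF eventually_gt_at_top[of 0]])
  fix l :: real assume l: "0 < l"
  have "?B l \<in> sets borel" "emeasure lborel (?B l) < \<infinity>"
   using scaled_window(1,2)[OF A l] Afin by (auto simp: ennreal_mult_less_top)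
  then show "exp (\<integral>x. comp_exp \<theta>' (a l * cover_volume (?B l) x) \<partial>m) = \<psi> l"
   unfolding \<psi>_def Y_def by (rule shot_noise_char[symmetric])
 qed
 have bound: "norm (\<phi> l - \<psi> l) \<le> \<epsilon> + \<theta>'\<^sup>2 / \<epsilon> * (exp \<mu> * (K * l powr e0))" if l: "0 < l" and \<epsilon>: "0 < \<epsilon>" for l \<epsilon>
 proof -
  note sw = scaled_window[OF A l]
  have B: "?B l \<in> sets borel" "emeasure lborel (?B l) < \<infinity>"
   using sw(1,2) Afin by (auto simp: ennreal_mult_less_top)
  interpret W: poisson_cover_window M m e C \<mu> \<rho> "?B l"
   using B by unfold_locales
  have shot: "W.shot (e j w) = cover_volume (?B l) (e j w)" if "w \<in> space M" for j w
   using measurable_space[OF measurable_points that] by (rule shot_eq_cover_volume[OF W.poisson_cover_window_axioms])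
  define err where "err w = exp \<mu> * W.U W.S w - W.b + ((\<Sum>j. W.shot (e j w)) - \<mu> * W.b)" for w
  have Sm [measurable]: "W.S \<in> sets m" by auto
  have Um [measurable]: "W.U W.S \<in> borel_measurable M" by measurable
  have ptm [measurable]: "e j \<in> measurable M m" for j by (rule measurable_points)
  have errm [measurable]: "err \<in> borel_measurable M" unfolding err_def[abs_def] by measurable
  have bW: "W.b = l powr \<nu>\<^sub>0 * measure lborel A" unfolding W.b_def by (rule sw(3))
  define f where "f w = iexp (\<theta> * (a l * (exp (- \<mu>) * W.b - W.U W.S w)))" for w
  define g where "g w = iexp (\<theta>' * (a l * ((\<Sum>j. W.shot (e j w)) - \<mu> * W.b)))" for w
  have fg [measurable]: "f \<in> borel_measurable M" "g \<in> borel_measurable M"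
   unfolding f_def[abs_def] g_def[abs_def] by measurable
  have fi: "integrable M f" "integrable M g"
   by (rule integrable_const_bound[of _ 1]; simp add: f_def g_def)+
  have "\<phi> l = (Mean w. f w)"
   unfolding \<phi>_def f_def by (intro Bochner_integral_cong) (auto simp: W.uncovered_eq bW)
  moreover have "\<psi> l = (Mean w. g w)"
   unfolding \<psi>_def g_def Y_def by (intro Bochner_integral_cong) (auto simp: shot W.b_def)
  ultimately have "\<phi> l - \<psi> l = (Mean w. f w - g w)" using fi by simp
  then have "ennreal (norm (\<phi> l - \<psi> l)) \<le> (nMean w. ennreal (norm (f w - g w)))"
   using integral_norm_bound_ennreal[of M "\<lambda>w. f w - g w"] fi by simp
  also have "\<dots> \<le> (nMean w. ennreal \<epsilon> + ennreal (\<theta>'\<^sup>2 / \<epsilon> * (a l)\<^sup>2) * ennreal ((err w)\<^sup>2))"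
  proof (rule nn_integral_mono)
   fix w
   have "\<theta> * (a l * (exp (- \<mu>) * W.b - W.U W.S w)) - \<theta>' * (a l * ((\<Sum>j. W.shot (e j w)) - \<mu> * W.b)) =
     - (\<theta>' * a l * err w)"
    unfolding \<theta>'_def err_def by (simp add: algebra_simps flip: exp_add)
   then have "norm (f w - g w) \<le> \<bar>\<theta>' * a l * err w\<bar>"
    unfolding f_def g_def using norm_iexp_diff_le by (metis abs_minus_cancel)
   also have "\<dots> \<le> \<epsilon> + (\<theta>' * a l * err w)\<^sup>2 / \<epsilon>" by (rule abs_le_add_square_divide[OF \<epsilon>])
   also have "(\<theta>' * a l * err w)\<^sup>2 / \<epsilon> = (\<theta>'\<^sup>2 / \<epsilon> * (a l)\<^sup>2) * (err w)\<^sup>2" by (simp add: power_mult_distrib)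
   finally have "ennreal (norm (f w - g w)) \<le> ennreal (\<epsilon> + (\<theta>'\<^sup>2 / \<epsilon> * (a l)\<^sup>2) * (err w)\<^sup>2)" by (rule ennreal_leI)
   then show "ennreal (norm (f w - g w)) \<le> ennreal \<epsilon> + ennreal (\<theta>'\<^sup>2 / \<epsilon> * (a l)\<^sup>2) * ennreal ((err w)\<^sup>2)"
   proof -
    have "ennreal (\<epsilon> + (\<theta>'\<^sup>2 / \<epsilon> * (a l)\<^sup>2) * (err w)\<^sup>2) = ennreal \<epsilon> + ennreal ((\<theta>'\<^sup>2 / \<epsilon> * (a l)\<^sup>2) * (err w)\<^sup>2)"
     using \<epsilon> by (intro ennreal_plus) auto
    moreover have "ennreal ((\<theta>'\<^sup>2 / \<epsilon> * (a l)\<^sup>2) * (err w)\<^sup>2) = ennreal (\<theta>'\<^sup>2 / \<epsilon> * (a l)\<^sup>2) * ennreal ((err w)\<^sup>2)"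
     using \<epsilon> by (intro ennreal_mult) auto
    ultimately show ?thesis using \<open>ennreal (norm (f w - g w)) \<le> _\<close> by (simp only:)
   qed
  qed
  also have "\<dots> = ennreal \<epsilon> + ennreal (\<theta>'\<^sup>2 / \<epsilon> * (a l)\<^sup>2) * (nMean w. ennreal ((err w)\<^sup>2))"
   by (subst nn_integral_add) (auto simp: nn_integral_cmult emeasure_space_1)
  also have "(nMean w. ennreal ((err w)\<^sup>2)) \<le> ennreal (exp \<mu> * (\<integral>t. (\<integral>s. (\<rho> (s - t))\<^sup>2 \<partial>W.LB) \<partial>W.LB))"
   unfolding err_def by (rule W.residual_bound)
  also have "\<dots> \<le> ennreal (exp \<mu>) * (nLeb t. indicator (?B l) t * (nLeb s. indicator (?B l) s * ennreal ((\<rho> (s - t))\<^sup>2)))"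
  proof -
   have [measurable]: "(\<lambda>t. \<integral>s. (\<rho> (s - t))\<^sup>2 \<partial>W.LB) \<in> borel_measurable W.LB"
    by (intro W.LB.borel_measurable_lebesgue_integral) measurable
   have "ennreal (\<integral>t. (\<integral>s. (\<rho> (s - t))\<^sup>2 \<partial>W.LB) \<partial>W.LB) \<le> (\<integral>\<^sup>+t. ennreal (\<integral>s. (\<rho> (s - t))\<^sup>2 \<partial>W.LB) \<partial>W.LB)"
    by (intro ennreal_integral_le integral_nonneg_AE) auto
   also have "\<dots> \<le> (\<integral>\<^sup>+t. (\<integral>\<^sup>+s. ennreal ((\<rho> (s - t))\<^sup>2) \<partial>W.LB) \<partial>W.LB)"
    by (intro nn_integral_mono ennreal_integral_le) auto
   also have "\<dots> = (nLeb t. indicator (?B l) t * (nLeb s. indicator (?B l) s * ennreal ((\<rho> (s - t))\<^sup>2)))"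
    by (subst W.nn_integral_LB, measurable) (simp add: W.nn_integral_LB)
   finally show ?thesis by (subst ennreal_mult') (auto intro!: mult_left_mono)
  qed
  finally have "ennreal (norm (\<phi> l - \<psi> l)) \<le> ennreal \<epsilon> + ennreal (\<theta>'\<^sup>2 / \<epsilon> * (a l)\<^sup>2) * (ennreal (exp \<mu>) *
    (nLeb t. indicator (?B l) t * (nLeb s. indicator (?B l) s * ennreal ((\<rho> (s - t))\<^sup>2))))"
   by (simp add: add_left_mono mult_left_mono)
  also have "\<dots> = ennreal \<epsilon> + ennreal (\<theta>'\<^sup>2 / \<epsilon> * exp \<mu>) * (ennreal ((a l)\<^sup>2) *
    (nLeb t. indicator (?B l) t * (nLeb s. indicator (?B l) s * ennreal ((\<rho> (s - t))\<^sup>2))))"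
  proof -
   have "ennreal (\<theta>'\<^sup>2 / \<epsilon> * (a l)\<^sup>2) * ennreal (exp \<mu>) = ennreal (\<theta>'\<^sup>2 / \<epsilon> * exp \<mu>) * ennreal ((a l)\<^sup>2)"
    using \<epsilon> by (simp add: mult_ac flip: ennreal_mult)
   then show ?thesis by (simp only: mult.assoc[symmetric])
  qed
  also have "(a l)\<^sup>2 = l powr (- (2 * \<nu>\<^sub>0 / sr.p))"
   unfolding a_def power2_eq_square powr_add[symmetric] by simp
  also have "ennreal \<epsilon> + ennreal (\<theta>'\<^sup>2 / \<epsilon> * exp \<mu>) * (ennreal (l powr (- (2 * \<nu>\<^sub>0 / sr.p))) *
    (nLeb t. indicator (?B l) t * (nLeb s. indicator (?B l) s * ennreal ((\<rho> (s - t))\<^sup>2)))) \<le>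
    ennreal \<epsilon> + ennreal (\<theta>'\<^sup>2 / \<epsilon> * exp \<mu>) * ennreal (K * l powr e0)"
   by (intro add_left_mono mult_left_mono res l) simp
  also have "\<dots> = ennreal (\<epsilon> + \<theta>'\<^sup>2 / \<epsilon> * (exp \<mu> * (K * l powr e0)))"
  proof -
   have "ennreal (\<theta>'\<^sup>2 / \<epsilon> * exp \<mu>) * ennreal (K * l powr e0) = ennreal (\<theta>'\<^sup>2 / \<epsilon> * exp \<mu> * (K * l powr e0))"
    using \<epsilon> K by (intro ennreal_mult[symmetric]) auto
   moreover have "ennreal \<epsilon> + ennreal (\<theta>'\<^sup>2 / \<epsilon> * exp \<mu> * (K * l powr e0)) = ennreal (\<epsilon> + \<theta>'\<^sup>2 / \<epsilon> * exp \<mu> * (K * l powr e0))"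
    using \<epsilon> K by (intro ennreal_plus[symmetric]) auto
   ultimately show ?thesis by (simp only: mult.assoc)
  qed
  finally show ?thesis using \<epsilon> K by (subst (asm) ennreal_le_iff) auto
 qed
 have "((\<lambda>l. \<phi> l - \<psi> l) \<longlongrightarrow> 0) at_top"
 proof (rule tendstoI)
  fix \<eta> :: real assume \<eta>: "0 < \<eta>"
  have "((\<lambda>l. \<theta>'\<^sup>2 / (\<eta> / 2) * (exp \<mu> * (K * l powr e0))) \<longlongrightarrow> \<theta>'\<^sup>2 / (\<eta> / 2) * (exp \<mu> * (K * 0))) at_top"
   by (intro tendsto_intros tendsto_neg_powr[OF e0] filterlim_ident)
  then have "((\<lambda>l. \<theta>'\<^sup>2 / (\<eta> / 2) * (exp \<mu> * (K * l powr e0))) \<longlongrightarrow> 0) at_top" by simp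
  from order_tendstoD(2)[OF this, of "\<eta> / 2"] have "\<forall>\<^sub>F l in at_top. \<theta>'\<^sup>2 / (\<eta> / 2) * (exp \<mu> * (K * l powr e0)) < \<eta> / 2"
   using \<eta> by simp
  then show "\<forall>\<^sub>F l in at_top. dist (\<phi> l - \<psi> l) 0 < \<eta>"
   using eventually_gt_at_top[of 0]
  proof eventually_elim
   case (elim l)
   have "norm (\<phi> l - \<psi> l) \<le> \<eta> / 2 + \<theta>'\<^sup>2 / (\<eta> / 2) * (exp \<mu> * (K * l powr e0))"
    using \<eta> elim by (intro bound) auto
   also have "\<dots> < \<eta> / 2 + \<eta> / 2" using elim by (intro add_strict_left_mono)
   finally show ?case by simp
  qed
 qed
 from tendsto_add[OF this \<psi>] show ?thesis unfolding \<phi>_def a_def \<theta>'_def by simp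
qed

end

subsection \<open>Limit laws\<close>


lemma (in real_distribution) char_meas [measurable]: "char M \<in> borel_measurable borel"
 by (intro borel_measurable_continuous_onI continuous_at_imp_continuous_on ballI isCont_char)

text \<open>Averaging the characteristic function over a Gaussian argument turns it into the Laplace-type
 transform \<open>E exp (- (u X)\<^sup>2 / 2)\<close>, which controls the tails.\<close>

lemma (in real_distribution) tail_le_char_average:
 "(1 - exp (- 1 / 2)) * prob {x. 1 \<le> \<bar>u * x\<bar>} \<le> (\<integral>z. 1 - Re (char M (u * z)) \<partial>std_normal_distribution)"
proof -
 let ?G = "std_normal_distribution"
 interpret G: real_distribution ?G by (rule real_dist_normal_dist)
 interpret P: pair_prob_space M ?G ..
 have int: "integrable (M \<Otimes>\<^sub>M ?G) (\<lambda>(x, z). iexp (u * z * x))"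
  by (rule P.P.integrable_const_bound[of _ 1]) (auto simp: split_beta')
 have gi: "integrable ?G (\<lambda>z. char M (u * z))"
  by (rule G.integrable_const_bound[of _ 1]) (auto simp: cmod_char_le_1)
 have "(\<integral>z. char M (u * z) \<partial>?G) = (\<integral>x. (\<integral>z. iexp (u * z * x) \<partial>?G) \<partial>M)"
  unfolding char_def using P.Fubini_integral[OF int] by simp
 also have "\<dots> = (\<integral>x. char ?G (u * x) \<partial>M)"
  unfolding char_def by (intro Bochner_integral_cong) (auto simp: mult_ac)
 also have "\<dots> = (\<integral>x. of_real (exp (- (u * x)\<^sup>2 / 2)) \<partial>M)"
  by (simp only: char_std_normal_distribution)
 also have "\<dots> = of_real (\<integral>x. exp (- (u * x)\<^sup>2 / 2) \<partial>M)" by (rule integral_complex_of_real)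
 finally have av: "(\<integral>z. char M (u * z) \<partial>?G) = of_real (\<integral>x. exp (- (u * x)\<^sup>2 / 2) \<partial>M)" .
 have ei: "integrable M (\<lambda>x. exp (- (u * x)\<^sup>2 / 2))"
  by (rule integrable_const_bound[of _ 1]) auto
 have "(\<integral>z. 1 - Re (char M (u * z)) \<partial>?G) = 1 - Re (\<integral>z. char M (u * z) \<partial>?G)"
  using gi by (simp add: G.prob_space[simplified])
 also have "\<dots> = 1 - (\<integral>x. exp (- (u * x)\<^sup>2 / 2) \<partial>M)" unfolding av by simp
 also have "\<dots> = (\<integral>x. 1 - exp (- (u * x)\<^sup>2 / 2) \<partial>M)" using ei by (simp add: prob_space[simplified])
 also have "\<dots> \<ge> (\<integral>x. (1 - exp (- 1 / 2)) * indicator {x. 1 \<le> \<bar>u * x\<bar>} x \<partial>M)"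
 proof (rule integral_mono)
  show "integrable M (\<lambda>x. (1 - exp (- 1 / 2 :: real)) * indicator {x. 1 \<le> \<bar>u * x\<bar>} x)"
   by (rule integrable_const_bound[of _ 1]) (auto split: split_indicator)
  fix x
  show "(1 - exp (- 1 / 2)) * indicator {x. 1 \<le> \<bar>u * x\<bar>} x \<le> 1 - exp (- (u * x)\<^sup>2 / 2)"
  proof (cases "1 \<le> \<bar>u * x\<bar>")
   case True
   then have "1\<^sup>2 \<le> \<bar>u * x\<bar>\<^sup>2" by (intro power_mono) auto
   then show ?thesis using True by simp
  qed simp
 qed (use ei in auto)
 finally show ?thesis by simp
qed

text \<open>Levy's continuity theorem with existence of the limit law. Continuity of \<phi> at 0
  makes the Gaussian average of 1 - Re(\<phi>(u z)) small for small u, which bounds the tails of the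
  late laws uniformly; a weak subsequential limit then has characteristic function \<phi>.\<close>

theorem char_limit_exists:
 fixes N :: "nat \<Rightarrow> real measure"
 assumes N: "\<And>n. real_distribution (N n)" and lim: "\<And>\<theta>. (\<lambda>n. char (N n) \<theta>) \<longlonglongrightarrow> \<phi> \<theta>" and cont: "isCont \<phi> 0"
 shows "\<exists>L. real_distribution L \<and> char L = \<phi>"
proof -
 let ?G = "std_normal_distribution"
 interpret G: real_distribution ?G by (rule real_dist_normal_dist)
 interpret N: real_distribution "N n" for n by (rule N)
 have \<phi>m [measurable]: "\<phi> \<in> borel_measurable borel"
  by (rule borel_measurable_LIMSEQ_metric[of "\<lambda>n. char (N n)"]) (auto intro: lim)
 have \<phi>0: "\<phi> 0 = 1" using LIMSEQ_unique[OF lim[of 0]] by (simp add: N.char_zero)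
 have \<phi>1: "norm (\<phi> \<theta>) \<le> 1" for \<theta>
  by (rule LIMSEQ_le_const2[OF tendsto_norm[OF lim]]) (auto simp: N.cmod_char_le_1)
 have Re2: "\<bar>1 - Re z\<bar> \<le> 2" if "norm z \<le> 1" for z :: complex
  using abs_Re_le_cmod[of z] that by linarith
 define \<kappa> where "\<kappa> = 1 - exp (- 1 / 2 :: real)"
 have \<kappa>: "0 < \<kappa>" by (simp add: \<kappa>_def)
 have "tight N"
  unfolding tight_def
 proof (intro conjI allI impI N)
  fix \<epsilon> :: real assume \<epsilon>: "0 < \<epsilon>"
  have "(\<lambda>k. \<integral>z. 1 - Re (\<phi> (1 / real (Suc k) * z)) \<partial>?G) \<longlonglongrightarrow> (\<integral>z. 0 \<partial>?G)"
  proof (rule integral_dominated_convergence[where w="\<lambda>_. 2"])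
   show "AE z in ?G. (\<lambda>k. 1 - Re (\<phi> (1 / real (Suc k) * z))) \<longlonglongrightarrow> 0"
   proof (rule AE_I2)
    fix z
    have "(\<lambda>k. 1 / real (Suc k) * z) \<longlonglongrightarrow> 0 * z"
     by (intro tendsto_intros LIMSEQ_Suc[OF lim_1_over_n])
    then have "(\<lambda>k. \<phi> (1 / real (Suc k) * z)) \<longlonglongrightarrow> 1"
     using isCont_tendsto_compose[OF cont] \<phi>0 by simp
    then have "(\<lambda>k. 1 - Re (\<phi> (1 / real (Suc k) * z))) \<longlonglongrightarrow> 1 - Re 1" by (intro tendsto_intros)
    then show "(\<lambda>k. 1 - Re (\<phi> (1 / real (Suc k) * z))) \<longlonglongrightarrow> 0" by simp
   qed
  qed (auto intro!: Re2 \<phi>1)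
  then have "(\<lambda>k. \<integral>z. 1 - Re (\<phi> (1 / real (Suc k) * z)) \<partial>?G) \<longlonglongrightarrow> 0" by simp
  from order_tendstoD(2)[OF this, of "\<kappa> * \<epsilon>"] obtain k where
   k: "(\<integral>z. 1 - Re (\<phi> (1 / real (Suc k) * z)) \<partial>?G) < \<kappa> * \<epsilon>"
   using \<kappa> \<epsilon> by (auto simp: eventually_sequentially)
  define u where "u = 1 / real (Suc k)"
  have u: "0 < u" by (simp add: u_def)
  have "(\<lambda>n. \<integral>z. 1 - Re (char (N n) (u * z)) \<partial>?G) \<longlonglongrightarrow> (\<integral>z. 1 - Re (\<phi> (u * z)) \<partial>?G)"
   by (rule integral_dominated_convergence[where w="\<lambda>_. 2"])
     (auto intro!: Re2 N.cmod_char_le_1 tendsto_intros lim)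
  from order_tendstoD(2)[OF this k[folded u_def]] obtain n0 where
   n0: "\<And>n. n0 \<le> n \<Longrightarrow> (\<integral>z. 1 - Re (char (N n) (u * z)) \<partial>?G) < \<kappa> * \<epsilon>"
   by (auto simp: eventually_sequentially)
  have late: "1 - \<epsilon> < measure (N n) {- real (Suc k)<..real (Suc k)}" if n: "n0 \<le> n" for n
  proof -
   have "\<kappa> * measure (N n) {x. 1 \<le> \<bar>u * x\<bar>} \<le> (\<integral>z. 1 - Re (char (N n) (u * z)) \<partial>?G)"
    unfolding \<kappa>_def by (rule N.tail_le_char_average)
   also have "\<dots> < \<kappa> * \<epsilon>" by (rule n0[OF n])
   finally have "\<kappa> * measure (N n) {x. 1 \<le> \<bar>u * x\<bar>} < \<kappa> * \<epsilon>" .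
   then have "measure (N n) {x. 1 \<le> \<bar>u * x\<bar>} < \<epsilon>" using \<kappa> by simp
   moreover have "measure (N n) (space (N n) - {- real (Suc k)<..real (Suc k)}) \<le> measure (N n) {x. 1 \<le> \<bar>u * x\<bar>}"
    by (rule N.finite_measure_mono) (auto simp: u_def abs_mult field_simps abs_if)
   moreover have "measure (N n) (space (N n) - {- real (Suc k)<..real (Suc k)}) = 1 - measure (N n) {- real (Suc k)<..real (Suc k)}"
    by (rule N.prob_compl) simp
   ultimately show ?thesis by simp
  qed
  have "\<exists>j::nat. 1 - \<epsilon> < measure (N n) {- real j<..real j}" for n
  proof -
   have "(\<lambda>j. measure (N n) {- real j<..real j}) \<longlonglongrightarrow> measure (N n) (\<Union>j. {- real j<..real j})"
    by (rule N.finite_Lim_measure_incseq) (auto simp: incseq_def)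
   moreover have "(\<Union>j. {- real j<..real j}) = (UNIV :: real set)"
   proof (intro equalityI subset_UNIV subsetI)
    fix x :: real
    obtain j where "\<bar>x\<bar> < real j" using reals_Archimedean2 by blast
    then show "x \<in> (\<Union>j. {- real j<..real j})" by (intro UN_I[of j]) auto
   qed
   ultimately have "(\<lambda>j. measure (N n) {- real j<..real j}) \<longlonglongrightarrow> 1" using N.prob_space[of n] by simp
   from order_tendstoD(1)[OF this, of "1 - \<epsilon>"] show ?thesis using \<epsilon> by (auto simp: eventually_sequentially)
  qed
  then obtain f :: "nat \<Rightarrow> nat" where f: "\<And>n. 1 - \<epsilon> < measure (N n) {- real (f n)<..real (f n)}" by metis
  \<comment> \<open>The first \<open>n0\<close> laws have their own radii \<open>f i\<close>; the
    sum exceeds each of them as well as the common radius \<open>Suc k\<close> of the later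
    laws.\<close>
  define K where "K = Suc k + (\<Sum>i<n0. f i)"
  have "1 - \<epsilon> < measure (N n) {- real K<..real K}" for n
  proof -
   define j where "j = (if n0 \<le> n then Suc k else f n)"
   have "1 - \<epsilon> < measure (N n) {- real j<..real j}" using late[of n] f[of n] by (simp add: j_def)
   also have "j \<le> K"
    using member_le_sum[of n "{..<n0}" f] by (auto simp: j_def K_def)
   then have "measure (N n) {- real j<..real j} \<le> measure (N n) {- real K<..real K}"
    by (intro N.finite_measure_mono) auto
   finally show ?thesis .
  qed
  moreover have "0 < K" by (simp add: K_def)
  then have "- real K < real K" by simp
  ultimately show "\<exists>a b. a < b \<and> (\<forall>n. 1 - \<epsilon> < measure (N n) {a<..b})" by blast
 qed
 from tight_imp_convergent_subsubsequence[OF this strict_mono_id] obtain r L where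
  r: "strict_mono (r :: nat \<Rightarrow> nat)" and L: "real_distribution L" and conv: "weak_conv_m (N \<circ> id \<circ> r) L" by blast
 have "char L \<theta> = \<phi> \<theta>" for \<theta>
 proof (rule LIMSEQ_unique)
  show "(\<lambda>n. char ((N \<circ> id \<circ> r) n) \<theta>) \<longlonglongrightarrow> char L \<theta>"
   by (rule levy_continuity1[OF _ L conv]) (simp add: N)
  show "(\<lambda>n. char ((N \<circ> id \<circ> r) n) \<theta>) \<longlonglongrightarrow> \<phi> \<theta>"
   using LIMSEQ_subseq_LIMSEQ[OF lim r, of \<theta>] by (simp add: comp_def)
 qed
 then show ?thesis using L by (auto intro!: ext)
qed

lemma weak_conv_along_char:
 assumes N: "\<And>l. 0 < l \<Longrightarrow> real_distribution (N l)" and L: "real_distribution L"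
  and lim: "\<And>\<theta>. ((\<lambda>l. char (N l) \<theta>) \<longlongrightarrow> char L \<theta>) at_top"
 shows "weak_conv_along N (at_top :: real filter) L"
 unfolding weak_conv_along_def
proof (intro allI impI)
 fix x assume x: "isCont (cdf L) x"
 \<comment> \<open>The family is frozen below 1, so that each of its members is a real distribution
   along an arbitrary sequence tending to infinity.\<close>
 define K where "K l = N (max l 1)" for l
 have eq: "\<forall>\<^sub>F l in at_top. K l = N l"
  using eventually_ge_at_top[of 1] by eventually_elim (simp add: K_def)
 have "((\<lambda>l. cdf (K l) x) \<longlongrightarrow> cdf L x) at_top"
 proof (rule tendsto_at_topI_sequentially)
  fix X :: "nat \<Rightarrow> real" assume X: "filterlim X at_top sequentially"
  have "weak_conv_m (\<lambda>n. K (X n)) L"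
  proof (rule levy_continuity)
   show "real_distribution (K (X n))" for n unfolding K_def by (rule N) simp
   fix \<theta>
   have "((\<lambda>l. char (K l) \<theta>) \<longlongrightarrow> char L \<theta>) at_top"
    by (rule Lim_transform_eventually[OF lim]) (use eq in eventually_elim, simp)
   then show "(\<lambda>n. char (K (X n)) \<theta>) \<longlonglongrightarrow> char L \<theta>" by (rule filterlim_compose[OF _ X])
  qed (rule L)
  then show "(\<lambda>n. cdf (K (X n)) x) \<longlonglongrightarrow> cdf L x"
   using x unfolding weak_conv_m_def weak_conv_def by simp
 qed
 then show "((\<lambda>l. cdf (N l) x) \<longlongrightarrow> cdf L x) at_top"
  by (rule Lim_transform_eventually) (use eq in eventually_elim, simp)
qed

lemma char_distr_scale:
 assumes "X \<in> borel_measurable M"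
 shows "char (distr M borel X) \<theta> = (\<integral>w. iexp (\<theta> * X w) \<partial>M)"
 unfolding char_def using assms by (subst integral_distr) auto

lemma char_normal:
 assumes "0 < \<sigma>"
 shows "char (density lborel (normal_density 0 \<sigma>)) \<theta> = of_real (exp (- (\<sigma> * \<theta>)\<^sup>2 / 2))"
proof -
 interpret G: real_distribution std_normal_distribution by (rule real_dist_normal_dist)
 have "distributed std_normal_distribution lborel (\<lambda>x. x) std_normal_density"
  by (auto simp: distributed_def distr_id2)
 from G.normal_density_affine[OF this, of \<sigma> 0] assms
 have "distributed std_normal_distribution lborel (\<lambda>x. \<sigma> * x) (normal_density 0 \<sigma>)" by simp
 then have "density lborel (normal_density 0 \<sigma>) = distr std_normal_distribution lborel (\<lambda>x. \<sigma> * x)"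
  by (simp add: distributed_distr_eq_density)
 also have "\<dots> = distr std_normal_distribution borel (\<lambda>x. \<sigma> * x)" by (intro distr_cong) auto
 finally have "char (density lborel (normal_density 0 \<sigma>)) \<theta> = (\<integral>x. iexp (\<theta> * (\<sigma> * x)) \<partial>std_normal_distribution)"
  by (simp only:) (rule char_distr_scale, simp)
 also have "\<dots> = char std_normal_distribution (\<sigma> * \<theta>)"
  unfolding char_def by (intro Bochner_integral_cong) (auto simp: mult_ac)
 finally show ?thesis by (simp only: char_std_normal_distribution)
qed

text \<open>Homogeneity gives \<psi>(a \<theta>) + \<psi>(b \<theta>) = \<psi>(s \<theta>) with
  s^\<alpha> = a^\<alpha> + b^\<alpha>, and characteristic functions determine laws. The shift is 0:
  the law is strictly stable.\<close>

lemma stable_law_char: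
 assumes L: "real_distribution L" and \<alpha>: "0 < \<alpha>" and ch: "\<And>\<theta>. char L \<theta> = exp (\<psi> \<theta>)"
  and hom: "\<And>s \<theta>. 0 < s \<Longrightarrow> \<psi> (s * \<theta>) = of_real (s powr \<alpha>) * \<psi> \<theta>"
 shows "stable_law \<alpha> L"
 unfolding stable_law_def
proof (intro conjI L allI impI)
 fix a b :: real assume ab: "0 < a" "0 < b"
 interpret L: real_distribution L by (rule L)
 interpret P: pair_prob_space L L ..
 let ?s = "(a powr \<alpha> + b powr \<alpha>) powr (1 / \<alpha>)"
 have s: "0 < ?s" "?s powr \<alpha> = a powr \<alpha> + b powr \<alpha>"
 proof -
  have "0 < a powr \<alpha> + b powr \<alpha>" using ab by (intro add_pos_pos) auto
  then show "0 < ?s" "?s powr \<alpha> = a powr \<alpha> + b powr \<alpha>" using \<alpha> by (simp_all add: powr_powr)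
 qed
 have lm [measurable]: "(\<lambda>(x, y). a * x + b * y) \<in> borel_measurable (L \<Otimes>\<^sub>M L)" by measurable
 have "distr (L \<Otimes>\<^sub>M L) borel (\<lambda>(x, y). a * x + b * y) = distr L borel (\<lambda>x. ?s * x + 0)"
 proof (rule Levy_uniqueness)
  show "real_distribution (distr (L \<Otimes>\<^sub>M L) borel (\<lambda>(x, y). a * x + b * y))"
   by (rule P.P.real_distribution_distr[OF lm])
  show "real_distribution (distr L borel (\<lambda>x. ?s * x + 0))"
   by (rule L.real_distribution_distr) measurable
  show "char (distr (L \<Otimes>\<^sub>M L) borel (\<lambda>(x, y). a * x + b * y)) = char (distr L borel (\<lambda>x. ?s * x + 0))"
  proof
   fix \<theta>
   have int: "integrable (L \<Otimes>\<^sub>M L) (\<lambda>(x, y). iexp (\<theta> * (a * x)) * iexp (\<theta> * (b * y)))"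
    by (rule P.P.integrable_const_bound[of _ 1]) (auto simp: split_beta' norm_mult)
   have "char (distr (L \<Otimes>\<^sub>M L) borel (\<lambda>(x, y). a * x + b * y)) \<theta> =
     (\<integral>p. (\<lambda>(x, y). iexp (\<theta> * (a * x)) * iexp (\<theta> * (b * y))) p \<partial>(L \<Otimes>\<^sub>M L))"
    unfolding char_distr_scale[OF lm]
    by (intro Bochner_integral_cong refl) (auto simp: algebra_simps simp flip: exp_add)
   also have "\<dots> = (\<integral>x. (\<integral>y. iexp (\<theta> * (a * x)) * iexp (\<theta> * (b * y)) \<partial>L) \<partial>L)"
    using P.integral_fst[OF int] by simp
   also have "\<dots> = char L (a * \<theta>) * char L (b * \<theta>)"
    unfolding char_def by (simp add: mult_ac)
   also have "\<dots> = exp (\<psi> (?s * \<theta>))"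
    unfolding ch exp_add[symmetric] hom[OF ab(1)] hom[OF ab(2)] hom[OF s(1)] s(2) by (simp add: algebra_simps)
   also have "\<dots> = char (distr L borel (\<lambda>x. ?s * x + 0)) \<theta>"
    unfolding ch[symmetric] by (subst char_distr_scale, measurable) (simp add: char_def mult_ac)
   finally show "char (distr (L \<Otimes>\<^sub>M L) borel (\<lambda>(x, y). a * x + b * y)) \<theta> = char (distr L borel (\<lambda>x. ?s * x + 0)) \<theta>" .
  qed
 qed
 then show "\<exists>d. distr (L \<Otimes>\<^sub>M L) borel (\<lambda>(x, y). a * x + b * y) = distr L borel (\<lambda>x. ?s * x + d)" by blast
qed

context stable_regime
begin

text \<open>Substituting s x for x in the kernel integral gives the power p - 1 of s, and the
  prefactor linear in \<theta> gives the remaining one.\<close>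

lemma stable_constant_scale:
 assumes s: "0 < s"
 shows "stable_constant (s * \<theta>) = of_real (s powr p) * stable_constant \<theta>"
proof -
 let ?I = "\<lambda>\<theta>. \<integral>x. indicator {0<..} x *\<^sub>R stable_kernel p \<theta> x \<partial>lborel"
 have [measurable]: "(\<lambda>x. indicator {0<..} x *\<^sub>R stable_kernel p \<theta> x) \<in> borel_measurable borel"
  unfolding stable_kernel_def by measurable
 have "?I \<theta> = s *\<^sub>R (Leb x. indicator {0<..} (s *\<^sub>R x) *\<^sub>R stable_kernel p \<theta> (s *\<^sub>R x))"
  using integral_lborel_scaleR[of "\<lambda>x. indicator {0<..} x *\<^sub>R stable_kernel p \<theta> x" s] s by simp
 also have "(Leb x. indicator {0<..} (s *\<^sub>R x) *\<^sub>R stable_kernel p \<theta> (s *\<^sub>R x)) =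
   (Leb x. s powr (- p) *\<^sub>R (indicator {0<..} x *\<^sub>R stable_kernel p (s * \<theta>) x))"
 proof (intro Bochner_integral_cong refl)
  fix x
  show "indicator {0<..} (s *\<^sub>R x) *\<^sub>R stable_kernel p \<theta> (s *\<^sub>R x) = s powr (- p) *\<^sub>R (indicator {0<..} x *\<^sub>R stable_kernel p (s * \<theta>) x)"
   using s by (cases "0 < x") (auto simp: stable_kernel_def powr_mult zero_less_mult_iff scaleR_conv_of_real mult_ac)
 qed
 finally have "?I \<theta> = of_real (s * s powr (- p)) * ?I (s * \<theta>)" by (simp add: scaleR_conv_of_real)
 then have "of_real (s powr p) * stable_constant \<theta> = of_real (s powr p * s powr (- p)) * stable_constant (s * \<theta>)"
  unfolding stable_constant_def by (simp add: mult_ac)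
 also have "s powr p * s powr (- p) = 1" using s by (simp flip: powr_add)
 finally show ?thesis by simp
qed

text \<open>Homogeneity reduces the norm to the values at 1 and -1, multiplied by
  \<bar>\<theta>\<bar>^p.\<close>

lemma stable_constant_isCont_0: "isCont stable_constant 0"
proof -
 define K where "K = norm (stable_constant 1) + norm (stable_constant (- 1))"
 have s0: "stable_constant 0 = 0" by (simp add: stable_constant_def)
 have le: "norm (stable_constant \<theta>) \<le> K * \<bar>\<theta>\<bar> powr p" for \<theta>
 proof (cases "\<theta> = 0")
  case False
  then have "norm (stable_constant \<theta>) = \<bar>\<theta>\<bar> powr p * norm (stable_constant (sgn \<theta>))"
   using stable_constant_scale[of "\<bar>\<theta>\<bar>" "sgn \<theta>"] by (simp add: norm_mult abs_mult_sgn)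
  also have "\<dots> \<le> \<bar>\<theta>\<bar> powr p * K"
   using False by (intro mult_left_mono) (auto simp: K_def sgn_if)
  finally show ?thesis by (simp only: mult.commute)
 qed (simp add: s0)
 have "((\<lambda>\<theta> :: real. K * \<bar>\<theta>\<bar> powr p) \<longlongrightarrow> K * 0) (at 0)"
 proof (intro tendsto_intros)
  have "((\<lambda>\<theta> :: real. \<bar>\<theta>\<bar> powr p) \<longlongrightarrow> \<bar>0\<bar> powr p) (at 0)"
   using p12 by (intro tendsto_powr' tendsto_intros) auto
  then show "((\<lambda>\<theta> :: real. \<bar>\<theta>\<bar> powr p) \<longlongrightarrow> 0) (at 0)" using p12 by simp
 qed
 then have "(stable_constant \<longlongrightarrow> 0) (at 0)"
  by (intro Lim_null_comparison[OF always_eventually[OF allI[OF le]]]) simp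
 then show ?thesis unfolding isCont_def s0 .
qed

end

section \<open>From the uncovered volume to the volume fraction\<close>

context scaled_grain_model
begin

lemma mem_boolean_set_iff:
 assumes "w \<in> space M"
 shows "(s, 0) \<in> boolean_set u Xis w \<longleftrightarrow> (\<exists>j. e j w \<in> C s)"
proof -
 have cl: "closed (Xis j w)" for j using measurable_space[OF Xis_meas assms] by simp
 have "(s, 0) \<in> (\<lambda>x. u j w + x) ` Xis j w \<longleftrightarrow> (s, 0) - u j w \<in> Xis j w" for j
  by (metis (no_types, lifting) add_diff_cancel_left' diff_add_cancel add.commute image_iff)
 then show ?thesis by (simp add: boolean_set_def e_def C_def cl)
qed

lemma uncovered_measurable:
 assumes B: "B \<in> sets borel" "emeasure lborel B < \<infinity>"
 shows "uncovered B \<in> borel_measurable M"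
proof -
 interpret W: poisson_cover_window M m e C \<mu> \<rho> B using B by unfold_locales
 have "W.U W.S \<in> borel_measurable M" by measurable
 then show ?thesis
  by (rule measurable_cong[THEN iffD1, rotated]) (simp add: W.uncovered_eq)
qed

lemma hyperplane_section:
 assumes A: "A \<in> sets borel" "bounded A"
 shows "{t'. (t', 0) \<in> A} \<in> sets (borel :: 'a measure)" "bounded {t'. (t', 0 :: 'b) \<in> A}"
proof -
 have "(\<lambda>t :: 'a. (t, 0 :: 'b)) -` A \<inter> space borel \<in> sets borel"
  using A by (intro measurable_sets[of _ _ borel]) auto
 then show "{t'. (t', 0) \<in> A} \<in> sets (borel :: 'a measure)" by (simp add: vimage_def)
 have "{t'. (t', 0 :: 'b) \<in> A} \<subseteq> fst ` A" by force
 then show "bounded {t'. (t', 0 :: 'b) \<in> A}" using bounded_fst[OF A(2)] bounded_subset by blast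
qed

lemma p_hat_eq:
 assumes A: "A \<in> sets borel" "bounded A" "0 < leb_H A" and l: "0 < l" and w: "z \<in> space M"
 shows "p_hat (boolean_set u Xis) A l z =
  1 - uncovered ((\<lambda>x. l *\<^sub>R x) ` {t'. (t', 0) \<in> A}) z / (l powr \<nu>\<^sub>0 * leb_H A)"
proof -
 define A' where "A' = {t'. (t', 0 :: 'b) \<in> A}"
 have A'm: "A' \<in> sets borel" and "bounded A'"
  unfolding A'_def by (rule hyperplane_section[OF A(1,2)])+
 have A'f: "emeasure lborel A' < \<infinity>" by (rule emeasure_bounded_finite) fact
 define B where "B = (\<lambda>x. l *\<^sub>R x) ` A'"
 note sw = scaled_window[OF A'm l, folded B_def]
 have lH: "leb_H A = measure lborel A'" by (simp add: leb_H_def A'_def)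
 have memB: "(t', 0) \<in> (\<lambda>x. l *\<^sub>R x) ` A \<longleftrightarrow> t' \<in> B" for t'
  unfolding B_def A'_def scaleR_image_eq_vimage[OF l] by (simp add: scaleR_Pair)
 have Bm: "B \<in> sets borel" "emeasure lborel B < \<infinity>" using sw(1,2) A'f by (auto simp: ennreal_mult_less_top)
 interpret W: poisson_cover_window M m e C \<mu> \<rho> B using Bm by unfold_locales
 have Cm: "{s. e j z \<in> C s} \<in> sets borel" for j
  using measurable_space[OF measurable_points w] by (rule W.sets_shot)
 define V where "V = {s \<in> B. \<forall>j. e j z \<notin> C s}"
 have "V = B - (\<Union>j. {s. e j z \<in> C s})" by (auto simp: V_def)
 then have Vm: "V \<in> sets borel" "V \<subseteq> B" using Bm Cm by auto
 have fm: "B \<in> fmeasurable lborel" "V \<in> fmeasurable lborel"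
  using Bm Vm le_less_trans[OF emeasure_mono[OF Vm(2)] Bm(2)] by (auto simp: fmeasurable_def)
 have "{t'. (t', 0) \<in> boolean_set u Xis z \<inter> H_plane \<inter> (\<lambda>x. l *\<^sub>R x) ` A} = B - V"
  using memB by (auto simp: mem_boolean_set_iff[OF w] H_plane_def V_def)
 then have "leb_H (boolean_set u Xis z \<inter> H_plane \<inter> (\<lambda>x. l *\<^sub>R x) ` A) = measure lborel B - measure lborel V"
  unfolding leb_H_def using fm Bm Vm by (simp add: measure_Diff)
 moreover have "{t'. (t', 0) \<in> H_plane \<inter> (\<lambda>x. l *\<^sub>R x) ` A} = B" using memB by (auto simp: H_plane_def)
 then have "leb_H (H_plane \<inter> (\<lambda>x. l *\<^sub>R x) ` A) = measure lborel B" by (simp add: leb_H_def)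
 moreover have "measure lborel B = l powr \<nu>\<^sub>0 * leb_H A" unfolding lH by (rule sw(3))
 moreover have "measure lborel V = uncovered B z" by (simp add: V_def uncovered_def)
 moreover have "0 < l powr \<nu>\<^sub>0 * leb_H A" using l A(3) by simp
 ultimately show ?thesis unfolding p_hat_def A'_def[symmetric] B_def[symmetric]
  using l A(3) by (simp add: diff_divide_distrib)
qed

text \<open>The estimator is one minus the uncovered share of the window, so the fluctuation of the
  uncovered volume appears with reversed sign.\<close>

lemma scaled_p_hat:
 assumes A: "A \<in> sets borel" "bounded A" "0 < leb_H A" and l: "0 < l" and w: "z \<in> space M"
 shows "l powr (\<nu>\<^sub>0 - \<gamma>) * (p_hat (boolean_set u Xis) A l z - (1 - exp (- \<mu>))) =
  (l powr (- \<gamma>) * (exp (- \<mu>) * (l powr \<nu>\<^sub>0 * leb_H A) - uncovered ((\<lambda>x. l *\<^sub>R x) ` {t'. (t', 0) \<in> A}) z)) / leb_H A"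
proof -
 have "l powr (\<nu>\<^sub>0 - \<gamma>) = l powr \<nu>\<^sub>0 * l powr (- \<gamma>)" by (simp flip: powr_add)
 then show ?thesis unfolding p_hat_eq[OF assms] using A(3) l by (simp add: field_simps)
qed

text \<open>The free exponent \<gamma> serves both regimes: it is \<open>\<nu>\<^sub>0 / 2\<close>
  in the Gaussian and \<open>\<nu>\<^sub>0 / sr.p\<close> in the stable one.\<close>

lemma p_hat_weak_conv:
 assumes A: "A \<in> sets borel" "bounded A" "0 < leb_H A" and L: "real_distribution L"
  and lim: "\<And>\<theta>. ((\<lambda>l. \<integral>w. iexp (\<theta> / leb_H A * (l powr (- \<gamma>) *
    (exp (- \<mu>) * (l powr \<nu>\<^sub>0 * leb_H A) - uncovered ((\<lambda>x. l *\<^sub>R x) ` {t'. (t', 0) \<in> A}) w))) \<partial>M) \<longlongrightarrow> char L \<theta>) at_top"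
 shows "weak_conv_along (\<lambda>l. distr M borel (\<lambda>w. l powr (\<nu>\<^sub>0 - \<gamma>) * (p_hat (boolean_set u Xis) A l w - (1 - exp (- \<mu>))))) at_top L"
proof (rule weak_conv_along_char)
 let ?T = "\<lambda>l w. l powr (\<nu>\<^sub>0 - \<gamma>) * (p_hat (boolean_set u Xis) A l w - (1 - exp (- \<mu>)))"
 note A' = hyperplane_section[OF A(1,2)]
 have m: "?T l \<in> borel_measurable M" if l: "0 < l" for l
 proof -
  have [measurable]: "uncovered ((\<lambda>x. l *\<^sub>R x) ` {t'. (t', 0) \<in> A}) \<in> borel_measurable M"
   using scaled_window(1,2)[OF A'(1) l] emeasure_bounded_finite[OF A'(2)]
   by (intro uncovered_measurable) (auto simp: ennreal_mult_less_top)
  have "(\<lambda>w. (l powr (- \<gamma>) * (exp (- \<mu>) * (l powr \<nu>\<^sub>0 * leb_H A) - uncovered ((\<lambda>x. l *\<^sub>R x) ` {t'. (t', 0) \<in> A}) w)) / leb_H A) \<in> borel_measurable M"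
   by measurable
  then show ?thesis by (rule measurable_cong[THEN iffD2, rotated]) (rule scaled_p_hat[OF A l])
 qed
 show "real_distribution (distr M borel (?T l))" if "0 < l" for l
  by (rule real_distribution_distr[OF m[OF that]])
 show "((\<lambda>l. char (distr M borel (?T l)) \<theta>) \<longlongrightarrow> char L \<theta>) at_top" for \<theta>
 proof (rule Lim_transform_eventually[OF lim[of \<theta>]], intro eventually_mono[OF eventually_gt_at_top[of 0]])
  fix l :: real assume l: "0 < l"
  show "(Mean w. iexp (\<theta> / leb_H A * (l powr (- \<gamma>) *
    (exp (- \<mu>) * (l powr \<nu>\<^sub>0 * leb_H A) - uncovered ((\<lambda>x. l *\<^sub>R x) ` {t'. (t', 0) \<in> A}) w)))) = char (distr M borel (?T l)) \<theta>"
   unfolding char_distr_scale[OF m[OF l]]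
   by (intro Bochner_integral_cong refl) (simp only: scaled_p_hat[OF A l], simp)
 qed
qed (rule L)

text \<open>Passing to complements leaves a covariance unchanged, so it is computed from the
  avoidance probabilities of C t, C 0 and their union, the latter of mass 2 \<mu> - \<rho>
  t.\<close>

lemma covariance_eq:
 "covariance M (\<lambda>z. indicator (boolean_set u Xis z) (t, 0)) (\<lambda>z. indicator (boolean_set u Xis z) 0) =
  exp (- \<mu>) * (exp (- (\<mu> - \<rho> t)) - exp (- \<mu>))"
proof -
 have Cf: "C s \<in> fmeasurable m" for s
 proof -
  have "{x \<in> space m. x \<in> C s} \<in> sets m" unfolding sets_m by (subst sets_eq_imp_space_eq[OF sets_m]) measurable
  moreover have "{x \<in> space m. x \<in> C s} = C s" using C_subset' by auto
  ultimately show ?thesis by (simp add: fmeasurable_def emeasure_C')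
 qed
 have Uf: "C t \<union> C 0 \<in> fmeasurable m" using Cf by auto
 have mC: "measure m (C s) = \<mu>" for s using mu_nonneg by (simp add: measure_def emeasure_C')
 have "measure m (C t \<union> C 0) = \<mu> + \<mu> - \<rho> t"
  using measure_Un3[OF Cf Cf, of t 0] mC by (simp add: \<rho>_def)
 then have vU: "(Mean z. void (C t \<union> C 0) z) = exp (- (\<mu> + \<mu> - \<rho> t))" using void_integral[OF Uf] by simp
 have vC: "(Mean z. void (C s) z) = exp (- \<mu>)" for s using void_integral[OF Cf] mC by simp
 \<comment> \<open>A nonzero Bochner integral certifies integrability, because the integral of a
   non-integrable function is 0.\<close>
 have vi: "integrable M (void W)" if "(Mean z. void W z) \<noteq> 0" for W
  using that not_integrable_integral_eq by blast
 have ind: "indicator (boolean_set u Xis z) (s, 0) = 1 - void (C s) z" if "z \<in> space M" for z s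
  by (simp add: mem_boolean_set_iff[OF that] void_def indicator_def)
 have iC: "integrable M (void (C s))" for s by (rule vi) (simp add: vC)
 have iU: "integrable M (void (C t \<union> C 0))" by (rule vi) (simp add: vU)
 have EX: "(Mean z. indicator (boolean_set u Xis z) (s, 0)) = 1 - exp (- \<mu>)" for s
 proof -
  have "(Mean z. indicator (boolean_set u Xis z) (s, 0)) = (Mean z. 1 - void (C s) z)"
   by (intro Bochner_integral_cong refl ind)
  then show ?thesis using iC by (simp add: vC prob_space)
 qed
 have "covariance M (\<lambda>z. indicator (boolean_set u Xis z) (t, 0)) (\<lambda>z. indicator (boolean_set u Xis z) (0, 0)) =
   (Mean z. exp (- \<mu>) * exp (- \<mu>) - exp (- \<mu>) * void (C t) z - exp (- \<mu>) * void (C 0) z + void (C t \<union> C 0) z)"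
  unfolding covariance_def EX
 proof (intro Bochner_integral_cong refl)
  fix z assume w: "z \<in> space M"
  have "void (C t \<union> C 0) z = void (C t) z * void (C 0) z" by (auto simp: void_def)
  then show "(indicator (boolean_set u Xis z) (t, 0) - (1 - exp (- \<mu>))) * (indicator (boolean_set u Xis z) (0, 0) - (1 - exp (- \<mu>))) =
    exp (- \<mu>) * exp (- \<mu>) - exp (- \<mu>) * void (C t) z - exp (- \<mu>) * void (C 0) z + void (C t \<union> C 0) z"
   unfolding ind[OF w] by (simp add: algebra_simps)
 qed
 also have "\<dots> = exp (- \<mu>) * exp (- \<mu>) - exp (- \<mu>) * exp (- \<mu>) - exp (- \<mu>) * exp (- \<mu>) + exp (- (\<mu> + \<mu> - \<rho> t))"
  using iC iU by (simp add: vC vU prob_space)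
 also have "exp (- (\<mu> + \<mu> - \<rho> t)) = exp (- \<mu>) * exp (- (\<mu> - \<rho> t))" by (simp flip: exp_add)
 finally show ?thesis by (simp add: zero_prod_def algebra_simps)
qed

text \<open>V is a positive multiple of the integral of k, and k is at least exp(- \<mu>) times
  \<rho>, so V > 0 and the normal density is a probability density. The limit for the uncovered
  volume is taken at the negated frequency.\<close>

lemma gaussian_part:
 assumes A: "A \<in> sets borel" "bounded A" "0 < leb_H A" and al: "1 + q < \<alpha>"
  and V: "V = leb_H A * (Leb t. covariance M (\<lambda>z. indicator (boolean_set u Xis z) (t, 0)) (\<lambda>z. indicator (boolean_set u Xis z) 0))"
 shows "weak_conv_along (\<lambda>l. distr M borel (\<lambda>z. l powr (\<nu>\<^sub>0 / 2) * (p_hat (boolean_set u Xis) A l z - (1 - exp (- \<mu>))))) at_top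
  (distr (density lborel (normal_density 0 (sqrt V))) borel (\<lambda>x. x / leb_H A))"
proof -
 define k where "k w = exp (- (\<mu> - \<rho> w)) - exp (- \<mu>)" for w
 have km [measurable]: "k \<in> borel_measurable borel" unfolding k_def[abs_def] by measurable
 have ri: "integrable lborel \<rho>" by (rule rho_integrable[OF al])
 have kb: "exp (- \<mu>) * \<rho> w \<le> k w" "k w \<le> \<rho> w" for w
 proof -
  have k: "k w = exp (- \<mu>) * (exp (\<rho> w) - 1)" by (simp add: k_def algebra_simps flip: exp_add)
  have "\<rho> w \<le> exp (\<rho> w) - 1" using exp_ge_add_one_self[of "\<rho> w"] by linarith
  then show "exp (- \<mu>) * \<rho> w \<le> k w" unfolding k by (intro mult_left_mono) auto
  have "exp (\<rho> w) * (1 - \<rho> w) \<le> exp (\<rho> w) * exp (- \<rho> w)" using exp_ge_add_one_self[of "- \<rho> w"] by (intro mult_left_mono) auto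
  also have "\<dots> = 1" by (simp flip: exp_add)
  finally have "exp (\<rho> w) - 1 \<le> exp (\<rho> w) * \<rho> w" by (simp add: algebra_simps)
  also have "\<dots> \<le> exp \<mu> * \<rho> w" using rho_le_mu rho_nonneg by (intro mult_right_mono) auto
  finally have "k w \<le> exp (- \<mu>) * (exp \<mu> * \<rho> w)" unfolding k by (intro mult_left_mono) auto
  then show "k w \<le> \<rho> w" by (simp flip: mult.assoc exp_add)
 qed
 have k0: "0 \<le> k w" for w using order_trans[OF _ kb(1)[of w]] rho_nonneg[of w] by simp
 have ki: "integrable lborel k"
  by (rule Bochner_integrable_bound[OF ri]) (use kb k0 rho_nonneg in auto)
 have "0 < exp (- \<mu>) * (Leb w. \<rho> w)" using rho_integral_pos[OF ri] by simp
 also have "\<dots> = (Leb w. exp (- \<mu>) * \<rho> w)" by simp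
 also have "\<dots> \<le> (Leb w. k w)" by (intro integral_mono kb ki) (use ri in simp)
 finally have kp: "0 < (Leb w. k w)" .
 have Vk: "V = exp (- \<mu>) * (leb_H A * (Leb w. k w))"
  unfolding V covariance_eq k_def[symmetric] by simp
 have Vp: "0 < V" unfolding Vk using A(3) kp by simp
 interpret N: prob_space "density lborel (normal_density 0 (sqrt V))"
  using Vp by (intro prob_space_normal_density) simp
 have chL: "char (distr (density lborel (normal_density 0 (sqrt V))) borel (\<lambda>x. x / leb_H A)) \<theta> =
   of_real (exp (- (V * (- (\<theta> / leb_H A))\<^sup>2 / 2)))" for \<theta>
 proof -
  have "char (distr (density lborel (normal_density 0 (sqrt V))) borel (\<lambda>x. x / leb_H A)) \<theta> =
    (\<integral>x. iexp (\<theta> * (x / leb_H A)) \<partial>density lborel (normal_density 0 (sqrt V)))"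
   by (rule char_distr_scale) simp
  also have "\<dots> = char (density lborel (normal_density 0 (sqrt V))) (\<theta> / leb_H A)"
   by (simp add: char_def)
  also have "\<dots> = of_real (exp (- (sqrt V * (\<theta> / leb_H A))\<^sup>2 / 2))" using Vp by (intro char_normal) simp
  also have "(sqrt V * (\<theta> / leb_H A))\<^sup>2 = V * (- (\<theta> / leb_H A))\<^sup>2"
   unfolding power_mult_distrib power2_minus using Vp by simp
  finally show ?thesis by simp
 qed
 note A' = hyperplane_section[OF A(1,2)]
 have lH: "measure lborel {t'. (t', 0) \<in> A} = leb_H A" by (simp add: leb_H_def)
 have "weak_conv_along (\<lambda>l. distr M borel (\<lambda>z. l powr (\<nu>\<^sub>0 - \<nu>\<^sub>0 / 2) * (p_hat (boolean_set u Xis) A l z - (1 - exp (- \<mu>))))) at_top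
  (distr (density lborel (normal_density 0 (sqrt V))) borel (\<lambda>x. x / leb_H A))"
 proof (rule p_hat_weak_conv[OF A])
  show "real_distribution (distr (density lborel (normal_density 0 (sqrt V))) borel (\<lambda>x. x / leb_H A))"
   by (rule N.real_distribution_distr) simp
  fix \<theta>
  from gaussian_limit[OF ri A', of "- (\<theta> / leb_H A)"]
  show "((\<lambda>l. \<integral>z. iexp (\<theta> / leb_H A * (l powr (- (\<nu>\<^sub>0 / 2)) *
    (exp (- \<mu>) * (l powr \<nu>\<^sub>0 * leb_H A) - uncovered ((\<lambda>x. l *\<^sub>R x) ` {t'. (t', 0) \<in> A}) z))) \<partial>M) \<longlongrightarrow>
    char (distr (density lborel (normal_density 0 (sqrt V))) borel (\<lambda>x. x / leb_H A)) \<theta>) at_top"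
   unfolding chL lH k_def[symmetric] Vk[symmetric]
  proof (rule Lim_transform_eventually, intro eventually_mono[OF eventually_gt_at_top[of 0]])
   fix l :: real assume l: "0 < l"
   have d: "l ^ DIM('a) = l powr \<nu>\<^sub>0" using l by (simp add: nu powr_realpow)
   have neg: "- (\<theta> / leb_H A) * (g * (U - x)) = \<theta> / leb_H A * (g * (x - U))" for g U x :: real
    by (simp add: algebra_simps)
   show "(Mean z. iexp (- (\<theta> / leb_H A) * (l powr (- (DIM('a) / 2)) *
      (uncovered ((\<lambda>x. l *\<^sub>R x) ` {t'. (t', 0) \<in> A}) z - exp (- \<mu>) * (l ^ DIM('a) * leb_H A))))) =
     (Mean z. iexp (\<theta> / leb_H A * (l powr (- (\<nu>\<^sub>0 / 2)) *
      (exp (- \<mu>) * (l powr \<nu>\<^sub>0 * leb_H A) - uncovered ((\<lambda>x. l *\<^sub>R x) ` {t'. (t', 0) \<in> A}) z))))"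
    unfolding neg d by (simp only: nu(1))
  qed
 qed
 then show ?thesis by simp
qed

end

lemma (in stable_grain_model) stable_part:
 assumes A: "A \<in> sets borel" "bounded A" "0 < leb_H A"
 shows "\<exists>L. stable_law sr.p L \<and>
  (\<forall>\<theta>. char L \<theta> = exp (of_real (leb_H A) * (of_real section_moment * sr.stable_constant \<theta>))) \<and>
  weak_conv_along (\<lambda>l. distr M borel (\<lambda>w. l powr (\<nu>\<^sub>0 - \<nu>\<^sub>0 / sr.p) * (p_hat (boolean_set u Xis) A l w - (1 - exp (- \<mu>))))) at_top
   (distr L borel (\<lambda>x. exp (- \<mu>) * (x / leb_H A)))"
proof -
 note A' = hyperplane_section[OF A(1,2)]
 have lH: "measure lborel {t'. (t', 0) \<in> A} = leb_H A" by (simp add: leb_H_def)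
 define \<psi> where "\<psi> \<theta> = of_real (leb_H A) * (of_real section_moment * sr.stable_constant \<theta>)" for \<theta>
 define Z where "Z l w = l powr (- (\<nu>\<^sub>0 / sr.p)) *
  (exp (- \<mu>) * (l powr \<nu>\<^sub>0 * leb_H A) - uncovered ((\<lambda>x. l *\<^sub>R x) ` {t'. (t', 0) \<in> A}) w)" for l w
 have lim: "((\<lambda>l. \<integral>w. iexp (\<theta> * Z l w) \<partial>M) \<longlongrightarrow> exp (\<psi> (\<theta> * exp (- \<mu>)))) at_top" for \<theta>
  using stable_limit[OF A', of \<theta>] unfolding lH Z_def \<psi>_def .
 \<comment> \<open>Multiplication by exp \<mu> undoes the factor exp(- \<mu>) that the theorem keeps
   outside L; \<open>Suc n\<close> keeps the scale positive.\<close>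
 define N where "N n = distr M borel (\<lambda>w. exp \<mu> * Z (real (Suc n)) w)" for n
 have Zm [measurable]: "Z l \<in> borel_measurable M" if l: "0 < l" for l
 proof -
  have [measurable]: "uncovered ((\<lambda>x. l *\<^sub>R x) ` {t'. (t', 0) \<in> A}) \<in> borel_measurable M"
   using scaled_window(1,2)[OF A'(1) l] emeasure_bounded_finite[OF A'(2)]
   by (intro uncovered_measurable) (auto simp: ennreal_mult_less_top)
  show ?thesis unfolding Z_def[abs_def] by measurable
 qed
 have "\<exists>L. real_distribution L \<and> char L = (\<lambda>\<theta>. exp (\<psi> \<theta>))"
 proof (rule char_limit_exists)
  fix n
  have [measurable]: "Z (real (Suc n)) \<in> borel_measurable M" by (rule Zm) simp
  show "real_distribution (N n)" unfolding N_def by (rule real_distribution_distr) measurable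
 next
  fix \<theta>
  have "filterlim (\<lambda>n. real (Suc n)) at_top sequentially"
   by (rule filterlim_compose[OF filterlim_real_sequentially filterlim_Suc])
  from filterlim_compose[OF lim[of "\<theta> * exp \<mu>"] this]
  have "(\<lambda>n. \<integral>w. iexp (\<theta> * exp \<mu> * Z (real (Suc n)) w) \<partial>M) \<longlonglongrightarrow> exp (\<psi> \<theta>)"
   by (simp add: mult.assoc flip: exp_add)
  moreover have "char (N n) \<theta> = (\<integral>w. iexp (\<theta> * exp \<mu> * Z (real (Suc n)) w) \<partial>M)" for n
  proof -
   have [measurable]: "Z (real (Suc n)) \<in> borel_measurable M" by (rule Zm) simp
   show ?thesis unfolding N_def by (subst char_distr_scale) (auto simp: mult_ac)
  qed
  ultimately show "(\<lambda>n. char (N n) \<theta>) \<longlonglongrightarrow> exp (\<psi> \<theta>)" by (simp only:)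
 next
  show "isCont (\<lambda>\<theta>. exp (\<psi> \<theta>)) 0"
   unfolding \<psi>_def by (intro continuous_intros sr.stable_constant_isCont_0)
 qed
 then obtain L where L: "real_distribution L" and chL: "\<And>\<theta>. char L \<theta> = exp (\<psi> \<theta>)" by (auto simp: fun_eq_iff)
 interpret L: real_distribution L by (rule L)
 have "stable_law sr.p L"
 proof (rule stable_law_char[OF L _ chL])
  show "0 < sr.p" using sr.p12 by simp
  show "\<psi> (s * \<theta>) = of_real (s powr sr.p) * \<psi> \<theta>" if "0 < s" for s \<theta>
   unfolding \<psi>_def sr.stable_constant_scale[OF that] by (simp add: mult_ac)
 qed
 moreover have "weak_conv_along (\<lambda>l. distr M borel (\<lambda>w. l powr (\<nu>\<^sub>0 - \<nu>\<^sub>0 / sr.p) * (p_hat (boolean_set u Xis) A l w - (1 - exp (- \<mu>))))) at_top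
   (distr L borel (\<lambda>x. exp (- \<mu>) * (x / leb_H A)))"
 proof (rule p_hat_weak_conv[OF A])
  show "real_distribution (distr L borel (\<lambda>x. exp (- \<mu>) * (x / leb_H A)))"
   by (rule L.real_distribution_distr) measurable
  fix \<theta>
  have "char (distr L borel (\<lambda>x. exp (- \<mu>) * (x / leb_H A))) \<theta> = (\<integral>x. iexp (\<theta> * (exp (- \<mu>) * (x / leb_H A))) \<partial>L)"
   by (rule char_distr_scale) measurable
  also have "\<dots> = char L (\<theta> / leb_H A * exp (- \<mu>))" unfolding char_def by (simp add: mult_ac)
  finally show "((\<lambda>l. \<integral>w. iexp (\<theta> / leb_H A * (l powr (- (\<nu>\<^sub>0 / sr.p)) *
    (exp (- \<mu>) * (l powr \<nu>\<^sub>0 * leb_H A) - uncovered ((\<lambda>x. l *\<^sub>R x) ` {t'. (t', 0) \<in> A}) w))) \<partial>M) \<longlongrightarrow>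
    char (distr L borel (\<lambda>x. exp (- \<mu>) * (x / leb_H A))) \<theta>) at_top"
   using lim[of "\<theta> / leb_H A"] unfolding Z_def chL by simp
 qed
 ultimately show ?thesis using chL unfolding \<psi>_def by blast
qed

theorem corollary3:
  fixes M :: "'w measure"
    and u :: "nat \<Rightarrow> 'w \<Rightarrow> (real^'m::finite) \<times> (real^'n::finite)"
    and R :: "'w \<Rightarrow> real"
    and Xi0 Xi :: "'w \<Rightarrow> ((real^'m) \<times> (real^'n)) set"
    and Xis :: "nat \<Rightarrow> 'w \<Rightarrow> ((real^'m) \<times> (real^'n)) set"
    and X :: "'w \<Rightarrow> ((real^'m) \<times> (real^'n)) set"
    and Xhat :: "(real^'m) \<times> (real^'n) \<Rightarrow> 'w \<Rightarrow> real"
    and A :: "((real^'m) \<times> (real^'n)) set"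
    and \<nu>\<^sub>0 \<nu> \<alpha> c\<^sub>R \<mu> p \<alpha>\<^sub>0 c\<^sub>0 V :: real
  defines "\<nu>\<^sub>0 \<equiv> real CARD('m)"
    and "\<nu> \<equiv> real (CARD('m) + CARD('n))"
    and "Xi \<equiv> \<lambda>\<omega>. (\<lambda>t. (R \<omega> powr (1 / \<nu>)) *\<^sub>R t) ` Xi0 \<omega>"
    and "X \<equiv> boolean_set u Xis"
    and "Xhat \<equiv> \<lambda>t \<omega>. indicator (X \<omega>) t"
    and "\<mu> \<equiv> mean_volume M Xi"
    and "p \<equiv> 1 - exp (- \<mu>)"
    and "\<alpha>\<^sub>0 \<equiv> 1 + \<nu> / \<nu>\<^sub>0 * (\<alpha> - 1)"
    and "c\<^sub>0 \<equiv> c\<^sub>R * \<alpha> * \<nu> / (\<alpha>\<^sub>0 * \<nu>\<^sub>0)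
                * (\<integral>s. (\<integral>\<omega>. section_volume (Xi0 \<omega>) s powr \<alpha>\<^sub>0 \<partial>M) \<partial>lborel)"
    and "V \<equiv> leb_H A * (\<integral>t'. covariance M (Xhat (t', 0)) (Xhat 0) \<partial>lborel)"
  assumes "prob_space M" and "complete_measure M"
    and \<alpha>: "1 < \<alpha>" "\<alpha> < 2"
    and R: "R \<in> borel_measurable M" "AE \<omega> in M. 0 < R \<omega>"
    and c\<^sub>R: "0 < c\<^sub>R"
    and tail: "(\<lambda>x. measure M {\<omega> \<in> space M. x < R \<omega>}) \<sim>[at_top] (\<lambda>x. c\<^sub>R * x powr (- \<alpha>))"
    and Xi0: "random_closed_set M Xi0" "AE \<omega> in M. Xi0 \<omega> \<subseteq> {t. norm t \<le> 1}"
      "AE \<omega> in M. 0 < emeasure lborel (Xi0 \<omega>)"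
    and indep: "independent_rvs M borel R fell_borel Xi0"
    and model: "boolean_model M u Xi Xis"
    and A: "A \<subseteq> H_plane" "bounded A" "A \<in> sets borel" "0 < leb_H A"
  shows
    "(1 < \<alpha> \<and> \<alpha> < 1 + \<nu>\<^sub>0 / \<nu> \<longrightarrow>
      (\<exists>L :: real measure. stable_law \<alpha>\<^sub>0 L \<and>
         (\<forall>\<theta>::real. char L \<theta> = exp (\<i> * c\<^sub>0 * \<theta> * leb_H A *
            (CLBINT x:{0::real<..}. (exp (\<i> * \<theta> * x) - 1) * complex_of_real (x powr (- \<alpha>\<^sub>0))))) \<and>
         weak_conv_along
           (\<lambda>l. distr M borel (\<lambda>\<omega>. l powr (\<nu>\<^sub>0 - \<nu>\<^sub>0 / \<alpha>\<^sub>0) * (p_hat X A l \<omega> - p)))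
           at_top
           (distr L borel (\<lambda>x. exp (- \<mu>) * (x / leb_H A))))) \<and>
     (1 + \<nu>\<^sub>0 / \<nu> < \<alpha> \<and> \<alpha> < 2 \<longrightarrow>
       weak_conv_along
         (\<lambda>l. distr M borel (\<lambda>\<omega>. l powr (\<nu>\<^sub>0 / 2) * (p_hat X A l \<omega> - p)))
         at_top
         (distr (density lborel (normal_density 0 (sqrt V))) borel (\<lambda>x. x / leb_H A)))"
proof -
 interpret prob_space M by fact
 have nu: "\<nu>\<^sub>0 = real DIM(real ^ 'm)" "\<nu> = real (DIM(real ^ 'm) + DIM(real ^ 'n))"
  by (simp_all add: \<nu>\<^sub>0_def \<nu>_def)
 have Xi: "Xi = (\<lambda>\<omega>. (\<lambda>t. (R \<omega> powr (1 / \<nu>)) *\<^sub>R t) ` Xi0 \<omega>)" by (simp add: Xi_def)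
 have \<alpha>0: "0 < \<alpha>" using \<alpha> by simp
 interpret G: scaled_grain_model M R \<alpha> c\<^sub>R u Xi0 Xi Xis \<nu>\<^sub>0 \<nu>
  by unfold_locales (rule R \<alpha>0 c\<^sub>R tail nu Xi \<alpha> Xi0 indep model)+
 have p: "p = 1 - exp (- G.\<mu>)" and mu: "\<mu> = G.\<mu>" by (simp_all add: p_def \<mu>_def G.\<mu>_def)
 have pos: "0 < \<nu>\<^sub>0" "0 < \<nu>" by (rule G.nu_pos)+
 note A' = A(3) A(2) A(4)
 show ?thesis
 proof (intro conjI impI; elim conjE)
  assume "\<alpha> < 1 + \<nu>\<^sub>0 / \<nu>"
  then interpret S: stable_grain_model M R \<alpha> c\<^sub>R u Xi0 Xi Xis \<nu>\<^sub>0 \<nu>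
   by unfold_locales (simp add: G.q_def)
  have sp: "S.sr.p = \<alpha>\<^sub>0"
  proof -
   have "S.sr.p = 1 + (\<alpha> - 1) / G.q" by (rule S.sr.p_def)
   also have "\<dots> = \<alpha>\<^sub>0" using pos by (simp add: \<alpha>\<^sub>0_def G.q_def)
   finally show ?thesis .
  qed
  obtain L where L: "stable_law \<alpha>\<^sub>0 L"
   "\<And>\<theta>. char L \<theta> = exp (of_real (leb_H A) * (of_real S.section_moment * S.sr.stable_constant \<theta>))"
   "weak_conv_along (\<lambda>l. distr M borel (\<lambda>\<omega>. l powr (\<nu>\<^sub>0 - \<nu>\<^sub>0 / \<alpha>\<^sub>0) * (p_hat X A l \<omega> - p))) at_top
    (distr L borel (\<lambda>x. exp (- \<mu>) * (x / leb_H A)))"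
   using S.stable_part[OF A'] unfolding sp X_def p mu by blast
  \<comment> \<open>The quotient \<open>\<nu> / \<nu>\<^sub>0\<close> in the constant is 1 / q, as
    in \<open>stable_constant\<close>.\<close>
  have c0: "c\<^sub>0 = c\<^sub>R * \<alpha> / (G.q * \<alpha>\<^sub>0) * S.section_moment"
  proof -
   have "c\<^sub>R * \<alpha> * \<nu> / (\<alpha>\<^sub>0 * \<nu>\<^sub>0) = c\<^sub>R * \<alpha> / (G.q * \<alpha>\<^sub>0)" by (simp add: G.q_def mult_ac)
   then show ?thesis unfolding c\<^sub>0_def S.section_moment_def sp by (simp only:)
  qed
  have "char L \<theta> = exp (\<i> * c\<^sub>0 * \<theta> * leb_H A *
    (CLBINT x:{0::real<..}. (exp (\<i> * \<theta> * x) - 1) * complex_of_real (x powr (- \<alpha>\<^sub>0))))" for \<theta>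
  proof -
   have I: "(CLBINT x:{0::real<..}. (exp (\<i> * \<theta> * x) - 1) * complex_of_real (x powr (- \<alpha>\<^sub>0))) =
     (\<integral>x. indicator {0<..} x *\<^sub>R stable_kernel \<alpha>\<^sub>0 \<theta> x \<partial>lborel)"
    unfolding set_lebesgue_integral_def stable_kernel_def by (simp add: mult.assoc)
   show ?thesis unfolding L(2) I S.sr.stable_constant_def sp c0 by (simp add: mult_ac)
  qed
  then show "\<exists>L. stable_law \<alpha>\<^sub>0 L \<and>
     (\<forall>\<theta>::real. char L \<theta> = exp (\<i> * c\<^sub>0 * \<theta> * leb_H A *
      (CLBINT x:{0::real<..}. (exp (\<i> * \<theta> * x) - 1) * complex_of_real (x powr (- \<alpha>\<^sub>0))))) \<and>
     weak_conv_along
      (\<lambda>l. distr M borel (\<lambda>\<omega>. l powr (\<nu>\<^sub>0 - \<nu>\<^sub>0 / \<alpha>\<^sub>0) * (p_hat X A l \<omega> - p)))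
      at_top
      (distr L borel (\<lambda>x. exp (- \<mu>) * (x / leb_H A)))"
   using L(1,3) by blast
 next
  assume "1 + \<nu>\<^sub>0 / \<nu> < \<alpha>"
  then have "1 + G.q < \<alpha>" by (simp add: G.q_def)
  then show "weak_conv_along
     (\<lambda>l. distr M borel (\<lambda>\<omega>. l powr (\<nu>\<^sub>0 / 2) * (p_hat X A l \<omega> - p)))
     at_top
     (distr (density lborel (normal_density 0 (sqrt V))) borel (\<lambda>x. x / leb_H A))"
   unfolding X_def p by (rule G.gaussian_part[OF A']) (simp only: V_def Xhat_def X_def)
 qed
qed

end
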